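(* Let $s$ be a swallowtail point of a front $S$ in general position in real $3$-space. In the neighbourhood of $s$, the flecnodal curve $F$ of $S$ has a cusp whose tangent direction coincides with that of the cuspidal edge. The point $s$ separates $F$ locally into its left and right branches. There are four possible generic configurations of $F$ in the neighbourhood of $s$, determined by the cr-invariant $\rho(s)$: $(e)$ For an elliptic swallowtail ($\rho(s)\in(1,\infty)$) the flecnodal curve is a cusp lying in the small domain bounded by the cuspidal edge. There are three different generic types of hyperbolic swallowtails: $(h_1)$ ($\rho(s)\in(0,1)$) Each branch of the cuspidal edge is separated from the self-intersection line by one branch of the flecnodal curve. $(h_2)$ ($\rho(s)\in(-\frac12,0)$) The self-intersection line lies between the two branches of the flecnodal curve and separates them from the branches of the cuspidal edge. The cusp of the flecnodal curve points in the same direction as the cusp of the cuspidal edge. $(h_3)$ ($\rho(s)\in(-\infty,-\frac12)$) The cusp of the flecnodal curve and the cusp of the cuspidal edge point in opposite directions.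
   Context: The ambient space is oriented $\mathbb{R}^3$ or $\mathbb{RP}^3$. The dual surface $S^\vee\subset(\mathbb{RP}^3)^\vee$ is the image of the tangential map, which sends each point of $S$ to the tangent plane of $S$ there. A front in general position is a surface $S$ such that the singularities of $S$ and of $S^\vee$ are at most self-intersection lines, semi-cubic cuspidal edges and swallowtails, and such that the parabolic curve does not pass through a swallowtail point, either for $S$ or for $S^\vee$; equivalently, the Legendrian manifold of contact elements tangent to $S$ is in general position with respect to both natural Legendrian fibrations $PT^*\mathbb{RP}^3\to\mathbb{RP}^3$ and $PT^*(\mathbb{RP}^3)^\vee\to(\mathbb{RP}^3)^\vee$. On the smooth part of a surface: the elliptic domain is the open set of points at which no real tangent line has more than $2$-point contact with the surface; the hyperbolic domain is the open set of points at which exactly two tangent lines (asymptotic lines) have more than $2$-point contact; parabolic points are those with a unique (double) asymptotic line, and they form the parabolic curve $P$. On a front these two domains are separated by the cuspidal edge and the parabolic curve. The flecnodal curve $F$ is formed by the points in the closure of the hyperbolic domain at which an asymptotic line has more than $3$-point contact with the surface. A regularly parametrised curve is left (right) if its first three derivatives form a negative (positive) frame at each point. Through each hyperbolic point pass one left and one right asymptotic curve (integral curves of the asymptotic directions), whose tangents are called the left and right asymptotic lines. The left (right) branch of $F$ consists of the points of $F$ whose asymptotic line of higher contact is a left (right) one. A swallowtail point is hyperbolic (elliptic) if, locally, the self-intersection line of the front lies in the hyperbolic (elliptic) domain. The small domain bounded by the cuspidal edge at a swallowtail is the one of the two local parts of the surface separated by the cuspidal edge that does not contain the self-intersection line. cr-invariant: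 near the point $g\in S^\vee$ dual to the swallowtail $s$, the surface $S^\vee$ is smooth and $g$ is a godron of it (a parabolic point at which the unique asymptotic direction is tangent to the parabolic curve). At $g$ the flecnodal curve $F$, the parabolic curve $P$ and the conodal curve $D$ of $S^\vee$ are smooth and mutually tangent, where $D$ is the closure of the set of points of contact of the surface with planes tangent to it at at least two distinct points. In the contact manifold $PT^*S^\vee$ of contact elements of the surface, let $\ell_F,\ell_P,\ell_D,\ell_g$ be the tangent lines, at their common point and in their common contact plane, of the Legendrian curves of contact elements tangent to $F$, to $P$, to $D$, and of the fibre over $g$. Then $\rho(s):=\rho(g):=(\ell_F,\ell_P,\ell_D,\ell_g)$, with the cross-ratio convention $(a,b,c,d)=\frac{(a-c)(b-d)}{(b-c)(a-d)}$.
   Formalization: The claims on the cusp of F, its tangent direction and its left and right branches are stated only when ρ(s) is neither 0 nor −1/2; at these two values, not excluded by the listed general-position conditions, F need not have such a cusp. *)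

theory Defs
  imports "HOL-Analysis.Analysis"
begin

section \<open>Smooth maps and iterated derivatives\<close>

primrec Ck_on :: "nat \<Rightarrow> ('a::real_normed_vector \<Rightarrow> 'b::real_normed_vector) \<Rightarrow> 'a set \<Rightarrow> bool" where
  "Ck_on 0 f U \<longleftrightarrow> continuous_on U f"
| "Ck_on (Suc k) f U \<longleftrightarrow>
     (\<forall>x\<in>U. f differentiable (at x)) \<and> (\<forall>v. Ck_on k (\<lambda>x. frechet_derivative f (at x) v) U)"

text \<open>Only used for open sets \<open>U\<close>.\<close>
definition smooth_on :: "'a::real_normed_vector set \<Rightarrow> ('a \<Rightarrow> 'b::real_normed_vector) \<Rightarrow> bool" where
  "smooth_on U f \<longleftrightarrow> (\<forall>k. Ck_on k f U)"

definition vd :: "nat \<Rightarrow> (real \<Rightarrow> 'a::real_normed_vector) \<Rightarrow> real \<Rightarrow> 'a" where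
  "vd k c = ((\<lambda>g t. vector_derivative g (at t)) ^^ k) c"

section \<open>Fronts in real projective 3-space\<close>

text \<open>
  A point of projective 3-space is represented by a nonzero vector of \<open>real^4\<close> up to scaling, a
  plane by a nonzero covector, written through the inner product as another nonzero vector of
  \<open>real^4\<close> up to scaling.  Affine oriented 3-space is the chart whose points are
  \<open>vector [1, x, y, z]\<close>.

  A Legendrian surface in the space of contact elements is described in a coordinate chart \<open>U\<close>
  by a map \<open>u \<mapsto> ([f u], [n u])\<close>: the front is the surface parametrised by \<open>f\<close>, and the plane
  \<open>n u\<close> is its tangent plane at \<open>f u\<close>, so that \<open>n\<close> parametrises the dual front.  Curves and
  domains on either surface are described as subsets of \<open>U\<close>; on the smooth part of a surface \<open>U\<close>
  is just a coordinate chart of it.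
\<close>

definition same_point :: "real^4 \<Rightarrow> real^4 \<Rightarrow> bool" where
  "same_point x y \<longleftrightarrow> (\<exists>r. r \<noteq> 0 \<and> y = r *\<^sub>R x)"

text \<open>The map to projective space induced by \<open>f\<close> is an immersion at \<open>u\<close>.\<close>
definition regular_at :: "(real^2 \<Rightarrow> real^4) \<Rightarrow> real^2 \<Rightarrow> bool" where
  "regular_at f u \<longleftrightarrow> (\<forall>v. frechet_derivative f (at u) v \<in> span {f u} \<longrightarrow> v = 0)"

definition legendrian :: "(real^2) set \<Rightarrow> (real^2 \<Rightarrow> real^4) \<Rightarrow> (real^2 \<Rightarrow> real^4) \<Rightarrow> bool" where
  "legendrian U f n \<longleftrightarrow>
     open U \<and> smooth_on U f \<and> smooth_on U n \<and>
     (\<forall>u\<in>U. f u \<noteq> 0 \<and> n u \<noteq> 0) \<and>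
     (\<forall>u\<in>U. f u \<bullet> n u = 0 \<and> (\<forall>v. frechet_derivative f (at u) v \<bullet> n u = 0)) \<and>
     (\<forall>u\<in>U. \<forall>v. frechet_derivative f (at u) v \<in> span {f u} \<and>
                 frechet_derivative n (at u) v \<in> span {n u} \<longrightarrow> v = 0) \<and>
     (\<forall>u\<in>U. \<forall>u'\<in>U. same_point (f u) (f u') \<and> same_point (n u) (n u') \<longrightarrow> u = u')"

text \<open>
  \<open>f\<close> at \<open>u\<close> is equivalent to the germ of \<open>g\<close> at \<open>0\<close> up to local diffeomorphisms of the source
  (\<open>\<phi>\<close>) and of projective space (\<open>\<Psi>\<close>).  A local chart of projective space is a function
  homogeneous of degree 0 whose differential has rank 3.
\<close>
definition germ_equivalent ::
    "(real^2) set \<Rightarrow> (real^2 \<Rightarrow> real^4) \<Rightarrow> real^2 \<Rightarrow> (real^2 \<Rightarrow> real^3) \<Rightarrow> bool" where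
  "germ_equivalent U f u g \<longleftrightarrow>
     (\<exists>A \<phi> W \<Psi>. open A \<and> 0 \<in> A \<and> smooth_on A \<phi> \<and> \<phi> ` A \<subseteq> U \<and> \<phi> 0 = u \<and>
        bij (frechet_derivative \<phi> (at 0)) \<and>
        open W \<and> smooth_on W \<Psi> \<and>
        (\<forall>x\<in>W. \<forall>r. r \<noteq> 0 \<longrightarrow> r *\<^sub>R x \<in> W \<and> \<Psi> (r *\<^sub>R x) = \<Psi> x) \<and>
        f u \<in> W \<and> surj (frechet_derivative \<Psi> (at (f u))) \<and>
        (\<forall>x\<in>A. f (\<phi> x) \<in> W \<and> \<Psi> (f (\<phi> x)) = g x))"

definition cuspidal_point :: "(real^2) set \<Rightarrow> (real^2 \<Rightarrow> real^4) \<Rightarrow> real^2 \<Rightarrow> bool" where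
  "cuspidal_point U f u \<longleftrightarrow>
     germ_equivalent U f u (\<lambda>x. vector [(x$1)^2, (x$1)^3, x$2])"

definition swallowtail_point :: "(real^2) set \<Rightarrow> (real^2 \<Rightarrow> real^4) \<Rightarrow> real^2 \<Rightarrow> bool" where
  "swallowtail_point U f u \<longleftrightarrow>
     germ_equivalent U f u
       (\<lambda>x. vector [3 * (x$1)^4 + (x$1)^2 * x$2, 4 * (x$1)^3 + 2 * x$1 * x$2, x$2])"

text \<open>The cuspidal edge includes the swallowtail points on it.\<close>
definition cuspidal_edge :: "(real^2) set \<Rightarrow> (real^2 \<Rightarrow> real^4) \<Rightarrow> (real^2) set" where
  "cuspidal_edge U f = {u\<in>U. cuspidal_point U f u \<or> swallowtail_point U f u}"

text \<open>Preimage in the chart of the self-intersection line, relative to a part \<open>V\<close> of the chart.\<close>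
definition self_intersection :: "(real^2) set \<Rightarrow> (real^2 \<Rightarrow> real^4) \<Rightarrow> (real^2) set" where
  "self_intersection V f =
     V \<inter> closure {u\<in>V. \<exists>u'\<in>V. u' \<noteq> u \<and> same_point (f u) (f u')}"

section \<open>Contact with lines\<close>

text \<open>
  The projective line \<open>l\<close> (a 2-dimensional subspace of \<open>real^4\<close>) passes through \<open>f u\<close> and has at
  least \<open>k\<close>-point contact there with the sheet of the surface parametrised near \<open>u\<close>: a local
  equation \<open>F = 0\<close> of (the cone over) this sheet, restricted to the line, vanishes to order \<open>k\<close>.
  Used at regular points only.
\<close>
definition line_contact ::
    "(real^2) set \<Rightarrow> (real^2 \<Rightarrow> real^4) \<Rightarrow> real^2 \<Rightarrow> nat \<Rightarrow> (real^4) set \<Rightarrow> bool" where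
  "line_contact U f u k l \<longleftrightarrow>
     (\<exists>w. w \<notin> span {f u} \<and> l = span {f u, w} \<and>
       (\<exists>W V (F :: real^4 \<Rightarrow> real).
          open W \<and> f u \<in> W \<and> smooth_on W F \<and> frechet_derivative F (at (f u)) \<noteq> (\<lambda>v. 0) \<and>
          open V \<and> u \<in> V \<and> V \<subseteq> U \<and>
          (\<forall>v\<in>V. \<forall>r. r *\<^sub>R f v \<in> W \<longrightarrow> F (r *\<^sub>R f v) = 0) \<and>
          (\<forall>j<k. vd j (\<lambda>t. F (f u + t *\<^sub>R w)) 0 = 0)))"

text \<open>Lines with more than 2-point contact; they are automatically tangent.\<close>
definition asymptotic_lines ::
    "(real^2) set \<Rightarrow> (real^2 \<Rightarrow> real^4) \<Rightarrow> real^2 \<Rightarrow> (real^4) set set" where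
  "asymptotic_lines U f u = {l. line_contact U f u 3 l}"

definition elliptic_domain :: "(real^2) set \<Rightarrow> (real^2 \<Rightarrow> real^4) \<Rightarrow> (real^2) set" where
  "elliptic_domain U f = {u\<in>U. regular_at f u \<and> asymptotic_lines U f u = {}}"

definition hyperbolic_domain :: "(real^2) set \<Rightarrow> (real^2 \<Rightarrow> real^4) \<Rightarrow> (real^2) set" where
  "hyperbolic_domain U f = {u\<in>U. regular_at f u \<and> card (asymptotic_lines U f u) = 2}"

definition parabolic_curve :: "(real^2) set \<Rightarrow> (real^2 \<Rightarrow> real^4) \<Rightarrow> (real^2) set" where
  "parabolic_curve U f = {u\<in>U. regular_at f u \<and> card (asymptotic_lines U f u) = 1}"

text \<open>
  Asymptotic lines only exist at regular points; the outer closure adds the singular points of the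
  front (such as swallowtails) through which the curve passes.
\<close>
definition flecnodal_curve :: "(real^2) set \<Rightarrow> (real^2 \<Rightarrow> real^4) \<Rightarrow> (real^2) set" where
  "flecnodal_curve U f =
     U \<inter> closure {u\<in>U. regular_at f u \<and> u \<in> closure (hyperbolic_domain U f) \<and>
                      (\<exists>l. line_contact U f u 4 l)}"

section \<open>Left and right\<close>

text \<open>
  Sign of the frame of the first three derivatives.  For an affine curve, lifted to
  \<open>\<gamma> = vector [1, x, y, z]\<close>, this is the determinant of these derivatives; in general its sign does
  not depend on the lift or on the parameter.
\<close>
definition frame :: "(real \<Rightarrow> real^4) \<Rightarrow> real \<Rightarrow> real" where
  "frame \<gamma> t = det (vector [\<gamma> t, vd 1 \<gamma> t, vd 2 \<gamma> t, vd 3 \<gamma> t] :: real^4^4)"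

definition asymptotic_curve ::
    "(real^2) set \<Rightarrow> (real^2 \<Rightarrow> real^4) \<Rightarrow> real set \<Rightarrow> (real \<Rightarrow> real^2) \<Rightarrow> bool" where
  "asymptotic_curve U f T c \<longleftrightarrow>
     smooth_on T c \<and> c ` T \<subseteq> hyperbolic_domain U f \<and>
     (\<forall>t\<in>T. vd 1 c t \<noteq> 0 \<and> span {f (c t), vd 1 (f \<circ> c) t} \<in> asymptotic_lines U f (c t))"

text \<open>
  At a flecnodal point the asymptotic curve of higher contact has an inflection, where the frame of
  its derivatives degenerates.  Hence the sign of the frame is required only at the neighbouring
  points of the asymptotic curve through \<open>u\<close>.
\<close>
definition left_asymptotic_line ::
    "(real^2) set \<Rightarrow> (real^2 \<Rightarrow> real^4) \<Rightarrow> real^2 \<Rightarrow> (real^4) set \<Rightarrow> bool" where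
  "left_asymptotic_line U f u l \<longleftrightarrow>
     (\<exists>c e. e > 0 \<and> asymptotic_curve U f {-e<..<e} c \<and> c 0 = u \<and>
            l = span {f u, vd 1 (f \<circ> c) 0} \<and>
            (\<forall>t\<in>{-e<..<e} - {0}. frame (f \<circ> c) t < 0))"

definition right_asymptotic_line ::
    "(real^2) set \<Rightarrow> (real^2 \<Rightarrow> real^4) \<Rightarrow> real^2 \<Rightarrow> (real^4) set \<Rightarrow> bool" where
  "right_asymptotic_line U f u l \<longleftrightarrow>
     (\<exists>c e. e > 0 \<and> asymptotic_curve U f {-e<..<e} c \<and> c 0 = u \<and>
            l = span {f u, vd 1 (f \<circ> c) 0} \<and>
            (\<forall>t\<in>{-e<..<e} - {0}. frame (f \<circ> c) t > 0))"

definition left_branch :: "(real^2) set \<Rightarrow> (real^2 \<Rightarrow> real^4) \<Rightarrow> (real^2) set" where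
  "left_branch U f =
     {u\<in>flecnodal_curve U f. \<exists>l. line_contact U f u 4 l \<and> left_asymptotic_line U f u l}"

definition right_branch :: "(real^2) set \<Rightarrow> (real^2 \<Rightarrow> real^4) \<Rightarrow> (real^2) set" where
  "right_branch U f =
     {u\<in>flecnodal_curve U f. \<exists>l. line_contact U f u 4 l \<and> right_asymptotic_line U f u l}"

section \<open>General position\<close>

text \<open>
  That the parabolic curve avoids a swallowtail means that the dual front is smooth there: the
  parabolic points of a front are the singular points of its dual.  Both forms are required, as the
  first one does not see parabolic points hidden in the cuspidal edge, where asymptotic
  lines are not defined.
\<close>
definition front_in_general_position ::
    "(real^2) set \<Rightarrow> (real^2 \<Rightarrow> real^4) \<Rightarrow> (real^2 \<Rightarrow> real^4) \<Rightarrow> bool" where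
  "front_in_general_position U f n \<longleftrightarrow>
     legendrian U f n \<and>
     (\<forall>u\<in>U. regular_at f u \<or> cuspidal_point U f u \<or> swallowtail_point U f u) \<and>
     (\<forall>u\<in>U. regular_at n u \<or> cuspidal_point U n u \<or> swallowtail_point U n u) \<and>
     (\<forall>u\<in>U. swallowtail_point U f u \<longrightarrow> u \<notin> closure (parabolic_curve U f) \<and> regular_at n u) \<and>
     (\<forall>u\<in>U. swallowtail_point U n u \<longrightarrow> u \<notin> closure (parabolic_curve U n) \<and> regular_at f u)"

definition elliptic_swallowtail :: "(real^2) set \<Rightarrow> (real^2 \<Rightarrow> real^4) \<Rightarrow> real^2 \<Rightarrow> bool" where
  "elliptic_swallowtail U f s \<longleftrightarrow> swallowtail_point U f s \<and>
     (\<exists>V. open V \<and> s \<in> V \<and> V \<subseteq> U \<and> self_intersection V f - {s} \<subseteq> elliptic_domain U f)"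

definition hyperbolic_swallowtail :: "(real^2) set \<Rightarrow> (real^2 \<Rightarrow> real^4) \<Rightarrow> real^2 \<Rightarrow> bool" where
  "hyperbolic_swallowtail U f s \<longleftrightarrow> swallowtail_point U f s \<and>
     (\<exists>V. open V \<and> s \<in> V \<and> V \<subseteq> U \<and> self_intersection V f - {s} \<subseteq> hyperbolic_domain U f)"

section \<open>The cr-invariant\<close>

definition parametrises :: "(real \<Rightarrow> real^2) \<Rightarrow> (real^2) set \<Rightarrow> real^2 \<Rightarrow> bool" where
  "parametrises c C s \<longleftrightarrow>
     smooth_on {-1<..<1} c \<and> inj_on c {-1<..<1} \<and> (\<forall>t\<in>{-1<..<1}. vd 1 c t \<noteq> 0) \<and>
     c 0 = s \<and> c ` {-1<..<1} = C"

definition tangent_plane :: "(real^2 \<Rightarrow> real^4) \<Rightarrow> real^2 \<Rightarrow> (real^4) set" where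
  "tangent_plane f u = span (insert (f u) (range (frechet_derivative f (at u))))"

definition conodal_curve :: "(real^2) set \<Rightarrow> (real^2 \<Rightarrow> real^4) \<Rightarrow> (real^2) set" where
  "conodal_curve V f =
     V \<inter> closure {u\<in>V. \<exists>u'\<in>V. \<not> same_point (f u) (f u') \<and> tangent_plane f u = tangent_plane f u'}"

text \<open>
  A contact element of the chart at \<open>u\<close> is a line in the tangent plane \<open>real^2\<close>; lines are encoded by
  the matrix of the orthogonal projection onto them, which embeds the projective line into
  \<open>real^2^2\<close>.
\<close>
definition line_matrix :: "real^2 \<Rightarrow> real^2^2" where
  "line_matrix v = (\<chi> i j. v$i * v$j / (v \<bullet> v))"

definition contact_lift :: "(real \<Rightarrow> real^2) \<Rightarrow> real \<Rightarrow> (real^2) \<times> (real^2^2)" where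
  "contact_lift c t = (c t, line_matrix (vd 1 c t))"

definition lift_tangent :: "(real \<Rightarrow> real^2) \<Rightarrow> ((real^2) \<times> (real^2^2)) set" where
  "lift_tangent c = span {vd 1 (contact_lift c) 0}"

text \<open>Tangent line, at the contact element spanned by \<open>v\<close>, of the fibre over \<open>s\<close>.\<close>
definition fibre_tangent :: "real^2 \<Rightarrow> real^2 \<Rightarrow> ((real^2) \<times> (real^2^2)) set" where
  "fibre_tangent s v = span {vd 1 (\<lambda>t. (s, line_matrix (v + t *\<^sub>R w))) 0 | w. True}"

text \<open>Cross-ratio of four lines of a plane with basis \<open>X, Y\<close> not containing the line of \<open>Y\<close>.\<close>
definition has_cross_ratio ::
    "'a::real_vector set \<Rightarrow> 'a set \<Rightarrow> 'a set \<Rightarrow> 'a set \<Rightarrow> real \<Rightarrow> bool" where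
  "has_cross_ratio A B C D r \<longleftrightarrow>
     (\<exists>X Y a b c d. Y \<noteq> 0 \<and> X \<notin> span {Y} \<and>
        A = span {X + a *\<^sub>R Y} \<and> B = span {X + b *\<^sub>R Y} \<and>
        C = span {X + c *\<^sub>R Y} \<and> D = span {X + d *\<^sub>R Y} \<and>
        b \<noteq> c \<and> a \<noteq> d \<and> r = ((a - c) * (b - d)) / ((b - c) * (a - d)))"

text \<open>
  Here \<open>n\<close> parametrises a surface which is smooth near its godron \<open>g\<close>.  The neighbourhoods \<open>W\<close>
  range over arbitrarily small ones so that only the germ of the conodal curve matters.
\<close>
definition has_cr_invariant ::
    "(real^2) set \<Rightarrow> (real^2 \<Rightarrow> real^4) \<Rightarrow> real^2 \<Rightarrow> real \<Rightarrow> bool" where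
  "has_cr_invariant U n g r \<longleftrightarrow>
     (\<forall>W0. open W0 \<and> g \<in> W0 \<longrightarrow>
       (\<exists>W cF cP cD. open W \<and> g \<in> W \<and> W \<subseteq> W0 \<and> W \<subseteq> U \<and>
          parametrises cF (flecnodal_curve U n \<inter> W) g \<and>
          parametrises cP (parabolic_curve U n \<inter> W) g \<and>
          parametrises cD (conodal_curve W n) g \<and>
          contact_lift cF 0 = contact_lift cP 0 \<and> contact_lift cP 0 = contact_lift cD 0 \<and>
          has_cross_ratio (lift_tangent cF) (lift_tangent cP) (lift_tangent cD)
            (fibre_tangent g (vd 1 cP 0)) r))"

definition cr_invariant :: "(real^2) set \<Rightarrow> (real^2 \<Rightarrow> real^4) \<Rightarrow> real^2 \<Rightarrow> real" where
  "cr_invariant U n g = (THE r. has_cr_invariant U n g r)"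

section \<open>The local picture at a swallowtail\<close>

text \<open>Projective space in the affine chart \<open>{x. a \<bullet> x = 1}\<close>.\<close>
definition affine_chart :: "real^4 \<Rightarrow> real^4 \<Rightarrow> real^4" where
  "affine_chart a x = x /\<^sub>R (a \<bullet> x)"

definition semicubical_cusp :: "(real \<Rightarrow> 'a::real_normed_vector) \<Rightarrow> bool" where
  "semicubical_cusp \<gamma> \<longleftrightarrow> vd 1 \<gamma> 0 = 0 \<and> vd 2 \<gamma> 0 \<noteq> 0 \<and> vd 3 \<gamma> 0 \<notin> span {vd 2 \<gamma> 0}"

text \<open>
  Both branches of a cusp \<open>\<gamma>\<close> leave \<open>\<gamma> 0\<close> in the direction \<open>vd 2 \<gamma> 0\<close>.  The three predicates compare
  these directions for two cusps at the same point: same line, same ray, opposite rays.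
\<close>
definition cotangent_cusps :: "(real \<Rightarrow> 'a::real_normed_vector) \<Rightarrow> (real \<Rightarrow> 'a) \<Rightarrow> bool" where
  "cotangent_cusps \<gamma> \<delta> \<longleftrightarrow> (\<exists>k. k \<noteq> 0 \<and> vd 2 \<gamma> 0 = k *\<^sub>R vd 2 \<delta> 0)"

definition codirected_cusps :: "(real \<Rightarrow> 'a::real_normed_vector) \<Rightarrow> (real \<Rightarrow> 'a) \<Rightarrow> bool" where
  "codirected_cusps \<gamma> \<delta> \<longleftrightarrow> (\<exists>k>0. vd 2 \<gamma> 0 = k *\<^sub>R vd 2 \<delta> 0)"

definition opposite_cusps :: "(real \<Rightarrow> 'a::real_normed_vector) \<Rightarrow> (real \<Rightarrow> 'a) \<Rightarrow> bool" where
  "opposite_cusps \<gamma> \<delta> \<longleftrightarrow> (\<exists>k<0. vd 2 \<gamma> 0 = k *\<^sub>R vd 2 \<delta> 0)"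

text \<open>
  \<open>cE\<close>, \<open>cF\<close>, \<open>cD\<close> parametrise in \<open>V\<close> the cuspidal edge, the flecnodal curve and the preimage of the
  self-intersection line; \<open>s\<close> cuts each of them into two branches.  The cuspidal edge cuts \<open>V\<close>
  into two parts, one of which contains the self-intersection line.
\<close>
definition local_picture ::
    "(real^2) set \<Rightarrow> (real^2 \<Rightarrow> real^4) \<Rightarrow> real^2 \<Rightarrow> (real^2) set \<Rightarrow>
     (real \<Rightarrow> real^2) \<Rightarrow> (real \<Rightarrow> real^2) \<Rightarrow> (real \<Rightarrow> real^2) \<Rightarrow> bool" where
  "local_picture U f s V cE cF cD \<longleftrightarrow>
     open V \<and> s \<in> V \<and> V \<subseteq> U \<and>
     parametrises cE (cuspidal_edge U f \<inter> V) s \<and>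
     parametrises cF (flecnodal_curve U f \<inter> V) s \<and>
     parametrises cD (self_intersection V f) s \<and>
     card (components (V - cuspidal_edge U f)) = 2 \<and>
     (\<exists>B\<in>components (V - cuspidal_edge U f). self_intersection V f - {s} \<subseteq> B)"

definition small_domain :: "(real^2) set \<Rightarrow> (real^2 \<Rightarrow> real^4) \<Rightarrow> (real^2) set \<Rightarrow> (real^2) set" where
  "small_domain U f V =
     \<Union> {A\<in>components (V - cuspidal_edge U f). A \<inter> self_intersection V f = {}}"

definition separates_in :: "'a::topological_space set \<Rightarrow> 'a set \<Rightarrow> 'a set \<Rightarrow> 'a set \<Rightarrow> bool" where
  "separates_in X C A B \<longleftrightarrow> A \<subseteq> X - C \<and> B \<subseteq> X - C \<and>
     (\<forall>a\<in>A. \<forall>b\<in>B. \<not> connected_component (X - C) a b)"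

text \<open>
  In space, the curve \<open>D\<close> runs near \<open>s\<close> between the branches \<open>L\<close> and \<open>R\<close> of a cusp with tangent
  direction \<open>T\<close> (affine chart \<open>a\<close>).  Cut by planes transversal to \<open>T\<close> (levels of \<open>h\<close>): the point of
  \<open>D\<close> lies between those of \<open>L\<close> and \<open>R\<close>, measured in the tangent plane \<open>p\<close> across \<open>T\<close> by any linear
  functional \<open>m\<close> which vanishes on \<open>T\<close> but not on the tangent plane.
\<close>
definition runs_between ::
    "(real^2 \<Rightarrow> real^4) \<Rightarrow> real^2 \<Rightarrow> real^4 \<Rightarrow> real^4 \<Rightarrow> real^4 \<Rightarrow>
     (real^2) set \<Rightarrow> (real^2) set \<Rightarrow> (real^2) set \<Rightarrow> bool" where
  "runs_between f s a p T D L R \<longleftrightarrow>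
     (\<forall>h m. h \<bullet> T \<noteq> 0 \<and> m \<bullet> T = 0 \<and> (\<exists>v. v \<bullet> p = 0 \<and> v \<bullet> a = 0 \<and> m \<bullet> v \<noteq> 0) \<longrightarrow>
       (\<forall>\<eta>>0. \<exists>\<epsilon>>0. \<forall>d\<in>D \<inter> ball s \<epsilon> - {s}. \<exists>u\<in>L \<inter> ball s \<eta>. \<exists>v\<in>R \<inter> ball s \<eta>.
          (let d' = affine_chart a (f d); u' = affine_chart a (f u); v' = affine_chart a (f v)
           in h \<bullet> u' = h \<bullet> d' \<and> h \<bullet> v' = h \<bullet> d' \<and>
              (m \<bullet> u' < m \<bullet> d' \<and> m \<bullet> d' < m \<bullet> v' \<or> m \<bullet> v' < m \<bullet> d' \<and> m \<bullet> d' < m \<bullet> u'))))"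

text \<open>
  Each branch of the cuspidal edge is separated from the self-intersection line by one branch of the
  flecnodal curve.  The part of the surface considered is the complement of the small domain,
  punctured at \<open>s\<close>: through the small domain one can go from one branch of the edge to the other.
\<close>
definition branchwise_separated ::
    "(real^2) set \<Rightarrow> (real^2 \<Rightarrow> real^4) \<Rightarrow> real^2 \<Rightarrow> (real^2) set \<Rightarrow> (real \<Rightarrow> real^2) \<Rightarrow> bool" where
  "branchwise_separated U f s V cE \<longleftrightarrow>
     (let X = V - small_domain U f V - {s};
          D = self_intersection V f - {s};
          E1 = cE ` {-1<..<0}; E2 = cE ` {0<..<1};
          L = left_branch U f \<inter> V; R = right_branch U f \<inter> V
      in separates_in X L E1 D \<and> separates_in X R E2 D \<or>
         separates_in X R E1 D \<and> separates_in X L E2 D)"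

end

theory Submission
  imports Defs
begin

text \<open>In the coordinates \<open>x\<close> of the normal form of the swallowtail, \<open>F = f \<circ> \<phi>\<close> satisfies
  \<open>F\<^sub>1 = e h + \<mu> F\<close> with \<open>e = 12 x\<^sub>1\<^sup>2 + 2 x\<^sub>2\<close>, so the second fundamental form has the
  coefficients \<open>e \<alpha>\<close>, \<open>e \<beta>\<close>, \<open>\<gamma>\<close> with \<open>\<alpha>\<close> and \<open>\<gamma>\<close> nonzero.  By the implicit function theorem the
  flecnodal curve is the graph of a smooth function with 2-jet \<open>- (6 + 8 q) x\<^sub>1\<^sup>2\<close>, where
  \<open>q = \<gamma> / \<alpha>\<close> at the swallowtail, while the cuspidal edge and the self-intersection line are
  \<open>x\<^sub>2 = - 6 x\<^sub>1\<^sup>2\<close> and \<open>x\<^sub>2 = - 2 x\<^sub>1\<^sup>2\<close>.  Contact with lines is preserved by duality, so these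
  are also the flecnodal, parabolic and conodal curves of the dual surface; their 2-jets give
  \<open>\<rho> = 1 + 2 q\<close>.  The configurations follow by comparing \<open>- (6 + 8 q)\<close> with \<open>- 6\<close>, \<open>- 2\<close> and \<open>0\<close>.\<close>

section \<open>Calculus of smooth maps\<close>

text \<open>Along the edge the front is not immersed, so at the swallowtail itself there is no
  contact with lines to speak of. The remedy is to treat the slope \<open>p\<close> of an asymptotic
  direction as a third unknown: the two conditions for 4-point contact, \<open>G1 = 0\<close> and
  \<open>G2 = 0\<close>, are polynomial in \<open>p\<close> with coefficients smooth across the
  edge, and they cut out a smooth curve in (x1, x2, p)-space. On it x2 is of second order, so the
  linear part of \<open>G2 = 0\<close> is -24 \<alpha> x1 - 6 \<alpha> p = 0, giving p = -4 x1; then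
  \<open>G1 = 0\<close> gives \<open>edge_fun\<close> = -16 q x1^2 to second order, whence the
  coefficient -(6 + 8 q). That \<alpha> and \<gamma> do not vanish is the immersivity of the dual
  surface. The excluded values are q = -1/2 (\<rho> = 0), where the flecnodal curve has the 2-jet of
  the self-intersection line, and q = -3/4 (\<rho> = -1/2), where its 2-jet vanishes. Left and right
  are told apart by the sign of the frame along asymptotic curves, which is a square times an
  expression in the slope; as the slope changes sign with x1, the swallowtail separates the
  branches.\<close>

lemmas real_derivative_iff = has_real_derivative_iff_has_vector_derivative

text \<open>The point is the last argument, so that \<open>pd f v\<close> is again a map and higher
  derivatives in fixed directions are iterated applications of \<open>pd\<close>.\<close>

definition pd :: "('a::real_normed_vector => 'b::real_normed_vector) => 'a => 'a => 'b" where
  "pd f v x = frechet_derivative f (at x) v"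

lemma has_derivative_pd: "f differentiable at x ==> (f has_derivative (\<lambda>v. pd f v x)) (at x)"
  unfolding pd_def frechet_derivative_works[symmetric] .

lemma pd_eqI: "(f has_derivative f') (at x) ==> pd f v x = f' v"
  by (metis frechet_derivative_at pd_def)

lemma Ck_on_cong:
  assumes "open U" "\<And>x. x \<in> U ==> f x = g x"
  shows "Ck_on k f U \<longleftrightarrow> Ck_on k g U"
  using assms
proof (induction k arbitrary: f g)
  case 0
  then show ?case by (auto intro: continuous_on_cong)
next
  case (Suc k)
  have D: "f differentiable at x \<longleftrightarrow> g differentiable at x" if "x \<in> U" for x
    using Suc.prems that by (metis differentiable_def has_derivative_transform_within_open)
  have F: "frechet_derivative f (at x) = frechet_derivative g (at x)"
    if "x \<in> U" "f differentiable at x" for x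
    using Suc.prems that by (metis frechet_derivative_transform_within_open)
  have C: "Ck_on k (\<lambda>x. frechet_derivative f (at x) v) U \<longleftrightarrow> Ck_on k (\<lambda>x. frechet_derivative g (at x) v) U"
    if "\<forall>x\<in>U. f differentiable at x" for v
    by (rule Suc.IH[OF Suc.prems(1)]) (use F that in auto)
  then show ?case using D by auto
qed

lemma Ck_on_subset: "Ck_on k f U ==> V \<subseteq> U ==> Ck_on k f V"
  by (induction k arbitrary: f) (auto intro: continuous_on_subset)

lemma Ck_on_continuous: "Ck_on k f U ==> continuous_on U f"
  by (cases k) (auto simp: continuous_at_imp_continuous_on differentiable_imp_continuous_within)

text \<open>\<open>Ck_on\<close> asks for the derivatives in all fixed directions. With this rule
  the closure proofs below present an explicit derivative and apply the induction hypothesis to each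
  direction.\<close>

lemma Ck_on_SucI:
  assumes "open U" "\<And>x. x \<in> U ==> (f has_derivative f' x) (at x)"
    "\<And>v. Ck_on k (\<lambda>x. f' x v) U"
  shows "Ck_on (Suc k) f U"
proof -
  have "Ck_on k (\<lambda>x. frechet_derivative f (at x) v) U" for v
    using assms Ck_on_cong[OF assms(1), of "\<lambda>x. frechet_derivative f (at x) v" "\<lambda>x. f' x v" k]
    by (metis frechet_derivative_at)
  then show ?thesis using assms by (auto simp: differentiable_def)
qed

lemma Ck_on_SucD: "Ck_on (Suc k) f U ==> Ck_on k f U"
proof (induction k arbitrary: f)
  case 0
  then show ?case by (metis Ck_on.simps(1) Ck_on_continuous)
next
  case (Suc k)
  then show ?case by (metis Ck_on.simps(2))
qed

lemma Ck_on_pd: "Ck_on (Suc k) f U ==> Ck_on k (pd f v) U"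
  by (simp add: pd_def[abs_def])

lemma Ck_on_has_derivative:
  "Ck_on (Suc k) f U ==> x \<in> U ==> (f has_derivative (\<lambda>v. pd f v x)) (at x)"
  by (simp add: has_derivative_pd)

lemma Ck_on_const: "open U ==> Ck_on k (\<lambda>x. c) U"
  by (induction k arbitrary: c) (auto simp del: Ck_on.simps(2) intro!: Ck_on_SucI[where f'="\<lambda>x v. 0"])

lemma Ck_on_linear:
  assumes "open U" "bounded_linear f"
  shows "Ck_on k f U"
proof (cases k)
  case 0
  then show ?thesis using assms by (simp add: linear_continuous_on)
next
  case (Suc j)
  then show ?thesis
    using assms by (auto simp del: Ck_on.simps(2) intro!: Ck_on_SucI[where f'="\<lambda>x v. f v"] Ck_on_const
      simp: bounded_linear_imp_has_derivative)
qed

lemma Ck_on_add: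
  assumes "open U" "Ck_on k f U" "Ck_on k g U"
  shows "Ck_on k (\<lambda>x. f x + g x) U"
  using assms(2,3)
proof (induction k arbitrary: f g)
  case (Suc k)
  then show ?case
    by (intro Ck_on_SucI[where f'="\<lambda>x v. pd f v x + pd g v x"])
       (auto intro!: has_derivative_add assms Ck_on_has_derivative Suc.IH Ck_on_pd simp del: Ck_on.simps(2))
qed (auto intro: continuous_on_add)

lemma Ck_on_bilinear:
  assumes "open U" "bounded_bilinear h" "Ck_on k f U" "Ck_on k g U"
  shows "Ck_on k (\<lambda>x. h (f x) (g x)) U"
  using assms(3,4)
proof (induction k arbitrary: f g)
  case 0
  then show ?case using bounded_bilinear.continuous_on[OF assms(2)] by auto
next
  case (Suc k)
  show ?case
  proof (rule Ck_on_SucI[OF assms(1)])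
    show "((\<lambda>x. h (f x) (g x)) has_derivative (\<lambda>v. h (f x) (pd g v x) + h (pd f v x) (g x))) (at x)"
      if "x \<in> U" for x
      by (rule bounded_bilinear.FDERIV[OF assms(2) Ck_on_has_derivative[OF Suc.prems(1) that]
          Ck_on_has_derivative[OF Suc.prems(2) that]])
    show "Ck_on k (\<lambda>x. h (f x) (pd g v x) + h (pd f v x) (g x)) U" for v
      by (intro Ck_on_add assms(1) Suc.IH Ck_on_pd Suc.prems Suc.prems[THEN Ck_on_SucD])
  qed
qed

lemma Ck_on_bounded_linear:
  assumes "open U" "bounded_linear h" "Ck_on k f U"
  shows "Ck_on k (\<lambda>x. h (f x)) U"
  using assms(3)
proof (induction k arbitrary: f)
  case 0
  then show ?case by (simp add: assms bounded_linear.continuous_on)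
next
  case (Suc k)
  then show ?case
    by (intro Ck_on_SucI[where f'="\<lambda>x v. h (pd f v x)"])
       (auto intro!: assms bounded_linear.has_derivative[OF assms(2)] Ck_on_has_derivative Suc.IH
          Ck_on_pd simp del: Ck_on.simps(2))
qed

lemma Ck_on_sum:
  "open U ==> (\<And>i. i \<in> I ==> Ck_on k (f i) U) ==> Ck_on k (\<lambda>x. \<Sum>i\<in>I. f i x) U"
  by (induction I rule: infinite_finite_induct) (auto intro: Ck_on_const Ck_on_add)

lemma Ck_on_prod:
  fixes f :: "'i => 'a::real_normed_vector => real"
  shows "open U ==> (\<And>i. i \<in> I ==> Ck_on k (f i) U) ==> Ck_on k (\<lambda>x. \<Prod>i\<in>I. f i x) U"
  by (induction I rule: infinite_finite_induct)
     (auto intro: Ck_on_const Ck_on_bilinear[OF _ bounded_bilinear_mult])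

lemma Ck_on_euclidean:
  fixes f :: "'a::real_normed_vector => 'b::euclidean_space"
  assumes "open U" "\<And>i. i \<in> Basis ==> Ck_on k (\<lambda>x. f x \<bullet> i) U"
  shows "Ck_on k f U"
proof -
  have "Ck_on k (\<lambda>x. \<Sum>i\<in>Basis. (f x \<bullet> i) *\<^sub>R i) U"
    by (intro Ck_on_sum Ck_on_bilinear[OF _ bounded_bilinear_scaleR] Ck_on_const assms)
  then show ?thesis by (simp add: euclidean_representation)
qed

lemma Ck_on_vec:
  fixes f :: "'a::real_normed_vector => real^'n"
  assumes "open U" "\<And>i. Ck_on k (\<lambda>x. f x $ i) U"
  shows "Ck_on k f U"
  by (rule Ck_on_euclidean) (use assms in \<open>auto simp: Basis_vec_def inner_axis\<close>)

lemma Ck_on_inverse: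
  fixes f :: "'a::real_normed_vector => real"
  assumes "open U" "Ck_on k f U" "\<And>x. x \<in> U ==> f x \<noteq> 0"
  shows "Ck_on k (\<lambda>x. inverse (f x)) U"
  using assms(2)
proof (induction k)
  case 0
  then show ?case using assms by (auto intro: continuous_on_inverse)
next
  case (Suc k)
  show ?case
  proof (rule Ck_on_SucI[OF assms(1)])
    show "((\<lambda>x. inverse (f x)) has_derivative (\<lambda>v. - (inverse (f x) * pd f v x * inverse (f x)))) (at x)"
      if "x \<in> U" for x
      by (rule Deriv.has_derivative_inverse[OF assms(3)[OF that] Ck_on_has_derivative[OF Suc.prems that]])
    show "Ck_on k (\<lambda>x. - (inverse (f x) * pd f v x * inverse (f x))) U" for v
      by (intro Ck_on_bounded_linear[OF _ bounded_linear_minus[OF bounded_linear_ident]]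
          Ck_on_bilinear[OF _ bounded_bilinear_mult] assms(1) Suc.IH Ck_on_pd Suc.prems Suc.prems[THEN Ck_on_SucD])
  qed
qed

text \<open>By the chain rule the derivative is that of \<open>f\<close> in the direction
  \<open>pd g v x\<close>, which moves with \<open>x\<close>, whereas the induction hypothesis
  covers fixed directions. Expansion in the basis separates the two.\<close>

lemma Ck_on_compose:
  fixes f :: "'b::euclidean_space => 'c::real_normed_vector"
  assumes "open U" "open V" "\<And>x. x \<in> U ==> g x \<in> V" "Ck_on k g U" "Ck_on k f V"
  shows "Ck_on k (\<lambda>x. f (g x)) U"
  using assms(4,5)
proof (induction k arbitrary: f)
  case 0
  then show ?case using assms by (auto intro: continuous_on_compose2)
next
  case (Suc k)
  have *: "((\<lambda>x. f (g x)) has_derivative (\<lambda>v. \<Sum>i\<in>Basis. (pd g v x \<bullet> i) *\<^sub>R pd f i (g x))) (at x)"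
    if "x \<in> U" for x
  proof -
    have d: "(f has_derivative (\<lambda>v. pd f v (g x))) (at (g x))"
      using Suc.prems assms that Ck_on_has_derivative by blast
    then have l: "linear (\<lambda>v. pd f v (g x))" by (rule has_derivative_linear)
    have D: "((\<lambda>x. f (g x)) has_derivative (\<lambda>v. pd f (pd g v x) (g x))) (at x)"
      using has_derivative_compose[OF Ck_on_has_derivative[OF Suc.prems(1) that] d] .
    have e: "pd f w (g x) = (\<Sum>i\<in>Basis. (w \<bullet> i) *\<^sub>R pd f i (g x))" for w
    proof -
      have "pd f (\<Sum>i\<in>Basis. (w \<bullet> i) *\<^sub>R i) (g x) = (\<Sum>i\<in>Basis. (w \<bullet> i) *\<^sub>R pd f i (g x))"
        using linear_sum[OF l, of "\<lambda>i. (w \<bullet> i) *\<^sub>R i" Basis] linear_cmul[OF l] by simp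
      then show ?thesis by (simp add: euclidean_representation)
    qed
    have "(\<lambda>v. pd f (pd g v x) (g x)) = (\<lambda>v. \<Sum>i\<in>Basis. (pd g v x \<bullet> i) *\<^sub>R pd f i (g x))"
      by (rule ext) (rule e)
    with D show ?thesis by (simp only:)
  qed
  have g: "Ck_on k g U" by (rule Ck_on_SucD[OF Suc.prems(1)])
  show ?case
  proof (rule Ck_on_SucI[OF assms(1) *])
    show "Ck_on k (\<lambda>x. \<Sum>i\<in>Basis. (pd g v x \<bullet> i) *\<^sub>R pd f i (g x)) U" for v
      by (rule Ck_on_sum[OF assms(1) Ck_on_bilinear[OF assms(1) bounded_bilinear_scaleR
            Ck_on_bounded_linear[OF assms(1) bounded_linear_inner_left Ck_on_pd[OF Suc.prems(1)]]
            Suc.IH[OF g Ck_on_pd[OF Suc.prems(2)]]]])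
  qed
qed

lemma smooth_on_cong: "open U ==> (\<And>x. x \<in> U ==> f x = g x) ==> smooth_on U f \<longleftrightarrow> smooth_on U g"
  unfolding smooth_on_def using Ck_on_cong by blast

lemma smooth_on_subset: "smooth_on U f ==> V \<subseteq> U ==> smooth_on V f"
  unfolding smooth_on_def using Ck_on_subset by blast

lemma smooth_on_has_derivative:
  "smooth_on U f ==> x \<in> U ==> (f has_derivative (\<lambda>v. pd f v x)) (at x)"
  unfolding smooth_on_def using Ck_on_has_derivative by blast

lemma smooth_on_differentiable: "smooth_on U f ==> x \<in> U ==> f differentiable at x"
  unfolding smooth_on_def by (metis Ck_on.simps(2))

lemma smooth_on_continuous: "smooth_on U f ==> continuous_on U f"
  unfolding smooth_on_def using Ck_on_continuous by blast

lemma smooth_on_isCont: "smooth_on U f ==> x \<in> U ==> isCont f x"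
  by (meson differentiable_imp_continuous_within smooth_on_differentiable)

lemma smooth_on_tendsto: "smooth_on U f ==> x \<in> U ==> (f \<longlongrightarrow> f x) (at x)"
  using smooth_on_isCont isCont_def by blast

lemma smooth_on_pd: "smooth_on U f ==> smooth_on U (pd f v)"
  unfolding smooth_on_def using Ck_on_pd by blast

lemma pd_linear: assumes "smooth_on U f" "x \<in> U" shows "linear (\<lambda>v. pd f v x)"
  using has_derivative_linear smooth_on_has_derivative assms by blast

lemma smooth_on_const: "open U ==> smooth_on U (\<lambda>x. c)"
  unfolding smooth_on_def using Ck_on_const by blast

lemma smooth_on_linear: "open U ==> bounded_linear f ==> smooth_on U f"
  unfolding smooth_on_def using Ck_on_linear by blast

lemma smooth_on_ident: "open U ==> smooth_on U (\<lambda>x. x)"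
  by (rule smooth_on_linear[OF _ bounded_linear_ident])

lemma smooth_on_add: "open U ==> smooth_on U f ==> smooth_on U g ==> smooth_on U (\<lambda>x. f x + g x)"
  unfolding smooth_on_def using Ck_on_add by blast

lemma smooth_on_bounded_linear:
  "open U ==> bounded_linear h ==> smooth_on U f ==> smooth_on U (\<lambda>x. h (f x))"
  unfolding smooth_on_def using Ck_on_bounded_linear by blast

lemma smooth_on_minus: "open U ==> smooth_on U f ==> smooth_on U (\<lambda>x. - f x)"
  by (rule smooth_on_bounded_linear[OF _ bounded_linear_minus[OF bounded_linear_ident]])

lemma smooth_on_diff: "open U ==> smooth_on U f ==> smooth_on U g ==> smooth_on U (\<lambda>x. f x - g x)"
  using smooth_on_add[of U f "\<lambda>x. - g x"] smooth_on_minus[of U g] by simp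

lemma smooth_on_bilinear:
  "open U ==> bounded_bilinear h ==> smooth_on U f ==> smooth_on U g ==>
   smooth_on U (\<lambda>x. h (f x) (g x))"
  unfolding smooth_on_def using Ck_on_bilinear by blast

lemmas smooth_on_scaleR = smooth_on_bilinear[OF _ bounded_bilinear_scaleR]
lemmas smooth_on_inner = smooth_on_bilinear[OF _ bounded_bilinear_inner]

lemma smooth_on_mult:
  fixes f g :: "_ => real"
  shows "open U ==> smooth_on U f ==> smooth_on U g ==> smooth_on U (\<lambda>x. f x * g x)"
  by (rule smooth_on_bilinear[OF _ bounded_bilinear_mult])

lemma smooth_on_power:
  fixes f :: "_ => real"
  shows "open U ==> smooth_on U f ==> smooth_on U (\<lambda>x. f x ^ n)"
  by (induction n) (auto intro: smooth_on_const smooth_on_mult)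

lemma smooth_on_divide:
  fixes f g :: "_ => real"
  assumes "open U" "smooth_on U f" "smooth_on U g" "\<And>x. x \<in> U ==> g x \<noteq> 0"
  shows "smooth_on U (\<lambda>x. f x / g x)"
  unfolding divide_inverse
  by (rule smooth_on_mult[OF assms(1,2)], unfold smooth_on_def, rule allI,
      rule Ck_on_inverse) (use assms in \<open>auto simp: smooth_on_def\<close>)

lemma smooth_on_vec:
  fixes f :: "'a::real_normed_vector => real^'n"
  shows "open U ==> (\<And>i. smooth_on U (\<lambda>x. f x $ i)) ==> smooth_on U f"
  unfolding smooth_on_def using Ck_on_vec by blast

lemma smooth_on_nth: "open U ==> smooth_on U f ==> smooth_on U (\<lambda>x. f x $ i)"
  by (rule smooth_on_bounded_linear[OF _ bounded_linear_vec_nth])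

lemma smooth_on_compose:
  fixes f :: "'b::euclidean_space => 'c::real_normed_vector"
  shows "open U ==> open V ==> (\<And>x. x \<in> U ==> g x \<in> V) ==> smooth_on U g ==> smooth_on V f ==>
   smooth_on U (\<lambda>x. f (g x))"
  unfolding smooth_on_def using Ck_on_compose by blast

lemma smooth_on_vector2:
  assumes "open U" "smooth_on U f" "smooth_on U g"
  shows "smooth_on U (\<lambda>x. vector [f x, g x] :: real^2)"
proof (rule smooth_on_vec[OF assms(1)])
  show "smooth_on U (\<lambda>x. (vector [f x, g x] :: real^2) $ i)" for i
    using exhaust_2[of i] assms by auto
qed

lemma smooth_on_vector3:
  assumes "open U" "smooth_on U f" "smooth_on U g" "smooth_on U h"
  shows "smooth_on U (\<lambda>x. vector [f x, g x, h x] :: real^3)"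
proof (rule smooth_on_vec[OF assms(1)])
  show "smooth_on U (\<lambda>x. (vector [f x, g x, h x] :: real^3) $ i)" for i
    using exhaust_3[of i] assms by auto
qed

lemma vector_4 [simp]:
  "(vector [x,y,z,w] :: ('a::zero)^4)$1 = x" "(vector [x,y,z,w] :: ('a::zero)^4)$2 = y"
  "(vector [x,y,z,w] :: ('a::zero)^4)$3 = z" "(vector [x,y,z,w] :: ('a::zero)^4)$4 = w"
  unfolding vector_def by simp_all

lemma smooth_on_vector4:
  assumes "open U" "smooth_on U f" "smooth_on U g" "smooth_on U h" "smooth_on U k"
  shows "smooth_on U (\<lambda>x. vector [f x, g x, h x, k x] :: real^4)"
proof (rule smooth_on_vec[OF assms(1)])
  show "smooth_on U (\<lambda>x. (vector [f x, g x, h x, k x] :: real^4) $ i)" for i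
    using exhaust_4[of i] assms by auto
qed

lemmas smooth_intros = smooth_on_const smooth_on_ident smooth_on_add smooth_on_minus smooth_on_diff
  smooth_on_scaleR smooth_on_inner smooth_on_mult smooth_on_power smooth_on_nth
  smooth_on_vector2 smooth_on_vector3 smooth_on_vector4 smooth_on_pd

section \<open>Linear systems with smooth coefficients and the inverse function theorem\<close>

lemma Ck_on_det:
  fixes A :: "'a::real_normed_vector => real^'n^'n"
  assumes "open U" "\<And>i j. Ck_on k (\<lambda>x. A x $ i $ j) U"
  shows "Ck_on k (\<lambda>x. det (A x)) U"
  unfolding det_def
  by (intro Ck_on_sum Ck_on_bilinear[OF _ bounded_bilinear_mult] Ck_on_const Ck_on_prod assms)

text \<open>Cramer's rule writes the solution as a quotient of determinants, that is, of polynomials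
  in the entries.\<close>

lemma Ck_on_matrix_solve:
  fixes A :: "'a::real_normed_vector => real^'n^'n"
  assumes "open U" "\<And>i j. Ck_on k (\<lambda>x. A x $ i $ j) U" "\<And>i. Ck_on k (\<lambda>x. b x $ i) U"
    "\<And>x. x \<in> U ==> det (A x) \<noteq> 0" "\<And>x. x \<in> U ==> A x *v w x = b x"
  shows "Ck_on k w U"
proof -
  have e: "w x $ m = det (\<chi> i j. if j = m then b x $ i else A x $ i $ j) * inverse (det (A x))"
    if "x \<in> U" for x m
    using cramer[OF assms(4)[OF that], of "w x" "b x"] assms(5)[OF that] by (simp add: divide_inverse)
  have "Ck_on k (\<lambda>x. w x $ m) U" for m
  proof -
    have "Ck_on k (\<lambda>x. det (\<chi> i j. if j = m then b x $ i else A x $ i $ j) * inverse (det (A x))) U"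
    proof (intro Ck_on_bilinear[OF _ bounded_bilinear_mult] Ck_on_det Ck_on_inverse assms)
      show "Ck_on k (\<lambda>x. (\<chi> i j. if j = m then b x $ i else A x $ i $ j) $ i $ j) U" for i j
        using assms by (cases "j = m") auto
    qed
    then show ?thesis
      by (subst Ck_on_cong[OF assms(1), where g="\<lambda>x. det (\<chi> i j. if j = m then b x $ i else A x $ i $ j) * inverse (det (A x))"])
         (rule e)
  qed
  then show ?thesis by (rule Ck_on_vec[OF assms(1)])
qed

text \<open>Continuity of the derivative in the operator norm, the form in which
  \<open>inverse_function_theorem\<close> takes it, follows from continuity in each basis
  direction.\<close>

lemma smooth_on_continuous_blinfun:
  fixes f :: "real^'n => real^'n"
  assumes "open U" "smooth_on U f"
  obtains f' where "\<And>x. x \<in> U ==> blinfun_apply (f' x) = (\<lambda>v. pd f v x)" "continuous_on U f'"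
proof -
  define f' where "f' x = Blinfun (\<lambda>v. pd f v x)" for x
  have *: "blinfun_apply (f' x) = (\<lambda>v. pd f v x)" if "x \<in> U" for x
    unfolding f'_def using has_derivative_bounded_linear[OF smooth_on_has_derivative[OF assms(2) that]]
    by (rule bounded_linear_Blinfun_apply)
  moreover have "continuous_on U f'"
  proof (rule continuous_on_blinfun_componentwise)
    fix i :: "real^'n"
    show "continuous_on U (\<lambda>x. blinfun_apply (f' x) i)"
      using smooth_on_continuous[OF smooth_on_pd[OF assms(2), of i]] * continuous_on_cong[of U U]
      by (metis (no_types, lifting))
  qed
  ultimately show thesis by (rule that)
qed

text \<open>The classical theorem gives a differentiable inverse \<open>g\<close>. Its derivative
  solves a linear system whose coefficients are derivatives of \<open>f\<close> at
  \<open>g y\<close>, so \<open>g\<close> of class C^k makes its derivative of class C^k, and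
  smoothness follows by induction.\<close>

theorem smooth_inverse_function:
  fixes f :: "real^'n => real^'n"
  assumes "open U" "smooth_on U f" "x0 \<in> U" "bij (\<lambda>v. pd f v x0)"
  obtains U' V g where "open U'" "U' \<subseteq> U" "x0 \<in> U'" "open V" "f ` U' = V" "g ` V = U'" "smooth_on V g"
    "\<And>x. x \<in> U' ==> g (f x) = x" "\<And>y. y \<in> V ==> f (g y) = y" "\<And>x. x \<in> U' ==> bij (\<lambda>v. pd f v x)"
proof -
  obtain f' where f': "\<And>x. x \<in> U ==> blinfun_apply (f' x) = (\<lambda>v. pd f v x)" and cf: "continuous_on U f'"
    by (rule smooth_on_continuous_blinfun[OF assms(1,2)], rule that)
  have lin: "linear (\<lambda>v. pd f v x0)" using pd_linear assms by blast
  obtain g0 where g0: "linear g0" "g0 \<circ> (\<lambda>v. pd f v x0) = id"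
    using linear_injective_left_inverse[OF lin] assms(4) bij_is_inj by blast
  have "blinfun_apply (Blinfun g0) = g0"
    using g0(1) linear_linear bounded_linear_Blinfun_apply by blast
  then have inv: "Blinfun g0 o\<^sub>L f' x0 = id_blinfun"
    using g0(2) f'[OF assms(3)] by (intro blinfun_eqI) (auto simp: fun_eq_iff)
  have der: "(f has_derivative blinfun_apply (f' x)) (at x)" if "x \<in> U" for x
    using smooth_on_has_derivative[OF assms(2) that] f'[OF that] by simp
  obtain U' V g g' where *: "open U'" "U' \<subseteq> U" "x0 \<in> U'" "open V" "homeomorphism U' V f g"
    "\<And>y. y \<in> V ==> (g has_derivative g' y) (at y)"
    "\<And>y. y \<in> V ==> g' y = inv (blinfun_apply (f' (g y)))"
    "\<And>y. y \<in> V ==> bij (blinfun_apply (f' (g y)))"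
    using inverse_function_theorem[OF assms(1) der cf assms(3) inv] by metis
  have gV: "g y \<in> U'" if "y \<in> V" for y using *(5) that by (auto simp: homeomorphism_def)
  have bij: "bij (\<lambda>v. pd f v (g y))" if "y \<in> V" for y
    using *(8)[OF that] f' gV[OF that] *(2) by auto
  have "Ck_on k g V" for k
  proof (induction k)
    case 0
    then show ?case using *(5) by (simp add: homeomorphism_def)
  next
    case (Suc k)
    show ?case
    proof (rule Ck_on_SucI[OF *(4,6)])
      fix v
      define A where "A y = matrix (\<lambda>v. pd f v (g y))" for y
      have lin: "linear (\<lambda>v. pd f v (g y))" if "y \<in> V" for y
        using pd_linear assms gV that *(2) by blast
      show "Ck_on k (\<lambda>y. g' y v) V"
      proof (rule Ck_on_matrix_solve[OF *(4), where A=A and b="\<lambda>y. v"])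
        show "Ck_on k (\<lambda>y. A y $ i $ j) V" for i j
          unfolding A_def matrix_def
          using smooth_on_nth[OF *(1) smooth_on_subset[OF smooth_on_pd[OF assms(2)] *(2)]]
          by (auto intro!: Ck_on_compose[OF *(4,1) gV Suc.IH] simp: smooth_on_def)
        show "det (A y) \<noteq> 0" if "y \<in> V" for y
          unfolding A_def using det_nz_iff_inj[OF lin[OF that]] bij[OF that] bij_is_inj by auto
        show "A y *v g' y v = v" if "y \<in> V" for y
          unfolding A_def fun_cong[OF matrix_vector_mul(2)[OF lin[OF that]]] *(7)[OF that]
          using surj_f_inv_f[OF bij_is_surj[OF bij[OF that]], of v] f'[of "g y"] gV[OF that] *(2) by auto
      qed (rule Ck_on_const[OF *(4)])
    qed
  qed
  then have "smooth_on V g" by (simp add: smooth_on_def)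
  moreover have "bij (\<lambda>v. pd f v x)" if "x \<in> U'" for x
    using bij[of "f x"] *(5) that by (auto simp: homeomorphism_def)
  ultimately show ?thesis
    using *(1-5) by (intro that[of U' V g]) (auto simp: homeomorphism_def)
qed

section \<open>Symmetry of second derivatives and derivatives of curves\<close>

lemma has_real_derivative_along:
  assumes "smooth_on U f" "x + s *\<^sub>R v \<in> U"
  shows "((\<lambda>s. f (x + s *\<^sub>R v)) has_real_derivative pd f v (x + s *\<^sub>R v)) (at s)"
proof -
  have "((\<lambda>s. x + s *\<^sub>R v) has_derivative (\<lambda>t. t *\<^sub>R v)) (at s)"
    by (auto intro!: derivative_eq_intros)
  from has_derivative_compose[OF this smooth_on_has_derivative[OF assms]]
  have "((\<lambda>s. f (x + s *\<^sub>R v)) has_derivative (\<lambda>t. pd f (t *\<^sub>R v) (x + s *\<^sub>R v))) (at s)" .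
  moreover have "pd f (t *\<^sub>R v) (x + s *\<^sub>R v) = t *\<^sub>R pd f v (x + s *\<^sub>R v)" for t
    using linear_cmul[OF pd_linear[OF assms]] .
  ultimately show ?thesis
    by (simp add: has_field_derivative_def mult_commute_abs)
qed

text \<open>The mean value theorem, applied along \<open>v\<close> and then along \<open>w\<close>,
  turns the second difference into a mixed derivative at an intermediate point. The second
  difference is symmetric in \<open>v\<close> and \<open>w\<close>, which is the source of
  \<open>pd_commute_real\<close>.\<close>

lemma second_difference:
  fixes f :: "'a::real_normed_vector => real"
  assumes f: "smooth_on U f" and h: "h > 0"
    and U: "\<And>s t. 0 \<le> s ==> s \<le> h ==> 0 \<le> t ==> t \<le> h ==> x + s *\<^sub>R v + t *\<^sub>R w \<in> U"
  obtains s t where "0 < s" "s < h" "0 < t" "t < h"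
    "f (x + h *\<^sub>R v + h *\<^sub>R w) - f (x + h *\<^sub>R v) - f (x + h *\<^sub>R w) + f x
     = h\<^sup>2 * pd (pd f v) w (x + s *\<^sub>R v + t *\<^sub>R w)"
proof -
  have "\<exists>s>0. s < h \<and> (\<lambda>s. f (x + h *\<^sub>R w + s *\<^sub>R v) - f (x + s *\<^sub>R v)) h - (\<lambda>s. f (x + h *\<^sub>R w + s *\<^sub>R v) - f (x + s *\<^sub>R v)) 0
     = (h - 0) * (pd f v (x + h *\<^sub>R w + s *\<^sub>R v) - pd f v (x + s *\<^sub>R v))"
  proof (rule MVT2[OF h])
    fix s assume "0 \<le> s" "s \<le> h"
    then show "((\<lambda>s. f (x + h *\<^sub>R w + s *\<^sub>R v) - f (x + s *\<^sub>R v)) has_real_derivative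
       pd f v (x + h *\<^sub>R w + s *\<^sub>R v) - pd f v (x + s *\<^sub>R v)) (at s)"
      using U[of s h] U[of s 0] h by (intro DERIV_diff has_real_derivative_along[OF f]) (auto simp: add_ac)
  qed
  then obtain s where s: "0 < s" "s < h"
    "f (x + h *\<^sub>R w + h *\<^sub>R v) - f (x + h *\<^sub>R v) - (f (x + h *\<^sub>R w) - f x)
     = h * (pd f v (x + h *\<^sub>R w + s *\<^sub>R v) - pd f v (x + s *\<^sub>R v))" by auto
  have "\<exists>t>0. t < h \<and> (\<lambda>t. pd f v (x + s *\<^sub>R v + t *\<^sub>R w)) h - (\<lambda>t. pd f v (x + s *\<^sub>R v + t *\<^sub>R w)) 0
     = (h - 0) * pd (pd f v) w (x + s *\<^sub>R v + t *\<^sub>R w)"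
    by (rule MVT2[OF h]) (use U s in \<open>auto intro!: has_real_derivative_along smooth_on_pd f\<close>)
  then obtain t where "0 < t" "t < h"
    "pd f v (x + s *\<^sub>R v + h *\<^sub>R w) - pd f v (x + s *\<^sub>R v) = h * pd (pd f v) w (x + s *\<^sub>R v + t *\<^sub>R w)"
    by auto
  with s that[of s t] show ?thesis by (simp add: algebra_simps power2_eq_square)
qed

lemma pd_commute_real:
  fixes f :: "'a::real_normed_vector => real"
  assumes U: "open U" and f: "smooth_on U f" and x: "x \<in> U"
  shows "pd (pd f v) w x = pd (pd f w) v x"
proof (rule ccontr)
  define A where "A = pd (pd f v) w"
  define B where "B = pd (pd f w) v"
  assume "pd (pd f v) w x \<noteq> pd (pd f w) v x"
  then have e: "\<bar>A x - B x\<bar> / 2 > 0" by (simp add: A_def B_def)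
  have "isCont A x" "isCont B x"
    unfolding A_def B_def using smooth_on_isCont smooth_on_pd f x by metis+
  then obtain d1 d2 where d1: "d1 > 0" "\<And>y. dist y x < d1 ==> dist (A y) (A x) < \<bar>A x - B x\<bar> / 2"
    and d2: "d2 > 0" "\<And>y. dist y x < d2 ==> dist (B y) (B x) < \<bar>A x - B x\<bar> / 2"
    using e unfolding continuous_at_eps_delta by metis
  obtain d3 where d3: "d3 > 0" "ball x d3 \<subseteq> U" using U x openE by blast
  define d where "d = min d1 (min d2 d3)"
  \<comment> \<open>This side length keeps the parallelogram spanned by \<open>h *\<^sub>R v\<close>
    and \<open>h *\<^sub>R w\<close> within distance \<open>d\<close> of \<open>x\<close>; the
    summand 1 keeps the denominator positive when both vectors vanish.\<close>
  define h where "h = d / (2 * (1 + norm v + norm w))"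
  have d: "d > 0" using d1 d2 d3 by (simp add: d_def)
  have n: "1 + norm v + norm w > 0" by (smt (verit) norm_ge_zero)
  then have h: "h > 0" using d by (simp add: h_def)
  have near: "dist (x + s *\<^sub>R v + t *\<^sub>R w) x < d" if "0 \<le> s" "s \<le> h" "0 \<le> t" "t \<le> h" for s t
  proof -
    have "dist (x + s *\<^sub>R v + t *\<^sub>R w) x \<le> s * norm v + t * norm w"
      using norm_triangle_ineq[of "s *\<^sub>R v" "t *\<^sub>R w"] that by (simp add: dist_norm)
    also have "\<dots> \<le> h * norm v + h * norm w"
      using that by (intro add_mono mult_right_mono) auto
    also have "\<dots> \<le> h * (1 + norm v + norm w)" using h by (simp add: algebra_simps)
    also have "\<dots> = d / 2" using n by (simp add: h_def field_simps)
    finally show ?thesis using d by simp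
  qed
  have inU: "x + s *\<^sub>R v + t *\<^sub>R w \<in> U" if "0 \<le> s" "s \<le> h" "0 \<le> t" "t \<le> h" for s t
    using near[OF that] d3 by (auto simp: d_def dist_commute subset_iff)
  obtain s t where st: "0 < s" "s < h" "0 < t" "t < h"
    "f (x + h *\<^sub>R v + h *\<^sub>R w) - f (x + h *\<^sub>R v) - f (x + h *\<^sub>R w) + f x = h\<^sup>2 * A (x + s *\<^sub>R v + t *\<^sub>R w)"
    using second_difference[OF f h inU] unfolding A_def by blast
  have "x + s *\<^sub>R w + t *\<^sub>R v \<in> U" if "0 \<le> s" "s \<le> h" "0 \<le> t" "t \<le> h" for s t
    using inU[OF that(3,4,1,2)] by (simp add: add_ac)
  then obtain s' t' where st': "0 < s'" "s' < h" "0 < t'" "t' < h"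
    "f (x + h *\<^sub>R w + h *\<^sub>R v) - f (x + h *\<^sub>R w) - f (x + h *\<^sub>R v) + f x = h\<^sup>2 * B (x + s' *\<^sub>R w + t' *\<^sub>R v)"
    using second_difference[OF f h] unfolding B_def by blast
  have "h\<^sup>2 * A (x + s *\<^sub>R v + t *\<^sub>R w) = h\<^sup>2 * B (x + t' *\<^sub>R v + s' *\<^sub>R w)"
  proof -
    have "x + h *\<^sub>R w + h *\<^sub>R v = x + h *\<^sub>R v + h *\<^sub>R w" "x + t' *\<^sub>R v + s' *\<^sub>R w = x + s' *\<^sub>R w + t' *\<^sub>R v"
      by simp_all
    with st(5) st'(5) show ?thesis by (smt (verit))
  qed
  then have eq: "A (x + s *\<^sub>R v + t *\<^sub>R w) = B (x + t' *\<^sub>R v + s' *\<^sub>R w)" using h by simp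
  have "dist (A (x + s *\<^sub>R v + t *\<^sub>R w)) (A x) < \<bar>A x - B x\<bar> / 2"
    "dist (B (x + t' *\<^sub>R v + s' *\<^sub>R w)) (B x) < \<bar>A x - B x\<bar> / 2"
    using d1(2) d2(2) near[of s t] near[of t' s'] st st' by (auto simp: d_def)
  then have "\<bar>(B (x + t' *\<^sub>R v + s' *\<^sub>R w) - B x) - (B (x + t' *\<^sub>R v + s' *\<^sub>R w) - A x)\<bar> < \<bar>A x - B x\<bar>"
    unfolding eq dist_real_def by (intro order.strict_trans1[OF abs_triangle_ineq4]) simp
  then show False by simp
qed

lemma pd_bounded_linear:
  assumes "smooth_on U f" "x \<in> U" "bounded_linear h"
  shows "pd (\<lambda>y. h (f y)) v x = h (pd f v x)"
  using pd_eqI[OF bounded_linear.has_derivative[OF assms(3) smooth_on_has_derivative[OF assms(1,2)]]] .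

lemma pd_cong: "open U ==> x \<in> U ==> smooth_on U f ==> (\<And>y. y \<in> U ==> f y = g y) ==> pd f v x = pd g v x"
  unfolding pd_def by (metis frechet_derivative_transform_within_open smooth_on_differentiable)

lemma pd_commute:
  fixes f :: "'a::real_normed_vector => 'b::euclidean_space"
  assumes U: "open U" and f: "smooth_on U f" and x: "x \<in> U"
  shows "pd (pd f v) w x = pd (pd f w) v x"
proof (rule euclidean_eqI)
  fix i :: 'b
  have *: "pd (pd f v) w x \<bullet> i = pd (pd (\<lambda>y. f y \<bullet> i) v) w x" for v w
  proof -
    have "pd (pd (\<lambda>y. f y \<bullet> i) v) w x = pd (\<lambda>y. pd f v y \<bullet> i) w x"
      by (rule pd_cong[OF U x]) (auto intro!: smooth_on_pd smooth_on_bounded_linear[OF U bounded_linear_inner_left] f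
         pd_bounded_linear[OF f _ bounded_linear_inner_left])
    also have "\<dots> = pd (pd f v) w x \<bullet> i"
      by (rule pd_bounded_linear[OF smooth_on_pd[OF f] x bounded_linear_inner_left])
    finally show ?thesis by simp
  qed
  show "pd (pd f v) w x \<bullet> i = pd (pd f w) v x \<bullet> i"
    unfolding * by (rule pd_commute_real[OF U smooth_on_bounded_linear[OF U bounded_linear_inner_left f] x])
qed

lemma pd_bilinear:
  assumes "smooth_on U f" "smooth_on U g" "x \<in> U" "bounded_bilinear h"
  shows "pd (\<lambda>y. h (f y) (g y)) v x = h (f x) (pd g v x) + h (pd f v x) (g x)"
  using pd_eqI[OF bounded_bilinear.FDERIV[OF assms(4) smooth_on_has_derivative[OF assms(1,3)]
     smooth_on_has_derivative[OF assms(2,3)]]] .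

lemmas pd_inner = pd_bilinear[OF _ _ _ bounded_bilinear_inner]
lemmas pd_scaleR = pd_bilinear[OF _ _ _ bounded_bilinear_scaleR]

lemma pd_add:
  assumes "smooth_on U f" "smooth_on U g" "x \<in> U"
  shows "pd (\<lambda>y. f y + g y) v x = pd f v x + pd g v x"
  using pd_eqI[OF has_derivative_add[OF smooth_on_has_derivative[OF assms(1,3)] smooth_on_has_derivative[OF assms(2,3)]]] .

lemma pd_const [simp]: "pd (\<lambda>y. c) v x = 0"
  by (simp add: pd_def)

section \<open>Iterated derivatives of curves\<close>

lemma vd_0 [simp]: "vd 0 c = c"
  by (simp add: vd_def)

lemma vd_Suc: "vd (Suc k) c t = vector_derivative (vd k c) (at t)"
  by (simp add: vd_def)

lemma vd_Suc': "vd (Suc k) c = vd k (vd 1 c)"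
  by (simp add: vd_def funpow_Suc_right del: funpow.simps)

lemma vd_cong:
  assumes "open T" "t \<in> T" "\<And>t. t \<in> T ==> c t = d t"
  shows "vd k c t = vd k d t"
  using assms(2)
proof (induction k arbitrary: t)
  case (Suc k)
  have "\<forall>\<^sub>F s in nhds t. vd k c s = vd k d s"
    using Suc.IH Suc.prems assms(1) by (auto simp: eventually_nhds)
  then show ?case unfolding vd_Suc by (intro vector_derivative_cong_eq) auto
qed (use assms in auto)

lemma vd_SucI:
  assumes "open T" "t \<in> T" "\<And>t. t \<in> T ==> (c has_vector_derivative c' t) (at t)"
  shows "vd (Suc k) c t = vd k c' t"
  unfolding vd_Suc'
  by (rule vd_cong[OF assms(1,2)]) (use assms(3) in \<open>auto simp: vd_def vector_derivative_at\<close>)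

lemma vd_1I: "(c has_vector_derivative c') (at t) ==> vd 1 c t = c'"
  by (simp add: vd_def vector_derivative_at)

lemma vd_1_pd: "smooth_on T c ==> t \<in> T ==> vd 1 c t = pd c 1 t"
proof (rule vd_1I)
  assume a: "smooth_on T c" "t \<in> T"
  have "pd c s t = s *\<^sub>R pd c 1 t" for s
    using linear_cmul[OF pd_linear[OF a], of s 1] by simp
  then have "(\<lambda>s. pd c s t) = (\<lambda>s. s *\<^sub>R pd c 1 t)" by (rule ext)
  with smooth_on_has_derivative[OF a] show "(c has_vector_derivative pd c 1 t) (at t)"
    by (simp only: has_vector_derivative_def)
qed

lemma smooth_on_vd:
  assumes "open T" "smooth_on T c"
  shows "smooth_on T (vd k c)"
proof (induction k)
  case 0
  then show ?case by (simp add: assms)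
next
  case (Suc k)
  have "vd (Suc k) c t = pd (vd k c) 1 t" if "t \<in> T" for t
    using vd_1_pd[OF Suc that] by (simp add: vd_def)
  then show ?case
    using smooth_on_cong[OF assms(1), of "vd (Suc k) c" "pd (vd k c) 1"] smooth_on_pd[OF Suc] by blast
qed

lemma has_vector_derivative_vd:
  assumes "open T" "smooth_on T c" "t \<in> T"
  shows "(vd k c has_vector_derivative vd (Suc k) c t) (at t)"
proof -
  have "vd k c differentiable at t"
    using assms smooth_on_vd smooth_on_differentiable by blast
  then show ?thesis by (simp add: vd_Suc vector_derivative_works)
qed

lemma has_vector_derivative_smooth:
  assumes "open T" "smooth_on T c" "t \<in> T"
  shows "(c has_vector_derivative vd 1 c t) (at t)"
  using has_vector_derivative_vd[OF assms, of 0] by simp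

lemma has_vector_derivative_compose_smooth:
  assumes "smooth_on U f" "c t \<in> U" "(c has_vector_derivative c') (at t)"
  shows "((\<lambda>t. f (c t)) has_vector_derivative pd f c' (c t)) (at t)"
proof -
  have "((\<lambda>t. f (c t)) has_derivative (\<lambda>s. pd f (s *\<^sub>R c') (c t))) (at t)"
    using has_derivative_compose[OF assms(3)[unfolded has_vector_derivative_def] smooth_on_has_derivative[OF assms(1,2)]] .
  moreover have "pd f (s *\<^sub>R c') (c t) = s *\<^sub>R pd f c' (c t)" for s
    using linear_cmul[OF pd_linear[OF assms(1,2)]] .
  ultimately show ?thesis by (simp add: has_vector_derivative_def)
qed

lemma pd_basis_sum:
  fixes f :: "'a::euclidean_space => 'b::real_normed_vector"
  assumes "smooth_on U f" "y \<in> U"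
  shows "pd f w y = (\<Sum>i\<in>Basis. (w \<bullet> i) *\<^sub>R pd f i y)"
  using linear_sum[OF pd_linear[OF assms], of "\<lambda>i. (w \<bullet> i) *\<^sub>R i" Basis] linear_cmul[OF pd_linear[OF assms]]
  by (simp add: euclidean_representation)

text \<open>The direction \<open>vd 1 c t\<close> moves with \<open>t\<close>, so the first
  derivative is expanded in the basis before it is differentiated again; the symmetry of second
  derivatives reassembles the result.\<close>

lemma vd2_compose:
  fixes f :: "'a::euclidean_space => 'b::euclidean_space"
  assumes U: "open U" and T: "open T" and f: "smooth_on U f" and c: "smooth_on T c"
    and cT: "\<And>t. t \<in> T ==> c t \<in> U" and t: "t \<in> T"
  shows "vd 2 (\<lambda>t. f (c t)) t = pd (pd f (vd 1 c t)) (vd 1 c t) (c t) + pd f (vd 2 c t) (c t)"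
proof -
  have 1: "((\<lambda>t. f (c t)) has_vector_derivative (\<Sum>i\<in>Basis. (vd 1 c s \<bullet> i) *\<^sub>R pd f i (c s))) (at s)" if "s \<in> T" for s
    using has_vector_derivative_compose_smooth[OF f cT[OF that] has_vector_derivative_smooth[OF T c that]]
    unfolding pd_basis_sum[OF f cT[OF that], of "vd 1 c s"] .
  have vv: "(vd 1 c has_vector_derivative vd 2 c t) (at t)"
    using has_vector_derivative_vd[OF T c t, of 1] by (simp add: numeral_2_eq_2)
  have "((\<lambda>s. \<Sum>i\<in>Basis. (vd 1 c s \<bullet> i) *\<^sub>R pd f i (c s)) has_vector_derivative
     (\<Sum>i\<in>Basis. (vd 1 c t \<bullet> i) *\<^sub>R pd (pd f i) (vd 1 c t) (c t) + (vd 2 c t \<bullet> i) *\<^sub>R pd f i (c t))) (at t)" (is "(_ has_vector_derivative ?d) _")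
  proof (rule has_vector_derivative_sum)
    fix i :: 'a
    show "((\<lambda>s. (vd 1 c s \<bullet> i) *\<^sub>R pd f i (c s)) has_vector_derivative
      (vd 1 c t \<bullet> i) *\<^sub>R pd (pd f i) (vd 1 c t) (c t) + (vd 2 c t \<bullet> i) *\<^sub>R pd f i (c t)) (at t)"
      by (rule bounded_bilinear.has_vector_derivative[OF bounded_bilinear_scaleR]
           bounded_linear.has_vector_derivative[OF bounded_linear_inner_left] vv
           has_vector_derivative_compose_smooth[where c=c and t=t, OF smooth_on_pd[OF f] cT[OF t]]
           has_vector_derivative_smooth[OF T c t])+
  qed
  then have "vd 1 (\<lambda>s. \<Sum>i\<in>Basis. (vd 1 c s \<bullet> i) *\<^sub>R pd f i (c s)) t = ?d"
    by (rule vd_1I)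
  moreover have "vd 2 (\<lambda>t. f (c t)) t = vd 1 (\<lambda>s. \<Sum>i\<in>Basis. (vd 1 c s \<bullet> i) *\<^sub>R pd f i (c s)) t"
    using vd_SucI[OF T t 1, of 1] by (simp add: numeral_2_eq_2)
  moreover have "(\<Sum>i\<in>Basis. (vd 1 c t \<bullet> i) *\<^sub>R pd (pd f i) (vd 1 c t) (c t)) = pd (pd f (vd 1 c t)) (vd 1 c t) (c t)"
    (is "?l = ?r")
  proof -
    have "?r = (\<Sum>i\<in>Basis. (vd 1 c t \<bullet> i) *\<^sub>R pd (pd f (vd 1 c t)) i (c t))"
      by (rule pd_basis_sum[OF smooth_on_pd[OF f] cT[OF t]])
    also have "\<dots> = ?l"
      by (rule sum.cong[OF refl], rule arg_cong[where f="scaleR _"], rule pd_commute[OF U f cT[OF t]])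
    finally show ?thesis by (rule sym)
  qed
  ultimately show ?thesis
    using pd_basis_sum[OF f cT[OF t], of "vd 2 c t"] by (simp add: sum.distrib)
qed

lemma vd_1_vd: "vd 1 (vd k c) = vd (Suc k) c"
  by (simp add: vd_def fun_eq_iff)

lemma vd2_scaleR:
  fixes a :: "real => real" and b :: "real => 'a::real_normed_vector"
  assumes T: "open T" and a: "smooth_on T a" and b: "smooth_on T b" and t: "t \<in> T"
  shows "vd 1 (\<lambda>t. a t *\<^sub>R b t) t = vd 1 a t *\<^sub>R b t + a t *\<^sub>R vd 1 b t"
    and "vd 2 (\<lambda>t. a t *\<^sub>R b t) t = vd 2 a t *\<^sub>R b t + (2 * vd 1 a t) *\<^sub>R vd 1 b t + a t *\<^sub>R vd 2 b t"
proof -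
  have p: "((\<lambda>t. a t *\<^sub>R b t) has_vector_derivative a s *\<^sub>R vd 1 b s + vd 1 a s *\<^sub>R b s) (at s)"
    if "s \<in> T" "smooth_on T a" "smooth_on T b" for s and a :: "real => real" and b :: "real => 'a"
    using has_vector_derivative_scaleR[OF has_vector_derivative_smooth[OF T that(2,1), folded real_derivative_iff]
      has_vector_derivative_smooth[OF T that(3,1)]] .
  show "vd 1 (\<lambda>t. a t *\<^sub>R b t) t = vd 1 a t *\<^sub>R b t + a t *\<^sub>R vd 1 b t"
    using vd_1I[OF p[OF t a b]] by (simp only: add.commute)
  have "vd 1 (\<lambda>s. a s *\<^sub>R vd 1 b s + vd 1 a s *\<^sub>R b s) t =
      (a t *\<^sub>R vd 1 (vd 1 b) t + vd 1 a t *\<^sub>R vd 1 b t) + (vd 1 a t *\<^sub>R vd 1 b t + vd 1 (vd 1 a) t *\<^sub>R b t)"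
    by (rule vd_1I[OF has_vector_derivative_add[OF p[OF t a smooth_on_vd[OF T b]] p[OF t smooth_on_vd[OF T a] b]]])
  moreover have "vd 2 (\<lambda>t. a t *\<^sub>R b t) t = vd 1 (\<lambda>s. a s *\<^sub>R vd 1 b s + vd 1 a s *\<^sub>R b s) t"
    using vd_SucI[OF T t p[OF _ a b], of 1] by (simp add: numeral_2_eq_2)
  ultimately show "vd 2 (\<lambda>t. a t *\<^sub>R b t) t = vd 2 a t *\<^sub>R b t + (2 * vd 1 a t) *\<^sub>R vd 1 b t + a t *\<^sub>R vd 2 b t"
    by (simp add: vd_1_vd[unfolded One_nat_def] numeral_2_eq_2 scaleR_2 flip: scaleR_scaleR)
qed

lemmas vd1_mult = vd2_scaleR(1)[where 'a = real, unfolded real_scaleR_def]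
  and vd2_mult = vd2_scaleR(2)[where 'a = real, unfolded real_scaleR_def]

lemma has_vector_derivative_line:
  assumes "smooth_on U f" "x + t *\<^sub>R v \<in> U"
  shows "((\<lambda>t. f (x + t *\<^sub>R v)) has_vector_derivative pd f v (x + t *\<^sub>R v)) (at t)"
  by (rule has_vector_derivative_compose_smooth[where c="\<lambda>t. x + t *\<^sub>R v", OF assms]) (auto intro!: derivative_eq_intros)

lemma vd_line:
  assumes U: "open U" and f: "smooth_on U f" and t: "x + t *\<^sub>R v \<in> U"
  shows "vd (Suc k) (\<lambda>t. f (x + t *\<^sub>R v)) t = vd k (\<lambda>t. pd f v (x + t *\<^sub>R v)) t"
proof (rule vd_SucI)
  show "open ((\<lambda>t. x + t *\<^sub>R v) -` U)" by (intro open_vimage U continuous_intros)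
qed (use has_vector_derivative_line[OF f] t in auto)

section \<open>Determinants in dimension four\<close>

definition det4 :: "real^4 => real^4 => real^4 => real^4 => real" where
  "det4 a b c d = det (vector [a, b, c, d] :: real^4^4)"

lemma det4_add:
  "det4 (x + y) b c d = det4 x b c d + det4 y b c d"
  "det4 a (x + y) c d = det4 a x c d + det4 a y c d"
  "det4 a b (x + y) d = det4 a b x d + det4 a b y d"
  "det4 a b c (x + y) = det4 a b c x + det4 a b c y"
proof -
  \<comment> \<open>Replacing the row with index \<open>k\<close> is written uniformly in
    \<open>k\<close>, so that one multilinearity rule serves all four rows.\<close>
  have *: "(vector [if k = 1 then x else a, if k = 2 then x else b, if k = 3 then x else c, if k = 4 then x else d] :: real^4^4) =
    (\<chi> i. if i = k then x else (vector [a,b,c,d] :: real^4^4) $ i)" for k :: 4 and x a b c d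
    using exhaust_4[of k] by (auto simp: vec_eq_iff forall_4)
  have "det (\<chi> i. if i = k then x + y else (vector [a,b,c,d] :: real^4^4) $ i) =
    det (\<chi> i. if i = k then x else (vector [a,b,c,d] :: real^4^4) $ i) +
    det (\<chi> i. if i = k then y else (vector [a,b,c,d] :: real^4^4) $ i)" for k :: 4
    by (rule det_row_add)
  note ** = this[folded *]
  show "det4 (x + y) b c d = det4 x b c d + det4 y b c d" using **[of 1] by (simp add: det4_def)
  show "det4 a (x + y) c d = det4 a x c d + det4 a y c d" using **[of 2] by (simp add: det4_def)
  show "det4 a b (x + y) d = det4 a b x d + det4 a b y d" using **[of 3] by (simp add: det4_def)
  show "det4 a b c (x + y) = det4 a b c x + det4 a b c y" using **[of 4] by (simp add: det4_def)
qed

lemma det4_scaleR: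
  "det4 (k *\<^sub>R x) b c d = k * det4 x b c d"
  "det4 a (k *\<^sub>R x) c d = k * det4 a x c d"
  "det4 a b (k *\<^sub>R x) d = k * det4 a b x d"
  "det4 a b c (k *\<^sub>R x) = k * det4 a b c x"
proof -
  have *: "(vector [if k = 1 then x else a, if k = 2 then x else b, if k = 3 then x else c, if k = 4 then x else d] :: real^4^4) =
    (\<chi> i. if i = k then x else (vector [a,b,c,d] :: real^4^4) $ i)" for k :: 4 and x a b c d
    using exhaust_4[of k] by (auto simp: vec_eq_iff forall_4)
  have "det (\<chi> i. if i = j then k *s x else (vector [a,b,c,d] :: real^4^4) $ i) =
    k * det (\<chi> i. if i = j then x else (vector [a,b,c,d] :: real^4^4) $ i)" for j :: 4
    by (rule det_row_mul)
  note ** = this[folded *]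
  have [simp]: "k *s x = k *\<^sub>R x" for x :: "real^4" by (simp add: scalar_mult_eq_scaleR)
  show "det4 (k *\<^sub>R x) b c d = k * det4 x b c d" using **[of 1] by (simp add: det4_def)
  show "det4 a (k *\<^sub>R x) c d = k * det4 a x c d" using **[of 2] by (simp add: det4_def)
  show "det4 a b (k *\<^sub>R x) d = k * det4 a b x d" using **[of 3] by (simp add: det4_def)
  show "det4 a b c (k *\<^sub>R x) = k * det4 a b c x" using **[of 4] by (simp add: det4_def)
qed

lemma det4_eq_rows [simp]:
  "det4 a a c d = 0" "det4 a b a d = 0" "det4 a b c a = 0"
  "det4 a b b d = 0" "det4 a b c b = 0" "det4 a b c c = 0"
  unfolding det4_def
  by (rule det_identical_rows[of 1 2] det_identical_rows[of 1 3] det_identical_rows[of 1 4]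
      det_identical_rows[of 2 3] det_identical_rows[of 2 4] det_identical_rows[of 3 4]; simp add: row_def vec_eq_iff)+

lemma det4_swap23: "det4 a c b d = - det4 a b c d"
proof -
  have "det4 a (b + c) (b + c) d = 0" by simp
  then show ?thesis unfolding det4_add by simp
qed

lemma det4_nonzero_iff:
  "det4 a b c d \<noteq> 0 \<longleftrightarrow> (\<forall>z. z \<bullet> a = 0 --> z \<bullet> b = 0 --> z \<bullet> c = 0 --> z \<bullet> d = 0 --> z = 0)"
proof -
  let ?A = "vector [a, b, c, d] :: real^4^4"
  have r: "(?A *v z) $ i = ?A $ i \<bullet> z" for z i
    by (simp add: matrix_vector_mult_def inner_vec_def)
  have "det ?A \<noteq> 0 \<longleftrightarrow> (\<forall>z. ?A *v z = 0 --> z = 0)"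
    by (metis invertible_det_nz invertible_left_inverse matrix_left_invertible_ker)
  then show ?thesis
    unfolding det4_def vec_eq_iff forall_4 r by (auto simp: inner_commute)
qed

lemma det4_indep:
  assumes "det4 a b c d \<noteq> 0" "i *\<^sub>R a + j *\<^sub>R b + k *\<^sub>R c + l *\<^sub>R d = 0"
  shows "i = 0 \<and> j = 0 \<and> k = 0 \<and> l = 0"
proof -
  let ?s = "i *\<^sub>R a + j *\<^sub>R b + k *\<^sub>R c + l *\<^sub>R d"
  have "det4 ?s b c d = i * det4 a b c d" "det4 a ?s c d = j * det4 a b c d"
    "det4 a b ?s d = k * det4 a b c d" "det4 a b c ?s = l * det4 a b c d"
    unfolding det4_add det4_scaleR by simp_all
  then have "i * det4 a b c d = det4 0 b c d" "j * det4 a b c d = det4 a 0 c d"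
    "k * det4 a b c d = det4 a b 0 d" "l * det4 a b c d = det4 a b c 0"
    unfolding assms(2) by simp_all
  moreover have "det4 0 b c d = 0" "det4 a 0 c d = 0" "det4 a b 0 d = 0" "det4 a b c 0 = 0"
    using det4_scaleR(1)[of 0 0] det4_scaleR(2)[of _ 0 0] det4_scaleR(3)[of _ _ 0 0] det4_scaleR(4)[of _ _ _ 0 0]
    by simp_all
  ultimately show ?thesis using assms(1) by simp
qed

lemma det4_expand:
  assumes "det4 a b c d \<noteq> 0"
  obtains i j k l where "z = i *\<^sub>R a + j *\<^sub>R b + k *\<^sub>R c + l *\<^sub>R d"
proof -
  let ?A = "vector [a, b, c, d] :: real^4^4"
  have "det (transpose ?A) \<noteq> 0" using assms by (simp add: det4_def)
  then obtain y where y: "transpose ?A *v y = z" using cramer by blast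
  have "z = y$1 *\<^sub>R a + y$2 *\<^sub>R b + y$3 *\<^sub>R c + y$4 *\<^sub>R d"
    unfolding y[symmetric] vec_eq_iff matrix_vector_mult_def transpose_def
    by (simp add: sum_4 mult.commute)
  then show ?thesis using that by blast
qed

lemma det4_exists_dependence:
  assumes "det4 a b c d = 0"
  obtains i j k l where "i *\<^sub>R a + j *\<^sub>R b + k *\<^sub>R c + l *\<^sub>R d = 0" "\<not> (i = 0 \<and> j = 0 \<and> k = 0 \<and> l = 0)"
proof -
  let ?A = "vector [a, b, c, d] :: real^4^4"
  have "det (transpose ?A) = 0" using assms by (simp add: det4_def)
  then obtain y where y: "transpose ?A *v y = 0" "y \<noteq> 0"
    by (metis invertible_det_nz invertible_left_inverse matrix_left_invertible_ker)
  have "y$1 *\<^sub>R a + y$2 *\<^sub>R b + y$3 *\<^sub>R c + y$4 *\<^sub>R d = transpose ?A *v y"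
    unfolding vec_eq_iff matrix_vector_mult_def transpose_def by (simp add: sum_4 mult.commute)
  moreover have "\<not> (y$1 = 0 \<and> y$2 = 0 \<and> y$3 = 0 \<and> y$4 = 0)"
    using y(2) by (simp add: vec_eq_iff forall_4)
  ultimately show ?thesis using that y(1) by metis
qed

lemma smooth_on_det4:
  assumes "open U" "smooth_on U a" "smooth_on U b" "smooth_on U c" "smooth_on U d"
  shows "smooth_on U (\<lambda>x. det4 (a x) (b x) (c x) (d x))"
  unfolding smooth_on_def det4_def
proof (intro allI Ck_on_det assms)
  fix k i j
  show "Ck_on k (\<lambda>x. (vector [a x, b x, c x, d x] :: real^4^4) $ i $ j) U"
    using exhaust_4[of i] smooth_on_nth[OF assms(1,2)] smooth_on_nth[OF assms(1,3)]
      smooth_on_nth[OF assms(1,4)] smooth_on_nth[OF assms(1,5)] by (auto simp: smooth_on_def)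
qed

section \<open>Dual pairs of surfaces and contact with lines\<close>

text \<open>Of \<open>legendrian\<close> only the pointwise contact condition is kept. It mentions
  derivatives of \<open>F\<close> alone but is symmetric in \<open>F\<close> and \<open>N\<close>,
  see \<open>dual_pair_sym\<close>.\<close>

definition dual_pair :: "(real^2) set => (real^2 => real^4) => (real^2 => real^4) => bool" where
  "dual_pair A F N \<longleftrightarrow> open A \<and> smooth_on A F \<and> smooth_on A N \<and>
     (\<forall>x\<in>A. F x \<noteq> 0 \<and> N x \<noteq> 0 \<and> F x \<bullet> N x = 0 \<and> (\<forall>v. pd F v x \<bullet> N x = 0))"

text \<open>The second fundamental form and, on asymptotic directions, the third order obstruction to
  contact with a line; up to sign both are symmetric in the two surfaces.\<close>
definition II :: "(real^2 => real^4) => (real^2 => real^4) => real^2 => real^2 => real^2 => real" where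
  "II F N x v w = pd N v x \<bullet> pd F w x"

definition III :: "(real^2 => real^4) => (real^2 => real^4) => real^2 => real^2 => real" where
  "III F N x v = pd (pd N v) v x \<bullet> pd F v x - pd N v x \<bullet> pd (pd F v) v x"

abbreviation e1 :: "real^2" where "e1 \<equiv> vector [1, 0]"
abbreviation e2 :: "real^2" where "e2 \<equiv> vector [0, 1]"

text \<open>For a dual pair \<open>N x\<close> is orthogonal to the other three rows, so this
  determinant vanishes exactly when they are dependent, that is, when \<open>F\<close> fails to
  induce an immersion into projective space.\<close>

definition jac :: "(real^2 => real^4) => (real^2 => real^4) => real^2 => real" where
  "jac F N x = det4 (F x) (pd F e1 x) (pd F e2 x) (N x)"

lemma pd_coords:
  fixes f :: "real^2 => 'b::real_normed_vector"
  assumes "smooth_on A f" "x \<in> A"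
  shows "pd f v x = v$1 *\<^sub>R pd f e1 x + v$2 *\<^sub>R pd f e2 x"
proof -
  have "v = v$1 *\<^sub>R e1 + v$2 *\<^sub>R e2" by (simp add: vec_eq_iff forall_2)
  then have "pd f v x = pd f (v$1 *\<^sub>R e1 + v$2 *\<^sub>R e2) x" by simp
  also have "\<dots> = v$1 *\<^sub>R pd f e1 x + v$2 *\<^sub>R pd f e2 x"
    using linear_add[OF pd_linear[OF assms]] linear_cmul[OF pd_linear[OF assms]] by simp
  finally show ?thesis .
qed

text \<open>Differentiate \<open>F x \<bullet> N x = 0\<close>; tangency removes the other term. So
  the plane given by \<open>F x\<close> is tangent to the dual surface.\<close>

lemma dual_pair_pd_N:
  assumes "dual_pair A F N" "x \<in> A"
  shows "pd N v x \<bullet> F x = 0"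
proof -
  have "pd (\<lambda>y. F y \<bullet> N y) v x = F x \<bullet> pd N v x + pd F v x \<bullet> N x"
    using assms by (intro pd_inner) (auto simp: dual_pair_def)
  moreover have "pd (\<lambda>y. F y \<bullet> N y) v x = pd (\<lambda>y. 0) v x"
    using assms by (intro pd_cong[of A] smooth_on_inner) (auto simp: dual_pair_def)
  ultimately show ?thesis using assms by (simp add: dual_pair_def inner_commute)
qed

lemma dual_pair_sym: "dual_pair A F N ==> dual_pair A N F"
  using dual_pair_pd_N unfolding dual_pair_def by (metis inner_commute)

text \<open>Differentiate the tangency condition: \<open>II\<close>, defined through first
  derivatives, is up to sign the normal component of the second derivative of \<open>F\<close>. Its
  symmetry is then that of second derivatives.\<close>

lemma dual_pair_second:
  assumes "dual_pair A F N" "x \<in> A"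
  shows "N x \<bullet> pd (pd F v) w x = - (pd N w x \<bullet> pd F v x)"
proof -
  have "pd (\<lambda>y. N y \<bullet> pd F v y) w x = N x \<bullet> pd (pd F v) w x + pd N w x \<bullet> pd F v x"
    using assms by (intro pd_inner smooth_on_pd) (auto simp: dual_pair_def)
  moreover have "pd (\<lambda>y. N y \<bullet> pd F v y) w x = pd (\<lambda>y. 0) w x"
    using assms by (intro pd_cong[of A] smooth_on_inner smooth_on_pd) (auto simp: dual_pair_def inner_commute)
  ultimately show ?thesis by simp
qed

lemma II_sym:
  assumes "dual_pair A F N" "x \<in> A"
  shows "II F N x v w = II F N x w v"
  using dual_pair_second[OF assms, of v w] dual_pair_second[OF assms, of w v] assms
    pd_commute[of A F x v w] by (simp add: II_def dual_pair_def)

text \<open>Together with \<open>III_swap\<close> this is the duality of contact: \<open>II\<close>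
  and \<open>III\<close> vanish on the same directions for a surface and for its dual.\<close>

lemma II_swap: "dual_pair A F N ==> x \<in> A ==> II N F x v w = II F N x v w"
  using II_sym[of A F N x v w] by (simp add: II_def inner_commute)

lemma III_swap: "III N F x v = - III F N x v"
  by (simp add: III_def inner_commute)

lemma II_coords:
  assumes "dual_pair A F N" "x \<in> A"
  shows "II F N x v w = v$1 * w$1 * II F N x e1 e1 + (v$1 * w$2 + v$2 * w$1) * II F N x e1 e2
     + v$2 * w$2 * II F N x e2 e2"
proof -
  have s: "smooth_on A N" "smooth_on A F" using assms by (auto simp: dual_pair_def)
  show ?thesis
    unfolding II_def pd_coords[OF s(1) assms(2), of v] pd_coords[OF s(2) assms(2), of w]
    using II_sym[OF assms, of e1 e2, unfolded II_def]
    by (simp add: inner_add_left inner_add_right algebra_simps)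
qed

lemma regular_at_iff_jac:
  assumes "dual_pair A F N" "x \<in> A"
  shows "regular_at F x \<longleftrightarrow> jac F N x \<noteq> 0"
proof
  have F: "smooth_on A F" using assms by (simp add: dual_pair_def)
  note c = pd_coords[OF F assms(2)]
  show "jac F N x \<noteq> 0" if r: "regular_at F x"
  proof
    assume "jac F N x = 0"
    then obtain i j k l where s: "i *\<^sub>R F x + j *\<^sub>R pd F e1 x + k *\<^sub>R pd F e2 x + l *\<^sub>R N x = 0"
      and nz: "\<not> (i = 0 \<and> j = 0 \<and> k = 0 \<and> l = 0)"
      unfolding jac_def by (rule det4_exists_dependence)
    from arg_cong[OF s, of "\<lambda>z. z \<bullet> N x"] have l: "l = 0"
      using assms by (simp add: inner_add_left dual_pair_def)
    have "pd F (vector [j, k]) x = (- i) *\<^sub>R F x"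
      using s l c[of "vector [j, k]"] by (simp add: eq_neg_iff_add_eq_0 add_ac)
    then have "pd F (vector [j, k]) x \<in> span {F x}"
      using span_mul[OF span_base, of "F x" "{F x}" "- i"] by simp
    then have "(vector [j, k] :: real^2) = 0" using r by (simp add: regular_at_def pd_def)
    then have "j = 0" "k = 0" by (metis vector_2 zero_index)+
    then show False using s l nz assms by (auto simp: dual_pair_def)
  qed
  show "regular_at F x" if "jac F N x \<noteq> 0"
    unfolding regular_at_def
  proof safe
    fix v assume "frechet_derivative F (at x) v \<in> span {F x}"
    then obtain k where "pd F v x = k *\<^sub>R F x" by (auto simp: pd_def span_singleton)
    then have "(- k) *\<^sub>R F x + v$1 *\<^sub>R pd F e1 x + v$2 *\<^sub>R pd F e2 x + 0 *\<^sub>R N x = 0"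
      using c[of v] by (simp add: algebra_simps)
    from det4_indep[OF that[unfolded jac_def] this] show "v = 0" by (simp add: vec_eq_iff forall_2)
  qed
qed

section \<open>Contact with lines through local equations\<close>

lemma span_insert_add_multiple: "span {f, i *\<^sub>R f + g} = span {f, g}"
proof -
  have 1: "i *\<^sub>R f + g \<in> span {f, g}" by (intro span_add span_mul span_base) auto
  have "(i *\<^sub>R f + g) - i *\<^sub>R f \<in> span {f, i *\<^sub>R f + g}"
    by (intro span_diff span_mul span_base) auto
  then have 2: "g \<in> span {f, i *\<^sub>R f + g}" by simp
  show ?thesis
    unfolding span_eq using 1 2 by (auto intro: span_base)
qed

text \<open>The part of \<open>line_contact\<close> that does not mention the line, so that one
  equation can be tested on all lines through the point.\<close>

definition local_equation ::
    "(real^2) set => (real^2 => real^4) => real^2 => (real^4) set => (real^2) set => (real^4 => real) => bool" where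
  "local_equation A F x W V G \<longleftrightarrow>
     open W \<and> F x \<in> W \<and> smooth_on W G \<and> frechet_derivative G (at (F x)) \<noteq> (\<lambda>v. 0) \<and>
     open V \<and> x \<in> V \<and> V \<subseteq> A \<and> (\<forall>v\<in>V. \<forall>r. r *\<^sub>R F v \<in> W --> G (r *\<^sub>R F v) = 0)"

lemma line_contact_local_equation:
  "line_contact A F x k l \<longleftrightarrow>
     (\<exists>w W V G. w \<notin> span {F x} \<and> l = span {F x, w} \<and> local_equation A F x W V G \<and>
       (\<forall>j<k. vd j (\<lambda>t. G (F x + t *\<^sub>R w)) 0 = 0))"
  unfolding line_contact_def local_equation_def by blast

text \<open>\<open>G\<close> vanishes on the cone over the sheet, so its gradient annihilates
  \<open>F y\<close> and the derivatives of \<open>F\<close>. In the frame of \<open>jac\<close>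
  only the component of \<open>u\<close> along \<open>N y\<close> survives, so the gradient is a
  multiple of \<open>N y\<close>.\<close>

lemma local_equation_gradient:
  assumes dp: "dual_pair A F N" and le: "local_equation A F x W V G"
    and y: "y \<in> V" "r *\<^sub>R F y \<in> W" "r \<noteq> 0" "jac F N y \<noteq> 0"
  shows "pd G u (r *\<^sub>R F y) = pd G (N y) (r *\<^sub>R F y) / (N y \<bullet> N y) * (N y \<bullet> u)"
proof -
  have W: "open W" "smooth_on W G" and V: "open V" "V \<subseteq> A"
    and G0: "\<And>v r. v \<in> V ==> r *\<^sub>R F v \<in> W ==> G (r *\<^sub>R F v) = 0"
    using le by (auto simp: local_equation_def)
  have F: "smooth_on A F" and yA: "y \<in> A" using dp y V by (auto simp: dual_pair_def)
  have l: "linear (\<lambda>v. pd G v (r *\<^sub>R F y))" using pd_linear[OF W(2) y(2)] .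
  have 0: "pd G (F y) (r *\<^sub>R F y) = 0"
  proof -
    have "((\<lambda>t. G (t *\<^sub>R F y)) has_vector_derivative pd G (F y) (r *\<^sub>R F y)) (at r)"
      by (rule has_vector_derivative_compose_smooth[where c="\<lambda>t. t *\<^sub>R F y", OF W(2) y(2)])
         (auto intro!: derivative_eq_intros)
    moreover have "((\<lambda>t. G (t *\<^sub>R F y)) has_vector_derivative 0) (at r)"
    proof (rule has_vector_derivative_transform_within_open[where f="\<lambda>t. 0" and S="(\<lambda>t. t *\<^sub>R F y) -` W"])
      show "open ((\<lambda>t. t *\<^sub>R F y) -` W)" by (intro open_vimage W continuous_intros)
    qed (use y G0 in auto)
    ultimately show ?thesis by (rule vector_derivative_unique_at)
  qed
  have 1: "pd G (pd F v y) (r *\<^sub>R F y) = 0" for v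
  proof -
    have "((\<lambda>t. G (r *\<^sub>R F (y + t *\<^sub>R v))) has_vector_derivative pd G (r *\<^sub>R pd F v y) (r *\<^sub>R F (y + 0 *\<^sub>R v))) (at 0)"
      using has_vector_derivative_line[OF F, of y 0 v] yA y(2)
      by (intro has_vector_derivative_compose_smooth[where c="\<lambda>t. r *\<^sub>R F (y + t *\<^sub>R v)", OF W(2)]
           bounded_linear.has_vector_derivative[OF bounded_linear_scaleR_right]) auto
    moreover have "((\<lambda>t. G (r *\<^sub>R F (y + t *\<^sub>R v))) has_vector_derivative 0) (at 0)"
    proof -
      have "continuous_on V (\<lambda>z. r *\<^sub>R F z)"
        by (intro continuous_intros continuous_on_subset[OF smooth_on_continuous[OF F] V(2)])
      then have o: "open {z\<in>V. r *\<^sub>R F z \<in> W}"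
        using continuous_open_preimage[OF _ V(1) W(1)] by (simp add: vimage_def Int_def)
      have "open ((\<lambda>t. y + t *\<^sub>R v) -` {z\<in>V. r *\<^sub>R F z \<in> W})" by (intro open_vimage o continuous_intros)
      then show ?thesis
        by (rule has_vector_derivative_transform_within_open[where f="\<lambda>t. 0", OF has_vector_derivative_const])
           (use y G0 in auto)
    qed
    ultimately have "pd G (r *\<^sub>R pd F v y) (r *\<^sub>R F y) = 0"
      using vector_derivative_unique_at by fastforce
    then show ?thesis using linear_cmul[OF l] y(3) by simp
  qed
  obtain i j k m where u: "u = i *\<^sub>R F y + j *\<^sub>R pd F e1 y + k *\<^sub>R pd F e2 y + m *\<^sub>R N y"
    using det4_expand[OF y(4)[unfolded jac_def]] by blast
  have "pd G u (r *\<^sub>R F y) = m * pd G (N y) (r *\<^sub>R F y)"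
    unfolding u using linear_add[OF l] linear_cmul[OF l] 0 1 by simp
  moreover have "N y \<bullet> u = m * (N y \<bullet> N y)" "N y \<bullet> N y \<noteq> 0"
    unfolding u using dp yA by (auto simp: dual_pair_def inner_add_right inner_commute)
  ultimately show ?thesis by simp
qed

text \<open>\<open>G\<close> is arbitrary, but along any curve in the cone its gradient is a
  multiple of \<open>N\<close>. Differentiating this relation along a curve tangent to the line
  yields the derivatives of \<open>G\<close> along the line in terms of \<open>F\<close> and
  \<open>N\<close>, up to one factor \<kappa>.\<close>

lemma local_equation_along_line:
  assumes dp: "dual_pair A F N" and le: "local_equation A F x W V G" and reg: "jac F N x \<noteq> 0"
  obtains \<kappa> where "\<kappa> \<noteq> 0"
    "\<And>w. vd 1 (\<lambda>t. G (F x + t *\<^sub>R w)) 0 = \<kappa> * (N x \<bullet> w)"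
    "\<And>\<alpha> v. vd 2 (\<lambda>t. G (F x + t *\<^sub>R (\<alpha> *\<^sub>R F x + pd F v x))) 0 = \<kappa> * II F N x v v"
    "\<And>\<alpha> v. II F N x v v = 0 ==> vd 3 (\<lambda>t. G (F x + t *\<^sub>R (\<alpha> *\<^sub>R F x + pd F v x))) 0 = \<kappa> * III F N x v"
proof -
  have W: "open W" "smooth_on W G" "F x \<in> W" and V: "open V" "V \<subseteq> A" "x \<in> V"
    and G0: "\<And>v r. v \<in> V ==> r *\<^sub>R F v \<in> W ==> G (r *\<^sub>R F v) = 0"
    and Gnz: "frechet_derivative G (at (F x)) \<noteq> (\<lambda>v. 0)"
    using le by (auto simp: local_equation_def)
  have A: "open A" and F: "smooth_on A F" and N: "smooth_on A N" and xA: "x \<in> A"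
    using dp V by (auto simp: dual_pair_def)
  have NF: "N y \<bullet> F y = 0" "N y \<bullet> pd F v y = 0" "N y \<noteq> 0" if "y \<in> A" for y v
    using dp that by (auto simp: dual_pair_def inner_commute)
  define \<kappa> where "\<kappa> = pd G (N x) (F x) / (N x \<bullet> N x)"
  have g0: "pd G u (F x) = \<kappa> * (N x \<bullet> u)" for u
    using local_equation_gradient[OF dp le V(3), of 1 u] W reg by (simp add: \<kappa>_def)
  have "\<kappa> \<noteq> 0"
  proof
    assume "\<kappa> = 0"
    then have "frechet_derivative G (at (F x)) = (\<lambda>v. 0)" using g0 by (auto simp: pd_def fun_eq_iff)
    then show False using Gnz by simp
  qed
  moreover have 1: "vd 1 (\<lambda>t. G (F x + t *\<^sub>R w)) 0 = \<kappa> * (N x \<bullet> w)" for w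
    using vd_line[OF W(1,2), of "F x" 0 w 0] W(3) g0 by simp
  moreover have "vd 2 (\<lambda>t. G (F x + t *\<^sub>R (\<alpha> *\<^sub>R F x + pd F v x))) 0 = \<kappa> * II F N x v v \<and>
     (II F N x v v = 0 --> vd 3 (\<lambda>t. G (F x + t *\<^sub>R (\<alpha> *\<^sub>R F x + pd F v x))) 0 = \<kappa> * III F N x v)" for \<alpha> v
  proof -
    define w where "w = \<alpha> *\<^sub>R F x + pd F v x"
    have v2: "vd 2 (\<lambda>t. G (F x + t *\<^sub>R w)) 0 = pd (pd G w) w (F x)"
      and v3: "vd 3 (\<lambda>t. G (F x + t *\<^sub>R w)) 0 = pd (pd (pd G w) w) w (F x)"
      using vd_line[OF W(1,2), of "F x" 0 w] vd_line[OF W(1) smooth_on_pd[OF W(2)], of "F x" 0 w _ w]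
        vd_line[OF W(1) smooth_on_pd[OF smooth_on_pd[OF W(2)]], of "F x" 0 w _ w w] W(3)
      by (simp_all add: numeral_2_eq_2 numeral_3_eq_3)
    \<comment> \<open>A curve in the cone; the factor \<open>1 + \<alpha> * t\<close> makes its
      velocity at 0 equal to the direction \<open>w\<close> of the line.\<close>
    define \<delta> where "\<delta> t = (1 + \<alpha> * t) *\<^sub>R F (x + t *\<^sub>R v)" for t
    define T where "T = {t. x + t *\<^sub>R v \<in> {y\<in>V. jac F N y \<noteq> 0} \<and> 1 + \<alpha> * t > 0} \<inter> {t. x + t *\<^sub>R v \<in> V \<and> \<delta> t \<in> W}"
    have jc: "smooth_on A (jac F N)"
      unfolding jac_def by (intro smooth_on_det4 smooth_on_pd A F N)
    have oJ: "open {y\<in>V. jac F N y \<noteq> 0}"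
      using continuous_open_preimage[OF continuous_on_subset[OF smooth_on_continuous[OF jc] V(2)] V(1), of "- {0}"]
        open_Compl[OF closed_singleton, of "0::real"]
      by (simp add: vimage_def Int_def)
    have oL: "open {t. x + t *\<^sub>R v \<in> V}"
      using open_vimage[OF V(1), of "\<lambda>t. x + t *\<^sub>R v"] by (simp add: vimage_def continuous_intros)
    have sl: "smooth_on B (\<lambda>t. x + t *\<^sub>R v)" if "open B" for B
      by (intro smooth_on_add smooth_on_const smooth_on_scaleR smooth_on_ident that)
    have sF: "smooth_on {t. x + t *\<^sub>R v \<in> V} (\<lambda>t. f (x + t *\<^sub>R v))" if "smooth_on A f" for f :: "real^2 => real^4"
      using V(2) by (intro smooth_on_compose[OF oL A _ sl[OF oL] that]) auto
    have s\<delta>: "smooth_on {t. x + t *\<^sub>R v \<in> V} \<delta>"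
      unfolding \<delta>_def by (intro smooth_on_scaleR smooth_on_add smooth_on_mult smooth_on_const smooth_on_ident oL sF F)
    have oT: "open T"
      unfolding T_def
    proof (rule open_Int)
      have "open ((\<lambda>t. x + t *\<^sub>R v) -` {y\<in>V. jac F N y \<noteq> 0} \<inter> (\<lambda>t. 1 + \<alpha> * t) -` {0<..})"
        by (intro open_Int open_vimage oJ open_greaterThan continuous_intros)
      then show "open {t. x + t *\<^sub>R v \<in> {y\<in>V. jac F N y \<noteq> 0} \<and> 1 + \<alpha> * t > 0}"
        by (simp add: vimage_def Int_def)
      show "open {t. x + t *\<^sub>R v \<in> V \<and> \<delta> t \<in> W}"
        using continuous_open_preimage[OF smooth_on_continuous[OF s\<delta>] oL W(1)] by (simp add: vimage_def Int_def)
    qed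
    have T0: "0 \<in> T" using W V reg by (simp add: T_def \<delta>_def)
    have TV: "T \<subseteq> {t. x + t *\<^sub>R v \<in> V}" by (auto simp: T_def)
    have TA: "x + t *\<^sub>R v \<in> A" if "t \<in> T" for t using TV V(2) that by auto
    have TW: "\<delta> t \<in> W" if "t \<in> T" for t using that by (simp add: T_def)
    note s\<delta>T = smooth_on_subset[OF s\<delta> TV]
    \<comment> \<open>The gradient as a vector-valued smooth map, so that the multiplier
      \<open>a\<close> below is a smooth function of \<open>t\<close>.\<close>
    define gr where "gr z = (\<Sum>i\<in>Basis. pd G i z *\<^sub>R i)" for z :: "real^4"
    have gr: "pd G u z = gr z \<bullet> u" if "z \<in> W" for u z
      unfolding pd_basis_sum[OF W(2) that, of u] gr_def by (simp add: inner_sum_left inner_commute[of u] mult.commute)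
    have sgr: "smooth_on W gr"
    proof -
      have "smooth_on W (\<lambda>z. \<Sum>i\<in>B. pd G i z *\<^sub>R i)" for B
        by (induction B rule: infinite_finite_induct)
           (auto intro!: smooth_on_add smooth_on_scaleR smooth_on_const smooth_on_pd W)
      then show ?thesis unfolding gr_def .
    qed
    define a where "a t = (gr (\<delta> t) \<bullet> N (x + t *\<^sub>R v)) / (N (x + t *\<^sub>R v) \<bullet> N (x + t *\<^sub>R v))" for t
    note sNT = smooth_on_subset[OF sF[OF N] TV]
    have sa: "smooth_on T a"
      unfolding a_def
      using NF TA by (intro smooth_on_divide smooth_on_inner oT sNT smooth_on_compose[OF oT W(1) TW s\<delta>T sgr]) auto
    have key: "pd G u (\<delta> t) = a t * (N (x + t *\<^sub>R v) \<bullet> u)" if "t \<in> T" for u t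
      using local_equation_gradient[OF dp le, of "x + t *\<^sub>R v" "1 + \<alpha> * t" u] that TW[OF that]
      by (auto simp: \<delta>_def a_def T_def gr)
    have a0: "a 0 = \<kappa>" using gr[OF W(3)] by (simp add: a_def \<kappa>_def \<delta>_def)
    have \<delta>0: "\<delta> 0 = F x" by (simp add: \<delta>_def)
    have F1: "((\<lambda>t. F (x + t *\<^sub>R v)) has_vector_derivative pd F v (x + t *\<^sub>R v)) (at t)" if "t \<in> T" for t
      using has_vector_derivative_line[OF F TA[OF that]] .
    have d\<delta>: "(\<delta> has_vector_derivative (\<alpha> *\<^sub>R F (x + t *\<^sub>R v) + (1 + \<alpha> * t) *\<^sub>R pd F v (x + t *\<^sub>R v))) (at t)" if "t \<in> T" for t
      unfolding \<delta>_def
      by (rule has_vector_derivative_eq_rhs, rule bounded_bilinear.has_vector_derivative[OF bounded_bilinear_scaleR _ F1[OF that]])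
         (auto intro!: derivative_eq_intros simp flip: real_derivative_iff)
    have \<delta>1: "vd 1 \<delta> 0 = w" using vd_1I[OF d\<delta>[OF T0]] by (simp add: w_def)
    have \<delta>2: "vd 2 \<delta> 0 = 2 *\<^sub>R \<alpha> *\<^sub>R pd F v x + pd (pd F v) v x"
    proof -
      have "vd 2 \<delta> 0 = vd 1 (\<lambda>t. \<alpha> *\<^sub>R F (x + t *\<^sub>R v) + (1 + \<alpha> * t) *\<^sub>R pd F v (x + t *\<^sub>R v)) 0"
        using vd_SucI[OF oT T0 d\<delta>, of 1] by (simp add: numeral_2_eq_2)
      also have "\<dots> = 2 *\<^sub>R \<alpha> *\<^sub>R pd F v x + pd (pd F v) v x"
      proof (rule vd_1I)
        have "((\<lambda>t. pd F v (x + t *\<^sub>R v)) has_vector_derivative pd (pd F v) v (x + 0 *\<^sub>R v)) (at 0)"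
          using has_vector_derivative_line[OF smooth_on_pd[OF F, of v], of x 0 v] xA by simp
        moreover have "((\<lambda>t. 1 + \<alpha> * t) has_vector_derivative \<alpha>) (at 0)"
          by (auto intro!: derivative_eq_intros simp flip: real_derivative_iff)
        ultimately have "((\<lambda>t. (1 + \<alpha> * t) *\<^sub>R pd F v (x + t *\<^sub>R v)) has_vector_derivative
            (1 + \<alpha> * 0) *\<^sub>R pd (pd F v) v (x + 0 *\<^sub>R v) + \<alpha> *\<^sub>R pd F v (x + 0 *\<^sub>R v)) (at 0)"
          using bounded_bilinear.has_vector_derivative[OF bounded_bilinear_scaleR] by fastforce
        from has_vector_derivative_add[OF bounded_linear.has_vector_derivative[OF bounded_linear_scaleR_right F1[OF T0]] this]
        show "((\<lambda>t. \<alpha> *\<^sub>R F (x + t *\<^sub>R v) + (1 + \<alpha> * t) *\<^sub>R pd F v (x + t *\<^sub>R v)) has_vector_derivative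
          2 *\<^sub>R \<alpha> *\<^sub>R pd F v x + pd (pd F v) v x) (at 0)"
          by (rule has_vector_derivative_eq_rhs) (simp add: vec_eq_iff algebra_simps)
      qed
      finally show ?thesis .
    qed
    have sb: "smooth_on T (\<lambda>t. N (x + t *\<^sub>R v) \<bullet> u)" for u
      by (intro smooth_on_inner smooth_on_const oT sNT)
    have b0: "vd 1 (\<lambda>t. N (x + t *\<^sub>R v) \<bullet> u) 0 = pd N v x \<bullet> u"
      "vd 2 (\<lambda>t. N (x + t *\<^sub>R v) \<bullet> u) 0 = pd (pd N v) v x \<bullet> u" for u
    proof -
      have d: "((\<lambda>t. M (x + t *\<^sub>R v) \<bullet> u) has_vector_derivative pd M v (x + t *\<^sub>R v) \<bullet> u) (at t)"
        if "smooth_on A M" "t \<in> T" for t and M :: "real^2 => real^4"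
        by (rule bounded_linear.has_vector_derivative[OF bounded_linear_inner_left has_vector_derivative_line[OF that(1) TA[OF that(2)]]])
      show "vd 1 (\<lambda>t. N (x + t *\<^sub>R v) \<bullet> u) 0 = pd N v x \<bullet> u"
        using vd_1I[OF d[OF N T0]] by simp
      show "vd 2 (\<lambda>t. N (x + t *\<^sub>R v) \<bullet> u) 0 = pd (pd N v) v x \<bullet> u"
        using vd_SucI[OF oT T0 d[OF N], of 1] vd_1I[OF d[OF smooth_on_pd[OF N] T0]] by (simp add: numeral_2_eq_2)
    qed
    have k1: "pd (pd G u) w (F x) = vd 1 a 0 * (N x \<bullet> u) + \<kappa> * (pd N v x \<bullet> u)" for u
    proof -
      have "vd 1 (\<lambda>t. pd G u (\<delta> t)) 0 = pd (pd G u) (vd 1 \<delta> 0) (\<delta> 0)"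
        by (rule vd_1I, rule has_vector_derivative_compose_smooth[where c=\<delta>, OF smooth_on_pd[OF W(2)] TW[OF T0]
              has_vector_derivative_smooth[OF oT s\<delta>T T0]])
      moreover have "vd 1 (\<lambda>t. pd G u (\<delta> t)) 0 = vd 1 (\<lambda>t. a t * (N (x + t *\<^sub>R v) \<bullet> u)) 0"
        by (rule vd_cong[OF oT T0 key])
      ultimately show ?thesis
        using vd1_mult[OF oT sa sb T0, of u] by (simp add: b0 a0 \<delta>0 \<delta>1 del: One_nat_def)
    qed
    have II0: "pd N v x \<bullet> w = II F N x v v" "N x \<bullet> w = 0"
      using dual_pair_pd_N[OF dp xA] NF[OF xA] by (simp_all add: w_def II_def inner_add_right)
    have "vd 2 (\<lambda>t. G (F x + t *\<^sub>R w)) 0 = \<kappa> * II F N x v v"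
      unfolding v2 k1 II0 by simp
    moreover have "vd 3 (\<lambda>t. G (F x + t *\<^sub>R w)) 0 = \<kappa> * III F N x v" if z: "II F N x v v = 0"
    proof -
      \<comment> \<open>Two derivatives along \<delta> produce the third derivative of
        \<open>G\<close> along the line and a correction in the direction of the acceleration of
        \<delta>, which \<open>k1\<close> evaluates after the order of differentiation is
        exchanged.\<close>
      have "vd 2 (\<lambda>t. pd G w (\<delta> t)) 0 = pd (pd (pd G w) (vd 1 \<delta> 0)) (vd 1 \<delta> 0) (\<delta> 0) + pd (pd G w) (vd 2 \<delta> 0) (\<delta> 0)"
        by (rule vd2_compose[OF W(1) oT smooth_on_pd[OF W(2)] s\<delta>T TW T0])
      moreover have "vd 2 (\<lambda>t. pd G w (\<delta> t)) 0 = vd 2 (\<lambda>t. a t * (N (x + t *\<^sub>R v) \<bullet> w)) 0"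
        by (rule vd_cong[OF oT T0 key])
      moreover have "\<dots> = \<kappa> * (pd (pd N v) v x \<bullet> w)"
        unfolding vd2_mult[OF oT sa sb T0] b0 II0 z using II0(2) by (simp add: a0)
      ultimately have e: "pd (pd (pd G w) w) w (F x) = \<kappa> * (pd (pd N v) v x \<bullet> w) - pd (pd G w) (vd 2 \<delta> 0) (F x)"
        unfolding \<delta>0 \<delta>1 by simp
      have "pd (pd G w) (vd 2 \<delta> 0) (F x) = pd (pd G (vd 2 \<delta> 0)) w (F x)"
        by (rule pd_commute[OF W])
      also have "\<dots> = \<kappa> * (pd N v x \<bullet> pd (pd F v) v x)"
        unfolding k1 \<delta>2 using NF[OF xA] z dual_pair_second[OF dp xA, of v v]
        by (simp add: inner_add_right II_def)
      finally have e2: "pd (pd G w) (vd 2 \<delta> 0) (F x) = \<kappa> * (pd N v x \<bullet> pd (pd F v) v x)" .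
      have "F x \<bullet> pd (pd N v) v x = 0"
        using dual_pair_second[OF dual_pair_sym[OF dp] xA, of v v] z by (simp add: II_def inner_commute)
      then have "pd (pd N v) v x \<bullet> w = pd (pd N v) v x \<bullet> pd F v x"
        by (simp add: w_def inner_add_right inner_commute)
      then show ?thesis unfolding v3 e e2 III_def by (simp add: algebra_simps)
    qed
    ultimately show ?thesis unfolding w_def by blast
  qed
  ultimately show ?thesis using that by blast
qed

lemma bounded_linear_vector2: "bounded_linear (\<lambda>p::real^'n. vector [p$i, p$j] :: real^2)"
  by (subst linear_conv_bounded_linear[symmetric], rule linearI) (simp_all add: vec_eq_iff forall_2)

text \<open>Use coordinates in which the cone over the sheet is flat: \<open>H\<close> maps (r, v,
  z) to \<open>r *\<^sub>R F v + z *\<^sub>R N x\<close> and is a local diffeomorphism at (1, x, 0).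
  The last coordinate of its inverse vanishes on the cone.\<close>

lemma local_equation_exists:
  assumes dp: "dual_pair A F N" and x: "x \<in> A" and reg: "jac F N x \<noteq> 0"
  obtains W V G where "local_equation A F x W V G"
proof -
  have A: "open A" and F: "smooth_on A F" and N: "smooth_on A N" and NF: "F x \<noteq> 0"
    using dp x by (auto simp: dual_pair_def)
  define q where "q p = (vector [p$2, p$3] :: real^2)" for p :: "real^4"
  have q: "bounded_linear q" unfolding q_def by (rule bounded_linear_vector2)
  define D where "D = q -` A"
  have D: "open D" unfolding D_def
    by (intro open_vimage A linear_continuous_on[OF q])
  define H where "H p = p$1 *\<^sub>R F (q p) + p$4 *\<^sub>R N x" for p
  define p0 :: "real^4" where "p0 = vector [1, x$1, x$2, 0]"
  have qp0: "q p0 = x" by (simp add: q_def p0_def vec_eq_iff forall_2)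
  have p0: "p0 \<in> D" by (simp add: D_def qp0 x)
  have sFq: "smooth_on D (\<lambda>p. F (q p))"
    by (rule smooth_on_compose[OF D A _ smooth_on_linear[OF D q] F]) (simp add: D_def)
  have H: "smooth_on D H"
    unfolding H_def
    by (intro smooth_on_add smooth_on_scaleR smooth_on_const smooth_on_linear[OF _ bounded_linear_vec_nth] D sFq)
  have pdH: "pd H u p0 = u$1 *\<^sub>R F x + u$2 *\<^sub>R pd F e1 x + u$3 *\<^sub>R pd F e2 x + u$4 *\<^sub>R N x" for u
  proof -
    have lin: "((\<lambda>p::real^4. p$i) has_derivative (\<lambda>u. u$i)) (at p0)" for i
      by (rule bounded_linear_imp_has_derivative[OF bounded_linear_vec_nth])
    have 1: "((\<lambda>p. F (q p)) has_derivative (\<lambda>u. pd F (q u) x)) (at p0)"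
      using has_derivative_compose[OF bounded_linear_imp_has_derivative[OF q], of F "\<lambda>v. pd F v x" p0 UNIV]
        smooth_on_has_derivative[OF F x] by (simp add: qp0)
    have "(H has_derivative (\<lambda>u. (p0$1 *\<^sub>R pd F (q u) x + u$1 *\<^sub>R F (q p0)) + (p0$4 *\<^sub>R 0 + u$4 *\<^sub>R N x))) (at p0)"
      unfolding H_def
      by (intro has_derivative_add has_derivative_scaleR lin 1 has_derivative_const)
    note e = pd_eqI[OF this, of u]
    have "p0$1 = 1" "p0$4 = 0" "(q u)$1 = u$2" "(q u)$2 = u$3" by (simp_all add: p0_def q_def)
    then show ?thesis unfolding e pd_coords[OF F x, of "q u"] by (simp add: qp0 algebra_simps)
  qed
  have l: "linear (\<lambda>u. pd H u p0)" by (rule pd_linear[OF H p0])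
  have "inj (\<lambda>u. pd H u p0)"
    unfolding linear_injective_0[OF l]
  proof (intro allI impI)
    fix u assume "pd H u p0 = 0"
    from det4_indep[OF reg[unfolded jac_def] this[unfolded pdH]]
    show "u = 0" by (simp add: vec_eq_iff forall_4)
  qed
  then have "bij (\<lambda>u. pd H u p0)"
    by (simp add: bij_def linear_injective_imp_surjective[OF l])
  from smooth_inverse_function[OF D H p0 this] obtain U' V' g where
    U': "open U'" "U' \<subseteq> D" "p0 \<in> U'" and V': "open V'" "H ` U' = V'" and g: "smooth_on V' g"
    and gH: "\<And>p. p \<in> U' ==> g (H p) = p"
    by metis
  obtain e0 where e0: "e0 > 0" "ball p0 e0 \<subseteq> U'" using U' openE by blast
  define e where "e = min (e0 / 4) 1"
  have e: "e > 0" "e \<le> 1" "4 * e \<le> e0" using e0 by (auto simp: e_def)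
  have near: "vector [r, v$1, v$2, z] \<in> U'" if "\<bar>r - 1\<bar> < e" "dist v x < e" "\<bar>z\<bar> < e" for r z and v :: "real^2"
  proof -
    have "norm (vector [r, v$1, v$2, z] - p0) \<le> \<bar>r - 1\<bar> + \<bar>(v - x)$1\<bar> + \<bar>(v - x)$2\<bar> + \<bar>z\<bar>"
      using norm_le_l1_cart[of "vector [r, v$1, v$2, z] - p0"] by (simp add: sum_4 p0_def)
    also have "\<dots> < e + e + e + e"
      using that component_le_norm_cart[of "v - x" 1] component_le_norm_cart[of "v - x" 2]
      by (simp add: dist_norm)
    finally show ?thesis using e e0 by (auto simp: dist_norm norm_minus_commute subset_iff)
  qed
  \<comment> \<open>\<open>s\<close> measures the multiple of \<open>F x\<close> contained in
    \<open>y\<close>. Bounding it for \<open>F v\<close> and for \<open>r *\<^sub>R F v\<close>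
    forces \<open>r\<close> close to 1, so that every representative of the point in
    \<open>W\<close> has its coordinates in the domain where \<open>H\<close> is inverted.\<close>
  define s where "s y = (y \<bullet> F x) / (F x \<bullet> F x)" for y
  define \<eta> where "\<eta> = e / 4"
  have \<eta>: "\<eta> > 0" "\<eta> \<le> 1/4" using e by (auto simp: \<eta>_def)
  have sc: "continuous_on S s" for S unfolding s_def using NF by (intro continuous_intros) auto
  define W where "W = V' \<inter> {y. \<bar>s y - 1\<bar> < \<eta>}"
  define V where "V = {v\<in>A. \<bar>s (F v) - 1\<bar> < \<eta>} \<inter> ball x e"
  have Hp0: "H p0 = F x" by (simp add: H_def qp0) (simp add: p0_def)
  have "open {y. \<bar>s y - 1\<bar> < \<eta>}"
    by (rule open_Collect_less) (intro continuous_intros sc)+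
  then have W: "open W" "F x \<in> W"
    using V' imageI[OF U'(3), of H] Hp0 NF \<eta> by (auto simp: W_def s_def intro!: open_Int)
  have "continuous_on A (\<lambda>v. \<bar>s (F v) - 1\<bar>)"
    by (intro continuous_intros continuous_on_compose2[OF sc smooth_on_continuous[OF F]]) auto
  then have "open {v\<in>A. \<bar>s (F v) - 1\<bar> < \<eta>}"
    using continuous_open_preimage[OF _ A open_lessThan[of \<eta>]] by (simp add: vimage_def Int_def)
  then have V: "open V" "x \<in> V" "V \<subseteq> A"
    using x NF \<eta> e by (auto simp: V_def s_def)
  define G where "G y = g y $ 4" for y
  have sG: "smooth_on W G"
    unfolding G_def by (rule smooth_on_subset[OF smooth_on_nth[OF V'(1) g]]) (auto simp: W_def)
  have zero: "G (r *\<^sub>R F v) = 0" if "v \<in> V" "r *\<^sub>R F v \<in> W" for v r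
  proof -
    have a: "\<bar>s (F v) - 1\<bar> < \<eta>" "\<bar>r * s (F v) - 1\<bar> < \<eta>" "dist v x < e"
      using that by (auto simp: V_def W_def s_def dist_commute)
    have sp: "s (F v) > 0" using a \<eta> by linarith
    have "\<bar>r - 1\<bar> * s (F v) = \<bar>(r - 1) * s (F v)\<bar>" using sp by (simp add: abs_mult)
    also have "\<dots> = \<bar>r * s (F v) - s (F v)\<bar>" by (simp add: left_diff_distrib)
    also have "\<dots> < 2 * \<eta>" using a by linarith
    finally have b: "\<bar>r - 1\<bar> * s (F v) < 2 * \<eta>" .
    have "\<bar>r - 1\<bar> * (1/2) \<le> \<bar>r - 1\<bar> * s (F v)" using a \<eta> by (intro mult_left_mono) auto
    then have "\<bar>r - 1\<bar> < e" using b by (simp add: \<eta>_def)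
    from near[OF this a(3), of 0] e have "vector [r, v$1, v$2, 0] \<in> U'" by simp
    moreover have "H (vector [r, v$1, v$2, 0]) = r *\<^sub>R F v"
    proof -
      have "q (vector [r, v$1, v$2, 0]) = v" by (simp add: q_def vec_eq_iff forall_2)
      then show ?thesis by (simp add: H_def)
    qed
    ultimately show ?thesis using gH[of "vector [r, v$1, v$2, 0]"] by (simp add: G_def)
  qed
  \<comment> \<open>Along the direction \<open>N x\<close> the function \<open>G\<close> is just the
    parameter \<open>t\<close>.\<close>
  have "frechet_derivative G (at (F x)) \<noteq> (\<lambda>v. 0)"
  proof
    assume "frechet_derivative G (at (F x)) = (\<lambda>v. 0)"
    then have "pd G (N x) (F x) = 0" by (simp add: pd_def)
    moreover have "((\<lambda>t. G (F x + t *\<^sub>R N x)) has_vector_derivative pd G (N x) (F x)) (at 0)"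
      using has_vector_derivative_line[OF sG, of "F x" 0 "N x"] W by simp
    moreover have "((\<lambda>t. G (F x + t *\<^sub>R N x)) has_vector_derivative 1) (at 0)"
    proof (rule has_vector_derivative_transform_within_open[where f="\<lambda>t. t" and S="{-e<..<e}"])
      fix t assume t: "t \<in> {-e<..<e}"
      have "q (vector [1, x$1, x$2, t]) = x" by (simp add: q_def vec_eq_iff forall_2)
      then have "H (vector [1, x$1, x$2, t]) = F x + t *\<^sub>R N x" by (simp add: H_def)
      moreover have "vector [1, x$1, x$2, t] \<in> U'" using near[of 1 x t] e t by auto
      ultimately show "t = G (F x + t *\<^sub>R N x)"
        using gH[of "vector [1, x$1, x$2, t]"] by (simp add: G_def)
    qed (use e in \<open>auto intro!: derivative_eq_intros\<close>)
    ultimately show False using vector_derivative_unique_at by fastforce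
  qed
  then have "local_equation A F x W V G"
    using W V sG zero by (auto simp: local_equation_def)
  then show ?thesis by (rule that)
qed

lemma III_scale:
  assumes dp: "dual_pair A F N" and x: "x \<in> A"
  shows "III F N x (k *\<^sub>R v) = k ^ 3 * III F N x v"
proof -
  have 1: "pd M (k *\<^sub>R v) y = k *\<^sub>R pd M v y" if "smooth_on A M" "y \<in> A" for y v and M :: "real^2 => real^4"
    using linear_cmul[OF pd_linear[OF that]] .
  have 2: "pd (pd M (k *\<^sub>R v)) (k *\<^sub>R v) x = k\<^sup>2 *\<^sub>R pd (pd M v) v x" if M: "smooth_on A M" for M :: "real^2 => real^4"
  proof -
    have "pd (pd M (k *\<^sub>R v)) (k *\<^sub>R v) x = pd (\<lambda>y. k *\<^sub>R pd M v y) (k *\<^sub>R v) x"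
      using dp by (intro pd_cong[OF _ x] smooth_on_pd M 1[OF M]) (auto simp: dual_pair_def)
    also have "\<dots> = k *\<^sub>R pd (pd M v) (k *\<^sub>R v) x"
      by (rule pd_bounded_linear[OF smooth_on_pd[OF M] x bounded_linear_scaleR_right])
    finally show ?thesis using 1[OF smooth_on_pd[OF M] x] by (simp add: power2_eq_square)
  qed
  show ?thesis
    using dp 1[of F x] 1[of N x] 2[of F] 2[of N] x
    by (simp add: III_def dual_pair_def power2_eq_square power3_eq_cube algebra_simps)
qed

lemma all_less_3: "(\<forall>j<3. P j) \<longleftrightarrow> P 0 \<and> P 1 \<and> P (2::nat)"
  by (auto simp: numeral_3_eq_3 numeral_2_eq_2 less_Suc_eq)

lemma all_less_4: "(\<forall>j<4. P j) \<longleftrightarrow> P 0 \<and> P 1 \<and> P 2 \<and> P (3::nat)"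
proof -
  have "(4::nat) = Suc 3" by simp
  then show ?thesis using all_less_3[of P] less_Suc_eq[of _ 3] by metis
qed

text \<open>The derivatives of order one, two and three along a line test tangency,
  \<open>II\<close> and \<open>III\<close>. The factor \<kappa> is nonzero for every local equation,
  so all of them give the same answer.\<close>

lemma line_contact_iff:
  assumes dp: "dual_pair A F N" and x: "x \<in> A" and reg: "jac F N x \<noteq> 0"
  shows "line_contact A F x 3 l \<longleftrightarrow> (\<exists>v. v \<noteq> 0 \<and> l = span {F x, pd F v x} \<and> II F N x v v = 0)"
    and "line_contact A F x 4 l \<longleftrightarrow>
      (\<exists>v. v \<noteq> 0 \<and> l = span {F x, pd F v x} \<and> II F N x v v = 0 \<and> III F N x v = 0)"
proof -
  have F: "smooth_on A F" using dp by (simp add: dual_pair_def)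
  have r: "regular_at F x" using regular_at_iff_jac[OF dp x] reg by simp
  have NF: "N x \<bullet> F x = 0" "N x \<bullet> pd F v x = 0" "N x \<noteq> 0" for v
    using dp x by (auto simp: dual_pair_def inner_commute)
  have fwd: "\<exists>v. v \<noteq> 0 \<and> l = span {F x, pd F v x} \<and> II F N x v v = 0 \<and>
      (vd 3 (\<lambda>t. G (F x + t *\<^sub>R w)) 0 = 0 --> III F N x v = 0)"
    if w: "w \<notin> span {F x}" "l = span {F x, w}" and le: "local_equation A F x W V G"
      and v1: "vd 1 (\<lambda>t. G (F x + t *\<^sub>R w)) 0 = 0" and v2: "vd 2 (\<lambda>t. G (F x + t *\<^sub>R w)) 0 = 0" for w W V G
  proof -
    obtain \<kappa> where \<kappa>: "\<kappa> \<noteq> 0"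
      "\<And>w. vd 1 (\<lambda>t. G (F x + t *\<^sub>R w)) 0 = \<kappa> * (N x \<bullet> w)"
      "\<And>\<alpha> v. vd 2 (\<lambda>t. G (F x + t *\<^sub>R (\<alpha> *\<^sub>R F x + pd F v x))) 0 = \<kappa> * II F N x v v"
      "\<And>\<alpha> v. II F N x v v = 0 ==> vd 3 (\<lambda>t. G (F x + t *\<^sub>R (\<alpha> *\<^sub>R F x + pd F v x))) 0 = \<kappa> * III F N x v"
      using local_equation_along_line[OF dp le reg] by blast
    obtain i j k m where e: "w = i *\<^sub>R F x + j *\<^sub>R pd F e1 x + k *\<^sub>R pd F e2 x + m *\<^sub>R N x"
      using det4_expand[OF reg[unfolded jac_def]] by blast
    have "N x \<bullet> w = 0" using v1 \<kappa> by simp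
    then have "m = 0" unfolding e using NF by (simp add: inner_add_right)
    then have w': "w = i *\<^sub>R F x + pd F (vector [j, k]) x"
      unfolding e pd_coords[OF F x, of "vector [j, k]"] by simp
    have "(vector [j, k] :: real^2) \<noteq> 0"
    proof
      assume "(vector [j, k] :: real^2) = 0"
      then have "w = i *\<^sub>R F x" using w' linear_0[OF pd_linear[OF F x]] by simp
      then show False using w(1) by (simp add: span_base span_mul)
    qed
    moreover have "l = span {F x, pd F (vector [j, k]) x}"
      unfolding w(2) w' by (rule span_insert_add_multiple)
    moreover have "II F N x (vector [j, k]) (vector [j, k]) = 0"
      using \<kappa>(1) \<kappa>(3)[of i "vector [j, k]"] v2 w' by simp
    ultimately show ?thesis using \<kappa>(1) \<kappa>(4)[of "vector [j, k]" i] w' by force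
  qed
  have bwd: "\<exists>w W V G. w \<notin> span {F x} \<and> l = span {F x, w} \<and> local_equation A F x W V G \<and>
      vd 0 (\<lambda>t. G (F x + t *\<^sub>R w)) 0 = 0 \<and> vd 1 (\<lambda>t. G (F x + t *\<^sub>R w)) 0 = 0 \<and>
      vd 2 (\<lambda>t. G (F x + t *\<^sub>R w)) 0 = 0 \<and> (III F N x v = 0 --> vd 3 (\<lambda>t. G (F x + t *\<^sub>R w)) 0 = 0)"
    if v: "v \<noteq> 0" "l = span {F x, pd F v x}" "II F N x v v = 0" for v
  proof -
    obtain W V G where le: "local_equation A F x W V G"
      using local_equation_exists[OF dp x reg] .
    obtain \<kappa> where \<kappa>: "\<kappa> \<noteq> 0"
      "\<And>w. vd 1 (\<lambda>t. G (F x + t *\<^sub>R w)) 0 = \<kappa> * (N x \<bullet> w)"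
      "\<And>\<alpha> v. vd 2 (\<lambda>t. G (F x + t *\<^sub>R (\<alpha> *\<^sub>R F x + pd F v x))) 0 = \<kappa> * II F N x v v"
      "\<And>\<alpha> v. II F N x v v = 0 ==> vd 3 (\<lambda>t. G (F x + t *\<^sub>R (\<alpha> *\<^sub>R F x + pd F v x))) 0 = \<kappa> * III F N x v"
      using local_equation_along_line[OF dp le reg] by blast
    have G0: "G (F x) = 0" using le[unfolded local_equation_def] scaleR_one by metis
    show ?thesis
      using r v le G0 \<kappa>(2)[of "pd F v x"] \<kappa>(3)[of 0 v] NF \<kappa>(4)[of v 0]
      by (intro exI[of _ "pd F v x"] exI[of _ W] exI[of _ V] exI[of _ G])
         (auto simp: regular_at_def pd_def)
  qed
  show "line_contact A F x 3 l \<longleftrightarrow> (\<exists>v. v \<noteq> 0 \<and> l = span {F x, pd F v x} \<and> II F N x v v = 0)" (is "?L \<longleftrightarrow> ?R")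
  proof
    assume ?L
    then obtain w W V G where w: "w \<notin> span {F x}" "l = span {F x, w}" "local_equation A F x W V G"
      "vd 1 (\<lambda>t. G (F x + t *\<^sub>R w)) 0 = 0" "vd 2 (\<lambda>t. G (F x + t *\<^sub>R w)) 0 = 0"
      unfolding line_contact_local_equation all_less_3 by blast
    from fwd[OF w(1-5)] show ?R by blast
  next
    assume ?R
    then obtain v where v: "v \<noteq> 0" "l = span {F x, pd F v x}" "II F N x v v = 0" by blast
    from bwd[OF v(1-3)] show ?L
      unfolding line_contact_local_equation all_less_3 by blast
  qed
  show "line_contact A F x 4 l \<longleftrightarrow>
      (\<exists>v. v \<noteq> 0 \<and> l = span {F x, pd F v x} \<and> II F N x v v = 0 \<and> III F N x v = 0)" (is "?L \<longleftrightarrow> ?R")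
  proof
    assume ?L
    then obtain w W V G where w: "w \<notin> span {F x}" "l = span {F x, w}" "local_equation A F x W V G"
      "vd 1 (\<lambda>t. G (F x + t *\<^sub>R w)) 0 = 0" "vd 2 (\<lambda>t. G (F x + t *\<^sub>R w)) 0 = 0" "vd 3 (\<lambda>t. G (F x + t *\<^sub>R w)) 0 = 0"
      unfolding line_contact_local_equation all_less_4 by blast
    from fwd[OF w(1-5)] w(6) show ?R by blast
  next
    assume ?R
    then obtain v where v: "v \<noteq> 0" "l = span {F x, pd F v x}" "II F N x v v = 0" "III F N x v = 0" by blast
    from bwd[OF v(1-3)] v(4) show ?L
      unfolding line_contact_local_equation all_less_4 by blast
  qed
qed

section \<open>Asymptotic directions by slope\<close>

definition slope_line :: "(real^2 => real^4) => real^2 => real => (real^4) set" where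
  "slope_line F x p = span {F x, pd F (vector [1, p]) x}"

text \<open>With \<open>II\<close> nonzero on \<open>e2\<close> an asymptotic direction has a
  nonzero first coordinate, which can be scaled to 1; a slope is then a root of a quadratic
  polynomial.\<close>

lemma slope_exists:
  assumes dp: "dual_pair A F N" and x: "x \<in> A" and c: "II F N x e2 e2 \<noteq> 0"
    and v: "v \<noteq> 0" "II F N x v v = 0"
  obtains p k where "k \<noteq> 0" "v = k *\<^sub>R vector [1, p]"
proof -
  have "v$1 \<noteq> 0"
  proof
    assume "v$1 = 0"
    then show False using II_coords[OF dp x, of v v] v c by (auto simp: vec_eq_iff forall_2)
  qed
  then show ?thesis by (intro that[of "v$1" "v$2 / v$1"]) (auto simp: vec_eq_iff forall_2)
qed

lemma line_contact_slope:
  assumes dp: "dual_pair A F N" and x: "x \<in> A" and reg: "jac F N x \<noteq> 0" and c: "II F N x e2 e2 \<noteq> 0"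
  shows "line_contact A F x 3 l \<longleftrightarrow> (\<exists>p. l = slope_line F x p \<and> II F N x (vector [1, p]) (vector [1, p]) = 0)"
    and "line_contact A F x 4 l \<longleftrightarrow>
      (\<exists>p. l = slope_line F x p \<and> II F N x (vector [1, p]) (vector [1, p]) = 0 \<and> III F N x (vector [1, p]) = 0)"
proof -
  have F: "smooth_on A F" and N: "smooth_on A N" using dp by (simp_all add: dual_pair_def)
  have sp: "span {F x, pd F (k *\<^sub>R v) x} = span {F x, pd F v x}" if "k \<noteq> 0" for k v
  proof -
    have "pd F v x = inverse k *\<^sub>R (k *\<^sub>R pd F v x)" using that by simp
    also have "\<dots> \<in> span {F x, k *\<^sub>R pd F v x}" by (intro span_mul span_base) auto
    finally have "pd F v x \<in> span {F x, k *\<^sub>R pd F v x}" .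
    moreover have "k *\<^sub>R pd F v x \<in> span {F x, pd F v x}" by (intro span_mul span_base) auto
    ultimately show ?thesis
      unfolding linear_cmul[OF pd_linear[OF F x]] span_eq by (auto intro: span_base)
  qed
  have II: "II F N x (k *\<^sub>R v) (k *\<^sub>R v) = k\<^sup>2 * II F N x v v" for k v
    unfolding II_def linear_cmul[OF pd_linear[OF F x]] linear_cmul[OF pd_linear[OF N x]] by (simp add: power2_eq_square)
  have nz: "(vector [1, p] :: real^2) \<noteq> 0" for p by (metis vector_2(1) zero_index zero_neq_one)
  have red: "(\<exists>v. v \<noteq> 0 \<and> l = span {F x, pd F v x} \<and> II F N x v v = 0 \<and> (Q --> III F N x v = 0)) \<longleftrightarrow>
     (\<exists>p. l = slope_line F x p \<and> II F N x (vector [1, p]) (vector [1, p]) = 0 \<and> (Q --> III F N x (vector [1, p]) = 0))" for Q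
  proof
    assume "\<exists>v. v \<noteq> 0 \<and> l = span {F x, pd F v x} \<and> II F N x v v = 0 \<and> (Q --> III F N x v = 0)"
    then obtain v where v: "v \<noteq> 0" "l = span {F x, pd F v x}" "II F N x v v = 0" "Q --> III F N x v = 0" by blast
    obtain p k where pk: "k \<noteq> 0" "v = k *\<^sub>R vector [1, p]" using slope_exists[OF dp x c v(1,3)] .
    then show "\<exists>p. l = slope_line F x p \<and> II F N x (vector [1, p]) (vector [1, p]) = 0 \<and>
      (Q --> III F N x (vector [1, p]) = 0)"
      using v sp[OF pk(1), of "vector [1, p]"] II[of k "vector [1, p]"] III_scale[OF dp x, of k "vector [1, p]"]
      unfolding slope_line_def by auto
  next
    assume "\<exists>p. l = slope_line F x p \<and> II F N x (vector [1, p]) (vector [1, p]) = 0 \<and> (Q --> III F N x (vector [1, p]) = 0)"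
    then show "\<exists>v. v \<noteq> 0 \<and> l = span {F x, pd F v x} \<and> II F N x v v = 0 \<and> (Q --> III F N x v = 0)"
      using nz unfolding slope_line_def by blast
  qed
  show "line_contact A F x 3 l \<longleftrightarrow> (\<exists>p. l = slope_line F x p \<and> II F N x (vector [1, p]) (vector [1, p]) = 0)"
    unfolding line_contact_iff(1)[OF dp x reg] using red[of False] by simp
  show "line_contact A F x 4 l \<longleftrightarrow>
      (\<exists>p. l = slope_line F x p \<and> II F N x (vector [1, p]) (vector [1, p]) = 0 \<and> III F N x (vector [1, p]) = 0)"
    unfolding line_contact_iff(2)[OF dp x reg] using red[of True] by simp
qed

lemma slope_line_inj:
  assumes dp: "dual_pair A F N" and x: "x \<in> A" and reg: "jac F N x \<noteq> 0"
  shows "slope_line F x p = slope_line F x p' \<longleftrightarrow> p = p'"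
proof
  assume "slope_line F x p = slope_line F x p'"
  then have "pd F (vector [1, p']) x \<in> span {F x, pd F (vector [1, p]) x}"
    unfolding slope_line_def by (metis insertI1 insertI2 span_base)
  then obtain i j where "pd F (vector [1, p']) x = i *\<^sub>R F x + j *\<^sub>R pd F (vector [1, p]) x"
    by (metis (no_types, lifting) add.commute diff_add_cancel span_breakdown_eq span_singleton rangeE)
  then have "(- i) *\<^sub>R F x + (1 - j) *\<^sub>R pd F e1 x + (p' - j * p) *\<^sub>R pd F e2 x + 0 *\<^sub>R N x = 0"
    using pd_coords[of A F x "vector [1, p]"] pd_coords[of A F x "vector [1, p']"] dp x
    by (simp add: dual_pair_def algebra_simps)
  from det4_indep[OF reg[unfolded jac_def] this] show "p = p'" by auto
qed simp

lemma II_slope: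
  assumes dp: "dual_pair A F N" and x: "x \<in> A"
  shows "II F N x (vector [1, p]) (vector [1, p]) = II F N x e1 e1 + 2 * II F N x e1 e2 * p + II F N x e2 e2 * p\<^sup>2"
  using II_coords[OF dp x, of "vector [1, p]" "vector [1, p]"] by (simp add: power2_eq_square)

definition discr :: "(real^2 => real^4) => (real^2 => real^4) => real^2 => real" where
  "discr F N x = (II F N x e1 e2)\<^sup>2 - II F N x e1 e1 * II F N x e2 e2"

lemma card_quadratic_roots:
  fixes a b c :: real
  assumes "c \<noteq> 0"
  shows "b\<^sup>2 - a * c > 0 ==> card {p. a + 2 * b * p + c * p\<^sup>2 = 0} = 2"
    and "b\<^sup>2 - a * c = 0 ==> card {p. a + 2 * b * p + c * p\<^sup>2 = 0} = 1"
    and "b\<^sup>2 - a * c < 0 ==> {p. a + 2 * b * p + c * p\<^sup>2 = 0} = {}"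
proof -
  have e: "a + 2 * b * p + c * p\<^sup>2 = 0 \<longleftrightarrow> (c * p + b)\<^sup>2 = b\<^sup>2 - a * c" for p
  proof -
    have "(c * p + b)\<^sup>2 - (b\<^sup>2 - a * c) = c * (a + 2 * b * p + c * p\<^sup>2)"
      by (simp add: power2_eq_square algebra_simps)
    then show ?thesis using assms by (metis eq_iff_diff_eq_0 mult_eq_0_iff)
  qed
  show "card {p. a + 2 * b * p + c * p\<^sup>2 = 0} = 2" if d: "b\<^sup>2 - a * c > 0"
  proof -
    define r where "r = sqrt (b\<^sup>2 - a * c)"
    have r: "r > 0" "r\<^sup>2 = b\<^sup>2 - a * c" using d by (auto simp: r_def)
    have "{p. a + 2 * b * p + c * p\<^sup>2 = 0} = {(r - b) / c, (- r - b) / c}"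
      unfolding e r(2)[symmetric] power2_eq_iff using assms by (auto simp: field_simps)
    moreover have "(r - b) / c \<noteq> (- r - b) / c" using r assms by simp
    ultimately show ?thesis by simp
  qed
  show "card {p. a + 2 * b * p + c * p\<^sup>2 = 0} = 1" if d: "b\<^sup>2 - a * c = 0"
  proof -
    have "{p. a + 2 * b * p + c * p\<^sup>2 = 0} = {- b / c}"
      unfolding e d using assms by (auto simp: field_simps eq_neg_iff_add_eq_0)
    then show ?thesis by simp
  qed
  show "{p. a + 2 * b * p + c * p\<^sup>2 = 0} = {}" if d: "b\<^sup>2 - a * c < 0"
    unfolding e using d by auto (smt (verit) zero_le_power2)
qed

lemma asymptotic_lines_card:
  assumes dp: "dual_pair A F N" and x: "x \<in> A" and reg: "jac F N x \<noteq> 0" and c: "II F N x e2 e2 \<noteq> 0"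
  shows "discr F N x > 0 ==> card (asymptotic_lines A F x) = 2"
    and "discr F N x = 0 ==> card (asymptotic_lines A F x) = 1"
    and "discr F N x < 0 ==> asymptotic_lines A F x = {}"
proof -
  let ?R = "{p. II F N x e1 e1 + 2 * II F N x e1 e2 * p + II F N x e2 e2 * p\<^sup>2 = 0}"
  have "p \<in> ?R \<longleftrightarrow> II F N x (vector [1, p]) (vector [1, p]) = 0" for p
    using II_slope[OF dp x, of p] by simp
  then have "asymptotic_lines A F x = slope_line F x ` ?R"
    unfolding asymptotic_lines_def line_contact_slope(1)[OF dp x reg c] by blast
  moreover have "inj_on (slope_line F x) ?R"
    using slope_line_inj[OF dp x reg] by (auto simp: inj_on_def)
  ultimately have "card (asymptotic_lines A F x) = card ?R" "asymptotic_lines A F x = {} \<longleftrightarrow> ?R = {}"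
    by (auto simp: card_image)
  then show "discr F N x > 0 ==> card (asymptotic_lines A F x) = 2"
    "discr F N x = 0 ==> card (asymptotic_lines A F x) = 1"
    "discr F N x < 0 ==> asymptotic_lines A F x = {}"
    using card_quadratic_roots[OF c, of "II F N x e1 e2" "II F N x e1 e1"] by (simp_all add: discr_def)
qed

text \<open>A local equation refers to the image of the sheet and not to its parameters, so the
  neighbourhood \<open>V\<close> can be transported along \<phi> in both directions.\<close>

lemma line_contact_reparam:
  assumes A: "open A" and c: "continuous_on A \<phi>" and o: "\<And>V. open V ==> V \<subseteq> A ==> open (\<phi> ` V)"
    and U: "\<phi> ` A \<subseteq> U" and x: "x \<in> A"
  shows "line_contact U f (\<phi> x) k l \<longleftrightarrow> line_contact A (\<lambda>x. f (\<phi> x)) x k l"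
proof -
  have 1: "local_equation A (\<lambda>x. f (\<phi> x)) x W (A \<inter> \<phi> -` V) G" if "local_equation U f (\<phi> x) W V G" for W V G
    using that x continuous_open_preimage[OF c A, of V] by (auto simp: local_equation_def)
  have 2: "local_equation U f (\<phi> x) W (\<phi> ` V) G" if "local_equation A (\<lambda>x. f (\<phi> x)) x W V G" for W V G
    using that U o[of V] by (auto simp: local_equation_def)
  show ?thesis unfolding line_contact_local_equation using 1 2 by blast
qed

section \<open>The chart of the swallowtail normal form\<close>

definition edge_fun :: "real^2 => real" where
  "edge_fun x = 12 * (x$1)\<^sup>2 + 2 * x$2"

definition swallowtail_model :: "real^2 => real^3" where
  "swallowtail_model x = vector [3 * (x$1)^4 + (x$1)^2 * x$2, 4 * (x$1)^3 + 2 * x$1 * x$2, x$2]"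

text \<open>In the coordinates \<open>x\<close> of the normal form \<open>edge_fun\<close> is an equation of the cuspidal edge and
  \<open>F = f \<circ> \<phi>\<close> has kernel direction \<open>e1\<close> along it; dividing the derivative along \<open>e1\<close> by this
  equation gives the transversal field \<open>h\<close>.\<close>
locale swallowtail_chart =
  fixes U :: "(real^2) set" and f n :: "real^2 => real^4" and s :: "real^2"
    and A :: "(real^2) set" and \<phi> \<psi> :: "real^2 => real^2"
    and F N h :: "real^2 => real^4" and \<mu> :: "real^2 => real"
  assumes leg: "legendrian U f n"
    and edge: "cuspidal_edge U f = {u\<in>U. \<not> regular_at f u}"
    and swt: "swallowtail_point U f s"
    and A: "open A" "0 \<in> A"
    and phi: "smooth_on A \<phi>" "\<phi> 0 = s" "\<phi> ` A \<subseteq> U" "open (\<phi> ` A)"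
    and psi: "smooth_on (\<phi> ` A) \<psi>" "\<And>x. x \<in> A ==> \<psi> (\<phi> x) = x"
    and F_eq: "F = (\<lambda>x. f (\<phi> x))" and N_eq: "N = (\<lambda>x. n (\<phi> x))"
    and h: "smooth_on A h" and mu: "smooth_on A \<mu>"
    and Fa: "\<And>x. x \<in> A ==> pd F e1 x = edge_fun x *\<^sub>R h x + \<mu> x *\<^sub>R F x"
    and same_iff: "\<And>x y. x \<in> A ==> y \<in> A ==>
      same_point (F x) (F y) \<longleftrightarrow> swallowtail_model x = swallowtail_model y"
    and al_pos: "\<And>x. x \<in> A ==> (pd N e1 x \<bullet> h x) * (pd N e1 0 \<bullet> h 0) > 0"
    and ga_pos: "\<And>x. x \<in> A ==> (pd N e2 x \<bullet> pd F e2 x) * (pd N e2 0 \<bullet> pd F e2 0) > 0"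
    and J0_pos: "\<And>x. x \<in> A ==>
      det4 (F x) (h x) (pd F e2 x) (N x) * det4 (F 0) (h 0) (pd F e2 0) (N 0) > 0"
    and dd_pos: "\<And>x. x \<in> A ==>
      ((pd N e1 x \<bullet> h x) * (pd N e2 x \<bullet> pd F e2 x) - edge_fun x * (pd N e2 x \<bullet> h x)\<^sup>2) *
      ((pd N e1 0 \<bullet> h 0) * (pd N e2 0 \<bullet> pd F e2 0)) > 0"
begin

text \<open>Along with \<open>be\<close> this is what remains of the first row of \<open>II\<close>
  after division by \<open>edge_fun\<close>. The sign assumptions of the locale say that
  \<open>al\<close>, \<open>ga\<close>, \<open>J0\<close> and the reduced discriminant keep on all
  of \<open>A\<close> the sign that they have at 0.\<close>

definition al where "al x = pd N e1 x \<bullet> h x"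
definition be where "be x = pd N e2 x \<bullet> h x"
definition ga where "ga x = pd N e2 x \<bullet> pd F e2 x"
text \<open>\<open>jac\<close> with the factor \<open>edge_fun\<close> divided out. Since it does
  not vanish, \<open>F\<close>, \<open>h\<close>, \<open>pd F e2\<close> and \<open>N\<close> are a
  frame of 4-space even on the edge.\<close>

definition J0 where "J0 x = det4 (F x) (h x) (pd F e2 x) (N x)"
definition q where "q = ga 0 / al 0"

lemma U: "open U" "smooth_on U f" "smooth_on U n"
  using leg by (auto simp: legendrian_def)

lemma phi_in_U: "x \<in> A ==> \<phi> x \<in> U"
  using phi by blast

lemma smooth_F: "smooth_on A F" and smooth_N: "smooth_on A N"
  unfolding F_eq N_eq by (rule smooth_on_compose[OF A(1) U(1) phi_in_U phi(1) U(2)],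
    assumption, rule smooth_on_compose[OF A(1) U(1) phi_in_U phi(1) U(3)])

lemma pd_compose_phi:
  assumes "smooth_on U k" "x \<in> A"
  shows "pd (\<lambda>x. k (\<phi> x)) v x = pd k (pd \<phi> v x) (\<phi> x)"
  using pd_eqI[OF has_derivative_compose[OF smooth_on_has_derivative[OF phi(1) assms(2)]
     smooth_on_has_derivative[OF assms(1) phi_in_U[OF assms(2)]]]] .

lemma dp: "dual_pair A F N"
  unfolding dual_pair_def
  using A(1) smooth_F smooth_N leg phi_in_U pd_compose_phi[OF U(2), folded F_eq]
  by (auto simp: legendrian_def F_eq N_eq pd_def[of f])

lemma pd_phi_bij:
  assumes "x \<in> A" shows "bij (\<lambda>v. pd \<phi> v x)"
proof -
  have l: "linear (\<lambda>v. pd \<phi> v x)" by (rule pd_linear[OF phi(1) assms])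
  have "((\<lambda>x. \<psi> (\<phi> x)) has_derivative (\<lambda>v. pd \<psi> (pd \<phi> v x) (\<phi> x))) (at x)"
    using assms by (intro has_derivative_compose[OF smooth_on_has_derivative[OF phi(1)]]
       smooth_on_has_derivative[OF psi(1)]) auto
  moreover have "((\<lambda>x. \<psi> (\<phi> x)) has_derivative (\<lambda>v. v)) (at x)"
    by (rule has_derivative_transform_within_open[OF has_derivative_ident A(1) assms]) (simp add: psi)
  ultimately have "pd \<psi> (pd \<phi> v x) (\<phi> x) = v" for v
    by (metis has_derivative_unique)
  then have "inj (\<lambda>v. pd \<phi> v x)" by (metis injI)
  then show ?thesis by (simp add: bij_def linear_injective_imp_surjective[OF l])
qed

lemma smooth_edge_fun: "open B ==> smooth_on B edge_fun"
  unfolding edge_fun_def by (intro smooth_intros)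

lemma smooth_abg: "smooth_on A al" "smooth_on A be" "smooth_on A ga"
  unfolding al_def be_def ga_def
  by (intro smooth_on_inner smooth_on_pd A smooth_N smooth_F h)+

lemma al0: "al 0 \<noteq> 0" and ga0: "ga 0 \<noteq> 0" and J00: "J0 0 \<noteq> 0"
  using al_pos[OF A(2)] ga_pos[OF A(2)] J0_pos[OF A(2)] by (auto simp: al_def ga_def J0_def)

lemma ga_nz: "x \<in> A ==> ga x \<noteq> 0" and J0_nz: "x \<in> A ==> J0 x \<noteq> 0"
  using ga_pos[of x] J0_pos[of x] by (auto simp: ga_def J0_def)

lemma NF: "x \<in> A ==> N x \<bullet> F x = 0" "x \<in> A ==> N x \<bullet> pd F v x = 0" "x \<in> A ==> pd N v x \<bullet> F x = 0"
  using dp dual_pair_pd_N[OF dp] by (auto simp: dual_pair_def inner_commute)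

lemma pd_edge_fun: "pd edge_fun v x = 24 * x$1 * v$1 + 2 * v$2"
proof -
  have "(edge_fun has_derivative (\<lambda>v. 24 * x$1 * v$1 + 2 * v$2)) (at x)"
    unfolding edge_fun_def
    by (auto intro!: derivative_eq_intros bounded_linear_imp_has_derivative[OF bounded_linear_vec_nth])
  then show ?thesis by (rule pd_eqI)
qed

text \<open>Off the edge this is clear, and the edge has empty interior.\<close>
lemma N_h: assumes "x \<in> A" shows "N x \<bullet> h x = 0"
proof -
  have off: "N y \<bullet> h y = 0" if "y \<in> A" "edge_fun y \<noteq> 0" for y
    using NF(1)[OF that(1)] NF(2)[OF that(1), of e1] Fa[OF that(1)] that(2) by (auto simp: inner_add_right)
  show ?thesis
  proof (cases "edge_fun x = 0")
    case True
    have c: "smooth_on A (\<lambda>y. N y \<bullet> h y)" by (intro smooth_on_inner A smooth_N h)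
    have "((\<lambda>t. x + t *\<^sub>R e2) \<longlongrightarrow> x + 0 *\<^sub>R e2) (at 0)" by (intro tendsto_intros)
    then have "((\<lambda>t. N (x + t *\<^sub>R e2) \<bullet> h (x + t *\<^sub>R e2)) \<longlongrightarrow> N x \<bullet> h x) (at 0)"
      using isCont_tendsto_compose[OF smooth_on_isCont[OF c assms]] by simp
    moreover have "\<forall>\<^sub>F t in at 0. N (x + t *\<^sub>R e2) \<bullet> h (x + t *\<^sub>R e2) = 0"
    proof -
      have "open ((\<lambda>t. x + t *\<^sub>R e2) -` A)" by (intro open_vimage A continuous_intros)
      then have "\<forall>\<^sub>F t in at 0. x + t *\<^sub>R e2 \<in> A"
        unfolding eventually_at_topological using assms
        by (intro exI[of _ "(\<lambda>t. x + t *\<^sub>R e2) -` A"]) simp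
      moreover have "\<forall>\<^sub>F t in at 0. (t::real) \<noteq> 0" by (simp add: eventually_at_filter)
      ultimately show ?thesis
        by eventually_elim (use True off in \<open>auto simp: edge_fun_def\<close>)
    qed
    ultimately show ?thesis
      by (rule tendsto_unique[OF at_neq_bot _ tendsto_eventually])
  qed (use off assms in auto)
qed

text \<open>The off-diagonal coefficient shows its factor \<open>edge_fun\<close> only when
  \<open>F\<close> is the one differentiated along \<open>e1\<close>; the symmetry of
  \<open>II\<close> arranges this.\<close>

lemma II_edge:
  assumes x: "x \<in> A"
  shows "II F N x e1 e1 = edge_fun x * al x" "II F N x e1 e2 = edge_fun x * be x" "II F N x e2 e2 = ga x"
proof -
  show "II F N x e1 e1 = edge_fun x * al x"
    unfolding II_def Fa[OF x] by (simp add: inner_add_right NF[OF x] al_def)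
  have "II F N x e2 e1 = edge_fun x * be x"
    unfolding II_def Fa[OF x] by (simp add: inner_add_right NF[OF x] be_def)
  then show "II F N x e1 e2 = edge_fun x * be x" using II_sym[OF dp x] by simp
  show "II F N x e2 e2 = ga x" by (simp add: II_def ga_def)
qed

lemma jac_edge: assumes x: "x \<in> A" shows "jac F N x = edge_fun x * J0 x"
  unfolding jac_def Fa[OF x] by (simp add: det4_add det4_scaleR J0_def)

lemma discr_edge: "x \<in> A ==> discr F N x = - edge_fun x * (al x * ga x - edge_fun x * (be x)\<^sup>2)"
  by (simp add: discr_def II_edge power2_eq_square algebra_simps)

text \<open>The second factor of \<open>discr_edge\<close> keeps the sign of
  \<open>al 0 * ga 0\<close>, which is the sign of \<open>q\<close>. So the front changes between
  hyperbolic and elliptic across the edge, and \<open>q\<close> decides on which side is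
  which.\<close>

lemma discr_sign:
  assumes x: "x \<in> A"
  shows "discr F N x > 0 \<longleftrightarrow> edge_fun x * q < 0" "discr F N x = 0 \<longleftrightarrow> edge_fun x = 0"
    "discr F N x < 0 \<longleftrightarrow> edge_fun x * q > 0"
proof -
  have d: "(al x * ga x - edge_fun x * (be x)\<^sup>2) * (al 0 * ga 0) > 0"
    using dd_pos[OF x] by (simp add: al_def ga_def be_def)
  have "al 0 * ga 0 = q * (al 0)\<^sup>2" using al0 by (simp add: q_def power2_eq_square)
  then have "0 < ((al x * ga x - edge_fun x * (be x)\<^sup>2) * q) * (al 0)\<^sup>2" using d by (simp add: mult.assoc)
  then have d: "(al x * ga x - edge_fun x * (be x)\<^sup>2) * q > 0"
    using al0 by (simp add: zero_less_mult_iff)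
  show "discr F N x > 0 \<longleftrightarrow> edge_fun x * q < 0" "discr F N x = 0 \<longleftrightarrow> edge_fun x = 0"
    "discr F N x < 0 \<longleftrightarrow> edge_fun x * q > 0"
    using d unfolding discr_edge[OF x]
    by (auto simp: zero_less_mult_iff mult_less_0_iff)
qed

text \<open>A vector killed by the differential of \<open>N\<close> modulo \<open>N\<close>
  satisfies two linear equations, obtained by pairing with \<open>h\<close> and with
  \<open>pd F e2\<close>. Their determinant is the reduced discriminant, which is nonzero on the
  edge as well.\<close>

lemma jac_N: assumes x: "x \<in> A" shows "jac N F x \<noteq> 0"
proof -
  have "regular_at N x"
    unfolding regular_at_def pd_def[symmetric]
  proof (intro allI impI)
    fix v assume "pd N v x \<in> span {N x}"
    then obtain k where k: "pd N v x = k *\<^sub>R N x" by (auto simp: span_singleton)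
    have v: "pd N v x = v$1 *\<^sub>R pd N e1 x + v$2 *\<^sub>R pd N e2 x" by (rule pd_coords[OF smooth_N x])
    have "pd N v x \<bullet> h x = 0" "pd N v x \<bullet> pd F e2 x = 0"
      unfolding k using N_h[OF x] NF[OF x] by simp_all
    then have e: "v$1 * al x + v$2 * be x = 0" "v$1 * (edge_fun x * be x) + v$2 * ga x = 0"
      unfolding v using II_edge(2,3)[OF x] by (simp_all add: inner_add_left al_def be_def II_def)
    let ?D = "al x * ga x - edge_fun x * (be x)\<^sup>2"
    have D: "?D \<noteq> 0" using dd_pos[OF x] by (auto simp: al_def ga_def be_def)
    have "v$1 * ?D = ga x * (v$1 * al x + v$2 * be x) - be x * (v$1 * (edge_fun x * be x) + v$2 * ga x)"
      "v$2 * ?D = al x * (v$1 * (edge_fun x * be x) + v$2 * ga x) - edge_fun x * be x * (v$1 * al x + v$2 * be x)"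
      by (simp_all add: power2_eq_square algebra_simps)
    then have "v$1 * ?D = 0" "v$2 * ?D = 0" unfolding e by simp_all
    then have "v$1 = 0" "v$2 = 0" using D mult_eq_0_iff by blast+
    then show "v = 0" by (simp add: vec_eq_iff forall_2)
  qed
  then show ?thesis using regular_at_iff_jac[OF dual_pair_sym[OF dp] x] by simp
qed

lemma regular_at_phi:
  assumes "smooth_on U k" "x \<in> A"
  shows "regular_at k (\<phi> x) \<longleftrightarrow> regular_at (\<lambda>x. k (\<phi> x)) x"
proof -
  have l: "linear (\<lambda>v. pd \<phi> v x)" by (rule pd_linear[OF phi(1) assms(2)])
  have b: "bij (\<lambda>v. pd \<phi> v x)" by (rule pd_phi_bij[OF assms(2)])
  show ?thesis
    unfolding regular_at_def pd_def[symmetric] pd_compose_phi[OF assms]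
  proof (intro iffI allI impI)
    fix v assume "\<forall>w. pd k w (\<phi> x) \<in> span {k (\<phi> x)} --> w = 0" "pd k (pd \<phi> v x) (\<phi> x) \<in> span {k (\<phi> x)}"
    then have "pd \<phi> v x = 0" by blast
    then show "v = 0" using linear_injective_0[OF l] bij_is_inj[OF b] by blast
  next
    fix w assume *: "\<forall>v. pd k (pd \<phi> v x) (\<phi> x) \<in> span {k (\<phi> x)} --> v = 0" "pd k w (\<phi> x) \<in> span {k (\<phi> x)}"
    obtain v where "w = pd \<phi> v x" using bij_is_surj[OF b] by (rule surjE)
    then show "w = 0" using * linear_0[OF l] by blast
  qed
qed

lemma regular_f: "x \<in> A ==> regular_at f (\<phi> x) \<longleftrightarrow> edge_fun x \<noteq> 0"
  using regular_at_phi[OF U(2), of x] regular_at_iff_jac[OF dp, of x] jac_edge[of x] J0_nz[of x]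
  by (simp add: F_eq)

lemma regular_n: "x \<in> A ==> regular_at n (\<phi> x)"
  using regular_at_phi[OF U(3), of x] regular_at_iff_jac[OF dual_pair_sym[OF dp], of x] jac_N[of x]
  by (simp add: N_eq)

lemma phi_inj: "inj_on \<phi> A"
  by (metis inj_on_inverseI psi(2))

lemma open_phi_image: assumes "open V" "V \<subseteq> A" shows "open (\<phi> ` V)"
proof -
  have "\<phi> ` V = {y \<in> \<phi> ` A. \<psi> y \<in> V}"
    using assms psi(2) by (auto simp: image_iff subset_iff)
  moreover have "open (\<phi> ` A \<inter> \<psi> -` V)"
    by (rule continuous_open_preimage[OF smooth_on_continuous[OF psi(1)] phi(4) assms(1)])
  ultimately show ?thesis by (simp add: Int_def vimage_def)
qed

lemma line_contact_phi:
  assumes "x \<in> A"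
  shows "line_contact U f (\<phi> x) k l \<longleftrightarrow> line_contact A F x k l"
    and "line_contact U n (\<phi> x) k l \<longleftrightarrow> line_contact A N x k l"
  unfolding F_eq N_eq
  by (rule line_contact_reparam[OF A(1) smooth_on_continuous[OF phi(1)] open_phi_image phi(3) assms]; assumption)+

lemma asymptotic_lines_phi:
  assumes "x \<in> A"
  shows "asymptotic_lines U f (\<phi> x) = asymptotic_lines A F x" "asymptotic_lines U n (\<phi> x) = asymptotic_lines A N x"
  using line_contact_phi[OF assms] by (simp_all add: asymptotic_lines_def)

lemma discr_swap: "x \<in> A ==> discr N F x = discr F N x"
  by (simp add: discr_def II_swap[OF dp])

lemma jac_nz: "x \<in> A ==> edge_fun x \<noteq> 0 ==> jac F N x \<noteq> 0"
  by (simp add: jac_edge J0_nz)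

lemma domains_f:
  assumes x: "x \<in> A"
  shows "\<phi> x \<in> hyperbolic_domain U f \<longleftrightarrow> edge_fun x * q < 0"
    and "\<phi> x \<in> elliptic_domain U f \<longleftrightarrow> edge_fun x * q > 0"
proof -
  have q: "q \<noteq> 0" using al0 ga0 by (simp add: q_def)
  have g: "II F N x e2 e2 \<noteq> 0" using ga_nz[OF x] by (simp add: II_edge[OF x])
  consider "edge_fun x = 0" | "edge_fun x * q < 0" | "edge_fun x * q > 0"
    using q by (metis linorder_neqE_linordered_idom mult_eq_0_iff)
  then have "(\<phi> x \<in> hyperbolic_domain U f \<longleftrightarrow> edge_fun x * q < 0) \<and> (\<phi> x \<in> elliptic_domain U f \<longleftrightarrow> edge_fun x * q > 0)"
  proof cases
    case 1
    then show ?thesis using regular_f[OF x] by (simp add: hyperbolic_domain_def elliptic_domain_def)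
  next
    case 2
    then have e: "edge_fun x \<noteq> 0" and d: "discr F N x > 0" using discr_sign[OF x] by auto
    then have "card (asymptotic_lines A F x) = 2"
      using asymptotic_lines_card(1)[OF dp x jac_nz[OF x e] g d] by simp
    then show ?thesis
      using 2 e regular_f[OF x] phi_in_U[OF x]
      by (auto simp: hyperbolic_domain_def elliptic_domain_def asymptotic_lines_phi[OF x])
  next
    case 3
    then have e: "edge_fun x \<noteq> 0" and d: "discr F N x < 0" using discr_sign[OF x] by auto
    then have "asymptotic_lines A F x = {}"
      using asymptotic_lines_card(3)[OF dp x jac_nz[OF x e] g d] by simp
    then show ?thesis
      using 3 e regular_f[OF x] phi_in_U[OF x]
      by (auto simp: hyperbolic_domain_def elliptic_domain_def asymptotic_lines_phi[OF x])
  qed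
  then show "\<phi> x \<in> hyperbolic_domain U f \<longleftrightarrow> edge_fun x * q < 0"
    "\<phi> x \<in> elliptic_domain U f \<longleftrightarrow> edge_fun x * q > 0" by auto
qed

lemma q_nz: "q \<noteq> 0" using al0 ga0 by (simp add: q_def)

text \<open>The discriminant is the same for both surfaces, but the dual one is immersed on the edge
  too, so that there a vanishing discriminant makes its points parabolic.\<close>

lemma domains_n:
  assumes x: "x \<in> A"
  shows "\<phi> x \<in> hyperbolic_domain U n \<longleftrightarrow> edge_fun x * q < 0"
    and "\<phi> x \<in> parabolic_curve U n \<longleftrightarrow> edge_fun x = 0"
proof -
  have g: "II N F x e2 e2 \<noteq> 0" using ga_nz[OF x] by (simp add: II_edge[OF x] II_swap[OF dp x])
  note c = asymptotic_lines_card[OF dual_pair_sym[OF dp] x jac_N[OF x] g, unfolded discr_swap[OF x]]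
  have "card (asymptotic_lines A N x) = 0" if "discr F N x < 0" using c(3)[OF that] by simp
  then show "\<phi> x \<in> hyperbolic_domain U n \<longleftrightarrow> edge_fun x * q < 0"
    "\<phi> x \<in> parabolic_curve U n \<longleftrightarrow> edge_fun x = 0"
    using c(1,2) regular_n[OF x] phi_in_U[OF x] discr_sign[OF x] q_nz
    by (auto simp: hyperbolic_domain_def parabolic_curve_def asymptotic_lines_phi[OF x])
qed

lemma cuspidal_edge_phi: "x \<in> A ==> \<phi> x \<in> cuspidal_edge U f \<longleftrightarrow> edge_fun x = 0"
  unfolding edge using regular_f phi_in_U by auto

subsection \<open>The flecnodal equations\<close>

text \<open>Coefficients of the cubic polynomial in \<open>p\<close> that \<open>III\<close> becomes
  on the direction of slope \<open>p\<close>, see \<open>III_G2\<close>.\<close>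

definition "c0 x = pd (pd N e1) e1 x \<bullet> pd F e1 x - pd N e1 x \<bullet> pd (pd F e1) e1 x"
definition "c1 x = 2 * (pd (pd N e1) e2 x \<bullet> pd F e1 x) + pd (pd N e1) e1 x \<bullet> pd F e2 x
   - 2 * (pd N e1 x \<bullet> pd (pd F e1) e2 x) - pd N e2 x \<bullet> pd (pd F e1) e1 x"
definition "c2 x = pd (pd N e2) e2 x \<bullet> pd F e1 x + 2 * (pd (pd N e1) e2 x \<bullet> pd F e2 x)
   - pd N e1 x \<bullet> pd (pd F e2) e2 x - 2 * (pd N e2 x \<bullet> pd (pd F e1) e2 x)"
definition "c3 x = pd (pd N e2) e2 x \<bullet> pd F e2 x - pd N e2 x \<bullet> pd (pd F e2) e2 x"

text \<open>\<open>II\<close> and \<open>III\<close> on the direction of slope \<open>p\<close>.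
  Unlike contact with lines of the front, these make sense on the edge.\<close>

definition "G1 x p = edge_fun x * (al x + 2 * be x * p) + ga x * p\<^sup>2"
definition "G2 x p = c0 x + c1 x * p + c2 x * p\<^sup>2 + c3 x * p ^ 3"

lemma pd2_slope:
  fixes M :: "real^2 => real^4"
  assumes M: "smooth_on A M" and x: "x \<in> A"
  shows "pd (pd M (vector [1, p])) (vector [1, p]) x =
    pd (pd M e1) e1 x + (2 * p) *\<^sub>R pd (pd M e1) e2 x + p\<^sup>2 *\<^sub>R pd (pd M e2) e2 x"
proof -
  have "pd (pd M (vector [1, p])) v x = pd (\<lambda>y. pd M e1 y + p *\<^sub>R pd M e2 y) v x" for v
    using pd_coords[OF M, of _ "vector [1, p]"] by (intro pd_cong[OF A(1) x] smooth_on_pd M) simp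
  also have "\<dots> v = pd (pd M e1) v x + p *\<^sub>R pd (pd M e2) v x" for v
    using pd_add[OF smooth_on_pd[OF M] smooth_on_bounded_linear[OF A(1) bounded_linear_scaleR_right smooth_on_pd[OF M]] x]
      pd_bounded_linear[OF smooth_on_pd[OF M] x bounded_linear_scaleR_right] by simp
  finally have "pd (pd M (vector [1, p])) (vector [1, p]) x = pd (pd M e1) (vector [1, p]) x + p *\<^sub>R pd (pd M e2) (vector [1, p]) x" .
  moreover have "pd (pd M e1) (vector [1, p]) x = pd (pd M e1) e1 x + p *\<^sub>R pd (pd M e1) e2 x"
    "pd (pd M e2) (vector [1, p]) x = pd (pd M e1) e2 x + p *\<^sub>R pd (pd M e2) e2 x"
    using pd_coords[OF smooth_on_pd[OF M] x, of _ "vector [1, p]"] pd_commute[OF A(1) M x, of e2 e1] by simp_all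
  ultimately show ?thesis by (simp add: vec_eq_iff algebra_simps power2_eq_square)
qed

lemma II_G1: "x \<in> A ==> II F N x (vector [1, p]) (vector [1, p]) = G1 x p"
  using II_slope[OF dp, of x p] II_edge[of x] by (simp add: G1_def algebra_simps)

lemma III_G2:
  assumes x: "x \<in> A" shows "III F N x (vector [1, p]) = G2 x p"
  unfolding III_def pd2_slope[OF smooth_N x, of p] pd2_slope[OF smooth_F x, of p]
    pd_coords[OF smooth_N x, of "vector [1, p]"] pd_coords[OF smooth_F x, of "vector [1, p]"]
  by (simp add: G2_def c0_def c1_def c2_def c3_def inner_add_left inner_add_right algebra_simps
      power2_eq_square power3_eq_cube)

lemma smooth_c: "smooth_on A c0" "smooth_on A c1" "smooth_on A c2" "smooth_on A c3"
  unfolding c0_def c1_def c2_def c3_def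
  by (intro smooth_on_diff smooth_on_add smooth_on_mult smooth_on_const smooth_on_inner smooth_on_pd A smooth_N smooth_F)+

lemma Fa_pd:
  assumes x: "x \<in> A"
  shows "pd (pd F e1) v x = edge_fun x *\<^sub>R pd h v x + pd edge_fun v x *\<^sub>R h x + (\<mu> x *\<^sub>R pd F v x + pd \<mu> v x *\<^sub>R F x)"
proof -
  have se: "smooth_on A edge_fun" by (rule smooth_edge_fun[OF A(1)])
  have "pd (pd F e1) v x = pd (\<lambda>y. edge_fun y *\<^sub>R h y + \<mu> y *\<^sub>R F y) v x"
    by (intro pd_cong[OF A(1) x] smooth_on_pd smooth_F Fa)
  also have "\<dots> = pd (\<lambda>y. edge_fun y *\<^sub>R h y) v x + pd (\<lambda>y. \<mu> y *\<^sub>R F y) v x"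
    by (intro pd_add[OF _ _ x] smooth_on_scaleR A se h mu smooth_F)
  finally show ?thesis
    unfolding pd_scaleR[OF se h x] pd_scaleR[OF mu smooth_F x] .
qed

text \<open>Both products defining \<open>c0\<close> carry the factor \<open>edge_fun\<close>,
  except for the term in which this factor is itself differentiated along \<open>e1\<close>; its
  derivative is \<open>24 * x$1\<close>.\<close>

lemma c0_eq:
  assumes x: "x \<in> A"
  shows "c0 x = - 24 * x$1 * al x + edge_fun x * (pd (pd N e1) e1 x \<bullet> h x - 2 * \<mu> x * al x - pd N e1 x \<bullet> pd h e1 x)"
proof -
  have 1: "pd (pd N e1) e1 x \<bullet> F x = - (edge_fun x * al x)"
    using dual_pair_second[OF dual_pair_sym[OF dp] x, of e1 e1] II_edge(1)[OF x]
    by (simp add: II_def inner_commute)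
  have 2: "pd N e1 x \<bullet> pd F e1 x = edge_fun x * al x" using II_edge(1)[OF x] by (simp add: II_def)
  have "pd (pd N e1) e1 x \<bullet> pd F e1 x = edge_fun x * (pd (pd N e1) e1 x \<bullet> h x) - \<mu> x * (edge_fun x * al x)"
    unfolding Fa[OF x] by (simp add: inner_add_right 1)
  moreover have "pd N e1 x \<bullet> pd (pd F e1) e1 x = edge_fun x * (pd N e1 x \<bullet> pd h e1 x) + 24 * x$1 * al x + \<mu> x * (edge_fun x * al x)"
    unfolding Fa_pd[OF x] by (simp add: inner_add_right 2 NF[OF x] pd_edge_fun al_def)
  ultimately show ?thesis by (simp add: c0_def algebra_simps)
qed

lemma edge_fun_0 [simp]: "edge_fun 0 = 0"
  by (simp add: edge_fun_def)

lemma c0_0: "c0 0 = 0"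
  by (simp add: c0_eq[OF A(2)])

lemma pd_c0_0: "pd c0 e1 0 = - 24 * al 0"
proof -
  define R where "R x = pd (pd N e1) e1 x \<bullet> h x - 2 * \<mu> x * al x - pd N e1 x \<bullet> pd h e1 x" for x
  have R: "smooth_on A R" unfolding R_def
    by (intro smooth_on_diff smooth_on_mult smooth_on_const smooth_on_inner smooth_on_pd A smooth_N h mu smooth_abg)
  have l: "((\<lambda>x::real^2. x$1) has_derivative (\<lambda>u. u$1)) (at 0)"
    by (rule bounded_linear_imp_has_derivative[OF bounded_linear_vec_nth])
  have "pd c0 e1 0 = pd (\<lambda>x. - 24 * x$1 * al x + edge_fun x * R x) e1 0"
    by (rule pd_cong[OF A smooth_c(1)]) (simp add: c0_eq R_def)
  also have "\<dots> = - 24 * al 0"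
    by (subst pd_eqI[OF has_derivative_add[OF has_derivative_mult[OF has_derivative_mult_right[OF l]
        smooth_on_has_derivative[OF smooth_abg(1) A(2)]]
        has_derivative_mult[OF smooth_on_has_derivative[OF smooth_edge_fun[OF A(1)] A(2)]
        smooth_on_has_derivative[OF R A(2)]]]]) (simp add: pd_edge_fun)
  finally show ?thesis .
qed

text \<open>The mixed second derivative of \<open>F\<close> contributes \<open>- 4 * al 0\<close>
  and the term with \<open>pd (pd N e1) e1\<close> the remaining \<open>- 2 * al 0\<close>; the
  other two terms vanish at 0.\<close>

lemma c1_0: "c1 0 = - 6 * al 0"
proof -
  note x = A(2)
  have Fa0: "pd F e1 0 = \<mu> 0 *\<^sub>R F 0" using Fa[OF x] by simp
  have 1: "pd N e1 0 \<bullet> pd F e2 0 = 0" "pd N e2 0 \<bullet> pd F e1 0 = 0" "pd N e1 0 \<bullet> pd F e1 0 = 0"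
    using II_edge[OF x] II_sym[OF dp x, of e1 e2] by (simp_all add: II_def)
  have Fab: "pd (pd F e1) e2 0 = 2 *\<^sub>R h 0 + (\<mu> 0 *\<^sub>R pd F e2 0 + pd \<mu> e2 0 *\<^sub>R F 0)"
    unfolding Fa_pd[OF x] by (simp add: pd_edge_fun)
  have 2: "pd N e1 0 \<bullet> pd (pd F e1) e2 0 = 2 * al 0"
    unfolding Fab by (simp add: inner_add_right 1 NF[OF x] al_def)
  have 3: "pd N e2 0 \<bullet> pd (pd F e1) e1 0 = 0"
    unfolding Fa_pd[OF x] by (simp add: pd_edge_fun inner_add_right 1 NF[OF x])
  have 4: "pd (pd N e1) e2 0 \<bullet> pd F e1 0 = 0"
    unfolding Fa0 using dual_pair_second[OF dual_pair_sym[OF dp] x, of e1 e2] 1 by (simp add: inner_commute)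
  text \<open>Differentiate the vanishing of the off-diagonal coefficient \<open>edge_fun * be\<close> along the edge.\<close>
  have 5: "pd (pd N e1) e1 0 \<bullet> pd F e2 0 = - (pd N e1 0 \<bullet> pd (pd F e2) e1 0)"
  proof -
    have "pd (\<lambda>y. pd N e1 y \<bullet> pd F e2 y) e1 0 = pd (\<lambda>y. edge_fun y * be y) e1 0"
      by (intro pd_cong[OF A] smooth_on_inner smooth_on_pd A smooth_N smooth_F) (use II_edge(2) in \<open>simp add: II_def\<close>)
    also have "\<dots> = 0"
      using pd_bilinear[OF smooth_edge_fun[OF A(1)] smooth_abg(2) A(2) bounded_bilinear_mult, of e1] by (simp add: pd_edge_fun)
    finally show ?thesis
      using pd_inner[OF smooth_on_pd[OF smooth_N] smooth_on_pd[OF smooth_F] A(2), of e1 e2 e1] by simp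
  qed
  have "pd (pd F e2) e1 0 = pd (pd F e1) e2 0" by (rule pd_commute[OF A(1) smooth_F A(2)])
  then show ?thesis unfolding c1_def 3 4 5 using 2 by simp
qed

end

lemma vd2_square_zero:
  fixes a b :: "real => real"
  assumes T: "open T" and a: "smooth_on T a" and b: "smooth_on T b" and t: "t \<in> T" and b0: "b t = 0"
  shows "vd 1 (\<lambda>t. a t * (b t * b t)) t = 0"
    and "vd 2 (\<lambda>t. a t * (b t * b t)) t = 2 * a t * (vd 1 b t)\<^sup>2"
proof -
  have bb: "smooth_on T (\<lambda>t. b t * b t)" by (intro smooth_on_mult T b)
  show "vd 1 (\<lambda>t. a t * (b t * b t)) t = 0"
    unfolding vd1_mult[OF T a bb t] vd1_mult[OF T b b t] by (simp add: b0)
  show "vd 2 (\<lambda>t. a t * (b t * b t)) t = 2 * a t * (vd 1 b t)\<^sup>2"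
    unfolding vd2_mult[OF T a bb t] vd2_mult[OF T b b t] vd1_mult[OF T b b t]
    by (simp add: b0 power2_eq_square)
qed

section \<open>The flecnodal curve by the inverse function theorem\<close>

context swallowtail_chart
begin

definition base_point :: "real^3 => real^2" where "base_point z = vector [z$1, z$2]"
text \<open>Completes the two flecnodal equations by the coordinate x1 to a map of 3-space. The
  flecnodal points with their slopes are the preimage of the first axis.\<close>

definition Phi :: "real^3 => real^3" where
  "Phi z = vector [z$1, G1 (base_point z) (z$3), G2 (base_point z) (z$3)]"
definition D3 :: "(real^3) set" where "D3 = base_point -` A"

lemma base_point_linear: "bounded_linear base_point"
  unfolding base_point_def by (rule bounded_linear_vector2)

lemma open_D3: "open D3"
  unfolding D3_def by (intro open_vimage A linear_continuous_on[OF base_point_linear])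

lemma smooth_base:
  assumes "smooth_on A k" shows "smooth_on D3 (\<lambda>z. k (base_point z))"
  by (rule smooth_on_compose[OF open_D3 A(1) _ smooth_on_linear[OF open_D3 base_point_linear] assms])
     (simp add: D3_def)

lemma smooth_Phi: "smooth_on D3 Phi"
proof -
  have e: "smooth_on A edge_fun" by (rule smooth_edge_fun[OF A(1)])
  have n: "smooth_on D3 (\<lambda>z. z$i)" for i by (intro smooth_on_nth smooth_on_ident open_D3)
  show ?thesis
    unfolding Phi_def G1_def G2_def
    by (intro smooth_on_vector3 smooth_on_add smooth_on_mult smooth_on_power smooth_on_const n open_D3
        smooth_base e smooth_abg smooth_c)
qed

lemma base_point_0 [simp]: "base_point 0 = 0"
  by (simp add: base_point_def vec_eq_iff forall_2)

lemma base_point_nth: "base_point z $ 1 = z $ 1" "base_point z $ 2 = z $ 2"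
  by (simp_all add: base_point_def)

lemma D3_0: "0 \<in> D3" by (simp add: D3_def A)

lemma has_derivative_base:
  assumes "smooth_on A k"
  shows "((\<lambda>z. k (base_point z)) has_derivative (\<lambda>u. pd k (base_point u) 0)) (at 0)"
  using has_derivative_compose[OF bounded_linear_imp_has_derivative[OF base_point_linear], of k "\<lambda>v. pd k v 0" 0 UNIV]
    smooth_on_has_derivative[OF assms A(2)] by simp

lemma pd_Phi_0:
  "pd Phi u 0 = vector [u$1, 2 * al 0 * u$2, pd c0 (base_point u) 0 - 6 * al 0 * u$3]"
proof -
  have i: "pd Phi u 0 $ i = pd (\<lambda>z. Phi z $ i) u 0" for i
    by (rule pd_bounded_linear[OF smooth_Phi D3_0 bounded_linear_vec_nth, symmetric])
  have l: "((\<lambda>z::real^3. z$i) has_derivative (\<lambda>u. u$i)) (at 0)" for i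
    by (rule bounded_linear_imp_has_derivative[OF bounded_linear_vec_nth])
  note b = has_derivative_base[OF smooth_edge_fun[OF A(1)]] has_derivative_base[OF smooth_abg(1)]
    has_derivative_base[OF smooth_abg(2)] has_derivative_base[OF smooth_abg(3)]
    has_derivative_base[OF smooth_c(1)] has_derivative_base[OF smooth_c(2)]
    has_derivative_base[OF smooth_c(3)] has_derivative_base[OF smooth_c(4)]
  have 1: "pd (\<lambda>z. Phi z $ 1) u 0 = u$1"
    unfolding Phi_def by (simp add: pd_eqI[OF l])
  have "((\<lambda>z. Phi z $ 2) has_derivative (\<lambda>u. 2 * al 0 * u$2)) (at 0)"
    unfolding Phi_def G1_def vector_3 power2_eq_square
    by (rule has_derivative_eq_rhs, (rule has_derivative_add has_derivative_mult has_derivative_const b l)+)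
       (simp add: fun_eq_iff pd_edge_fun base_point_nth)
  then have 2: "pd (\<lambda>z. Phi z $ 2) u 0 = 2 * al 0 * u$2" by (rule pd_eqI)
  have "((\<lambda>z. Phi z $ 3) has_derivative (\<lambda>u. pd c0 (base_point u) 0 - 6 * al 0 * u$3)) (at 0)"
    unfolding Phi_def G2_def vector_3 power2_eq_square power3_eq_cube
    by (rule has_derivative_eq_rhs, (rule has_derivative_add has_derivative_mult has_derivative_const b l)+)
       (simp add: fun_eq_iff c1_0)
  then have 3: "pd (\<lambda>z. Phi z $ 3) u 0 = pd c0 (base_point u) 0 - 6 * al 0 * u$3" by (rule pd_eqI)
  show ?thesis using i 1 2 3 by (simp add: vec_eq_iff forall_3)
qed

text \<open>The differential is triangular with diagonal 1, \<open>2 * al 0\<close>,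
  \<open>- 6 * al 0\<close>, because at the swallowtail the slope enters \<open>G1\<close> to second
  order only.\<close>

lemma bij_pd_Phi_0: "bij (\<lambda>u. pd Phi u 0)"
proof -
  have l: "linear (\<lambda>u. pd Phi u 0)" by (rule pd_linear[OF smooth_Phi D3_0])
  have "inj (\<lambda>u. pd Phi u 0)"
    unfolding linear_injective_0[OF l]
  proof (intro allI impI)
    fix u assume "pd Phi u 0 = 0"
    then have *: "u$1 = 0" "2 * al 0 * u$2 = 0" "pd c0 (base_point u) 0 - 6 * al 0 * u$3 = 0"
      by (simp_all add: pd_Phi_0 vec_eq_iff forall_3)
    then have "base_point u = 0" using al0 by (simp add: base_point_def vec_eq_iff forall_2)
    then have "u$3 = 0" using *(3) al0 linear_0[OF pd_linear[OF smooth_c(1) A(2)]] by simp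
    then show "u = 0" using * al0 by (simp add: vec_eq_iff forall_3)
  qed
  then show ?thesis by (simp add: bij_def linear_injective_imp_surjective[OF l])
qed

text \<open>The inverse function theorem controls small slopes, whereas flecnodal points have to be
  located for every slope. Both roots of \<open>G1\<close> tend to 0 at the swallowtail, so near it
  every root is small.\<close>

lemma slope_small:
  assumes "e > 0"
  obtains r where "r > 0" "\<And>a b. \<bar>a\<bar> < r ==> \<bar>b\<bar> < r ==> vector [a, b] \<in> A"
    "\<And>a b p. \<bar>a\<bar> < r ==> \<bar>b\<bar> < r ==> G1 (vector [a, b]) p = 0 ==> \<bar>p\<bar> < e"
proof -
  \<comment> \<open>A bound for the modulus of both roots, read off from the quadratic formula; it
    is continuous and vanishes at 0.\<close>
  define B where "B x = (\<bar>edge_fun x * be x\<bar> + sqrt \<bar>discr F N x\<bar>) / \<bar>ga x\<bar>" for x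
  have se: "smooth_on A edge_fun" by (rule smooth_edge_fun[OF A(1)])
  have sd: "continuous_on A (discr F N)"
    unfolding discr_def II_def
    by (intro smooth_on_continuous smooth_on_diff smooth_on_power smooth_on_mult smooth_on_inner smooth_on_pd smooth_F smooth_N A)
  have cB: "continuous_on A B"
    unfolding B_def using ga_nz
    by (intro continuous_intros smooth_on_continuous[OF se] smooth_on_continuous[OF smooth_abg(2)]
        smooth_on_continuous[OF smooth_abg(3)] sd) auto
  have "open {x\<in>A. B x < e}"
    using continuous_open_preimage[OF cB A(1) open_lessThan[of e]] by (simp add: vimage_def Int_def)
  moreover have "0 \<in> {x\<in>A. B x < e}"
    using A(2) assms by (simp add: B_def discr_edge)
  ultimately obtain r0 where r0: "r0 > 0" "ball 0 r0 \<subseteq> {x\<in>A. B x < e}" using openE by blast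
  have near: "vector [a, b] \<in> A \<and> B (vector [a, b]) < e" if "\<bar>a\<bar> < r0 / 2" "\<bar>b\<bar> < r0 / 2" for a b
  proof -
    have "norm (vector [a, b] :: real^2) \<le> \<bar>a\<bar> + \<bar>b\<bar>"
      using norm_le_l1_cart[of "vector [a, b] :: real^2"] by (simp add: sum_2)
    then show ?thesis using r0 that by (auto simp: subset_iff)
  qed
  show ?thesis
  proof (rule that[of "r0 / 2"])
    fix a b p assume ab: "\<bar>a\<bar> < r0 / 2" "\<bar>b\<bar> < r0 / 2" and p: "G1 (vector [a, b]) p = 0"
    let ?x = "vector [a, b] :: real^2"
    have x: "?x \<in> A" "B ?x < e" using near[OF ab] by auto
    have "(ga ?x * p + edge_fun ?x * be ?x)\<^sup>2 = ga ?x * G1 ?x p + discr F N ?x"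
      unfolding discr_edge[OF x(1)] G1_def by (simp add: power2_eq_square algebra_simps)
    then have "(ga ?x * p + edge_fun ?x * be ?x)\<^sup>2 = discr F N ?x" using p by simp
    then have "\<bar>ga ?x * p + edge_fun ?x * be ?x\<bar> \<le> sqrt \<bar>discr F N ?x\<bar>"
      by (metis abs_ge_self real_le_rsqrt power2_abs)
    then have "\<bar>ga ?x\<bar> * \<bar>p\<bar> \<le> \<bar>edge_fun ?x * be ?x\<bar> + sqrt \<bar>discr F N ?x\<bar>"
      unfolding abs_mult[symmetric] by linarith
    then have "\<bar>p\<bar> \<le> B ?x"
      unfolding B_def using ga_nz[OF x(1)] by (simp add: field_simps)
    then show "\<bar>p\<bar> < e" using x by simp
  qed (use r0 near in auto)
qed

text \<open>\<open>bt\<close> and \<pi> are the last two coordinates of the inverse of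
  \<open>Phi\<close> on the first axis. Their jets come from differentiating the equations along the
  curve: \<open>G1\<close> once, \<open>G2\<close> once, then \<open>G1\<close> twice.\<close>

lemma flecnodal_functions:
  obtains r bt \<pi> where "r > 0"
    "\<And>a b. \<bar>a\<bar> < r ==> \<bar>b\<bar> < r ==> vector [a, b] \<in> A"
    "smooth_on {-r<..<r} bt" "smooth_on {-r<..<r} \<pi>" "bt 0 = 0" "\<pi> 0 = 0"
    "\<And>a. \<bar>a\<bar> < r ==> vector [a, bt a] \<in> A \<and> G1 (vector [a, bt a]) (\<pi> a) = 0 \<and> G2 (vector [a, bt a]) (\<pi> a) = 0"
    "\<And>a b p. \<bar>a\<bar> < r ==> \<bar>b\<bar> < r ==> G1 (vector [a, b]) p = 0 ==> G2 (vector [a, b]) p = 0 ==>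
       b = bt a \<and> p = \<pi> a"
    "\<And>a. \<bar>a\<bar> < r ==> inj (\<lambda>u. pd Phi u (vector [a, bt a, \<pi> a]))"
    "vd 1 bt 0 = 0" "vd 2 bt 0 = - 12 - 16 * q" "vd 1 \<pi> 0 = - 4"
proof -
  obtain U' V' g where
    U': "open U'" "U' \<subseteq> D3" "0 \<in> U'" and V': "open V'" "Phi ` U' = V'" "g ` V' = U'" and g: "smooth_on V' g"
    and gP: "\<And>z. z \<in> U' ==> g (Phi z) = z" and Pg: "\<And>y. y \<in> V' ==> Phi (g y) = y"
    and bij: "\<And>z. z \<in> U' ==> bij (\<lambda>u. pd Phi u z)"
    by (rule smooth_inverse_function[OF open_D3 smooth_Phi D3_0 bij_pd_Phi_0], rule that)
  obtain e where e: "e > 0" "ball 0 e \<subseteq> U'" using U' openE by blast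
  define r0 where "r0 = e / 3"
  have box: "z \<in> U'" if "\<bar>z$1\<bar> < r0" "\<bar>z$2\<bar> < r0" "\<bar>z$3\<bar> < r0" for z
  proof -
    have "norm z \<le> \<bar>z$1\<bar> + \<bar>z$2\<bar> + \<bar>z$3\<bar>" using norm_le_l1_cart[of z] by (simp add: sum_3)
    then show ?thesis using that e by (auto simp: r0_def subset_iff)
  qed
  have r0: "r0 > 0" using e by (simp add: r0_def)
  define k where "k a = (vector [a, 0, 0] :: real^3)" for a :: real
  have ka: "k a = a *\<^sub>R vector [1, 0, 0]" for a by (simp add: k_def vec_eq_iff forall_3)
  have k0: "k 0 = 0" by (simp add: ka)
  have P0: "Phi 0 = 0" by (simp add: Phi_def G1_def G2_def c0_0 vec_eq_iff forall_3)
  have "open (k -` V')" unfolding ka by (intro open_vimage V' continuous_intros)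
  moreover have "0 \<in> k -` V'" using U' V' P0 k0 by (metis image_eqI vimageI)
  ultimately obtain r1 where r1: "r1 > 0" "ball 0 r1 \<subseteq> k -` V'" using openE by blast
  obtain r2 where r2: "r2 > 0" "\<And>a b. \<bar>a\<bar> < r2 ==> \<bar>b\<bar> < r2 ==> vector [a, b] \<in> A"
    "\<And>a b p. \<bar>a\<bar> < r2 ==> \<bar>b\<bar> < r2 ==> G1 (vector [a, b]) p = 0 ==> \<bar>p\<bar> < r0"
    using slope_small[OF r0] by blast
  define r where "r = min r0 (min r1 r2)"
  have r: "r > 0" using r0 r1 r2 by (simp add: r_def)
  define T where "T = {-r<..<r}"
  have T: "open T" "0 \<in> T" using r by (auto simp: T_def)
  have kV: "k a \<in> V'" if "a \<in> T" for a
    using r1(2) that by (auto simp: T_def r_def subset_iff)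
  define G where "G a = g (k a)" for a
  have sG: "smooth_on T G"
    unfolding G_def using kV
    by (intro smooth_on_compose[OF T(1) V'(1) _ _ g]) (auto simp: ka intro!: smooth_on_scaleR smooth_on_const smooth_on_ident T)
  define bt where "bt a = G a $ 2" for a
  define \<pi> where "\<pi> a = G a $ 3" for a
  have GU: "G a \<in> U'" if "a \<in> T" for a using V'(3) kV[OF that] by (auto simp: G_def)
  have PG: "Phi (G a) = k a" if "a \<in> T" for a unfolding G_def by (rule Pg[OF kV[OF that]])
  have G1: "G a $ 1 = a" if "a \<in> T" for a
    using arg_cong[OF PG[OF that], of "\<lambda>z. z$1"] by (simp add: Phi_def k_def)
  have Gv: "G a = vector [a, bt a, \<pi> a]" if "a \<in> T" for a
    using G1[OF that] by (simp add: vec_eq_iff forall_3 bt_def \<pi>_def)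
  have bG: "base_point (G a) = vector [a, bt a]" if "a \<in> T" for a
    using G1[OF that] by (simp add: base_point_def bt_def)
  have A': "vector [a, bt a] \<in> A" if "a \<in> T" for a
    using GU[OF that] U'(2) bG[OF that] by (auto simp: D3_def)
  have Geq: "G1 (vector [a, bt a]) (\<pi> a) = 0 \<and> G2 (vector [a, bt a]) (\<pi> a) = 0" if "a \<in> T" for a
    using PG[OF that] bG[OF that] by (simp add: Phi_def k_def vec_eq_iff forall_3 \<pi>_def)
  have G0: "G 0 = 0" unfolding G_def k0 using gP[OF U'(3)] P0 by simp
  have sb: "smooth_on T bt" and sp: "smooth_on T \<pi>"
    unfolding bt_def \<pi>_def by (intro smooth_on_nth T sG)+
  have bp0: "bt 0 = 0" "\<pi> 0 = 0" by (simp_all add: bt_def \<pi>_def G0)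
  have uniq: "b = bt a \<and> p = \<pi> a"
    if "\<bar>a\<bar> < r" "\<bar>b\<bar> < r" "G1 (vector [a, b]) p = 0" "G2 (vector [a, b]) p = 0" for a b p
  proof -
    have "\<bar>p\<bar> < r0" using r2(3)[of a b p] that by (simp add: r_def)
    then have "vector [a, b, p] \<in> U'" using box[of "vector [a, b, p]"] that by (simp add: r_def)
    moreover have "Phi (vector [a, b, p]) = k a"
      using that by (simp add: Phi_def base_point_def k_def)
    ultimately have "vector [a, b, p] = G a" using gP by (metis G_def)
    then have "G a $ 2 = b" "G a $ 3 = p" by (metis vector_3)+
    then show ?thesis by (simp add: bt_def \<pi>_def)
  qed
  define \<gamma> where "\<gamma> a = (vector [a, bt a] :: real^2)" for a
  have s\<gamma>: "smooth_on T \<gamma>" unfolding \<gamma>_def by (intro smooth_on_vector2 smooth_on_ident sb T)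
  have \<gamma>A: "\<gamma> a \<in> A" if "a \<in> T" for a using A'[OF that] by (simp add: \<gamma>_def)
  have sk: "smooth_on T (\<lambda>a. k (\<gamma> a))" if "smooth_on A k" for k :: "real^2 => real"
    by (rule smooth_on_compose[OF T(1) A(1) \<gamma>A s\<gamma> that])
  have \<gamma>0: "\<gamma> 0 = 0" by (simp add: \<gamma>_def bp0 vec_eq_iff forall_2)
  have d\<gamma>: "(\<gamma> has_vector_derivative vector [1, vd 1 bt 0]) (at 0)"
  proof -
    have "((\<lambda>a. a *\<^sub>R e1 + bt a *\<^sub>R e2) has_vector_derivative (1 *\<^sub>R e1 + vd 1 bt 0 *\<^sub>R e2)) (at 0)"
      using has_vector_derivative_smooth[OF T(1) sb T(2)]
      by (intro has_vector_derivative_add bounded_linear.has_vector_derivative[OF bounded_linear_scaleR_left])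
         (auto intro!: derivative_eq_intros simp flip: real_derivative_iff)
    moreover have "(\<lambda>a. a *\<^sub>R e1 + bt a *\<^sub>R e2) = \<gamma>" "1 *\<^sub>R e1 + vd 1 bt 0 *\<^sub>R e2 = vector [1, vd 1 bt 0]"
      by (simp_all add: \<gamma>_def fun_eq_iff vec_eq_iff forall_2)
    ultimately show ?thesis by simp
  qed
  \<comment> \<open>Along the curve \<open>G1 = 0\<close> reads E P + ga \<pi>^2 = 0 with E and
    \<pi> vanishing at 0. Hence E'(0) = 0, and the second derivative leaves E''(0) al + 2 ga
    \<pi>'(0)^2 = 0.\<close>
  define E where "E a = 12 * (a * a) + 2 * bt a" for a
  define P where "P a = al (\<gamma> a) + 2 * be (\<gamma> a) * \<pi> a" for a
  have sE: "smooth_on T E" and sP: "smooth_on T P"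
    unfolding E_def P_def
    by (intro smooth_on_add smooth_on_mult smooth_on_const smooth_on_ident sb sp sk smooth_abg T)+
  have E0: "E 0 = 0" and P0: "P 0 = al 0" by (simp_all add: E_def P_def bp0 \<gamma>0)
  have eq1: "E a * P a + ga (\<gamma> a) * (\<pi> a * \<pi> a) = 0" if "a \<in> T" for a
    using Geq[OF that] by (simp add: G1_def E_def P_def \<gamma>_def edge_fun_def power2_eq_square)
  note sga = sk[OF smooth_abg(3)]
  have s1: "smooth_on T (\<lambda>a. E a * P a)" and s2: "smooth_on T (\<lambda>a. ga (\<gamma> a) * (\<pi> a * \<pi> a))"
    by (intro smooth_on_mult T sE sP sga sp)+
  have add1: "vd 1 (\<lambda>a. E a * P a + ga (\<gamma> a) * (\<pi> a * \<pi> a)) t = vd 1 (\<lambda>a. E a * P a) t + vd 1 (\<lambda>a. ga (\<gamma> a) * (\<pi> a * \<pi> a)) t"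
    if "t \<in> T" for t
    by (rule vd_1I[OF has_vector_derivative_add[OF has_vector_derivative_smooth[OF T(1) s1 that] has_vector_derivative_smooth[OF T(1) s2 that]]])
  have add2: "vd 2 (\<lambda>a. E a * P a + ga (\<gamma> a) * (\<pi> a * \<pi> a)) 0 = vd 2 (\<lambda>a. E a * P a) 0 + vd 2 (\<lambda>a. ga (\<gamma> a) * (\<pi> a * \<pi> a)) 0"
  proof -
    have "vd 2 (\<lambda>a. E a * P a + ga (\<gamma> a) * (\<pi> a * \<pi> a)) 0 = vd 1 (\<lambda>t. vd 1 (\<lambda>a. E a * P a) t + vd 1 (\<lambda>a. ga (\<gamma> a) * (\<pi> a * \<pi> a)) t) 0"
      using vd_SucI[OF T, of _ "\<lambda>t. vd 1 (\<lambda>a. E a * P a) t + vd 1 (\<lambda>a. ga (\<gamma> a) * (\<pi> a * \<pi> a)) t" 1]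
        has_vector_derivative_add[OF has_vector_derivative_smooth[OF T(1) s1] has_vector_derivative_smooth[OF T(1) s2]]
      by (simp add: numeral_2_eq_2)
    also have "\<dots> = vd (Suc 1) (\<lambda>a. E a * P a) 0 + vd (Suc 1) (\<lambda>a. ga (\<gamma> a) * (\<pi> a * \<pi> a)) 0"
      by (rule vd_1I[OF has_vector_derivative_add[OF has_vector_derivative_vd[OF T(1) s1 T(2)] has_vector_derivative_vd[OF T(1) s2 T(2)]]])
    finally show ?thesis by (simp add: numeral_2_eq_2)
  qed
  have z: "vd j (\<lambda>a. E a * P a + ga (\<gamma> a) * (\<pi> a * \<pi> a)) 0 = vd j (\<lambda>a. 0) 0" for j
    by (rule vd_cong[OF T eq1])
  have c1: "vd 1 (\<lambda>a. 0::real) t = 0" for t by (rule vd_1I) simp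
  have c2: "vd 2 (\<lambda>a. 0::real) 0 = 0"
  proof -
    have "vd 1 (\<lambda>a. 0::real) = (\<lambda>a. 0)" using c1 by (rule ext)
    then show ?thesis using vd_Suc'[of 1 "\<lambda>a. 0::real"] c1[of 0] by (simp add: numeral_2_eq_2)
  qed
  have "vd 1 E 0 * al 0 = 0"
    using add1[OF T(2)] z[of 1] vd1_mult[OF T(1) sE sP T(2)] vd2_square_zero(1)[OF T(1) sga sp T(2) bp0(2)]
    by (simp add: c1 E0 P0 del: One_nat_def)
  then have E1: "vd 1 E 0 = 0" using al0 by simp
  have dE: "(E has_vector_derivative 24 * t + 2 * vd 1 bt t) (at t)" if "t \<in> T" for t
  proof -
    have "(bt has_real_derivative vd 1 bt t) (at t)"
      using has_vector_derivative_smooth[OF T(1) sb that] by (simp add: real_derivative_iff)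
    then have "(E has_real_derivative 24 * t + 2 * vd 1 bt t) (at t)"
      unfolding E_def by (auto intro!: derivative_eq_intros)
    then show ?thesis by (simp add: real_derivative_iff)
  qed
  have b1: "vd 1 bt 0 = 0" using E1 vd_1I[OF dE[OF T(2)]] by simp
  have E2: "vd 2 E 0 = 24 + 2 * vd 2 bt 0"
  proof -
    have "(vd 1 bt has_real_derivative vd 2 bt 0) (at 0)"
      using has_vector_derivative_vd[OF T(1) sb T(2), of 1]
      by (simp add: real_derivative_iff numeral_2_eq_2)
    then have "((\<lambda>t. 24 * t + 2 * vd 1 bt t) has_real_derivative 24 + 2 * vd 2 bt 0) (at 0)"
      by (auto intro!: derivative_eq_intros)
    then have "vd 1 (\<lambda>t. 24 * t + 2 * vd 1 bt t) 0 = 24 + 2 * vd 2 bt 0"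
      by (intro vd_1I) (simp add: real_derivative_iff)
    then show ?thesis using vd_SucI[OF T dE, of 1] by (simp add: numeral_2_eq_2)
  qed
  \<comment> \<open>Since \<open>bt\<close> has no linear term, the derivative of \<open>G2\<close>
    along the curve is \<open>pd c0 e1 0 + c1 0 * vd 1 \<pi> 0\<close>, that is, -24 al - 6 al
    \<pi>'(0).\<close>
  have p1: "vd 1 \<pi> 0 = - 4"
  proof -
    have dk: "((\<lambda>a. k (\<gamma> a)) has_real_derivative pd k e1 0) (at 0)" if "smooth_on A k" for k :: "real^2 => real"
      using has_vector_derivative_compose_smooth[where c=\<gamma>, OF that, of 0] A(2) d\<gamma>
      by (simp add: real_derivative_iff \<gamma>0 b1 del: One_nat_def)
    have dp: "(\<pi> has_real_derivative vd 1 \<pi> 0) (at 0)"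
      using has_vector_derivative_smooth[OF T(1) sp T(2)] by (simp add: real_derivative_iff)
    have "((\<lambda>a. G2 (\<gamma> a) (\<pi> a)) has_real_derivative (pd c0 e1 0 + c1 0 * vd 1 \<pi> 0)) (at 0)"
      unfolding G2_def power2_eq_square power3_eq_cube
      by (rule DERIV_cong, (rule DERIV_add DERIV_mult dk dp smooth_c)+) (simp add: bp0 \<gamma>0)
    moreover have "((\<lambda>a. G2 (\<gamma> a) (\<pi> a)) has_real_derivative 0) (at 0)"
      by (rule has_field_derivative_transform_within_open[where f="\<lambda>a. 0" and S=T])
         (use T Geq in \<open>auto simp: \<gamma>_def\<close>)
    ultimately have "pd c0 e1 0 + c1 0 * vd 1 \<pi> 0 = 0" by (rule DERIV_unique)
    then have "al 0 * (vd 1 \<pi> 0 + 4) = 0" unfolding pd_c0_0 c1_0 by (simp add: algebra_simps)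
    then show ?thesis using al0 by simp
  qed
  have "(24 + 2 * vd 2 bt 0) * al 0 + 32 * ga 0 = 0"
    using add2 z[of 2] vd2_mult[OF T(1) sE sP T(2)] vd2_square_zero(2)[OF T(1) sga sp T(2) bp0(2)]
    by (simp add: c2 E0 P0 E1 E2 p1 \<gamma>0 del: One_nat_def)
  then have b2: "vd 2 bt 0 = - 12 - 16 * q"
    using al0 by (simp add: q_def field_simps)
  show ?thesis
  proof (rule that[of r bt \<pi>])
    show "inj (\<lambda>u. pd Phi u (vector [a, bt a, \<pi> a]))" if "\<bar>a\<bar> < r" for a
    proof -
      have a: "a \<in> T" using that by (auto simp: T_def)
      show ?thesis using bij_is_inj[OF bij[OF GU[OF a]]] Gv[OF a] by simp
    qed
    show "vector [a, b] \<in> A" if "\<bar>a\<bar> < r" "\<bar>b\<bar> < r" for a b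
      using r2(2)[of a b] that by (simp add: r_def)
    show "vector [a, bt a] \<in> A \<and> G1 (vector [a, bt a]) (\<pi> a) = 0 \<and> G2 (vector [a, bt a]) (\<pi> a) = 0" if "\<bar>a\<bar> < r" for a
    proof -
      have a: "a \<in> T" using that by (auto simp: T_def)
      show ?thesis using A'[OF a] Geq[OF a] by simp
    qed
  qed (use r sb sp bp0 uniq b1 b2 p1 in \<open>auto simp: T_def simp del: One_nat_def\<close>)
qed

end

section \<open>The curves in the chart\<close>

lemma tendsto_quotient_first:
  fixes c :: "real => real"
  assumes T: "open T" "0 \<in> T" and c: "smooth_on T c" and c0: "c 0 = 0"
  shows "((\<lambda>a. c a / a) \<longlongrightarrow> vd 1 c 0) (at 0)"
proof -
  have "(c has_real_derivative vd 1 c 0) (at 0)"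
    using has_vector_derivative_smooth[OF T(1) c T(2)] by (simp add: real_derivative_iff)
  then show ?thesis using c0 by (simp add: has_field_derivative_iff del: One_nat_def)
qed

lemma tendsto_quotient_second:
  fixes c :: "real => real"
  assumes T: "open T" "0 \<in> T" and c: "smooth_on T c" and c0: "c 0 = 0" "vd 1 c 0 = 0"
  shows "((\<lambda>a. c a / a\<^sup>2) \<longlongrightarrow> vd 2 c 0 / 2) (at 0)"
proof (rule lhopital[where f'="vd 1 c" and g'="\<lambda>a. 2 * a"])
  have ev: "\<forall>\<^sub>F a in at 0. a \<in> T" using T by (rule eventually_at_in_open')
  have nz: "\<forall>\<^sub>F a in at 0. (a::real) \<noteq> 0" by (simp add: eventually_at_filter)
  show "(c \<longlongrightarrow> 0) (at 0)" using smooth_on_tendsto[OF c T(2)] c0 by simp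
  show "((\<lambda>a::real. a\<^sup>2) \<longlongrightarrow> 0) (at 0)" by (auto intro!: tendsto_eq_intros)
  show "\<forall>\<^sub>F a in at 0. (a::real)\<^sup>2 \<noteq> 0" using nz by eventually_elim simp
  show "\<forall>\<^sub>F a in at 0. 2 * (a::real) \<noteq> 0" using nz by eventually_elim simp
  show "\<forall>\<^sub>F a in at 0. (c has_real_derivative vd 1 c a) (at a)"
    using ev by eventually_elim
      (use has_vector_derivative_smooth[OF T(1) c] in \<open>simp add: real_derivative_iff\<close>)
  show "\<forall>\<^sub>F a in at 0. ((\<lambda>a. a\<^sup>2) has_real_derivative 2 * a) (at (a::real))"
    by (auto intro!: always_eventually derivative_eq_intros)
  have "((\<lambda>a. vd 1 c a / a / 2) \<longlongrightarrow> vd 1 (vd 1 c) 0 / 2) (at 0)"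
    by (intro tendsto_divide tendsto_const tendsto_quotient_first[OF T smooth_on_vd[OF T(1) c] c0(2)]) simp
  moreover have "vd 1 (vd 1 c) 0 = vd 2 c 0" by (simp add: vd_def numeral_2_eq_2)
  ultimately show "((\<lambda>a. vd 1 c a / (2 * a)) \<longlongrightarrow> vd 2 c 0 / 2) (at 0)"
    by (simp add: field_simps del: One_nat_def)
qed

text \<open>With equal third coordinates the other two equations are divisible by x1 - y1. If x1 +
  y1 were nonzero as well, the quotients would combine to (x1 - y1)^2 = 0.\<close>

lemma swallowtail_model_eq:
  assumes "x \<noteq> y"
  shows "swallowtail_model x = swallowtail_model y \<longleftrightarrow> x$1 \<noteq> 0 \<and> y$1 = - x$1 \<and> x$2 = - 2 * (x$1)\<^sup>2 \<and> y$2 = x$2"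
proof
  assume "swallowtail_model x = swallowtail_model y"
  then have e: "3 * (x$1)^4 + (x$1)^2 * x$2 = 3 * (y$1)^4 + (y$1)^2 * y$2"
    "4 * (x$1)^3 + 2 * x$1 * x$2 = 4 * (y$1)^3 + 2 * y$1 * y$2" and b: "x$2 = y$2"
    unfolding swallowtail_model_def vec_eq_iff forall_3 vector_3 by blast+
  define p r c where "p = x$1" and "r = y$1" and "c = x$2"
  have pr: "p \<noteq> r" using assms b by (auto simp: p_def r_def vec_eq_iff forall_2)
  have "(p - r) * ((p + r) * (3 * (p\<^sup>2 + r\<^sup>2) + c)) = 0" "(p - r) * (4 * (p\<^sup>2 + p * r + r\<^sup>2) + 2 * c) = 0"
    using e b by (simp_all add: p_def r_def c_def algebra_simps power2_eq_square power3_eq_cube power4_eq_xxxx)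
  then have "(p + r) * (3 * (p\<^sup>2 + r\<^sup>2) + c) = 0" "4 * (p\<^sup>2 + p * r + r\<^sup>2) + 2 * c = 0"
    using pr by (simp_all only: mult_eq_0_iff[of "p - r"] right_minus_eq, simp_all)
  then have 1: "p + r = 0 \<or> 3 * (p\<^sup>2 + r\<^sup>2) + c = 0" and 2: "c = - 2 * (p\<^sup>2 + p * r + r\<^sup>2)"
    by (simp only: mult_eq_0_iff, linarith)
  have "p + r = 0"
  proof (rule ccontr)
    assume "p + r \<noteq> 0"
    then have "3 * (p\<^sup>2 + r\<^sup>2) + c = 0" using 1 by blast
    moreover have "(p - r)\<^sup>2 = (3 * (p\<^sup>2 + r\<^sup>2) + c) - (c + 2 * (p\<^sup>2 + p * r + r\<^sup>2))"
      by (simp add: power2_eq_square algebra_simps)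
    ultimately have "(p - r)\<^sup>2 = 0" using 2 by simp
    then show False using pr by simp
  qed
  then have "r = - p" by simp
  then show "x$1 \<noteq> 0 \<and> y$1 = - x$1 \<and> x$2 = - 2 * (x$1)\<^sup>2 \<and> y$2 = x$2"
    using pr 2 b by (auto simp: p_def r_def c_def power2_eq_square)
next
  assume *: "x$1 \<noteq> 0 \<and> y$1 = - x$1 \<and> x$2 = - 2 * (x$1)\<^sup>2 \<and> y$2 = x$2"
  then show "swallowtail_model x = swallowtail_model y"
    by (simp add: swallowtail_model_def vec_eq_iff forall_3 power2_eq_square power3_eq_cube)
qed

lemma components_two:
  assumes S: "S = P \<union> Q" and P: "open P" "connected P" "P \<noteq> {}" and Q: "open Q" "connected Q" "Q \<noteq> {}"
    and d: "P \<inter> Q = {}"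
  shows "components S = {P, Q}"
proof -
  have max: "D = P" if "open P" "open Q" "P \<inter> Q = {}" "connected D" "P \<noteq> {}" "P \<subseteq> D" "D \<subseteq> P \<union> Q"
    for P Q D :: "'a set"
  proof -
    have "Q \<inter> D = {}" using connectedD[OF that(4,1,2)] that by auto
    then show ?thesis using that by blast
  qed
  have PS: "P \<in> components S" and QS: "Q \<in> components S"
    unfolding in_components_maximal using max[of P Q] max[of Q P] S P Q d by (auto simp: Int_commute Un_commute)
  have "C \<in> {P, Q}" if C: "C \<in> components S" for C
  proof -
    have "C \<noteq> {}" "C \<subseteq> P \<union> Q" using in_components_nonempty[OF C] in_components_subset[OF C] S by auto
    then have "C \<inter> P \<noteq> {} \<or> C \<inter> Q \<noteq> {}" by auto
    then show ?thesis using components_nonoverlap[OF C PS] components_nonoverlap[OF C QS] by auto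
  qed
  then show ?thesis using PS QS by blast
qed

text \<open>The outcome of \<open>flecnodal_functions\<close>, fixed as data: the flecnodal curve is
  the graph of \<open>bt\<close>, and \<pi> is the slope of its asymptotic line of higher
  contact.\<close>

locale flecnodal_chart = swallowtail_chart +
  fixes r :: real and bt \<pi> :: "real => real"
  assumes r: "r > 0"
    and boxA: "\<And>a b. \<bar>a\<bar> < r ==> \<bar>b\<bar> < r ==> vector [a, b] \<in> A"
    and bt_smooth: "smooth_on {-r<..<r} bt" and pi_smooth: "smooth_on {-r<..<r} \<pi>"
    and bt0: "bt 0 = 0" and pi0: "\<pi> 0 = 0"
    and fl_eq: "\<And>a. \<bar>a\<bar> < r ==>
       vector [a, bt a] \<in> A \<and> G1 (vector [a, bt a]) (\<pi> a) = 0 \<and> G2 (vector [a, bt a]) (\<pi> a) = 0"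
    and fl_uniq: "\<And>a b p. \<bar>a\<bar> < r ==> \<bar>b\<bar> < r ==> G1 (vector [a, b]) p = 0 ==>
       G2 (vector [a, b]) p = 0 ==> b = bt a \<and> p = \<pi> a"
    and Phi_inj: "\<And>a. \<bar>a\<bar> < r ==> inj (\<lambda>u. pd Phi u (vector [a, bt a, \<pi> a]))"
    and bt1: "vd 1 bt 0 = 0" and bt2: "vd 2 bt 0 = - 12 - 16 * q" and pi1: "vd 1 \<pi> 0 = - 4"
begin

text \<open>Larger in modulus than the quadratic coefficients 6 + 8 q, 6 and 2 of the three curves.
  The box below has a height quadratic in its width, so it contains their graphs over its whole
  base.\<close>

definition K where "K = \<bar>6 + 8 * q\<bar> + 7"

definition box :: "real => (real^2) set" where "box \<xi> = {x. \<bar>x$1\<bar> < \<xi> \<and> \<bar>x$2\<bar> < K * \<xi>\<^sup>2}"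

text \<open>In this order: the flecnodal graph stays in the box; it lies in the hyperbolic domain;
  its position relative to the self-intersection line; its tangent is not the asymptotic direction
  of higher contact; the quantity that decides between left and right has a definite sign on each
  half.\<close>

definition good :: "real => bool" where
  "good \<xi> \<longleftrightarrow> 0 < \<xi> \<and> \<xi> < r \<and> K * \<xi>\<^sup>2 < r \<and>
    (\<forall>a. a \<noteq> 0 --> \<bar>a\<bar> < \<xi> -->
      \<bar>bt a\<bar> < K * a\<^sup>2 \<and> (bt a + 6 * a\<^sup>2) * q < 0 \<and>
      (q > - 1/2 --> bt a < - 2 * a\<^sup>2) \<and> (q < - 1/2 --> bt a > - 2 * a\<^sup>2) \<and>
      (q \<noteq> - 1/2 --> vd 1 bt a \<noteq> \<pi> a) \<and>
      (edge_fun (vector [a, bt a]) * be (vector [a, bt a]) + ga (vector [a, bt a]) * \<pi> a) * (a * ga 0) < 0)"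

text \<open>After division by a suitable power of \<open>a\<close> each condition is an open one,
  satisfied by the limit at 0 that the jets of \<open>bt\<close> and \<pi> provide.\<close>

lemma good_small:
  assumes "\<delta> > 0"
  obtains \<xi> where "good \<xi>" "\<xi> < \<delta>"
proof -
  let ?T = "{-r<..<r}"
  have T: "open ?T" "0 \<in> ?T" using r by auto
  have ev: "\<forall>\<^sub>F a in at 0. a \<in> ?T" using T by (rule eventually_at_in_open')
  have nz: "\<forall>\<^sub>F a in at 0. (a::real) \<noteq> 0" by (simp add: eventually_at_filter)
  have b2: "((\<lambda>a. bt a / a\<^sup>2) \<longlongrightarrow> - 6 - 8 * q) (at 0)"
    using tendsto_quotient_second[OF T bt_smooth bt0 bt1] by (simp add: bt2 diff_divide_distrib)
  have p1: "((\<lambda>a. \<pi> a / a) \<longlongrightarrow> - 4) (at 0)"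
    using tendsto_quotient_first[OF T pi_smooth pi0] pi1 by simp
  have b1: "((\<lambda>a. vd 1 bt a / a) \<longlongrightarrow> - 12 - 16 * q) (at 0)"
  proof -
    have "vd 1 (vd 1 bt) 0 = vd 2 bt 0" by (simp add: vd_def numeral_2_eq_2)
    then show ?thesis using tendsto_quotient_first[OF T smooth_on_vd[OF T(1) bt_smooth] bt1] bt2 by simp
  qed
  have sq: "\<forall>\<^sub>F a in at 0. (a::real)\<^sup>2 > 0" using nz by eventually_elim simp
  have K1: "\<forall>\<^sub>F a in at 0. \<bar>bt a\<bar> < K * a\<^sup>2"
  proof -
    have "\<forall>\<^sub>F a in at 0. \<bar>bt a / a\<^sup>2\<bar> < K"
      by (rule order_tendstoD(2)[OF tendsto_rabs[OF b2]]) (auto simp: K_def)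
    with sq show ?thesis by eventually_elim (simp add: abs_divide field_simps)
  qed
  have K2: "\<forall>\<^sub>F a in at 0. (bt a + 6 * a\<^sup>2) * q < 0"
  proof -
    have "((\<lambda>a. (bt a / a\<^sup>2 + 6) * q) \<longlongrightarrow> (- 6 - 8 * q + 6) * q) (at 0)"
      by (intro tendsto_intros b2)
    moreover have "(- 6 - 8 * q + 6) * q < 0" using q_nz by (simp add: mult_less_0_iff zero_less_mult_iff) (metis linorder_neqE_linordered_idom)
    ultimately have "\<forall>\<^sub>F a in at 0. (bt a / a\<^sup>2 + 6) * q < 0" by (rule order_tendstoD(2))
    with sq show ?thesis
    proof eventually_elim
      case (elim a)
      have "bt a + 6 * a\<^sup>2 = a\<^sup>2 * (bt a / a\<^sup>2 + 6)" using elim(1) by (simp add: field_simps)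
      then have eq: "(bt a + 6 * a\<^sup>2) * q = a\<^sup>2 * ((bt a / a\<^sup>2 + 6) * q)" by (simp only: mult.assoc)
      show ?case unfolding eq by (rule mult_pos_neg[OF elim])
    qed
  qed
  have K3: "\<forall>\<^sub>F a in at 0. (q > - 1/2 --> bt a < - 2 * a\<^sup>2) \<and> (q < - 1/2 --> bt a > - 2 * a\<^sup>2)"
  proof -
    have "\<forall>\<^sub>F a in at 0. q > - 1/2 --> bt a / a\<^sup>2 < - 2"
      by (cases "q > - 1/2") (auto intro!: order_tendstoD(2)[OF b2])
    moreover have "\<forall>\<^sub>F a in at 0. q < - 1/2 --> bt a / a\<^sup>2 > - 2"
      by (cases "q < - 1/2") (auto intro!: order_tendstoD(1)[OF b2])
    ultimately show ?thesis using sq by eventually_elim (simp add: field_simps)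
  qed
  \<comment> \<open>The quotients by \<open>a\<close> differ in the limit by - 8 - 16 q, which
    vanishes for q = - 1/2 alone.\<close>
  have K4: "\<forall>\<^sub>F a in at 0. q \<noteq> - 1/2 --> vd 1 bt a \<noteq> \<pi> a"
  proof (cases "q = - 1/2")
    case False
    have "((\<lambda>a. vd 1 bt a / a - \<pi> a / a) \<longlongrightarrow> (- 12 - 16 * q) - (- 4)) (at 0)"
      by (intro tendsto_intros b1 p1)
    moreover have "(- 12 - 16 * q) - (- 4) \<noteq> 0" using False by simp
    ultimately have "\<forall>\<^sub>F a in at 0. vd 1 bt a / a - \<pi> a / a \<noteq> 0"
      by (rule tendsto_imp_eventually_ne)
    then show ?thesis by eventually_elim auto
  qed simp
  \<comment> \<open>The summand with \<open>edge_fun\<close> is of second order in \<open>a\<close>,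
    the other behaves like \<open>- 4 * a * ga 0\<close>; divided by a^2 the product tends to -4 (ga
    0)^2.\<close>
  have K5: "\<forall>\<^sub>F a in at 0. (edge_fun (vector [a, bt a]) * be (vector [a, bt a]) + ga (vector [a, bt a]) * \<pi> a) * (a * ga 0) < 0"
  proof -
    define \<gamma> where "\<gamma> a = (vector [a, bt a] :: real^2)" for a
    have s\<gamma>: "smooth_on ?T \<gamma>" unfolding \<gamma>_def by (intro smooth_on_vector2 smooth_on_ident bt_smooth T)
    have \<gamma>0: "\<gamma> 0 = 0" by (simp add: \<gamma>_def bt0 vec_eq_iff forall_2)
    have lim: "((\<lambda>a. k (\<gamma> a)) \<longlongrightarrow> k 0) (at 0)" if "smooth_on A k" for k :: "real^2 => real"
    proof -
      have "(\<gamma> \<longlongrightarrow> 0) (at 0)" using smooth_on_tendsto[OF s\<gamma> T(2)] by (simp add: \<gamma>0)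
      then show ?thesis using isCont_tendsto_compose[OF smooth_on_isCont[OF that A(2)]] by blast
    qed
    have "((\<lambda>a. ((12 + 2 * (bt a / a\<^sup>2)) * a * be (\<gamma> a) + ga (\<gamma> a) * (\<pi> a / a)) * ga 0) \<longlongrightarrow>
      ((12 + 2 * (- 6 - 8 * q)) * 0 * be 0 + ga 0 * (- 4)) * ga 0) (at 0)"
      by (intro tendsto_intros b2 p1 lim smooth_abg)
    moreover have "((12 + 2 * (- 6 - 8 * q)) * 0 * be 0 + ga 0 * (- 4)) * ga 0 < 0"
      using ga0 by (auto simp: zero_less_mult_iff)
    ultimately have "\<forall>\<^sub>F a in at 0. ((12 + 2 * (bt a / a\<^sup>2)) * a * be (\<gamma> a) + ga (\<gamma> a) * (\<pi> a / a)) * ga 0 < 0"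
      by (rule order_tendstoD(2))
    with sq show ?thesis
    proof eventually_elim
      case (elim a)
      have eq: "(edge_fun (\<gamma> a) * be (\<gamma> a) + ga (\<gamma> a) * \<pi> a) * (a * ga 0) =
        a\<^sup>2 * (((12 + 2 * (bt a / a\<^sup>2)) * a * be (\<gamma> a) + ga (\<gamma> a) * (\<pi> a / a)) * ga 0)"
        using elim(1) by (simp add: edge_fun_def \<gamma>_def power2_eq_square field_simps)
      show ?case unfolding eq[unfolded \<gamma>_def] by (rule mult_pos_neg[OF elim[unfolded \<gamma>_def]])
    qed
  qed
  have "\<forall>\<^sub>F a in at 0. a \<noteq> 0 -->
      \<bar>bt a\<bar> < K * a\<^sup>2 \<and> (bt a + 6 * a\<^sup>2) * q < 0 \<and>
      (q > - 1/2 --> bt a < - 2 * a\<^sup>2) \<and> (q < - 1/2 --> bt a > - 2 * a\<^sup>2) \<and>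
      (q \<noteq> - 1/2 --> vd 1 bt a \<noteq> \<pi> a) \<and>
      (edge_fun (vector [a, bt a]) * be (vector [a, bt a]) + ga (vector [a, bt a]) * \<pi> a) * (a * ga 0) < 0"
    using K1 K2 K3 K4 K5 by eventually_elim simp
  then obtain d where d: "d > 0" "\<And>a. a \<noteq> 0 ==> \<bar>a\<bar> < d ==>
      \<bar>bt a\<bar> < K * a\<^sup>2 \<and> (bt a + 6 * a\<^sup>2) * q < 0 \<and>
      (q > - 1/2 --> bt a < - 2 * a\<^sup>2) \<and> (q < - 1/2 --> bt a > - 2 * a\<^sup>2) \<and>
      (q \<noteq> - 1/2 --> vd 1 bt a \<noteq> \<pi> a) \<and>
      (edge_fun (vector [a, bt a]) * be (vector [a, bt a]) + ga (vector [a, bt a]) * \<pi> a) * (a * ga 0) < 0"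
    unfolding eventually_at by (auto simp: dist_real_def)
  have Kp: "K > 0" by (simp add: K_def)
  define m where "m = min (min d \<delta>) (min r (min 1 (r / K)))"
  define \<xi> where "\<xi> = m / 2"
  have "m > 0" using d r Kp assms by (simp add: m_def)
  then have "\<xi> > 0" "\<xi> < m" by (auto simp: \<xi>_def)
  moreover have "m \<le> d" "m \<le> \<delta>" "m \<le> r" "m \<le> 1" "m \<le> r / K" by (auto simp: m_def)
  ultimately have e: "\<xi> > 0" "\<xi> < d" "\<xi> < \<delta>" "\<xi> < r" "\<xi> < 1" "\<xi> < r / K" by linarith+
  have "\<xi>\<^sup>2 \<le> \<xi>" using e by (simp add: power2_eq_square mult_left_le)
  then have "K * \<xi>\<^sup>2 \<le> K * \<xi>" using Kp by simp
  also have "\<dots> < r" using e(6) Kp by (simp add: field_simps)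
  finally have "K * \<xi>\<^sup>2 < r" .
  then have "good \<xi>" unfolding good_def using d(2) e by auto
  then show ?thesis using that e by blast
qed

end

locale flecnodal_box = flecnodal_chart +
  fixes \<xi> :: real
  assumes good: "good \<xi>"
begin

lemma eps: "\<xi> > 0" "\<xi> < r" "K * \<xi>\<^sup>2 < r" "K > 0"
  using good by (auto simp: good_def K_def)

lemma box_A: "box \<xi> \<subseteq> A"
proof
  fix x assume "x \<in> box \<xi>"
  then have "vector [x$1, x$2] \<in> A" using eps by (intro boxA) (auto simp: box_def)
  moreover have "vector [x$1, x$2] = x" by (simp add: vec_eq_iff forall_2)
  ultimately show "x \<in> A" by simp
qed

lemma box_open: "open (box \<xi>)"
  unfolding box_def
  by (intro open_Collect_conj open_Collect_less continuous_intros)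

lemma zero_box: "0 \<in> box \<xi>"
  using eps by (simp add: box_def)

abbreviation V where "V \<equiv> \<phi> ` box \<xi>"

lemma V_open: "open V" by (rule open_phi_image[OF box_open box_A])

lemma V_U: "V \<subseteq> U" using box_A phi(3) by blast

lemma s_V: "s \<in> V" using zero_box phi(2) by force

lemma phi_eq_iff: "x \<in> A ==> y \<in> A ==> \<phi> x = \<phi> y \<longleftrightarrow> x = y"
  using phi_inj by (auto simp: inj_on_def)

section \<open>Graphs over the first axis\<close>

definition graph :: "(real => real) => (real^2) set" where
  "graph \<beta> = {x\<in>box \<xi>. x$2 = \<beta> (x$1)}"

text \<open>The flecnodal curve, the edge and the self-intersection line are all of this kind, so
  that closures, parametrisations and separations are treated once.\<close>

definition small_graph :: "(real => real) => bool" where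
  "small_graph \<beta> \<longleftrightarrow> smooth_on {-\<xi><..<\<xi>} \<beta> \<and> \<beta> 0 = 0 \<and> (\<forall>a. \<bar>a\<bar> < \<xi> --> \<bar>\<beta> a\<bar> < K * \<xi>\<^sup>2)"

lemma small_graph_bt: "small_graph bt"
  unfolding small_graph_def
proof (intro conjI allI impI)
  show "smooth_on {-\<xi><..<\<xi>} bt" by (rule smooth_on_subset[OF bt_smooth]) (use eps in auto)
  show "\<bar>bt a\<bar> < K * \<xi>\<^sup>2" if "\<bar>a\<bar> < \<xi>" for a
  proof (cases "a = 0")
    case False
    then have "\<bar>bt a\<bar> < K * a\<^sup>2" using good that by (auto simp: good_def)
    also have "\<dots> \<le> K * \<xi>\<^sup>2" using that eps by (intro mult_left_mono) (auto simp: abs_le_square_iff[symmetric])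
    finally show ?thesis .
  qed (use eps bt0 in auto)
qed (rule bt0)

lemma small_graph_square: "\<bar>k\<bar> < 7 ==> small_graph (\<lambda>a. k * a\<^sup>2)"
  unfolding small_graph_def
proof (intro conjI allI impI)
  assume k: "\<bar>k\<bar> < 7"
  show "smooth_on {-\<xi><..<\<xi>} (\<lambda>a. k * a\<^sup>2)"
    by (intro smooth_on_mult smooth_on_power smooth_on_const smooth_on_ident open_greaterThanLessThan)
  fix a assume "\<bar>a\<bar> < \<xi>"
  then have "a\<^sup>2 \<le> \<xi>\<^sup>2" by (auto simp: abs_le_square_iff[symmetric])
  then have "\<bar>k * a\<^sup>2\<bar> \<le> \<bar>k\<bar> * \<xi>\<^sup>2" by (simp add: abs_mult mult_left_mono)
  also have "\<dots> < K * \<xi>\<^sup>2" using k eps by (intro mult_strict_right_mono) (auto simp: K_def)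
  finally show "\<bar>k * a\<^sup>2\<bar> < K * \<xi>\<^sup>2" .
qed simp

lemma graph_mem: "small_graph \<beta> ==> \<bar>a\<bar> < \<xi> ==> vector [a, \<beta> a] \<in> graph \<beta>"
  by (simp add: graph_def box_def small_graph_def)

lemma graph_subset: "graph \<beta> \<subseteq> box \<xi>" by (auto simp: graph_def)

lemma open_box_minus_graph: assumes "small_graph \<beta>" shows "open (box \<xi> - graph \<beta>)"
proof -
  have c: "continuous_on (box \<xi>) (\<lambda>x. x$2 - \<beta> (x$1))"
    by (intro continuous_intros continuous_on_compose2[OF smooth_on_continuous[of "{-\<xi><..<\<xi>}" \<beta>]])
       (use assms in \<open>auto simp: small_graph_def box_def\<close>)
  have "box \<xi> - graph \<beta> = box \<xi> \<inter> (\<lambda>x. x$2 - \<beta> (x$1)) -` (- {0})" by (auto simp: graph_def)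
  then show ?thesis using continuous_open_preimage[OF c box_open open_Compl[OF closed_singleton]] by simp
qed

lemma smooth_graph_param:
  assumes \<beta>: "small_graph \<beta>"
  shows "smooth_on {-\<xi><..<\<xi>} (\<lambda>a. \<phi> (vector [a, \<beta> a]))"
proof (rule smooth_on_compose[OF _ A(1) _ _ phi(1)])
  show "vector [a, \<beta> a] \<in> A" if "a \<in> {-\<xi><..<\<xi>}" for a
    using graph_mem[OF \<beta>, of a] graph_subset box_A that by (auto simp: abs_less_iff)
  show "smooth_on {-\<xi><..<\<xi>} (\<lambda>a. vector [a, \<beta> a] :: real^2)"
    using \<beta> by (intro smooth_on_vector2 smooth_on_ident) (auto simp: small_graph_def)
qed simp

text \<open>The flecnodal curve and the self-intersection line are closures of sets that may omit
  the swallowtail. Within \<open>V\<close> such a closure is the whole graph: the graph is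
  relatively closed, and its origin is a limit of its other points.\<close>

lemma closure_graph:
  assumes \<beta>: "small_graph \<beta>" and S: "\<phi> ` (graph \<beta> - {0}) \<subseteq> S" "S \<inter> V \<subseteq> \<phi> ` graph \<beta>"
  shows "V \<inter> closure S = \<phi> ` graph \<beta>"
proof
  show "V \<inter> closure S \<subseteq> \<phi> ` graph \<beta>"
  proof safe
    fix x assume x: "x \<in> box \<xi>" "\<phi> x \<in> closure S"
    have "open (\<phi> ` (box \<xi> - graph \<beta>))"
      using box_A by (intro open_phi_image open_box_minus_graph[OF \<beta>]) auto
    moreover have "\<phi> ` (box \<xi> - graph \<beta>) \<inter> S = {}"
      using S(2) phi_eq_iff box_A graph_subset by blast
    ultimately have "\<phi> ` (box \<xi> - graph \<beta>) \<inter> closure S = {}"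
      by (simp add: open_Int_closure_eq_empty)
    then show "\<phi> x \<in> \<phi> ` graph \<beta>" using x by blast
  qed
  have "\<phi> 0 \<in> closure S"
  proof -
    let ?c = "\<lambda>a. \<phi> (vector [a, \<beta> a])"
    have v0: "vector [0, \<beta> 0] = (0 :: real^2)" using \<beta> by (simp add: small_graph_def vec_eq_iff forall_2)
    have "(?c \<longlongrightarrow> ?c 0) (at 0)"
      by (rule smooth_on_tendsto[OF smooth_graph_param[OF \<beta>]]) (use eps in auto)
    moreover have "\<forall>\<^sub>F a in at 0. ?c a \<in> closure S"
    proof -
      have "\<forall>\<^sub>F a in at 0. a \<in> {-\<xi><..<\<xi>}" using eps by (intro eventually_at_in_open') auto
      moreover have "\<forall>\<^sub>F a in at 0. (a::real) \<noteq> 0" by (simp add: eventually_at_filter)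
      ultimately show ?thesis
      proof eventually_elim
        case (elim a)
        have "vector [a, \<beta> a] \<in> graph \<beta>" using elim by (intro graph_mem[OF \<beta>]) auto
        moreover have "(vector [a, \<beta> a] :: real^2) \<noteq> 0" using elim(2) by (metis vector_2(1) zero_index)
        ultimately show ?case using S(1) closure_subset by blast
      qed
    qed
    ultimately have "?c 0 \<in> closure S" by (intro Lim_in_closed_set[OF closed_closure _ at_neq_bot])
    then show ?thesis by (simp add: v0)
  qed
  then show "\<phi> ` graph \<beta> \<subseteq> V \<inter> closure S"
    using S(1) graph_subset closure_subset[of S] by (auto simp: image_subset_iff)
qed

text \<open>The sign \<sigma> admits both orientations; the flecnodal curve is later run from its
  left to its right branch.\<close>

lemma parametrises_graph:
  assumes \<beta>: "small_graph \<beta>" and \<sigma>: "\<sigma> = 1 \<or> \<sigma> = (-1::real)"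
  shows "parametrises (\<lambda>t. \<phi> (vector [\<sigma> * \<xi> * t, \<beta> (\<sigma> * \<xi> * t)])) (\<phi> ` graph \<beta>) s"
proof -
  define c where "c t = (vector [\<sigma> * \<xi> * t, \<beta> (\<sigma> * \<xi> * t)] :: real^2)" for t
  let ?T = "{-1<..<1::real}"
  have small: "\<bar>\<sigma> * \<xi> * t\<bar> < \<xi>" if "t \<in> ?T" for t
    using that eps \<sigma> by (auto simp: abs_mult)
  have small2: "\<sigma> * \<xi> * t \<in> {-\<xi><..<\<xi>}" if "t \<in> ?T" for t
    using small[OF that] by (simp only: greaterThanLessThan_iff) linarith
  have l: "smooth_on ?T (\<lambda>t. \<sigma> * \<xi> * t)"
    by (intro smooth_on_mult smooth_on_const smooth_on_ident open_greaterThanLessThan)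
  have "smooth_on ?T (\<lambda>t. \<phi> (vector [\<sigma> * \<xi> * t, \<beta> (\<sigma> * \<xi> * t)]))"
    by (rule smooth_on_compose[OF _ _ _ l smooth_graph_param[OF \<beta>]]) (use small2 in auto)
  moreover have inA: "c t \<in> A" if "t \<in> ?T" for t
    using graph_mem[OF \<beta> small[OF that]] graph_subset box_A by (auto simp: c_def)
  have sc: "smooth_on ?T c"
    unfolding c_def
    by (intro smooth_on_vector2 l smooth_on_compose[OF _ _ _ l, of "{-\<xi><..<\<xi>}"])
       (use small2 \<beta> in \<open>auto simp: small_graph_def\<close>)
  have "inj_on (\<lambda>t. \<phi> (c t)) ?T"
  proof (rule inj_onI)
    fix t t' assume t: "t \<in> ?T" "t' \<in> ?T" "\<phi> (c t) = \<phi> (c t')"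
    then have "c t = c t'" using inA phi_eq_iff by blast
    then have "c t $ 1 = c t' $ 1" by simp
    then show "t = t'" using \<sigma> eps by (auto simp: c_def)
  qed
  moreover have "vd 1 (\<lambda>t. \<phi> (c t)) t \<noteq> 0" if t: "t \<in> ?T" for t
  proof
    assume z: "vd 1 (\<lambda>t. \<phi> (c t)) t = 0"
    have dc: "(c has_vector_derivative vd 1 c t) (at t)" by (rule has_vector_derivative_smooth[OF _ sc t]) simp
    have "vd 1 (\<lambda>t. \<phi> (c t)) t = pd \<phi> (vd 1 c t) (c t)"
      by (rule vd_1I[OF has_vector_derivative_compose_smooth[where c=c, OF phi(1) inA[OF t] dc]])
    then have "vd 1 c t = 0"
      using z linear_injective_0[OF pd_linear[OF phi(1) inA[OF t]]] bij_is_inj[OF pd_phi_bij[OF inA[OF t]]] by metis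
    moreover have "((\<lambda>t. c t $ 1) has_vector_derivative vd 1 c t $ 1) (at t)"
      by (rule bounded_linear.has_vector_derivative[OF bounded_linear_vec_nth dc])
    moreover have "((\<lambda>t. c t $ 1) has_vector_derivative \<sigma> * \<xi>) (at t)"
      by (auto simp: c_def real_derivative_iff[symmetric] intro!: derivative_eq_intros)
    ultimately have "\<sigma> * \<xi> = 0" using vector_derivative_unique_at by fastforce
    then show False using \<sigma> eps by auto
  qed
  moreover have "\<phi> (c 0) = s"
  proof -
    have "c 0 = 0" using \<beta> by (simp add: c_def small_graph_def vec_eq_iff forall_2)
    then show ?thesis using phi(2) by simp
  qed
  moreover have "c ` ?T = graph \<beta>"
  proof
    show "c ` ?T \<subseteq> graph \<beta>" using graph_mem[OF \<beta> small] by (auto simp: c_def)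
    show "graph \<beta> \<subseteq> c ` ?T"
    proof
      fix x assume x: "x \<in> graph \<beta>"
      then have "x = c (x$1 / (\<sigma> * \<xi>))" "x$1 / (\<sigma> * \<xi>) \<in> ?T"
        using eps \<sigma> by (auto simp: c_def graph_def box_def vec_eq_iff forall_2 field_simps)
      then show "x \<in> c ` ?T" by blast
    qed
  qed
  then have "(\<lambda>t. \<phi> (c t)) ` ?T = \<phi> ` graph \<beta>" by (metis image_image)
  ultimately show ?thesis unfolding parametrises_def c_def by simp
qed

end

text \<open>The region is the image of an open rectangle under linear interpolation between the two
  graphs.\<close>

lemma connected_between_graphs:
  fixes lo hi :: "real => real"
  assumes "continuous_on {-e<..<e} lo" "continuous_on {-e<..<e} hi"
    and lt: "\<And>a. \<bar>a\<bar> < e ==> lo a < hi a"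
  shows "connected {x :: real^2. \<bar>x$1\<bar> < e \<and> lo (x$1) < x$2 \<and> x$2 < hi (x$1)}"
proof -
  define g where "g p = (vector [fst p, lo (fst p) + snd p * (hi (fst p) - lo (fst p))] :: real^2)" for p
  have g: "g p = fst p *\<^sub>R vector [1, 0] + (lo (fst p) + snd p * (hi (fst p) - lo (fst p))) *\<^sub>R vector [0, 1]" for p
    by (simp add: g_def vec_eq_iff forall_2)
  have "continuous_on ({-e<..<e} \<times> {0<..<1}) g"
    unfolding g
    by (intro continuous_intros continuous_on_compose2[OF assms(1)] continuous_on_compose2[OF assms(2)]) auto
  moreover have "connected ({-e<..<e} \<times> {0<..<1::real})"
    by (intro connected_Times connected_Ioo)
  moreover have "g ` ({-e<..<e} \<times> {0<..<1}) = {x :: real^2. \<bar>x$1\<bar> < e \<and> lo (x$1) < x$2 \<and> x$2 < hi (x$1)}"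
  proof
    show "g ` ({-e<..<e} \<times> {0<..<1}) \<subseteq> {x :: real^2. \<bar>x$1\<bar> < e \<and> lo (x$1) < x$2 \<and> x$2 < hi (x$1)}"
    proof safe
      fix a t :: real assume at: "a \<in> {-e<..<e}" "t \<in> {0<..<1}"
      then have d: "hi a - lo a > 0" using lt[of a] by (auto simp: abs_less_iff)
      define D where "D = t * (hi a - lo a)"
      have "D < 1 * (hi a - lo a)" unfolding D_def using at d by (intro mult_strict_right_mono) auto
      moreover have "D > 0" unfolding D_def using at d by simp
      moreover have g12: "g (a, t) $ 1 = a" "g (a, t) $ 2 = lo a + D" by (simp_all add: g_def D_def)
      ultimately show "lo (g (a, t) $ 1) < g (a, t) $ 2" "g (a, t) $ 2 < hi (g (a, t) $ 1)" by simp_all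
      show "\<bar>g (a, t) $ 1\<bar> < e" unfolding g12 using at by auto
    qed
    show "{x :: real^2. \<bar>x$1\<bar> < e \<and> lo (x$1) < x$2 \<and> x$2 < hi (x$1)} \<subseteq> g ` ({-e<..<e} \<times> {0<..<1})"
    proof safe
      fix x :: "real^2" assume x: "\<bar>x$1\<bar> < e" "lo (x$1) < x$2" "x$2 < hi (x$1)"
      define t where "t = (x$2 - lo (x$1)) / (hi (x$1) - lo (x$1))"
      have d: "hi (x$1) - lo (x$1) > 0" using lt[OF x(1)] by simp
      have "t * (hi (x$1) - lo (x$1)) = x$2 - lo (x$1)" using d by (simp add: t_def)
      then have "x = g (x$1, t)" by (simp add: g_def vec_eq_iff forall_2)
      moreover have "t \<in> {0<..<1}" using x d by (simp add: t_def)
      moreover have "x$1 \<in> {-e<..<e}" using x(1) by (auto simp: abs_less_iff)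
      ultimately show "x \<in> g ` ({-e<..<e} \<times> {0<..<1})" by blast
    qed
  qed
  ultimately show ?thesis using connected_continuous_image by metis
qed

lemma separates_inI:
  assumes "open P" "open Q" "P \<inter> Q = {}" "X - C \<subseteq> P \<union> Q" "A \<subseteq> P" "B \<subseteq> Q" "A \<subseteq> X - C" "B \<subseteq> X - C"
  shows "separates_in X C A B"
  unfolding separates_in_def
proof (intro conjI ballI notI assms(7,8))
  fix a b assume "a \<in> A" "b \<in> B" "connected_component (X - C) a b"
  then obtain T where T: "connected T" "T \<subseteq> X - C" "a \<in> T" "b \<in> T" by (auto simp: connected_component_def)
  then show False using connectedD[OF T(1) assms(1,2)] assms \<open>a \<in> A\<close> \<open>b \<in> B\<close> by blast
qed

lemma (in flecnodal_chart) box_small: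
  assumes "open W" "s \<in> W"
  obtains \<xi> where "good \<xi>" "\<phi> ` box \<xi> \<subseteq> W"
proof -
  have "open (A \<inter> \<phi> -` W)" by (rule continuous_open_preimage[OF smooth_on_continuous[OF phi(1)] A(1) assms(1)])
  moreover have "0 \<in> A \<inter> \<phi> -` W" using A phi assms by auto
  ultimately obtain d where d: "d > 0" "ball 0 d \<subseteq> A \<inter> \<phi> -` W" using openE by blast
  have K: "K > 0" by (simp add: K_def)
  define \<delta> where "\<delta> = min 1 (d / (1 + K))"
  have "\<delta> > 0" using d K by (simp add: \<delta>_def)
  then obtain \<xi> where e: "good \<xi>" "\<xi> < \<delta>" by (rule good_small)
  have e0: "\<xi> > 0" using e(1) by (simp add: good_def)
  have "\<xi> * (1 + K) < d" using e(2) K by (simp add: \<delta>_def field_simps)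
  moreover have "K * \<xi>\<^sup>2 \<le> K * \<xi>"
    using e(2) e0 K by (intro mult_left_mono) (auto simp: \<delta>_def power2_eq_square mult_left_le)
  ultimately have s: "\<xi> + K * \<xi>\<^sup>2 \<le> d" by (simp add: algebra_simps)
  have "box \<xi> \<subseteq> ball 0 d"
  proof
    fix x assume x: "x \<in> box \<xi>"
    have "norm x \<le> \<bar>x$1\<bar> + \<bar>x$2\<bar>" using norm_le_l1_cart[of x] by (simp add: sum_2)
    also have "\<dots> < \<xi> + K * \<xi>\<^sup>2" using x by (simp add: box_def)
    finally show "x \<in> ball 0 d" using s by simp
  qed
  then have "\<phi> ` box \<xi> \<subseteq> W" using d by blast
  then show ?thesis using e(1) that by blast
qed

section \<open>The curves of the front and of its dual as graphs\<close>

context flecnodal_box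
begin

lemma in_graph_iff: "x \<in> graph \<beta> \<longleftrightarrow> x \<in> box \<xi> \<and> x$2 = \<beta> (x$1)"
  by (auto simp: graph_def)

lemma box_small_coords: "x \<in> box \<xi> ==> \<bar>x$1\<bar> < r \<and> \<bar>x$2\<bar> < r"
  using eps by (auto simp: box_def)

lemma vec_coords: "vector [x$1, x$2] = (x :: real^2)"
  by (simp add: vec_eq_iff forall_2)

lemma flecnodal_eq_iff:
  assumes "x \<in> box \<xi>"
  shows "(\<exists>p. G1 x p = 0 \<and> G2 x p = 0) \<longleftrightarrow> x \<in> graph bt"
    and "G1 x p = 0 ==> G2 x p = 0 ==> p = \<pi> (x$1)"
    and "x \<in> graph bt ==> G1 x (\<pi> (x$1)) = 0 \<and> G2 x (\<pi> (x$1)) = 0"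
proof -
  note b = box_small_coords[OF assms]
  show "G1 x p = 0 ==> G2 x p = 0 ==> p = \<pi> (x$1)"
    using fl_uniq[of "x$1" "x$2" p] b by (simp add: vec_coords)
  show 3: "x \<in> graph bt ==> G1 x (\<pi> (x$1)) = 0 \<and> G2 x (\<pi> (x$1)) = 0"
    using fl_eq[of "x$1"] b vec_coords[of x] by (simp add: in_graph_iff)
  show "(\<exists>p. G1 x p = 0 \<and> G2 x p = 0) \<longleftrightarrow> x \<in> graph bt"
    using fl_uniq[of "x$1" "x$2"] b 3 assms by (auto simp: vec_coords in_graph_iff)
qed

lemma graph_bt_edge_fun:
  assumes "x \<in> graph bt" "x \<noteq> 0"
  shows "edge_fun x * q < 0" "x$1 \<noteq> 0"
proof -
  show 1: "x$1 \<noteq> 0" using assms bt0 by (auto simp: in_graph_iff vec_eq_iff forall_2)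
  have "\<bar>x$1\<bar> < \<xi>" using assms by (simp add: in_graph_iff box_def)
  then have "(bt (x$1) + 6 * (x$1)\<^sup>2) * q < 0" using good 1 by (auto simp: good_def)
  moreover have "edge_fun x * q = 2 * ((bt (x$1) + 6 * (x$1)\<^sup>2) * q)"
    using assms by (simp add: edge_fun_def in_graph_iff algebra_simps)
  ultimately show "edge_fun x * q < 0" by linarith
qed

lemma contact4_f:
  assumes x: "x \<in> box \<xi>" "edge_fun x \<noteq> 0"
  shows "line_contact U f (\<phi> x) 4 l \<longleftrightarrow> (\<exists>p. l = slope_line F x p \<and> G1 x p = 0 \<and> G2 x p = 0)"
proof -
  have xA: "x \<in> A" using x box_A by blast
  show ?thesis
    using line_contact_slope(2)[OF dp xA jac_nz[OF xA x(2)], of l] ga_nz[OF xA]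
    by (simp add: line_contact_phi[OF xA] II_edge[OF xA] II_G1[OF xA] III_G2[OF xA])
qed

text \<open>On the dual surface \<open>II\<close> is the same and \<open>III\<close> changes sign,
  so the flecnodal equations agree. The dual is immersed on all of \<open>A\<close>, which lets the
  origin be included.\<close>

lemma contact4_n:
  assumes x: "x \<in> box \<xi>"
  shows "(\<exists>l. line_contact U n (\<phi> x) 4 l) \<longleftrightarrow> x \<in> graph bt"
proof -
  have xA: "x \<in> A" using x box_A by blast
  have "line_contact A N x 4 l \<longleftrightarrow> (\<exists>p. l = slope_line N x p \<and> II N F x (vector [1, p]) (vector [1, p]) = 0 \<and> III N F x (vector [1, p]) = 0)" for l
    using line_contact_slope(2)[OF dual_pair_sym[OF dp] xA jac_N[OF xA], of l] ga_nz[OF xA]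
    by (simp add: II_swap[OF dp xA] II_edge[OF xA])
  moreover have "II N F x (vector [1, p]) (vector [1, p]) = G1 x p" "III N F x (vector [1, p]) = - G2 x p" for p
    by (simp_all add: II_swap[OF dp xA] II_G1[OF xA] III_swap[of N F] III_G2[OF xA])
  ultimately show ?thesis
    unfolding line_contact_phi(2)[OF xA] using flecnodal_eq_iff(1)[OF x] by auto
qed

text \<open>Contact is available off the edge only. The graph of \<open>bt\<close> meets the edge at
  the origin alone, and the outer closure in the definition restores this point.\<close>

lemma flecnodal_f: "flecnodal_curve U f \<inter> V = \<phi> ` graph bt"
proof -
  let ?S = "{u\<in>U. regular_at f u \<and> u \<in> closure (hyperbolic_domain U f) \<and> (\<exists>l. line_contact U f u 4 l)}"
  have "V \<inter> closure ?S = \<phi> ` graph bt"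
  proof (rule closure_graph[OF small_graph_bt])
    show "\<phi> ` (graph bt - {0}) \<subseteq> ?S"
    proof safe
      fix x assume x: "x \<in> graph bt" "x \<noteq> 0"
      have xb: "x \<in> box \<xi>" and xA: "x \<in> A" using x graph_subset box_A by blast+
      note e = graph_bt_edge_fun[OF x]
      have e': "edge_fun x \<noteq> 0" using e by auto
      show "\<phi> x \<in> U" by (rule phi_in_U[OF xA])
      show "regular_at f (\<phi> x)" using regular_f[OF xA] e' by simp
      show "\<phi> x \<in> closure (hyperbolic_domain U f)" using domains_f[OF xA] e closure_subset by blast
      show "\<exists>l. line_contact U f (\<phi> x) 4 l" using contact4_f[OF xb e'] flecnodal_eq_iff(3)[OF xb x(1)] by blast
    qed
    show "?S \<inter> V \<subseteq> \<phi> ` graph bt"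
    proof safe
      fix x l assume x: "x \<in> box \<xi>" "regular_at f (\<phi> x)" "line_contact U f (\<phi> x) 4 l"
      have "edge_fun x \<noteq> 0" using regular_f x(1,2) box_A by auto
      then show "\<phi> x \<in> \<phi> ` graph bt" using contact4_f[OF x(1)] x(3) flecnodal_eq_iff(1)[OF x(1)] by blast
    qed
  qed
  moreover have "flecnodal_curve U f \<inter> V = V \<inter> closure ?S"
    unfolding flecnodal_curve_def using V_U by auto
  ultimately show ?thesis by simp
qed

lemma flecnodal_n: "flecnodal_curve U n \<inter> V = \<phi> ` graph bt"
proof -
  let ?S = "{u\<in>U. regular_at n u \<and> u \<in> closure (hyperbolic_domain U n) \<and> (\<exists>l. line_contact U n u 4 l)}"
  have "V \<inter> closure ?S = \<phi> ` graph bt"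
  proof (rule closure_graph[OF small_graph_bt])
    show "\<phi> ` (graph bt - {0}) \<subseteq> ?S"
    proof safe
      fix x assume x: "x \<in> graph bt" "x \<noteq> 0"
      have xb: "x \<in> box \<xi>" and xA: "x \<in> A" using x graph_subset box_A by blast+
      note e = graph_bt_edge_fun[OF x]
      show "\<phi> x \<in> U" by (rule phi_in_U[OF xA])
      show "regular_at n (\<phi> x)" by (rule regular_n[OF xA])
      show "\<phi> x \<in> closure (hyperbolic_domain U n)" using domains_n[OF xA] e closure_subset by blast
      show "\<exists>l. line_contact U n (\<phi> x) 4 l" using contact4_n[OF xb] x(1) by blast
    qed
    show "?S \<inter> V \<subseteq> \<phi> ` graph bt" using contact4_n by auto
  qed
  moreover have "flecnodal_curve U n \<inter> V = V \<inter> closure ?S"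
    unfolding flecnodal_curve_def using V_U by auto
  ultimately show ?thesis by simp
qed

lemma edge_fun_graph: "x \<in> box \<xi> ==> edge_fun x = 0 \<longleftrightarrow> x \<in> graph (\<lambda>a. - 6 * a\<^sup>2)"
  by (auto simp: edge_fun_def in_graph_iff)

lemma edge_V: "cuspidal_edge U f \<inter> V = \<phi> ` graph (\<lambda>a. - 6 * a\<^sup>2)"
  using cuspidal_edge_phi edge_fun_graph box_A graph_subset by blast

lemma parabolic_n: "parabolic_curve U n \<inter> V = \<phi> ` graph (\<lambda>a. - 6 * a\<^sup>2)"
  using domains_n(2) edge_fun_graph box_A graph_subset by blast

text \<open>The partner of a double point is its mirror image in x1, which lies in the box because
  the box is symmetric.\<close>

lemma double_points:
  "{u\<in>V. \<exists>u'\<in>V. u' \<noteq> u \<and> same_point (f u) (f u')} = \<phi> ` (graph (\<lambda>a. - 2 * a\<^sup>2) - {0})"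
proof -
  have "(\<exists>u'\<in>V. u' \<noteq> \<phi> x \<and> same_point (f (\<phi> x)) (f u')) \<longleftrightarrow> x \<in> graph (\<lambda>a. - 2 * a\<^sup>2) - {0}"
    if x: "x \<in> box \<xi>" for x
  proof -
    have "(\<exists>u'\<in>V. u' \<noteq> \<phi> x \<and> same_point (f (\<phi> x)) (f u')) \<longleftrightarrow>
      (\<exists>y\<in>box \<xi>. \<phi> y \<noteq> \<phi> x \<and> same_point (F x) (F y))"
      unfolding F_eq by blast
    also have "\<dots> \<longleftrightarrow> (\<exists>y\<in>box \<xi>. y \<noteq> x \<and> swallowtail_model x = swallowtail_model y)"
    proof (rule bex_cong[OF refl])
      fix y assume "y \<in> box \<xi>"
      then have "x \<in> A" "y \<in> A" using x box_A by blast+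
      then show "(\<phi> y \<noteq> \<phi> x \<and> same_point (F x) (F y)) = (y \<noteq> x \<and> swallowtail_model x = swallowtail_model y)"
        by (simp add: phi_eq_iff same_iff)
    qed
    also have "\<dots> \<longleftrightarrow> (\<exists>y\<in>box \<xi>. y \<noteq> x \<and> x$1 \<noteq> 0 \<and> y$1 = - x$1 \<and> x$2 = - 2 * (x$1)\<^sup>2 \<and> y$2 = x$2)"
    proof (rule bex_cong[OF refl], rule conj_cong[OF refl])
      fix y assume "y \<noteq> x"
      then show "(swallowtail_model x = swallowtail_model y) =
        (x$1 \<noteq> 0 \<and> y$1 = - x$1 \<and> x$2 = - 2 * (x$1)\<^sup>2 \<and> y$2 = x$2)"
        by (intro swallowtail_model_eq) simp
    qed
    also have "\<dots> \<longleftrightarrow> x \<in> graph (\<lambda>a. - 2 * a\<^sup>2) - {0}"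
    proof
      assume r: "x \<in> graph (\<lambda>a. - 2 * a\<^sup>2) - {0}"
      then have e: "x$2 = - 2 * (x$1)\<^sup>2" "x$1 \<noteq> 0" by (auto simp: in_graph_iff vec_eq_iff forall_2)
      have "vector [- x$1, x$2] \<in> box \<xi>" using x by (simp add: box_def)
      moreover have "vector [- x$1, x$2] \<noteq> x" using e(2) by (auto simp: vec_eq_iff forall_2)
      ultimately show "\<exists>y\<in>box \<xi>. y \<noteq> x \<and> x$1 \<noteq> 0 \<and> y$1 = - x$1 \<and> x$2 = - 2 * (x$1)\<^sup>2 \<and> y$2 = x$2"
        using e by (intro bexI[of _ "vector [- x$1, x$2]"]) auto
    qed (use x in \<open>auto simp: in_graph_iff\<close>)
    finally show ?thesis .
  qed
  then show ?thesis using graph_subset by blast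
qed

lemma self_V: "self_intersection V f = \<phi> ` graph (\<lambda>a. - 2 * a\<^sup>2)"
  unfolding self_intersection_def double_points
  by (rule closure_graph[OF small_graph_square]) auto

text \<open>Biduality: the planes tangent to the front near a point sweep out a surface whose
  tangent plane consists of the planes through that point. Equality holds because \<open>N\<close>,
  its two derivatives and \<open>F\<close> form a basis.\<close>

lemma tangent_plane_n:
  assumes x: "x \<in> A" shows "tangent_plane n (\<phi> x) = {z. z \<bullet> f (\<phi> x) = 0}"
proof
  have sub: "subspace {z. z \<bullet> f (\<phi> x) = 0}" by (simp add: subspace_def inner_add_left)
  have ns: "n (\<phi> x) \<bullet> f (\<phi> x) = 0" using NF(1)[OF x] by (simp add: F_eq N_eq)
  have dn: "pd n w (\<phi> x) \<bullet> f (\<phi> x) = 0" for w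
  proof -
    obtain v where "w = pd \<phi> v x" using bij_is_surj[OF pd_phi_bij[OF x]] by (rule surjE)
    then show ?thesis using NF(3)[OF x, of v] pd_compose_phi[OF U(3) x, of v] by (simp add: F_eq N_eq)
  qed
  show "tangent_plane n (\<phi> x) \<subseteq> {z. z \<bullet> f (\<phi> x) = 0}"
    unfolding tangent_plane_def by (rule span_minimal[OF _ sub]) (use ns dn in \<open>auto simp: pd_def\<close>)
  show "{z. z \<bullet> f (\<phi> x) = 0} \<subseteq> tangent_plane n (\<phi> x)"
  proof safe
    fix z assume z: "z \<bullet> f (\<phi> x) = 0"
    obtain i j k l where e: "z = i *\<^sub>R N x + j *\<^sub>R pd N e1 x + k *\<^sub>R pd N e2 x + l *\<^sub>R F x"
      using det4_expand[OF jac_N[OF x, unfolded jac_def]] by blast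
    have "l * (F x \<bullet> F x) = 0" using z NF[OF x] unfolding e by (simp add: inner_add_left F_eq[symmetric] fun_cong[OF F_eq, symmetric])
    then have l: "l = 0" using dp x by (auto simp: dual_pair_def)
    have N: "pd N v x = frechet_derivative n (at (\<phi> x)) (pd \<phi> v x)" for v
      using pd_compose_phi[OF U(3) x, of v] by (simp add: N_eq pd_def[of n])
    have "z = i *\<^sub>R n (\<phi> x) + j *\<^sub>R pd N e1 x + k *\<^sub>R pd N e2 x" by (simp add: e l N_eq)
    then show "z \<in> tangent_plane n (\<phi> x)"
      unfolding tangent_plane_def N by (simp only:, intro span_add span_mul span_base) auto
  qed
qed

lemma orthogonal_planes_eq:
  fixes a b :: "real^4"
  assumes "a \<noteq> 0" "b \<noteq> 0"
  shows "{z. z \<bullet> a = 0} = {z. z \<bullet> b = 0} \<longleftrightarrow> same_point a b"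
proof
  assume e: "{z. z \<bullet> a = 0} = {z. z \<bullet> b = 0}"
  define k where "k = (b \<bullet> a) / (a \<bullet> a)"
  have "(b - k *\<^sub>R a) \<bullet> a = 0" using assms by (simp add: k_def inner_diff_left)
  then have 1: "(b - k *\<^sub>R a) \<bullet> a = 0" "(b - k *\<^sub>R a) \<bullet> b = 0" using e by blast+
  then have "(b - k *\<^sub>R a) \<bullet> (b - k *\<^sub>R a) = 0" by (simp add: inner_diff_right)
  then have "b = k *\<^sub>R a" by simp
  then show "same_point a b" using assms unfolding same_point_def by (intro exI[of _ k]) auto
qed (auto simp: same_point_def)

text \<open>A plane tangent to the dual surface at two points is a double point of the front; that
  the two points of contact differ is the injectivity contained in
  \<open>legendrian\<close>.\<close>

lemma conodal_V: "conodal_curve V n = \<phi> ` graph (\<lambda>a. - 2 * a\<^sup>2)"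
proof -
  have "{u\<in>V. \<exists>u'\<in>V. \<not> same_point (n u) (n u') \<and> tangent_plane n u = tangent_plane n u'} =
     {u\<in>V. \<exists>u'\<in>V. u' \<noteq> u \<and> same_point (f u) (f u')}"
  proof (rule Collect_cong, rule conj_cong[OF refl], rule bex_cong[OF refl])
    fix u u' assume u: "u \<in> V" "u' \<in> V"
    then obtain x x' where x: "u = \<phi> x" "u' = \<phi> x'" "x \<in> A" "x' \<in> A" using box_A by blast
    have nz: "f u \<noteq> 0" "f u' \<noteq> 0" using dp x by (auto simp: dual_pair_def F_eq)
    have "tangent_plane n u = tangent_plane n u' \<longleftrightarrow> same_point (f u) (f u')"
      using tangent_plane_n x orthogonal_planes_eq[OF nz] by simp
    moreover have "same_point (f u) (f u') \<and> same_point (n u) (n u') ==> u = u'"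
      using leg u V_U by (auto simp: legendrian_def subset_iff)
    moreover have "same_point (n u) (n u)" by (auto simp: same_point_def intro: exI[of _ 1])
    ultimately show "(\<not> same_point (n u) (n u') \<and> tangent_plane n u = tangent_plane n u') =
      (u' \<noteq> u \<and> same_point (f u) (f u'))" by auto
  qed
  then show ?thesis using self_V by (simp add: conodal_curve_def self_intersection_def)
qed

section \<open>The two sides of the cuspidal edge\<close>

definition upper where "upper = {x\<in>box \<xi>. x$2 > - 6 * (x$1)\<^sup>2}"
definition lower where "lower = {x\<in>box \<xi>. x$2 < - 6 * (x$1)\<^sup>2}"

lemma K6: "\<bar>a\<bar> < \<xi> ==> 6 * a\<^sup>2 < K * \<xi>\<^sup>2"
  using small_graph_square[of "-6"] by (auto simp: small_graph_def)

lemma upper_lower: "open upper" "open lower" "connected upper" "connected lower" "upper \<inter> lower = {}"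
  "vector [0, K * \<xi>\<^sup>2 / 2] \<in> upper" "vector [0, - (K * \<xi>\<^sup>2) / 2] \<in> lower"
proof -
  show "open upper" "open lower"
    unfolding upper_def lower_def box_def mem_Collect_eq
    by (intro open_Collect_conj open_Collect_less continuous_intros)+
  have "upper = {x. \<bar>x$1\<bar> < \<xi> \<and> - 6 * (x$1)\<^sup>2 < x$2 \<and> x$2 < K * \<xi>\<^sup>2}"
    unfolding upper_def box_def mem_Collect_eq
  proof (rule Collect_cong)
    fix x :: "real^2"
    show "((\<bar>x$1\<bar> < \<xi> \<and> \<bar>x$2\<bar> < K * \<xi>\<^sup>2) \<and> - 6 * (x$1)\<^sup>2 < x$2) =
      (\<bar>x$1\<bar> < \<xi> \<and> - 6 * (x$1)\<^sup>2 < x$2 \<and> x$2 < K * \<xi>\<^sup>2)"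
      using K6[of "x$1"] by (smt (verit))
  qed
  moreover have "connected {x::real^2. \<bar>x$1\<bar> < \<xi> \<and> - 6 * (x$1)\<^sup>2 < x$2 \<and> x$2 < K * \<xi>\<^sup>2}"
  proof (rule connected_between_graphs[where lo="\<lambda>a. - 6 * a\<^sup>2" and hi="\<lambda>a. K * \<xi>\<^sup>2"])
    show "- 6 * a\<^sup>2 < K * \<xi>\<^sup>2" for a :: real
    proof -
      have "K * \<xi>\<^sup>2 > 0" using eps by simp
      then show ?thesis using zero_le_power2[of a] by linarith
    qed
  qed (intro continuous_intros)+
  ultimately show "connected upper" by simp
  have "lower = {x. \<bar>x$1\<bar> < \<xi> \<and> - (K * \<xi>\<^sup>2) < x$2 \<and> x$2 < - 6 * (x$1)\<^sup>2}"
  proof -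
    have "x$2 < K * \<xi>\<^sup>2" if "x$2 < - 6 * (x$1)\<^sup>2" for x :: "real^2"
    proof -
      have "K * \<xi>\<^sup>2 > 0" using eps by simp
      moreover have "(x$1)\<^sup>2 \<ge> 0" by simp
      ultimately show ?thesis using that by linarith
    qed
    then show ?thesis by (auto simp: lower_def box_def abs_less_iff)
  qed
  moreover have "connected {x::real^2. \<bar>x$1\<bar> < \<xi> \<and> - (K * \<xi>\<^sup>2) < x$2 \<and> x$2 < - 6 * (x$1)\<^sup>2}"
    by (rule connected_between_graphs[where hi="\<lambda>a. - 6 * a\<^sup>2" and lo="\<lambda>a. - (K * \<xi>\<^sup>2)"])
       (use K6 in \<open>auto intro!: continuous_intros\<close>)
  ultimately show "connected lower" by simp
  show "upper \<inter> lower = {}" by (auto simp: upper_def lower_def)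
  show "vector [0, K * \<xi>\<^sup>2 / 2] \<in> upper" "vector [0, - (K * \<xi>\<^sup>2) / 2] \<in> lower"
    using eps by (auto simp: upper_def lower_def box_def)
qed

lemma upper_lower_box: "upper \<subseteq> box \<xi>" "lower \<subseteq> box \<xi>"
  by (auto simp: upper_def lower_def)

lemma phi_upper_lower: "\<phi> ` upper \<inter> \<phi> ` lower = {}"
proof -
  have "\<phi> ` upper \<inter> \<phi> ` lower = \<phi> ` (upper \<inter> lower)"
    by (rule inj_on_image_Int[OF phi_inj, symmetric]) (use upper_lower_box box_A in auto)
  then show ?thesis by (simp add: upper_lower(5))
qed

lemma components_V: "components (V - cuspidal_edge U f) = {\<phi> ` upper, \<phi> ` lower}"
proof (rule components_two)
  have "box \<xi> - graph (\<lambda>a. - 6 * a\<^sup>2) = upper \<union> lower"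
    by (auto simp: in_graph_iff upper_def lower_def)
  moreover have "V - cuspidal_edge U f = \<phi> ` (box \<xi> - graph (\<lambda>a. - 6 * a\<^sup>2))"
    using edge_V phi_eq_iff box_A graph_subset by blast
  ultimately show "V - cuspidal_edge U f = \<phi> ` upper \<union> \<phi> ` lower" by auto
  show "open (\<phi> ` upper)" "open (\<phi> ` lower)"
    using upper_lower upper_lower_box box_A by (auto intro!: open_phi_image)
  show "connected (\<phi> ` upper)" "connected (\<phi> ` lower)"
    using upper_lower upper_lower_box box_A
    by (auto intro!: connected_continuous_image continuous_on_subset[OF smooth_on_continuous[OF phi(1)]])
  show "\<phi> ` upper \<noteq> {}" "\<phi> ` lower \<noteq> {}" using upper_lower by auto
  show "\<phi> ` upper \<inter> \<phi> ` lower = {}" by (rule phi_upper_lower)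
qed

lemma graph_D_point: "vector [\<xi> / 2, - 2 * (\<xi> / 2)\<^sup>2] \<in> graph (\<lambda>a. - 2 * a\<^sup>2) - {0}"
proof -
  have "(vector [\<xi> / 2, - 2 * (\<xi> / 2)\<^sup>2] :: real^2) $ 1 \<noteq> 0" using eps by simp
  then have "(vector [\<xi> / 2, - 2 * (\<xi> / 2)\<^sup>2] :: real^2) \<noteq> 0" by (metis zero_index)
  moreover have "vector [\<xi> / 2, - 2 * (\<xi> / 2)\<^sup>2] \<in> graph (\<lambda>a. - 2 * a\<^sup>2)"
    by (rule graph_mem[OF small_graph_square]) (use eps in auto)
  ultimately show ?thesis by blast
qed

lemma graph_D_upper: "graph (\<lambda>a. - 2 * a\<^sup>2) - {0} \<subseteq> upper"
proof
  fix x assume "x \<in> graph (\<lambda>a. - 2 * a\<^sup>2) - {0}"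
  then have x: "x \<in> graph (\<lambda>a. - 2 * a\<^sup>2)" "x \<noteq> 0" by blast+
  then have "x$1 \<noteq> 0" by (auto simp: in_graph_iff vec_eq_iff forall_2)
  then show "x \<in> upper" using x by (simp add: in_graph_iff upper_def)
qed

lemma phi_minus_s: "B \<subseteq> A ==> \<phi> ` B - {s} = \<phi> ` (B - {0})"
  using phi_eq_iff[OF _ A(2)] phi(2) by auto

lemma self_minus: "self_intersection V f - {s} = \<phi> ` (graph (\<lambda>a. - 2 * a\<^sup>2) - {0})"
  unfolding self_V using graph_subset box_A by (intro phi_minus_s) blast

text \<open>The self-intersection line x2 = -2 x1^2 runs above the edge x2 = -6 x1^2, so the small
  domain is the side below.\<close>

lemma small_domain_V: "small_domain U f V = \<phi> ` lower"
proof -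
  note m = graph_D_point
  have "\<phi> ` upper \<inter> self_intersection V f \<noteq> {}"
    using m graph_D_upper unfolding self_V by blast
  moreover have "\<phi> ` lower \<inter> self_intersection V f = {}"
  proof -
    have "x \<notin> lower" if "x \<in> graph (\<lambda>a. - 2 * a\<^sup>2)" for x
      using that zero_le_power2[of "x$1"] unfolding in_graph_iff lower_def by simp
    then show ?thesis unfolding self_V using upper_lower_box graph_subset box_A phi_eq_iff by blast
  qed
  ultimately show ?thesis unfolding small_domain_def components_V by auto
qed

text \<open>The factors \<open>1 *\<close> keep the parametrisations of the edge and of the
  self-intersection line in the very form of \<open>parametrises_graph\<close> with \<sigma> =
  1.\<close>

lemma local_picture_V:
  assumes \<sigma>: "\<sigma> = 1 \<or> \<sigma> = (-1::real)"
  shows "local_picture U f s V (\<lambda>t. \<phi> (vector [1 * \<xi> * t, - 6 * (1 * \<xi> * t)\<^sup>2]))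
    (\<lambda>t. \<phi> (vector [\<sigma> * \<xi> * t, bt (\<sigma> * \<xi> * t)])) (\<lambda>t. \<phi> (vector [1 * \<xi> * t, - 2 * (1 * \<xi> * t)\<^sup>2]))"
  unfolding local_picture_def
proof (intro conjI)
  show "open V" "s \<in> V" "V \<subseteq> U" by (rule V_open s_V V_U)+
  show "parametrises (\<lambda>t. \<phi> (vector [1 * \<xi> * t, - 6 * (1 * \<xi> * t)\<^sup>2])) (cuspidal_edge U f \<inter> V) s"
    unfolding edge_V by (rule parametrises_graph[OF small_graph_square]) auto
  show "parametrises (\<lambda>t. \<phi> (vector [\<sigma> * \<xi> * t, bt (\<sigma> * \<xi> * t)])) (flecnodal_curve U f \<inter> V) s"
    unfolding flecnodal_f by (rule parametrises_graph[OF small_graph_bt \<sigma>])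
  show "parametrises (\<lambda>t. \<phi> (vector [1 * \<xi> * t, - 2 * (1 * \<xi> * t)\<^sup>2])) (self_intersection V f) s"
    unfolding self_V by (rule parametrises_graph[OF small_graph_square]) auto
  have "\<phi> ` upper \<noteq> \<phi> ` lower"
    using phi_upper_lower upper_lower(6) by (metis Int_absorb empty_iff imageI)
  then show "card (components (V - cuspidal_edge U f)) = 2" unfolding components_V by simp
  show "\<exists>B\<in>components (V - cuspidal_edge U f). self_intersection V f - {s} \<subseteq> B"
    unfolding components_V self_minus by (intro bexI[of _ "\<phi> ` upper"] image_mono graph_D_upper) simp
qed

text \<open>\<open>edge_fun\<close> is positive on the punctured self-intersection line, so the sign
  of \<open>q\<close> decides its domain. The third claim serves the converse, where this sign is
  read off at a double point.\<close>

lemma self_domains: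
  shows "q < 0 ==> self_intersection V f - {s} \<subseteq> hyperbolic_domain U f"
    and "q > 0 ==> self_intersection V f - {s} \<subseteq> elliptic_domain U f"
    and "\<exists>x\<in>A. \<phi> x \<in> self_intersection V f - {s} \<and> edge_fun x > 0"
proof -
  have e: "edge_fun x > 0" if "x \<in> graph (\<lambda>a. - 2 * a\<^sup>2) - {0}" for x
    using graph_D_upper that by (auto simp: upper_def edge_fun_def)
  have g: "graph (\<lambda>a. - 2 * a\<^sup>2) \<subseteq> A" using graph_subset box_A by blast
  show "self_intersection V f - {s} \<subseteq> hyperbolic_domain U f" if "q < 0"
    unfolding self_minus
  proof (rule image_subsetI)
    fix x assume x: "x \<in> graph (\<lambda>a. - 2 * a\<^sup>2) - {0}"
    then have "x \<in> A" using g by blast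
    then show "\<phi> x \<in> hyperbolic_domain U f" using domains_f(1) mult_pos_neg[OF e[OF x] that] by blast
  qed
  show "self_intersection V f - {s} \<subseteq> elliptic_domain U f" if "q > 0"
    unfolding self_minus
  proof (rule image_subsetI)
    fix x assume x: "x \<in> graph (\<lambda>a. - 2 * a\<^sup>2) - {0}"
    then have "x \<in> A" using g by blast
    then show "\<phi> x \<in> elliptic_domain U f" using domains_f(2) mult_pos_pos[OF e[OF x] that] by blast
  qed
  note m = graph_D_point
  show "\<exists>x\<in>A. \<phi> x \<in> self_intersection V f - {s} \<and> edge_fun x > 0"
    unfolding self_minus using e[OF m] m g by blast
qed

end

lemma self_intersection_mono: "V \<subseteq> V' ==> self_intersection V f \<subseteq> self_intersection V' f"
proof -
  assume v: "V \<subseteq> V'"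
  then have "{u\<in>V. \<exists>u'\<in>V. u' \<noteq> u \<and> same_point (f u) (f u')} \<subseteq> {u\<in>V'. \<exists>u'\<in>V'. u' \<noteq> u \<and> same_point (f u) (f u')}"
    by blast
  from closure_mono[OF this] v show ?thesis unfolding self_intersection_def by blast
qed

section \<open>The type of the swallowtail\<close>

context flecnodal_chart
begin

text \<open>The neighbourhood in the definitions is arbitrary. A box inside it still contains double
  points, and the domain in which such a point lies determines the sign of \<open>q\<close>.\<close>

lemma swallowtail_type:
  "hyperbolic_swallowtail U f s \<longleftrightarrow> q < 0" "elliptic_swallowtail U f s \<longleftrightarrow> q > 0"
proof -
  have sU: "s \<in> U" using phi(2) phi_in_U[OF A(2)] by simp
  obtain \<xi> where g: "good \<xi>" using box_small[OF open_UNIV] by blast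
  interpret flecnodal_box U f n s A \<phi> \<psi> F N h \<mu> r bt \<pi> \<xi> by unfold_locales (rule g)
  have pt: "\<exists>x\<in>A. \<phi> x \<in> self_intersection V' f - {s} \<and> edge_fun x > 0" if V': "open V'" "s \<in> V'" for V'
  proof -
    obtain \<xi>' where g': "good \<xi>'" "\<phi> ` box \<xi>' \<subseteq> V'" using box_small[OF V'] by blast
    interpret b: flecnodal_box U f n s A \<phi> \<psi> F N h \<mu> r bt \<pi> \<xi>' by unfold_locales (rule g')
    obtain x where "x \<in> A" "\<phi> x \<in> self_intersection (\<phi> ` box \<xi>') f - {s}" "edge_fun x > 0"
      using b.self_domains(3) by blast
    then show ?thesis using self_intersection_mono[OF g'(2), of f] by blast
  qed
  show "hyperbolic_swallowtail U f s \<longleftrightarrow> q < 0"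
  proof
    assume "hyperbolic_swallowtail U f s"
    then obtain V' where V': "open V'" "s \<in> V'" "self_intersection V' f - {s} \<subseteq> hyperbolic_domain U f"
      by (auto simp: hyperbolic_swallowtail_def)
    then obtain x where "x \<in> A" "\<phi> x \<in> hyperbolic_domain U f" "edge_fun x > 0" using pt by blast
    then show "q < 0" using domains_f(1) by (auto simp: mult_less_0_iff)
  next
    assume "q < 0"
    then show "hyperbolic_swallowtail U f s"
      unfolding hyperbolic_swallowtail_def using swt self_domains(1) V_open s_V V_U
      by (intro conjI exI[of _ V]) simp_all
  qed
  show "elliptic_swallowtail U f s \<longleftrightarrow> q > 0"
  proof
    assume "elliptic_swallowtail U f s"
    then obtain V' where V': "open V'" "s \<in> V'" "self_intersection V' f - {s} \<subseteq> elliptic_domain U f"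
      by (auto simp: elliptic_swallowtail_def)
    then obtain x where "x \<in> A" "\<phi> x \<in> elliptic_domain U f" "edge_fun x > 0" using pt by blast
    then show "q > 0" using domains_f(2) by (auto simp: zero_less_mult_iff)
  next
    assume "q > 0"
    then show "elliptic_swallowtail U f s"
      unfolding elliptic_swallowtail_def using swt self_domains(2) V_open s_V V_U
      by (intro conjI exI[of _ V]) simp_all
  qed
qed

end

section \<open>A scalar differential equation\<close>

text \<open>The derivative is half the reciprocal of the root, which the induction hypothesis
  covers. This makes the roots of \<open>G1\<close> smooth in the hyperbolic domain.\<close>

lemma smooth_on_sqrt: "smooth_on {0<..} sqrt"
  unfolding smooth_on_def
proof
  fix k show "Ck_on k sqrt {0<..}"
  proof (induction k)
    case 0
    then show ?case by (auto intro: continuous_intros)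
  next
    case (Suc k)
    show ?case
    proof (rule Ck_on_SucI[where f'="\<lambda>x v. inverse (sqrt x) * (v / 2)"])
      show "(sqrt has_derivative (\<lambda>v. inverse (sqrt x) * (v / 2))) (at x)" if "x \<in> {0<..}" for x
      proof -
        have "(\<lambda>v. inverse (sqrt x) * (v / 2)) = (*) (inverse (sqrt x) / 2)" by (simp add: fun_eq_iff)
        then show ?thesis using DERIV_real_sqrt[of x] that by (simp add: has_field_derivative_def)
      qed
      show "Ck_on k (\<lambda>x. inverse (sqrt x) * (v / 2)) {0<..}" for v
        by (intro Ck_on_bilinear[OF _ bounded_bilinear_mult] Ck_on_inverse Ck_on_const Suc) auto
    qed simp
  qed
qed

text \<open>The right hand side is made globally bounded and Lipschitz by clamping its arguments, so that
  the Picard operator is a contraction of the space of all bounded continuous functions.\<close>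
theorem scalar_ode_solution:
  fixes P :: "real^2 => real"
  assumes W: "open W" "vector [a0, b0] \<in> W" and P: "smooth_on W P"
  obtains e y where "e > 0" "smooth_on {-e<..<e} y" "y 0 = b0"
    "\<And>t. t \<in> {-e<..<e} ==> vector [a0 + t, y t] \<in> W"
    "\<And>t. t \<in> {-e<..<e} ==> (y has_real_derivative P (vector [a0 + t, y t])) (at t)"
proof -
  define u where "u = e1"
  define w where "w = e2"
  have veq: "vector [a, b] = a *\<^sub>R u + b *\<^sub>R w" for a b :: real
    by (simp add: u_def w_def vec_eq_iff forall_2)
  obtain d where d: "d > 0" "ball (vector [a0, b0]) d \<subseteq> W" using W openE by blast
  define \<delta> where "\<delta> = d / 3"
  have \<delta>: "\<delta> > 0" using d by (simp add: \<delta>_def)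
  define Q where "Q = cbox (vector [a0 - \<delta>, b0 - \<delta>]) (vector [a0 + \<delta>, b0 + \<delta>] :: real^2)"
  have inQ: "vector [a, b] \<in> Q \<longleftrightarrow> \<bar>a - a0\<bar> \<le> \<delta> \<and> \<bar>b - b0\<bar> \<le> \<delta>" for a b
    by (auto simp: Q_def mem_box_cart forall_2)
  have QW: "Q \<subseteq> W"
  proof
    fix x assume x: "x \<in> Q"
    have "norm (x - vector [a0, b0]) \<le> \<bar>x$1 - a0\<bar> + \<bar>x$2 - b0\<bar>"
      using norm_le_l1_cart[of "x - vector [a0, b0]"] by (simp add: sum_2)
    also have "\<dots> \<le> \<delta> + \<delta>" using x by (auto simp: Q_def mem_box_cart forall_2 abs_le_iff intro!: add_mono)
    also have "\<dots> < d" using d by (simp add: \<delta>_def)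
    finally show "x \<in> W" using d(2) by (auto simp: dist_norm norm_minus_commute)
  qed
  have "compact Q" by (simp add: Q_def)
  have "bounded (P ` Q)"
    by (intro compact_imp_bounded compact_continuous_image[OF _ \<open>compact Q\<close>]
        continuous_on_subset[OF smooth_on_continuous[OF P] QW])
  then obtain M where M: "M > 0" "\<And>x. x \<in> Q ==> \<bar>P x\<bar> \<le> M"
    unfolding bounded_pos by (metis imageI real_norm_def)
  have "bounded (pd P w ` Q)"
    by (intro compact_imp_bounded compact_continuous_image[OF _ \<open>compact Q\<close>]
        continuous_on_subset[OF smooth_on_continuous[OF smooth_on_pd[OF P]] QW])
  then obtain L where L: "L > 0" "\<And>x. x \<in> Q ==> \<bar>pd P w x\<bar> \<le> L"
    unfolding bounded_pos by (metis imageI real_norm_def)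
  have lip: "\<bar>P (vector [a, b]) - P (vector [a, b'])\<bar> \<le> L * \<bar>b - b'\<bar>"
    if "\<bar>a - a0\<bar> \<le> \<delta>" "\<bar>b - b0\<bar> \<le> \<delta>" "\<bar>b' - b0\<bar> \<le> \<delta>" for a b b'
  proof -
    have "norm (P (vector [a, b]) - P (vector [a, b'])) \<le> L * norm (b - b')"
    proof (rule field_differentiable_bound[where S="{b0 - \<delta>..b0 + \<delta>}" and f'="\<lambda>b. pd P w (vector [a, b])"])
      fix z assume z: "z \<in> {b0 - \<delta>..b0 + \<delta>}"
      then have zQ: "vector [a, z] \<in> Q" using that(1) by (auto simp: inQ abs_le_iff)
      then have "a *\<^sub>R u + z *\<^sub>R w \<in> W" using QW by (auto simp: veq)
      from has_real_derivative_along[OF P this]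
      show "((\<lambda>b. P (vector [a, b])) has_field_derivative pd P w (vector [a, z])) (at z within {b0 - \<delta>..b0 + \<delta>})"
        unfolding veq by (rule has_field_derivative_at_within)
      show "norm (pd P w (vector [a, z])) \<le> L" using L(2)[OF zQ] by simp
    qed (use that in \<open>auto simp: abs_le_iff\<close>)
    then show ?thesis by simp
  qed
  define cl where "cl b = max (b0 - \<delta>) (min (b0 + \<delta>) b)" for b
  have cl: "\<bar>cl b - b0\<bar> \<le> \<delta>" "\<bar>cl b - cl b'\<bar> \<le> \<bar>b - b'\<bar>" "\<bar>b - b0\<bar> \<le> \<delta> ==> cl b = b" for b b'
    using \<delta> by (auto simp: cl_def)
  \<comment> \<open>The first bound keeps the time interval in \<open>Q\<close>, the second makes
    the Picard operator a contraction with factor 1/2, the third keeps its values within \<delta> of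
    \<open>b0\<close>. The factors 8 and 4 arise because two integrals over length at most
    \<open>2 * e\<close> are involved.\<close>
  define e where "e = min \<delta> (min (1 / (8 * L)) (\<delta> / (4 * M)))"
  have e: "e > 0" "e \<le> \<delta>" "e \<le> 1 / (8 * L)" "e \<le> \<delta> / (4 * M)" using \<delta> M L by (auto simp: e_def)
  have eL: "8 * (e * L) \<le> 1" and eM: "4 * (e * M) \<le> \<delta>"
    using e(3,4) L(1) M(1) by (simp_all add: field_simps)
  define \<tau> where "\<tau> t = max (- e) (min e t)" for t
  have \<tau>: "\<tau> t \<in> {-e..e}" "t \<in> {-e..e} ==> \<tau> t = t" for t using e by (auto simp: \<tau>_def)
  define g where "g y s = P (vector [a0 + \<tau> s, cl (apply_bcontfun y s)])" for y :: "real \<Rightarrow>\<^sub>C real" and s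
  have gQ: "vector [a0 + \<tau> s, cl (apply_bcontfun y s)] \<in> Q" for y s
    using \<tau>(1)[of s] cl(1) e(2) by (auto simp: inQ abs_le_iff)
  have cg: "continuous_on S (g y)" for S y
    unfolding g_def veq
  proof (rule continuous_on_compose2[OF smooth_on_continuous[OF P]])
    show "continuous_on S (\<lambda>s. (a0 + \<tau> s) *\<^sub>R u + cl (apply_bcontfun y s) *\<^sub>R w)"
      unfolding \<tau>_def cl_def
      by (intro continuous_intros continuous_on_apply_bcontfun)
    show "(\<lambda>s. (a0 + \<tau> s) *\<^sub>R u + cl (apply_bcontfun y s) *\<^sub>R w) ` S \<subseteq> W"
      using gQ QW by (auto simp: veq[symmetric])
  qed
  have gM: "\<bar>g y s\<bar> \<le> M" for y s unfolding g_def by (rule M(2)[OF gQ])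
  have gint: "g y integrable_on {-e..t}" for y t
    by (rule integrable_continuous_real[OF cg])
  \<comment> \<open>The difference of two integrals from \<open>-e\<close> is the oriented integral
    from 0 to \<open>\<tau> t\<close>, whatever the sign of \<open>t\<close>.\<close>
  define I where "I y t = b0 + (integral {-e..\<tau> t} (g y) - integral {-e..0} (g y))" for y t
  have len: "\<tau> t + e \<le> 2 * e" "\<tau> t + e \<ge> 0" for t using \<tau>(1)[of t] by auto
  have int_bound: "\<bar>integral {-e..t} k\<bar> \<le> 2 * e * B" if "\<And>s. \<bar>k s\<bar> \<le> B" "continuous_on UNIV k" "-e \<le> t" "t \<le> e" "B \<ge> 0" for k :: "real => real" and t B
  proof -
    have "norm (integral {-e..t} k) \<le> B * (t - (-e))"
      by (rule integral_bound) (use that in \<open>auto intro: continuous_on_subset\<close>)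
    also have "\<dots> \<le> B * (2 * e)" using that by (intro mult_left_mono) auto
    finally show ?thesis by (simp add: mult_ac)
  qed
  have Ib: "\<bar>I y t - b0\<bar> \<le> \<delta>" for y t
  proof -
    have "\<bar>integral {-e..\<tau> t} (g y)\<bar> \<le> 2 * e * M" "\<bar>integral {-e..0} (g y)\<bar> \<le> 2 * e * M"
      using \<tau>(1)[of t] e(1) M(1) by (auto intro!: int_bound gM cg)
    then have "\<bar>I y t - b0\<bar> \<le> 4 * (e * M)" unfolding I_def by linarith
    then show ?thesis using eM by linarith
  qed
  have Ic: "continuous_on UNIV (I y)" for y
  proof -
    have "continuous_on {-e..e} (\<lambda>t. integral {-e..t} (g y))"
      by (rule indefinite_integral_continuous_1[OF gint])
    then have "continuous_on UNIV (\<lambda>t. integral {-e..\<tau> t} (g y))"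
      by (rule continuous_on_compose2) (use \<tau>(1) in \<open>auto simp: \<tau>_def intro!: continuous_intros\<close>)
    then show ?thesis unfolding I_def by (intro continuous_intros)
  qed
  have Ibc: "I y \<in> bcontfun" for y
  proof (rule bcontfun_normI[OF Ic])
    show "norm (I y t) \<le> \<delta> + \<bar>b0\<bar>" for t using Ib[of y t] by simp
  qed
  define T where "T y = Bcontfun (I y)" for y
  have T: "apply_bcontfun (T y) = I y" for y unfolding T_def by (rule Bcontfun_inverse[OF Ibc])
  have contr: "dist (T y) (T z) \<le> (1/2) * dist y z" for y z
  proof (rule dist_bound)
    fix t
    have k: "\<bar>g y s - g z s\<bar> \<le> L * dist y z" for s
    proof -
      have "\<bar>g y s - g z s\<bar> \<le> L * \<bar>cl (apply_bcontfun y s) - cl (apply_bcontfun z s)\<bar>"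
        unfolding g_def using gQ[of s y] gQ[of s z] by (intro lip) (auto simp: inQ)
      also have "\<dots> \<le> L * dist (apply_bcontfun y s) (apply_bcontfun z s)"
        using cl(2) L(1) by (intro mult_left_mono) (auto simp: dist_real_def)
      also have "\<dots> \<le> L * dist y z"
        using L(1) dist_bounded[of y s z] by (intro mult_left_mono) auto
      finally show ?thesis .
    qed
    have c: "continuous_on S (\<lambda>s. g y s - g z s)" for S by (intro continuous_intros cg)
    have "\<bar>integral {-e..\<tau> t} (\<lambda>s. g y s - g z s)\<bar> \<le> 2 * e * (L * dist y z)"
      "\<bar>integral {-e..0} (\<lambda>s. g y s - g z s)\<bar> \<le> 2 * e * (L * dist y z)"
      using \<tau>(1)[of t] e(1) L(1) by (auto intro!: int_bound k c)
    moreover have "I y t - I z t = integral {-e..\<tau> t} (\<lambda>s. g y s - g z s) - integral {-e..0} (\<lambda>s. g y s - g z s)"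
      unfolding I_def integral_diff[OF gint gint] by simp
    ultimately have "\<bar>I y t - I z t\<bar> \<le> 4 * (e * L) * dist y z"
      by (simp add: algebra_simps)
    also have "\<dots> \<le> (1/2) * dist y z" using eL by (intro mult_right_mono) auto
    finally show "dist (apply_bcontfun (T y) t) (apply_bcontfun (T z) t) \<le> (1/2) * dist y z"
      unfolding T by (simp add: dist_real_def)
  qed
  have "\<exists>!x. T x = x" by (rule banach_fix_type[of "1/2"]) (use contr in auto)
  then obtain Y where Y: "T Y = Y" by blast
  define y where "y = apply_bcontfun Y"
  have yI: "y t = I Y t" for t unfolding y_def using T[of Y] Y by simp
  have "\<tau> 0 = 0" using e \<tau>(2)[of 0] by simp
  then have "y 0 = b0" unfolding yI I_def by simp
  have yb: "\<bar>y t - b0\<bar> \<le> \<delta>" for t unfolding yI by (rule Ib)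
  have gy: "g Y t = P (vector [a0 + t, y t])" if "t \<in> {-e<..<e}" for t
  proof -
    have "\<tau> t = t" "cl (y t) = y t" using that \<tau>(2)[of t] cl(3)[OF yb[of t]] by auto
    then show ?thesis unfolding g_def y_def[symmetric] by simp
  qed
  have yW: "vector [a0 + t, y t] \<in> W" if "t \<in> {-e<..<e}" for t
    using that yb[of t] e(2) by (intro subsetD[OF QW]) (auto simp: inQ abs_le_iff)
  have yd: "(y has_real_derivative P (vector [a0 + t, y t])) (at t)" if t: "t \<in> {-e<..<e}" for t
  proof -
    have "((\<lambda>u. integral {-e..u} (g Y)) has_real_derivative g Y t) (at t within {-e..e})"
      using t by (intro integral_has_real_derivative cg) auto
    then have "((\<lambda>u. integral {-e..u} (g Y)) has_real_derivative g Y t) (at t)"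
      using t at_within_Icc_at[of "-e" t e] by (simp only: greaterThanLessThan_iff)
    then have "((\<lambda>u. b0 + (integral {-e..u} (g Y) - integral {-e..0} (g Y))) has_real_derivative g Y t) (at t)"
      by (auto intro!: derivative_eq_intros)
    then have "(y has_real_derivative g Y t) (at t)"
      by (rule has_field_derivative_transform_within_open[where S="{-e<..<e}"])
         (use t \<tau>(2) in \<open>simp_all only: yI I_def open_greaterThanLessThan, auto\<close>)
    then show ?thesis by (simp add: gy[OF t])
  qed
  \<comment> \<open>The differential equation expresses the derivative through \<open>P\<close> and
    \<open>y\<close>, so each order of differentiability gives the next.\<close>
  have "Ck_on k y {-e<..<e}" for k
  proof (induction k)
    case 0
    have "isCont y t" if "t \<in> {-e<..<e}" for t by (rule DERIV_isCont[OF yd[OF that]])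
    then show ?case by (simp only: Ck_on.simps) (intro continuous_at_imp_continuous_on ballI)
  next
    case (Suc k)
    show ?case
    proof (rule Ck_on_SucI[where f'="\<lambda>t v. P (vector [a0 + t, y t]) * v"])
      show "(y has_derivative (\<lambda>v. P (vector [a0 + t, y t]) * v)) (at t)" if "t \<in> {-e<..<e}" for t
        using yd[OF that] by (simp add: has_field_derivative_def)
      have "Ck_on k (\<lambda>t. vector [a0 + t, y t] :: real^2) {-e<..<e}"
        unfolding veq
        by (intro Ck_on_add Ck_on_bilinear[OF _ bounded_bilinear_scaleR] Ck_on_const Suc
             Ck_on_linear[OF _ bounded_linear_ident] open_greaterThanLessThan)
      moreover have "Ck_on k P W" using P by (simp add: smooth_on_def)
      ultimately have "Ck_on k (\<lambda>t. P (vector [a0 + t, y t])) {-e<..<e}"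
        using Ck_on_compose[of "{-e<..<e}" W "\<lambda>t. vector [a0 + t, y t]" k P] W(1) yW by simp
      then show "Ck_on k (\<lambda>t. P (vector [a0 + t, y t]) * v) {-e<..<e}" for v
        by (rule Ck_on_bilinear[OF open_greaterThanLessThan bounded_bilinear_mult _ Ck_on_const[OF open_greaterThanLessThan]])
    qed simp
  qed
  then have "smooth_on {-e<..<e} y" by (simp add: smooth_on_def)
  show ?thesis by (rule that[of e y]; fact)
qed

section \<open>Left and right branches\<close>

lemma inner_zero_derivative:
  fixes a b :: "real => real^4"
  assumes T: "open T" and a: "smooth_on T a" and b: "smooth_on T b" and z: "\<And>t. t \<in> T ==> a t \<bullet> b t = 0" and t: "t \<in> T"
  shows "a t \<bullet> vd 1 b t + vd 1 a t \<bullet> b t = 0"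
proof -
  have "((\<lambda>t. a t \<bullet> b t) has_vector_derivative a t \<bullet> vd 1 b t + vd 1 a t \<bullet> b t) (at t)"
    by (rule bounded_bilinear.has_vector_derivative[OF bounded_bilinear_inner
          has_vector_derivative_smooth[OF T a t] has_vector_derivative_smooth[OF T b t]])
  moreover have "((\<lambda>t. a t \<bullet> b t) has_vector_derivative 0) (at t)"
    by (rule has_vector_derivative_transform_within_open[OF has_vector_derivative_const T t]) (simp add: z)
  ultimately show ?thesis by (rule vector_derivative_unique_at)
qed

section \<open>The sign of the frame along asymptotic curves\<close>

context swallowtail_chart
begin

lemma vd_1_compose:
  assumes "open T" "smooth_on A M" "smooth_on T c" "t \<in> T" "c t \<in> A"
  shows "vd 1 (\<lambda>t. M (c t)) t = pd M (vd 1 c t) (c t)"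
  by (rule vd_1I[OF has_vector_derivative_compose_smooth[where c=c, OF assms(2,5) has_vector_derivative_smooth[OF assms(1,3,4)]]])

lemma II_scale: "x \<in> A ==> II F N x (k *\<^sub>R v) (k *\<^sub>R v) = k\<^sup>2 * II F N x v v"
  unfolding II_def using linear_cmul[OF pd_linear[OF smooth_F]] linear_cmul[OF pd_linear[OF smooth_N]]
  by (simp add: power2_eq_square)

text \<open>Along an asymptotic curve \<open>N\<close> is orthogonal to the curve and its first two
  derivatives, so the frame is the \<open>N\<close>-component of the third derivative times an area
  in the tangent plane. Both are proportional to the same quantity, whose square leaves a sign that
  depends on the slope only, as in the theorem of Beltrami and Enneper.\<close>

lemma frame_asymptotic:
  assumes T: "open T" and c: "smooth_on T c" and cA: "\<And>t. t \<in> T ==> c t \<in> A"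
    and as: "\<And>t. t \<in> T ==> II F N (c t) (vd 1 c t) (vd 1 c t) = 0"
    and t: "t \<in> T" and v: "vd 1 c t = k *\<^sub>R vector [1, p]" "k \<noteq> 0" and e: "edge_fun (c t) \<noteq> 0"
  obtains z where "frame (\<lambda>t. F (c t)) t * (N (c t) \<bullet> N (c t)) =
      - (edge_fun (c t) * be (c t) + ga (c t) * p) * (edge_fun (c t) * J0 (c t)) * z\<^sup>2"
    "G2 (c t) p \<noteq> 0 ==> z \<noteq> 0"
proof -
  define \<gamma> where "\<gamma> t = F (c t)" for t
  define \<nu> where "\<nu> t = N (c t)" for t
  have s\<gamma>: "smooth_on T \<gamma>" and s\<nu>: "smooth_on T \<nu>"
    unfolding \<gamma>_def \<nu>_def by (rule smooth_on_compose[OF T A(1) cA c smooth_F], assumption)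
      (rule smooth_on_compose[OF T A(1) cA c smooth_N])
  have g1: "vd 1 \<gamma> s = pd F (vd 1 c s) (c s)" and n1: "vd 1 \<nu> s = pd N (vd 1 c s) (c s)" if "s \<in> T" for s
    unfolding \<gamma>_def \<nu>_def using vd_1_compose[OF T smooth_F c that cA[OF that]] vd_1_compose[OF T smooth_N c that cA[OF that]] by auto
  let ?x = "c t" and ?v = "vd 1 c t" and ?w = "vd 2 c t"
  have x: "?x \<in> A" by (rule cA[OF t])
  have g2: "vd 2 \<gamma> t = pd (pd F ?v) ?v ?x + pd F ?w ?x" and n2: "vd 2 \<nu> t = pd (pd N ?v) ?v ?x + pd N ?w ?x"
    unfolding \<gamma>_def \<nu>_def using vd2_compose[OF A(1) T smooth_F c cA t] vd2_compose[OF A(1) T smooth_N c cA t] by auto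
  have sg1: "smooth_on T (vd 1 \<gamma>)" "smooth_on T (vd 1 \<nu>)" "smooth_on T (vd 2 \<gamma>)"
    by (intro smooth_on_vd T s\<gamma> s\<nu>)+
  have 2: "vd 1 (vd 1 \<gamma>) = vd 2 \<gamma>" "vd 1 (vd 1 \<nu>) = vd 2 \<nu>" "vd 1 (vd 2 \<gamma>) = vd 3 \<gamma>"
    by (simp_all only: vd_1_vd) (simp_all add: numeral_2_eq_2 numeral_3_eq_3)
  have z1: "\<nu> s \<bullet> vd 1 \<gamma> s = 0" and z2: "vd 1 \<nu> s \<bullet> vd 1 \<gamma> s = 0" if "s \<in> T" for s
    using NF(2)[OF cA[OF that]] as[OF that] by (simp_all add: g1[OF that] n1[OF that] \<nu>_def II_def del: One_nat_def)
  have z3: "\<nu> s \<bullet> vd 2 \<gamma> s = 0" if "s \<in> T" for s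
    using inner_zero_derivative[OF T s\<nu> sg1(1) z1 that] z2[OF that] by (simp add: 2 del: One_nat_def)
  have z4: "\<nu> t \<bullet> vd 3 \<gamma> t = - (vd 1 \<nu> t \<bullet> vd 2 \<gamma> t)"
    using inner_zero_derivative[OF T s\<nu> sg1(3) z3 t] by (simp add: 2 del: One_nat_def)
  have z5: "vd 2 \<nu> t \<bullet> vd 1 \<gamma> t = - (vd 1 \<nu> t \<bullet> vd 2 \<gamma> t)"
    using inner_zero_derivative[OF T sg1(2,1) z2 t] by (simp add: 2 del: One_nat_def)
  have jac: "jac F N ?x \<noteq> 0" by (rule jac_nz[OF x e])
  obtain i j m l where X: "vd 2 \<gamma> t = i *\<^sub>R F ?x + j *\<^sub>R pd F e1 ?x + m *\<^sub>R pd F e2 ?x + l *\<^sub>R N ?x"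
    using det4_expand[OF jac[unfolded jac_def]] by blast
  obtain i' j' m' l' where X': "vd 3 \<gamma> t = i' *\<^sub>R F ?x + j' *\<^sub>R pd F e1 ?x + m' *\<^sub>R pd F e2 ?x + l' *\<^sub>R N ?x"
    using det4_expand[OF jac[unfolded jac_def]] by blast
  have NN: "N ?x \<bullet> N ?x \<noteq> 0" using dp x by (auto simp: dual_pair_def)
  have l: "l = 0" using z3[OF t] NF[OF x] NN by (simp add: X \<nu>_def inner_add_right)
  have l': "\<nu> t \<bullet> vd 3 \<gamma> t = l' * (N ?x \<bullet> N ?x)" using NF[OF x] by (simp add: X' \<nu>_def inner_add_right)
  have Fv: "pd F ?v ?x = k *\<^sub>R pd F e1 ?x + (k * p) *\<^sub>R pd F e2 ?x"
    using pd_coords[OF smooth_F x, of ?v] by (simp add: v del: One_nat_def)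
  have Nv: "pd N ?v ?x = k *\<^sub>R pd N (vector [1, p]) ?x"
    unfolding v by (rule linear_cmul[OF pd_linear[OF smooth_N x]])
  define A1 where "A1 = II F N ?x (vector [1, p]) e1"
  define A2 where "A2 = II F N ?x (vector [1, p]) e2"
  have A2: "A2 = edge_fun ?x * be ?x + ga ?x * p"
    unfolding A2_def using II_coords[OF dp x, of "vector [1, p]" e2] II_edge[OF x] by (simp add: algebra_simps)
  have "k * k * (A1 + p * A2) = 0"
    using as[OF t] unfolding II_def Nv Fv
    by (simp add: A1_def A2_def II_def inner_add_right algebra_simps)
  then have A12: "A1 = - p * A2" using v(2) by simp
  \<comment> \<open>The part of the second derivative across the curve: it vanishes when
    \<open>vd 2 \<gamma> t\<close> lies in the span of \<open>F\<close> and the velocity.\<close>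
  define y where "y = m - p * j"
  have N2: "vd 1 \<nu> t \<bullet> vd 2 \<gamma> t = k * A2 * y"
    unfolding n1[OF t] Nv X l using NF[OF x] A12
    by (simp add: inner_add_right A1_def A2_def II_def y_def algebra_simps)
  have l'': "l' * (N ?x \<bullet> N ?x) = - (k * A2 * y)" using z4 N2 l' by simp
  have fr: "frame \<gamma> t = l' * k * y * jac F N ?x"
  proof -
    have "frame \<gamma> t = det4 (F ?x) (k *\<^sub>R pd F e1 ?x + (k * p) *\<^sub>R pd F e2 ?x)
      (i *\<^sub>R F ?x + j *\<^sub>R pd F e1 ?x + m *\<^sub>R pd F e2 ?x + l *\<^sub>R N ?x)
      (i' *\<^sub>R F ?x + j' *\<^sub>R pd F e1 ?x + m' *\<^sub>R pd F e2 ?x + l' *\<^sub>R N ?x)"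
      unfolding frame_def det4_def[symmetric] X X' g1[OF t] Fv by (simp add: \<gamma>_def)
    then show ?thesis
      unfolding l jac_def det4_add det4_scaleR
      by (simp add: det4_swap23[of "F ?x" "pd F e2 ?x" "pd F e1 ?x"] y_def algebra_simps)
  qed
  have "frame \<gamma> t * (N ?x \<bullet> N ?x) = (l' * (N ?x \<bullet> N ?x)) * k * y * jac F N ?x"
    by (simp add: fr mult_ac)
  also have "\<dots> = - A2 * (edge_fun ?x * J0 ?x) * (k * y)\<^sup>2"
    unfolding l'' jac_edge[OF x] by (simp add: power2_eq_square)
  finally have 1: "frame \<gamma> t * (N ?x \<bullet> N ?x) = - A2 * (edge_fun ?x * J0 ?x) * (k * y)\<^sup>2" .
  \<comment> \<open>The terms with \<open>vd 2 c\<close> cancel by the symmetry of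
    \<open>II\<close>. So \<open>III\<close> is a multiple of the same quantity
    \<open>k * y\<close>, and a nonzero \<open>G2\<close> makes it nonzero.\<close>
  have "III F N ?x ?v = - 2 * (vd 1 \<nu> t \<bullet> vd 2 \<gamma> t)"
  proof -
    have "III F N ?x ?v = (vd 2 \<nu> t - pd N ?w ?x) \<bullet> vd 1 \<gamma> t - vd 1 \<nu> t \<bullet> (vd 2 \<gamma> t - pd F ?w ?x)"
      by (simp add: III_def g1[OF t] n1[OF t] g2 n2 del: One_nat_def)
    also have "\<dots> = vd 2 \<nu> t \<bullet> vd 1 \<gamma> t - vd 1 \<nu> t \<bullet> vd 2 \<gamma> t - II F N ?x ?w ?v + II F N ?x ?v ?w"
      by (simp add: inner_diff_left inner_diff_right II_def g1[OF t] n1[OF t] del: One_nat_def)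
    finally show ?thesis using II_sym[OF dp x, of ?w ?v] z5 by simp
  qed
  then have "k ^ 3 * G2 ?x p = - 2 * (k * A2 * y)"
    unfolding N2 v III_scale[OF dp x] III_G2[OF x] .
  then have "G2 ?x p \<noteq> 0 ==> k * y \<noteq> 0" using v(2) by auto
  then show ?thesis using that[of "k * y"] 1 unfolding A2 \<gamma>_def by blast
qed

end

context flecnodal_box
begin

text \<open>Its sign decides which half of the flecnodal curve is the left one: near a flecnodal
  point \<open>x\<close> the frame along the asymptotic curve of higher contact takes the sign of
  \<open>x$1 * side\<close>.\<close>

definition side where "side = - ga 0 * q * J0 0"

lemma side_nz: "side \<noteq> 0" using ga0 q_nz J00 by (simp add: side_def)

text \<open>The factor of the frame in \<open>frame_asymptotic\<close> that is not a square.\<close>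

definition R where "R x p = - (edge_fun x * be x + ga x * p) * (edge_fun x * J0 x)"

lemma R_sign:
  assumes x: "x \<in> graph bt" "x \<noteq> 0"
  shows "R x (\<pi> (x$1)) * (x$1 * side) > 0" "edge_fun x * be x + ga x * \<pi> (x$1) \<noteq> 0"
proof -
  have xb: "x \<in> box \<xi>" and xA: "x \<in> A" using x graph_subset box_A by blast+
  note e = graph_bt_edge_fun[OF x]
  have xv: "vector [x$1, bt (x$1)] = x" using x vec_coords[of x] by (simp add: in_graph_iff)
  have "\<bar>x$1\<bar> < \<xi>" using xb by (simp add: box_def)
  then have 1: "(edge_fun x * be x + ga x * \<pi> (x$1)) * (x$1 * ga 0) < 0"
    using good e(2) xv unfolding good_def by metis
  then show "edge_fun x * be x + ga x * \<pi> (x$1) \<noteq> 0" by auto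
  have "J0 x * J0 0 > 0" using J0_pos[OF xA] by (simp add: J0_def)
  define X where "X = edge_fun x * be x + ga x * \<pi> (x$1)"
  have "(X * (x$1 * ga 0)) * (edge_fun x * q) * (J0 x * J0 0) > 0"
    using mult_neg_neg[OF 1 e(1)] \<open>J0 x * J0 0 > 0\<close> unfolding X_def by simp
  then show "R x (\<pi> (x$1)) * (x$1 * side) > 0" by (simp add: R_def side_def X_def[symmetric] mult_ac)
qed

lemma smooth_J0: "smooth_on A J0"
  unfolding J0_def by (intro smooth_on_det4 smooth_on_pd A smooth_F smooth_N h)

lemma eventually_R_sign:
  assumes x: "x \<in> graph bt" "x \<noteq> 0" and c: "(c \<longlongrightarrow> x) (at (0::real))" and p: "(p \<longlongrightarrow> \<pi> (x$1)) (at 0)"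
  shows "\<forall>\<^sub>F t in at 0. R (c t) (p t) * (x$1 * side) > 0"
proof -
  have xA: "x \<in> A" using x graph_subset box_A by blast
  have l: "((\<lambda>t. k (c t)) \<longlongrightarrow> k x) (at 0)" if "smooth_on A k" for k :: "real^2 => real"
    by (rule isCont_tendsto_compose[OF smooth_on_isCont[OF that xA] c])
  have "((\<lambda>t. R (c t) (p t) * (x$1 * side)) \<longlongrightarrow> R x (\<pi> (x$1)) * (x$1 * side)) (at 0)"
    unfolding R_def
    by (intro tendsto_intros l p smooth_J0 smooth_abg smooth_edge_fun[OF A(1)])
  then show ?thesis using R_sign(1)[OF x] by (rule order_tendstoD(1))
qed

text \<open>A smooth choice of a root of \<open>G1\<close> near \<open>x0\<close>: the sign in front
  of the square root is the one for which the value at \<open>x0\<close> is the slope \<pi>.\<close>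

definition slope where
  "slope x0 x = (sgn (edge_fun x0 * be x0 + ga x0 * \<pi> (x0$1)) * sqrt (discr F N x) - edge_fun x * be x) / ga x"

lemma G1_discr: "x \<in> A ==> (ga x * p + edge_fun x * be x)\<^sup>2 = ga x * G1 x p + discr F N x"
  unfolding discr_edge G1_def by (simp add: power2_eq_square algebra_simps)

lemma smooth_discr: "smooth_on A (discr F N)"
  unfolding discr_def II_def
  by (intro smooth_on_diff smooth_on_power smooth_on_mult smooth_on_inner smooth_on_pd smooth_F smooth_N A)

lemma slope_props:
  assumes x0: "x0 \<in> graph bt" "x0 \<noteq> 0"
  defines "W \<equiv> {x\<in>box \<xi>. discr F N x > 0}"
  shows "open W" "x0 \<in> W" "smooth_on W (slope x0)" "\<And>x. x \<in> W ==> G1 x (slope x0 x) = 0"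
    "slope x0 x0 = \<pi> (x0$1)"
proof -
  have WA: "W \<subseteq> A" using box_A by (auto simp: W_def)
  have x0b: "x0 \<in> box \<xi>" and x0A: "x0 \<in> A" using x0 graph_subset box_A by blast+
  show W: "open W"
    using continuous_open_preimage[OF continuous_on_subset[OF smooth_on_continuous[OF smooth_discr] box_A] box_open open_greaterThan[of 0]]
    by (simp add: W_def vimage_def Int_def)
  show "x0 \<in> W" using discr_sign(1)[OF x0A] graph_bt_edge_fun(1)[OF x0] x0b by (simp add: W_def)
  let ?s = "sgn (edge_fun x0 * be x0 + ga x0 * \<pi> (x0$1))"
  have s: "?s\<^sup>2 = 1" using R_sign(2)[OF x0] by (auto simp: sgn_if)
  have sd: "smooth_on W (\<lambda>x. sqrt (discr F N x))"
    by (rule smooth_on_compose[OF W _ _ smooth_on_subset[OF smooth_discr WA] smooth_on_sqrt]) (auto simp: W_def)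
  show "smooth_on W (slope x0)"
    unfolding slope_def
    using ga_nz WA
    by (intro smooth_on_divide smooth_on_diff smooth_on_mult smooth_on_const sd W
        smooth_on_subset[OF smooth_edge_fun[OF A(1)] WA] smooth_on_subset[OF smooth_abg(2) WA] smooth_on_subset[OF smooth_abg(3) WA]) auto
  have root: "ga x * slope x0 x + edge_fun x * be x = ?s * sqrt (discr F N x)" if "x \<in> A" for x
    using ga_nz[OF that] by (simp add: slope_def)
  show "G1 x (slope x0 x) = 0" if "x \<in> W" for x
  proof -
    have xA: "x \<in> A" using that WA by blast
    have "(ga x * slope x0 x + edge_fun x * be x)\<^sup>2 = discr F N x"
      unfolding root[OF xA] using that s by (simp add: W_def power_mult_distrib)
    then show ?thesis using G1_discr[OF xA, of "slope x0 x"] ga_nz[OF xA] by simp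
  qed
  have "discr F N x0 = (ga x0 * \<pi> (x0$1) + edge_fun x0 * be x0)\<^sup>2"
    using G1_discr[OF x0A, of "\<pi> (x0$1)"] flecnodal_eq_iff(3)[OF x0b x0(1)] by simp
  then have "?s * sqrt (discr F N x0) = ga x0 * \<pi> (x0$1) + edge_fun x0 * be x0"
    by (simp add: add.commute mult.commute sgn_mult_abs abs_mult_sgn)
  then show "slope x0 x0 = \<pi> (x0$1)" using root[OF x0A] ga_nz[OF x0A] by simp
qed

lemma Phi_vector: "Phi (vector [a, b, p]) = vector [a, G1 (vector [a, b]) p, G2 (vector [a, b]) p]"
  by (simp add: Phi_def base_point_def)

lemma has_vector_derivative_vector3:
  assumes "(a has_real_derivative a') (at t)" "(b has_real_derivative b') (at t)" "(c has_real_derivative c') (at t)"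
  shows "((\<lambda>t. vector [a t, b t, c t] :: real^3) has_vector_derivative vector [a', b', c']) (at t)"
proof -
  define u1 u2 u3 :: "real^3" where "u1 = vector [1,0,0]" and "u2 = vector [0,1,0]" and "u3 = vector [0,0,1]"
  have v: "(vector [x, y, z] :: real^3) = x *\<^sub>R u1 + y *\<^sub>R u2 + z *\<^sub>R u3" for x y z
    by (simp add: u1_def u2_def u3_def vec_eq_iff forall_3)
  show ?thesis
    unfolding v
    by (intro has_vector_derivative_add bounded_linear.has_vector_derivative[OF bounded_linear_scaleR_left])
       (use assms in \<open>simp_all add: real_derivative_iff\<close>)
qed

text \<open>Integrate the field of slopes through \<open>x0\<close>. The strict sign of the frame
  next to \<open>x0\<close> comes from a simple zero of \<open>G2\<close> along this curve, that is,
  from its crossing the flecnodal curve transversally, which \<open>good\<close> provides for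
  \<open>q \<noteq> - 1/2\<close>.\<close>

lemma asymptotic_curve_exists:
  assumes x0: "x0 \<in> graph bt" "x0 \<noteq> 0" and q: "q \<noteq> - 1/2"
  obtains c e where "e > 0" "asymptotic_curve U f {-e<..<e} c" "c 0 = \<phi> x0"
    "slope_line F x0 (\<pi> (x0$1)) = span {f (\<phi> x0), vd 1 (f \<circ> c) 0}"
    "\<And>t. t \<in> {-e<..<e} - {0} ==> frame (f \<circ> c) t * (x0$1 * side) > 0"
proof -
  define W where "W = {x\<in>box \<xi>. discr F N x > 0}"
  note sp = slope_props[OF x0, folded W_def]
  have WA: "W \<subseteq> A" using box_A by (auto simp: W_def)
  define a0 where "a0 = x0$1"
  have x0v: "x0 = vector [a0, bt a0]" using x0 vec_coords[of x0] by (simp add: in_graph_iff a0_def)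
  have a0: "a0 \<noteq> 0" "\<bar>a0\<bar> < \<xi>" using graph_bt_edge_fun(2)[OF x0] x0 by (auto simp: a0_def in_graph_iff box_def)
  obtain e y where ey: "e > 0" "smooth_on {-e<..<e} y" "y 0 = bt a0"
    "\<And>t. t \<in> {-e<..<e} ==> vector [a0 + t, y t] \<in> W"
    "\<And>t. t \<in> {-e<..<e} ==> (y has_real_derivative slope x0 (vector [a0 + t, y t])) (at t)"
    by (rule scalar_ode_solution[OF sp(1) sp(2)[unfolded x0v] sp(3)[unfolded x0v]], unfold x0v[symmetric], rule that)
  let ?T = "{-e<..<e}"
  have T: "open ?T" "0 \<in> ?T" using ey(1) by auto
  define d where "d t = (vector [a0 + t, y t] :: real^2)" for t
  define p where "p t = slope x0 (d t)" for t
  have d0: "d 0 = x0" by (simp add: d_def ey(3) x0v)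
  have dW: "d t \<in> W" and dA: "d t \<in> A" if "t \<in> ?T" for t using ey(4)[OF that] WA by (auto simp: d_def)
  have sd: "smooth_on ?T d"
    unfolding d_def by (intro smooth_on_vector2 smooth_on_add smooth_on_const smooth_on_ident ey(2) T)
  have sp': "smooth_on ?T p" unfolding p_def by (rule smooth_on_compose[OF T(1) sp(1) dW sd sp(3)])
  have d1: "vd 1 d t = vector [1, p t]" if "t \<in> ?T" for t
  proof (rule vd_1I)
    have "d = (\<lambda>t. (a0 + t) *\<^sub>R e1 + y t *\<^sub>R e2)" by (simp add: d_def fun_eq_iff vec_eq_iff forall_2)
    moreover have "vector [1, p t] = 1 *\<^sub>R e1 + p t *\<^sub>R e2" by (simp add: vec_eq_iff forall_2)
    moreover have "((\<lambda>t. (a0 + t) *\<^sub>R e1 + y t *\<^sub>R e2) has_vector_derivative 1 *\<^sub>R e1 + p t *\<^sub>R e2) (at t)"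
      using ey(5)[OF that]
      by (intro has_vector_derivative_add bounded_linear.has_vector_derivative[OF bounded_linear_scaleR_left])
         (auto simp: p_def d_def real_derivative_iff[symmetric] intro!: derivative_eq_intros)
    ultimately show "(d has_vector_derivative vector [1, p t]) (at t)" by simp
  qed
  have G1p: "G1 (d t) (p t) = 0" if "t \<in> ?T" for t unfolding p_def by (rule sp(4)[OF dW[OF that]])
  have ef: "edge_fun (d t) * q < 0" if "t \<in> ?T" for t
    using dW[OF that] discr_sign(1)[OF dA[OF that]] by (simp add: W_def)
  define c where "c t = \<phi> (d t)" for t
  have fc: "f \<circ> c = (\<lambda>t. F (d t))" by (simp add: fun_eq_iff c_def F_eq)
  have sc: "smooth_on ?T c" unfolding c_def by (rule smooth_on_compose[OF T(1) A(1) dA sd phi(1)])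
  have F1: "vd 1 (f \<circ> c) t = pd F (vector [1, p t]) (d t)" if "t \<in> ?T" for t
    unfolding fc vd_1_compose[OF T(1) smooth_F sd that dA[OF that]] d1[OF that] ..
  have c1: "vd 1 c t \<noteq> 0" if "t \<in> ?T" for t
  proof
    assume "vd 1 c t = 0"
    moreover have "vd 1 c t = pd \<phi> (vector [1, p t]) (d t)"
      unfolding c_def vd_1_compose[OF T(1) phi(1) sd that dA[OF that]] d1[OF that] ..
    ultimately have "(vector [1, p t] :: real^2) = 0"
      using linear_injective_0[OF pd_linear[OF phi(1) dA[OF that]]] bij_is_inj[OF pd_phi_bij[OF dA[OF that]]] by metis
    then show False by (metis vector_2(1) zero_index zero_neq_one)
  qed
  have asym: "span {f (c t), vd 1 (f \<circ> c) t} \<in> asymptotic_lines U f (c t)" if "t \<in> ?T" for t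
  proof -
    have xA: "d t \<in> A" and e: "edge_fun (d t) \<noteq> 0" using dA[OF that] ef[OF that] by auto
    have "line_contact A F (d t) 3 (slope_line F (d t) (p t))"
      unfolding line_contact_slope(1)[OF dp xA jac_nz[OF xA e] ga_nz[OF xA, folded II_edge(3)[OF xA]]]
      using II_G1[OF xA, of "p t"] G1p[OF that] by (intro exI[of _ "p t"]) simp
    then have "slope_line F (d t) (p t) \<in> asymptotic_lines U f (c t)"
      unfolding c_def asymptotic_lines_phi[OF xA] by (simp add: asymptotic_lines_def)
    moreover have "F (d t) = f (c t)" by (simp add: F_eq c_def)
    ultimately show ?thesis unfolding F1[OF that] slope_line_def by simp
  qed
  define w where "w t = G2 (d t) (p t)" for t
  have sw: "smooth_on ?T w"
  proof -
    have k: "smooth_on ?T (\<lambda>t. k (d t))" if "smooth_on A k" for k :: "real^2 => real"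
      by (rule smooth_on_compose[OF T(1) A(1) dA sd that])
    show ?thesis unfolding w_def G2_def
      by (intro smooth_on_add smooth_on_mult smooth_on_power k smooth_c sp' T)
  qed
  have p0: "p 0 = \<pi> a0" using sp(5) by (simp add: p_def d0 a0_def)
  have w0: "w 0 = 0"
    using flecnodal_eq_iff(3)[of x0] x0 graph_subset by (auto simp: w_def d0 p0 a0_def)
  have ar: "\<bar>a0\<bar> < r" using a0 eps by simp
  \<comment> \<open>If the zero were not simple, \<open>Phi\<close> would have the same derivative
    along \<open>Z\<close>, the lifted asymptotic curve, and along \<open>Y\<close>, the lifted
    flecnodal curve. As the differential of \<open>Phi\<close> is injective, their tangents would
    agree, against \<open>good\<close>.\<close>
  have w1: "vd 1 w 0 \<noteq> 0"
  proof
    assume w1: "vd 1 w 0 = 0"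
    have deriv: "(k has_real_derivative vd 1 k t) (at t)" if "open S" "smooth_on S k" "t \<in> S" for k S and t :: real
      using has_vector_derivative_smooth[OF that] by (simp add: real_derivative_iff)
    define Z where "Z t = (vector [a0 + t, y t, p t] :: real^3)" for t
    define Y where "Y t = (vector [a0 + t, bt (a0 + t), \<pi> (a0 + t)] :: real^3)" for t
    have "(y has_real_derivative p 0) (at 0)" using ey(5)[OF T(2)] by (simp add: p_def d_def)
    then have Z1: "(Z has_vector_derivative vector [1, p 0, vd 1 p 0]) (at 0)"
      unfolding Z_def by (intro has_vector_derivative_vector3 deriv[OF T(1) sp' T(2)]) (auto intro!: derivative_eq_intros)
    have sh: "((\<lambda>t. k (a0 + t)) has_real_derivative vd 1 k a0) (at 0)" if "smooth_on {-r<..<r} k" for k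
    proof -
      have "a0 \<in> {-r<..<r}" using ar by (simp only: greaterThanLessThan_iff) linarith
      then have "(k has_real_derivative vd 1 k a0) (at (0 + a0))"
        using deriv[OF _ that, of a0] by simp
      then have "((\<lambda>t. k (t + a0)) has_real_derivative vd 1 k a0) (at 0)" unfolding DERIV_shift .
      then show ?thesis by (simp add: add.commute del: One_nat_def)
    qed
    have Y1: "(Y has_vector_derivative vector [1, vd 1 bt a0, vd 1 \<pi> a0]) (at 0)"
      unfolding Y_def by (intro has_vector_derivative_vector3 sh bt_smooth pi_smooth) (auto intro!: derivative_eq_intros)
    have ZY0: "Z 0 = Y 0" by (simp add: Z_def Y_def ey(3) p0)
    have D: "Y 0 \<in> D3" using x0 graph_subset box_A by (auto simp: D3_def Y_def base_point_def x0v[symmetric])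
    have PZ: "((\<lambda>t. Phi (Z t)) has_vector_derivative pd Phi (vector [1, p 0, vd 1 p 0]) (Y 0)) (at 0)"
      using has_vector_derivative_compose_smooth[where c=Z, OF smooth_Phi _ Z1] D ZY0 by simp
    have PY: "((\<lambda>t. Phi (Y t)) has_vector_derivative pd Phi (vector [1, vd 1 bt a0, vd 1 \<pi> a0]) (Y 0)) (at 0)"
      by (rule has_vector_derivative_compose_smooth[where c=Y, OF smooth_Phi D Y1])
    have "((\<lambda>t. Phi (Z t)) has_vector_derivative vector [1, 0, 0]) (at 0)"
    proof (rule has_vector_derivative_transform_within_open[OF _ T])
      show "((\<lambda>t. vector [a0 + t, 0, w t] :: real^3) has_vector_derivative vector [1, 0, 0]) (at 0)"
        using deriv[OF T(1) sw T(2)] w1 by (intro has_vector_derivative_vector3) (auto intro!: derivative_eq_intros)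
      show "vector [a0 + t, 0, w t] = Phi (Z t)" if "t \<in> ?T" for t
        using G1p[OF that] by (simp add: Z_def Phi_vector w_def d_def)
    qed
    then have 1: "pd Phi (vector [1, p 0, vd 1 p 0]) (Y 0) = vector [1, 0, 0]"
      using PZ vector_derivative_unique_at by blast
    have "((\<lambda>t. Phi (Y t)) has_vector_derivative vector [1, 0, 0]) (at 0)"
    proof (rule has_vector_derivative_transform_within_open[of _ _ _ "{-(r - \<bar>a0\<bar>)<..<r - \<bar>a0\<bar>}"])
      show "((\<lambda>t. vector [a0 + t, 0, 0] :: real^3) has_vector_derivative vector [1, 0, 0]) (at 0)"
        by (intro has_vector_derivative_vector3) (auto intro!: derivative_eq_intros)
      show "vector [a0 + t, 0, 0] = Phi (Y t)" if "t \<in> {-(r - \<bar>a0\<bar>)<..<r - \<bar>a0\<bar>}" for t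
      proof -
        have "\<bar>a0 + t\<bar> < r" using that by auto
        then show ?thesis using fl_eq[of "a0 + t"] by (simp add: Y_def Phi_vector)
      qed
    qed (use ar in auto)
    then have 2: "pd Phi (vector [1, vd 1 bt a0, vd 1 \<pi> a0]) (Y 0) = vector [1, 0, 0]"
      using PY vector_derivative_unique_at by blast
    have "Y 0 = vector [a0, bt a0, \<pi> a0]" by (simp add: Y_def)
    then have "(vector [1, p 0, vd 1 p 0] :: real^3) = vector [1, vd 1 bt a0, vd 1 \<pi> a0]"
      using Phi_inj[OF ar] 1 2 by (metis (no_types, lifting) injD)
    then have "p 0 = vd 1 bt a0" by (metis vector_3(2))
    then show False using good a0 q p0 by (auto simp: good_def)
  qed
  have "((\<lambda>t. w t / t) \<longlongrightarrow> vd 1 w 0) (at 0)" by (rule tendsto_quotient_first[OF T sw w0])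
  then have wnz: "\<forall>\<^sub>F t in at 0. w t / t \<noteq> 0" by (rule tendsto_imp_eventually_ne[OF _ w1])
  have Rpos: "\<forall>\<^sub>F t in at 0. R (d t) (p t) * (x0$1 * side) > 0"
    using smooth_on_tendsto[OF sd T(2)] smooth_on_tendsto[OF sp' T(2)]
    by (intro eventually_R_sign[OF x0]) (simp_all add: d0 p0 a0_def)
  have "\<forall>\<^sub>F t in at 0. t \<in> ?T" using T by (rule eventually_at_in_open')
  with wnz Rpos have "\<forall>\<^sub>F t in at 0. frame (f \<circ> c) t * (x0$1 * side) > 0"
  proof eventually_elim
    case (elim t)
    have as: "II F N (d t) (vd 1 d t) (vd 1 d t) = 0" if "t \<in> ?T" for t
      using II_G1[OF dA[OF that]] G1p[OF that] by (simp only: d1[OF that])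
    have v: "vd 1 d t = 1 *\<^sub>R vector [1, p t]" using d1[OF elim(3)] by simp
    have e: "edge_fun (d t) \<noteq> 0" using ef[OF elim(3)] by auto
    obtain z where z: "frame (\<lambda>t. F (d t)) t * (N (d t) \<bullet> N (d t)) = R (d t) (p t) * z\<^sup>2"
      "G2 (d t) (p t) \<noteq> 0 ==> z \<noteq> 0"
      using frame_asymptotic[OF T(1) sd dA as elim(3) v _ e] unfolding R_def by auto
    have "z \<noteq> 0" using z(2) elim(1) by (auto simp: w_def)
    then have "(R (d t) (p t) * (x0$1 * side)) * z\<^sup>2 > 0" using elim(2) by simp
    then have "(frame (\<lambda>t. F (d t)) t * (x0$1 * side)) * (N (d t) \<bullet> N (d t)) > 0"
      using z(1) by (simp add: mult_ac)
    then show ?case unfolding fc by (metis inner_ge_zero mult_less_0_iff not_less zero_less_mult_iff)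
  qed
  then obtain e' where e': "e' > 0" "\<And>t. t \<noteq> 0 ==> \<bar>t\<bar> < e' ==> frame (f \<circ> c) t * (x0$1 * side) > 0"
    unfolding eventually_at by (auto simp: dist_real_def)
  show ?thesis
  proof (rule that[of "min e e'" c])
    show "asymptotic_curve U f {-min e e'<..<min e e'} c"
      unfolding asymptotic_curve_def
    proof (intro conjI ballI)
      show "smooth_on {-min e e'<..<min e e'} c" by (rule smooth_on_subset[OF sc]) auto
      show "c ` {-min e e'<..<min e e'} \<subseteq> hyperbolic_domain U f"
      proof (rule image_subsetI)
        fix t assume "t \<in> {-min e e'<..<min e e'}"
        then have "t \<in> ?T" by auto
        then show "c t \<in> hyperbolic_domain U f" unfolding c_def using domains_f(1) dA ef by blast
      qed
    qed (use c1 asym in auto)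
    show "c 0 = \<phi> x0" by (simp add: c_def d0)
    show "slope_line F x0 (\<pi> (x0$1)) = span {f (\<phi> x0), vd 1 (f \<circ> c) 0}"
      unfolding F1[OF T(2)] d0 p0 slope_line_def a0_def by (simp add: F_eq)
  qed (use ey(1) e' in auto)
qed

text \<open>Any asymptotic curve through \<open>x0\<close> in the direction of higher contact has
  slope \<pi> there, which fixes the sign of \<open>R\<close> nearby. One parameter with the weak
  sign is enough to contradict the opposite strict sign at all of them.\<close>

lemma asymptotic_curve_sign:
  assumes x0: "x0 \<in> graph bt" "x0 \<noteq> 0" and e: "e > 0" and ac: "asymptotic_curve U f {-e<..<e} c"
    and c0: "c 0 = \<phi> x0" and l: "line_contact U f (\<phi> x0) 4 (span {f (\<phi> x0), vd 1 (f \<circ> c) 0})"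
  shows "\<exists>t\<in>{-e<..<e} - {0}. frame (f \<circ> c) t * (x0$1 * side) \<ge> 0"
proof -
  let ?S = "{-e<..<e}"
  have sc: "smooth_on ?S c" and ch: "\<And>t. t \<in> ?S ==> c t \<in> hyperbolic_domain U f"
    and c1: "\<And>t. t \<in> ?S ==> vd 1 c t \<noteq> 0"
    and ca: "\<And>t. t \<in> ?S ==> span {f (c t), vd 1 (f \<circ> c) t} \<in> asymptotic_lines U f (c t)"
    using ac by (auto simp: asymptotic_curve_def)
  have x0b: "x0 \<in> box \<xi>" using x0 graph_subset by blast
  define T where "T = ?S \<inter> c -` V"
  have T: "open T" unfolding T_def
    by (rule continuous_open_preimage[OF smooth_on_continuous[OF sc] _ V_open]) simp
  have T0: "0 \<in> T" using e c0 x0b by (simp add: T_def)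
  define d where "d t = \<psi> (c t)" for t
  have dc: "d t \<in> box \<xi>" "\<phi> (d t) = c t" if t: "t \<in> T" for t
  proof -
    obtain x where "x \<in> box \<xi>" "c t = \<phi> x" using t by (auto simp: T_def)
    then show "d t \<in> box \<xi>" "\<phi> (d t) = c t" using psi(2) box_A by (auto simp: d_def)
  qed
  have dA: "d t \<in> A" if "t \<in> T" for t using dc(1)[OF that] box_A by blast
  have d0: "d 0 = x0" using c0 psi(2) x0b box_A by (auto simp: d_def)
  have sd: "smooth_on T d"
    unfolding d_def
    by (rule smooth_on_compose[OF T phi(4) _ smooth_on_subset[OF sc] psi(1)]) (use box_A in \<open>auto simp: T_def\<close>)
  have e_nz: "edge_fun (d t) \<noteq> 0" if "t \<in> T" for t
    using ch[of t] that domains_f(1)[OF dA[OF that]] dc(2)[OF that] by (auto simp: T_def)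
  have d1: "vd 1 d t \<noteq> 0" if t: "t \<in> T" for t
  proof
    assume z: "vd 1 d t = 0"
    have "vd 1 c t = vd 1 (\<lambda>t. \<phi> (d t)) t" by (rule vd_cong[OF T t]) (simp add: dc)
    also have "\<dots> = pd \<phi> 0 (d t)" unfolding vd_1_compose[OF T phi(1) sd t dA[OF t]] z ..
    also have "\<dots> = 0" by (rule linear_0[OF pd_linear[OF phi(1) dA[OF t]]])
    finally show False using c1[of t] t by (simp add: T_def)
  qed
  have fc: "(f \<circ> c) t = F (d t)" if "t \<in> T" for t by (simp add: F_eq dc(2)[OF that])
  have F1: "vd 1 (f \<circ> c) t = pd F (vd 1 d t) (d t)" if t: "t \<in> T" for t
  proof -
    have "vd 1 (f \<circ> c) t = vd 1 (\<lambda>t. F (d t)) t" by (rule vd_cong[OF T t fc])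
    then show ?thesis unfolding vd_1_compose[OF T smooth_F sd t dA[OF t]] .
  qed
  have par: "\<exists>j. j \<noteq> 0 \<and> w = j *\<^sub>R v" if t: "t \<in> T" and sp: "span {F (d t), pd F w (d t)} = span {F (d t), pd F v (d t)}" and w: "w \<noteq> 0" for t v w
  proof -
    have "pd F w (d t) \<in> span {F (d t), pd F v (d t)}" using sp by (metis insertI1 insertI2 span_base)
    then obtain i j where "pd F w (d t) = i *\<^sub>R F (d t) + j *\<^sub>R pd F v (d t)"
      by (metis (no_types, lifting) add.commute diff_add_cancel span_breakdown_eq span_singleton rangeE)
    then have "(- i) *\<^sub>R F (d t) + (w$1 - j * v$1) *\<^sub>R pd F e1 (d t) + (w$2 - j * v$2) *\<^sub>R pd F e2 (d t) + 0 *\<^sub>R N (d t) = 0"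
      using pd_coords[OF smooth_F dA[OF t], of w] pd_coords[OF smooth_F dA[OF t], of v] by (simp add: algebra_simps)
    from det4_indep[OF jac_nz[OF dA[OF t] e_nz[OF t], unfolded jac_def] this]
    have "w = j *\<^sub>R v" by (simp add: vec_eq_iff forall_2)
    then show ?thesis using w by auto
  qed
  have as: "II F N (d t) (vd 1 d t) (vd 1 d t) = 0" if t: "t \<in> T" for t
  proof -
    have "line_contact A F (d t) 3 (span {F (d t), pd F (vd 1 d t) (d t)})"
    proof -
      have "f (c t) = F (d t)" using fc[OF t] by simp
      moreover have "t \<in> ?S" using t by (simp add: T_def)
      ultimately have "line_contact U f (\<phi> (d t)) 3 (span {F (d t), pd F (vd 1 d t) (d t)})"
        using ca[of t] unfolding F1[OF t] asymptotic_lines_def dc(2)[OF t] by simp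
      then show ?thesis unfolding line_contact_phi(1)[OF dA[OF t]] .
    qed
    then obtain v where v: "span {F (d t), pd F (vd 1 d t) (d t)} = span {F (d t), pd F v (d t)}" "II F N (d t) v v = 0"
      unfolding line_contact_iff(1)[OF dp dA[OF t] jac_nz[OF dA[OF t] e_nz[OF t]]] by blast
    obtain j where "vd 1 d t = j *\<^sub>R v" using par[OF t v(1) d1[OF t]] by blast
    then show ?thesis using v(2) II_scale[OF dA[OF t]] by simp
  qed
  define p where "p t = vd 1 d t $ 2 / vd 1 d t $ 1" for t
  have dv: "vd 1 d t = (vd 1 d t $ 1) *\<^sub>R vector [1, p t]" "vd 1 d t $ 1 \<noteq> 0" if t: "t \<in> T" for t
  proof -
    obtain p' k where pk: "k \<noteq> 0" "vd 1 d t = k *\<^sub>R vector [1, p']"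
      using slope_exists[OF dp dA[OF t] ga_nz[OF dA[OF t], folded II_edge(3)[OF dA[OF t]]] d1[OF t] as[OF t]] .
    then show "vd 1 d t $ 1 \<noteq> 0" by simp
    then show "vd 1 d t = (vd 1 d t $ 1) *\<^sub>R vector [1, p t]" by (simp add: p_def vec_eq_iff forall_2)
  qed
  have p0: "p 0 = \<pi> (x0$1)"
  proof -
    have "line_contact U f (\<phi> x0) 4 (span {F x0, pd F (vd 1 d 0) x0})"
      using l unfolding F1[OF T0] d0 by (simp add: F_eq)
    then obtain p' where p': "span {F x0, pd F (vd 1 d 0) x0} = slope_line F x0 p'" "G1 x0 p' = 0" "G2 x0 p' = 0"
      unfolding contact4_f[OF x0b e_nz[OF T0, unfolded d0]] by blast
    then obtain j where "vd 1 d 0 = j *\<^sub>R vector [1, p']" "j \<noteq> 0"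
      using par[OF T0, unfolded d0, of "vd 1 d 0" "vector [1, p']"] d1[OF T0] unfolding slope_line_def by blast
    then have "p 0 = p'" by (simp add: p_def)
    then show ?thesis using flecnodal_eq_iff(2)[OF x0b p'(2,3)] by simp
  qed
  have sd1: "smooth_on T (vd 1 d)" by (rule smooth_on_vd[OF T sd])
  have "(p \<longlongrightarrow> p 0) (at 0)"
    unfolding p_def
    by (intro tendsto_divide tendsto_vec_nth smooth_on_tendsto[OF sd1 T0] dv(2)[OF T0])
  then have "\<forall>\<^sub>F t in at 0. R (d t) (p t) * (x0$1 * side) > 0"
    using smooth_on_tendsto[OF sd T0] by (intro eventually_R_sign[OF x0]) (simp_all add: d0 p0)
  moreover have "\<forall>\<^sub>F t in at 0. t \<in> T" using T T0 by (rule eventually_at_in_open')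
  moreover have "\<forall>\<^sub>F t in at 0. (t::real) \<noteq> 0" by (simp add: eventually_at_filter)
  ultimately have "\<forall>\<^sub>F t in at 0. t \<in> ?S - {0} \<and> frame (f \<circ> c) t * (x0$1 * side) \<ge> 0"
  proof eventually_elim
    case (elim t)
    obtain z where z: "frame (\<lambda>t. F (d t)) t * (N (d t) \<bullet> N (d t)) = R (d t) (p t) * z\<^sup>2"
      using frame_asymptotic[OF T sd dA as elim(2) dv[OF elim(2)] e_nz[OF elim(2)]] unfolding R_def by metis
    have "vd k (f \<circ> c) t = vd k (\<lambda>t. F (d t)) t" for k by (rule vd_cong[OF T elim(2) fc])
    then have "frame (f \<circ> c) t = frame (\<lambda>t. F (d t)) t"
      unfolding frame_def using fc[OF elim(2)] by metis
    moreover have "(frame (\<lambda>t. F (d t)) t * (x0$1 * side)) * (N (d t) \<bullet> N (d t)) = (R (d t) (p t) * (x0$1 * side)) * z\<^sup>2"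
      using z by (simp add: mult_ac)
    moreover have "(R (d t) (p t) * (x0$1 * side)) * z\<^sup>2 \<ge> 0" using elim(1) by simp
    moreover have "N (d t) \<bullet> N (d t) > 0" using dp dA[OF elim(2)] by (simp add: dual_pair_def)
    ultimately have "frame (f \<circ> c) t * (x0$1 * side) \<ge> 0" by (metis mult_less_0_iff not_less)
    then show ?case using elim by (simp add: T_def)
  qed
  then show ?thesis using eventually_happens'[OF at_neq_bot] by blast
qed

text \<open>One inclusion uses the asymptotic curve constructed above, the other the sign along an
  arbitrary one. The swallowtail lies on neither branch since it is not a hyperbolic point.\<close>

lemma branches:
  assumes q: "q \<noteq> - 1/2"
  shows "left_branch U f \<inter> V = \<phi> ` {x\<in>graph bt. x$1 * side < 0}"
    and "right_branch U f \<inter> V = \<phi> ` {x\<in>graph bt. x$1 * side > 0}"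
proof -
  have nz: "x \<noteq> 0" if "c ` {-e<..<e} \<subseteq> hyperbolic_domain U f" "c 0 = \<phi> x" "e > (0::real)" for c e x
  proof
    assume "x = 0"
    moreover have "\<phi> x \<in> hyperbolic_domain U f" using that by (metis greaterThanLessThan_iff image_subset_iff neg_less_0_iff_less)
    ultimately show False using domains_f(1)[OF A(2)] by simp
  qed
  have contact: "line_contact U f (\<phi> x) 4 (slope_line F x (\<pi> (x$1)))" if "x \<in> graph bt" "x \<noteq> 0" for x
  proof -
    have xb: "x \<in> box \<xi>" using that graph_subset by blast
    have "edge_fun x \<noteq> 0" using graph_bt_edge_fun[OF that] by auto
    then show ?thesis using contact4_f[OF xb] flecnodal_eq_iff(3)[OF xb that(1)] by blast
  qed
  have fl: "\<phi> x \<in> flecnodal_curve U f \<longleftrightarrow> x \<in> graph bt" if "x \<in> box \<xi>" for x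
    using flecnodal_f that phi_eq_iff box_A graph_subset by blast
  have x1: "x$1 \<noteq> 0" if "x \<in> graph bt" "x \<noteq> 0" for x using graph_bt_edge_fun(2)[OF that] .
  show "left_branch U f \<inter> V = \<phi> ` {x\<in>graph bt. x$1 * side < 0}"
  proof
    show "left_branch U f \<inter> V \<subseteq> \<phi> ` {x\<in>graph bt. x$1 * side < 0}"
    proof
      fix u assume u: "u \<in> left_branch U f \<inter> V"
      then obtain x where x: "x \<in> box \<xi>" "u = \<phi> x" by blast
      then have xg: "x \<in> graph bt" using u fl by (auto simp: left_branch_def)
      obtain l where l4: "line_contact U f (\<phi> x) 4 l" and al: "left_asymptotic_line U f (\<phi> x) l"
        using u unfolding x(2) left_branch_def by blast
      obtain c e where "e > 0" "asymptotic_curve U f {-e<..<e} c" "c 0 = \<phi> x"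
        "l = span {f (\<phi> x), vd 1 (f \<circ> c) 0}" "\<forall>t\<in>{-e<..<e} - {0}. frame (f \<circ> c) t < 0"
        using al unfolding left_asymptotic_line_def by (elim exE conjE) (rule that)
      note l = l4 this
      have x0: "x \<noteq> 0" using nz[of c e x] l by (auto simp: asymptotic_curve_def)
      obtain t where "t \<in> {-e<..<e} - {0}" "frame (f \<circ> c) t * (x$1 * side) \<ge> 0"
        using asymptotic_curve_sign[OF xg x0 l(2-4) l(1)[unfolded l(5)]] by blast
      then have "x$1 * side \<le> 0" using l(6) by (metis mult_less_0_iff not_less)
      then have "x$1 * side < 0" using x1[OF xg x0] side_nz by (simp add: order_less_le)
      then show "u \<in> \<phi> ` {x\<in>graph bt. x$1 * side < 0}" using x xg by blast
    qed
    show "\<phi> ` {x\<in>graph bt. x$1 * side < 0} \<subseteq> left_branch U f \<inter> V"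
    proof (rule image_subsetI)
      fix x assume "x \<in> {x\<in>graph bt. x$1 * side < 0}"
      then have x: "x \<in> graph bt" "x \<noteq> 0" "x$1 * side < 0" by auto
      obtain c e where c: "e > 0" "asymptotic_curve U f {-e<..<e} c" "c 0 = \<phi> x"
        "slope_line F x (\<pi> (x$1)) = span {f (\<phi> x), vd 1 (f \<circ> c) 0}"
        "\<And>t. t \<in> {-e<..<e} - {0} ==> frame (f \<circ> c) t * (x$1 * side) > 0"
        by (rule asymptotic_curve_exists[OF x(1,2) q], rule that)
      have "\<forall>t\<in>{-e<..<e} - {0}. frame (f \<circ> c) t < 0"
        using c(5) x(3) by (metis less_asym zero_less_mult_iff)
      then have "left_asymptotic_line U f (\<phi> x) (slope_line F x (\<pi> (x$1)))"
        unfolding left_asymptotic_line_def using c by blast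
      then show "\<phi> x \<in> left_branch U f \<inter> V"
        unfolding left_branch_def using contact[OF x(1,2)] fl x(1) graph_subset by blast
    qed
  qed
  show "right_branch U f \<inter> V = \<phi> ` {x\<in>graph bt. x$1 * side > 0}"
  proof
    show "right_branch U f \<inter> V \<subseteq> \<phi> ` {x\<in>graph bt. x$1 * side > 0}"
    proof
      fix u assume u: "u \<in> right_branch U f \<inter> V"
      then obtain x where x: "x \<in> box \<xi>" "u = \<phi> x" by blast
      then have xg: "x \<in> graph bt" using u fl by (auto simp: right_branch_def)
      obtain l where l4: "line_contact U f (\<phi> x) 4 l" and al: "right_asymptotic_line U f (\<phi> x) l"
        using u unfolding x(2) right_branch_def by blast
      obtain c e where "e > 0" "asymptotic_curve U f {-e<..<e} c" "c 0 = \<phi> x"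
        "l = span {f (\<phi> x), vd 1 (f \<circ> c) 0}" "\<forall>t\<in>{-e<..<e} - {0}. frame (f \<circ> c) t > 0"
        using al unfolding right_asymptotic_line_def by (elim exE conjE) (rule that)
      note l = l4 this
      have x0: "x \<noteq> 0" using nz[of c e x] l by (auto simp: asymptotic_curve_def)
      obtain t where "t \<in> {-e<..<e} - {0}" "frame (f \<circ> c) t * (x$1 * side) \<ge> 0"
        using asymptotic_curve_sign[OF xg x0 l(2-4) l(1)[unfolded l(5)]] by blast
      then have "x$1 * side \<ge> 0" using l(6) by (metis mult_less_0_iff not_less)
      then have "x$1 * side > 0" using x1[OF xg x0] side_nz by (simp add: order_less_le)
      then show "u \<in> \<phi> ` {x\<in>graph bt. x$1 * side > 0}" using x xg by blast
    qed
    show "\<phi> ` {x\<in>graph bt. x$1 * side > 0} \<subseteq> right_branch U f \<inter> V"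
    proof (rule image_subsetI)
      fix x assume "x \<in> {x\<in>graph bt. x$1 * side > 0}"
      then have x: "x \<in> graph bt" "x \<noteq> 0" "x$1 * side > 0" by auto
      obtain c e where c: "e > 0" "asymptotic_curve U f {-e<..<e} c" "c 0 = \<phi> x"
        "slope_line F x (\<pi> (x$1)) = span {f (\<phi> x), vd 1 (f \<circ> c) 0}"
        "\<And>t. t \<in> {-e<..<e} - {0} ==> frame (f \<circ> c) t * (x$1 * side) > 0"
        by (rule asymptotic_curve_exists[OF x(1,2) q], rule that)
      have "\<forall>t\<in>{-e<..<e} - {0}. frame (f \<circ> c) t > 0"
        using c(5) x(3) by (metis less_asym zero_less_mult_iff)
      then have "right_asymptotic_line U f (\<phi> x) (slope_line F x (\<pi> (x$1)))"
        unfolding right_asymptotic_line_def using c by blast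
      then show "\<phi> x \<in> right_branch U f \<inter> V"
        unfolding right_branch_def using contact[OF x(1,2)] fl x(1) graph_subset by blast
    qed
  qed
qed

end

section \<open>The cr-invariant\<close>

text \<open>The derivative of \<open>line_matrix\<close> at \<open>v\<close> in the direction
  \<open>w\<close>, by the quotient rule. It depends on \<open>w\<close> only modulo
  \<open>v\<close>.\<close>

definition line_matrix_deriv :: "real^2 => real^2 => real^2^2" where
  "line_matrix_deriv v w =
     (\<chi> i j. ((w$i * v$j + v$i * w$j) * (v \<bullet> v) - v$i * v$j * (2 * (v \<bullet> w))) / (v \<bullet> v)\<^sup>2)"

lemma has_vector_derivative_vec:
  fixes f :: "real => 'a::euclidean_space^'n"
  assumes "\<And>i. ((\<lambda>t. f t $ i) has_vector_derivative f' $ i) (at t)"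
  shows "(f has_vector_derivative f') (at t)"
  unfolding has_vector_derivative_def
proof (subst has_derivative_componentwise_within, intro ballI)
  fix b :: "'a^'n" assume "b \<in> Basis"
  then obtain i u where b: "b = axis i u" by (auto simp: Basis_vec_def)
  have "((\<lambda>t. f t $ i \<bullet> u) has_vector_derivative f' $ i \<bullet> u) (at t)"
    by (rule bounded_linear.has_vector_derivative[OF bounded_linear_inner_left assms])
  then show "((\<lambda>t. f t \<bullet> b) has_derivative (\<lambda>x. (x *\<^sub>R f') \<bullet> b)) (at t)"
    by (simp add: b inner_axis has_vector_derivative_def)
qed

lemma has_vector_derivative_line_matrix:
  assumes c: "(c has_vector_derivative w) (at t)" and nz: "c t \<noteq> 0"
  shows "((\<lambda>t. line_matrix (c t)) has_vector_derivative line_matrix_deriv (c t) w) (at t)"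
proof (rule has_vector_derivative_vec, rule has_vector_derivative_vec)
  fix i j
  have ci: "((\<lambda>t. c t $ i) has_real_derivative w $ i) (at t)" for i
    using bounded_linear.has_vector_derivative[OF bounded_linear_vec_nth c]
    by (simp add: real_derivative_iff)
  have cc: "((\<lambda>t. c t \<bullet> c t) has_real_derivative 2 * (c t \<bullet> w)) (at t)"
    using bounded_bilinear.has_vector_derivative[OF bounded_bilinear_inner c c]
    by (simp add: real_derivative_iff inner_commute)
  have "((\<lambda>t. c t $ i * c t $ j / (c t \<bullet> c t)) has_real_derivative
      ((w$i * c t$j + c t$i * w$j) * (c t \<bullet> c t) - c t$i * c t$j * (2 * (c t \<bullet> w))) / (c t \<bullet> c t)\<^sup>2) (at t)"
    by (rule DERIV_cong[OF DERIV_divide[OF DERIV_mult[OF ci ci] cc]])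
       (use nz in \<open>simp_all add: power2_eq_square algebra_simps\<close>)
  then show "((\<lambda>t. line_matrix (c t) $ i $ j) has_vector_derivative line_matrix_deriv (c t) w $ i $ j) (at t)"
    by (simp add: real_derivative_iff line_matrix_def line_matrix_deriv_def)
qed

lemma line_matrix_deriv_linear:
  "line_matrix_deriv v (w + w') = line_matrix_deriv v w + line_matrix_deriv v w'"
  "line_matrix_deriv v (k *\<^sub>R w) = k *\<^sub>R line_matrix_deriv v w"
  by (simp_all add: line_matrix_deriv_def vec_eq_iff inner_add_right algebra_simps add_divide_distrib diff_divide_distrib)

lemma line_matrix_deriv_self: "line_matrix_deriv v (k *\<^sub>R v) = 0"
  by (simp add: line_matrix_deriv_def vec_eq_iff algebra_simps)

lemma line_matrix_deriv_scale:
  "m \<noteq> 0 ==> line_matrix_deriv (m *\<^sub>R v) w = (1 / m) *\<^sub>R line_matrix_deriv v w"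
  by (cases "v = 0") (simp_all add: line_matrix_deriv_def vec_eq_iff power2_eq_square divide_simps, simp add: algebra_simps)

lemma line_matrix_scale: "m \<noteq> 0 ==> line_matrix (m *\<^sub>R v) = line_matrix v"
  by (cases "v = 0") (simp_all add: line_matrix_def vec_eq_iff)

text \<open>Up to constants the numerators of the entries contain (v1^2 - v2^2) d and v1 v2 d, where
  d is the determinant of \<open>v\<close> and \<open>w\<close>; for nonzero d both vanish for v = 0
  alone.\<close>

lemma line_matrix_deriv_nonzero:
  assumes "v$1 * w$2 - v$2 * w$1 \<noteq> 0"
  shows "line_matrix_deriv v w \<noteq> 0"
proof
  have v: "v \<bullet> v \<noteq> 0" using assms by auto
  assume z: "line_matrix_deriv v w = 0"
  have e: "(w$i * v$j + v$i * w$j) * (v \<bullet> v) - v$i * v$j * (2 * (v \<bullet> w)) = 0" for i j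
  proof -
    have "line_matrix_deriv v w $ i $ j = 0" by (simp add: z)
    then show ?thesis using v by (simp add: line_matrix_deriv_def)
  qed
  have vv: "v \<bullet> v = v$1 * v$1 + v$2 * v$2" and vw: "v \<bullet> w = v$1 * w$1 + v$2 * w$2"
    by (simp_all add: inner_vec_def sum_2)
  let ?d = "v$1 * w$2 - v$2 * w$1"
  have "(v \<bullet> v) * ((v$1 * v$1 - v$2 * v$2) * ?d) = (v \<bullet> v) * 0"
    "v$1 * v$2 * ?d = 0"
    using e[of 1 2] e[of 1 1] unfolding vv vw by algebra+
  then have "(v$1 * v$1 - v$2 * v$2) * ?d = 0" "v$1 * v$2 * ?d = 0" using v by simp_all
  then have "v$1 * v$1 = v$2 * v$2" "v$1 * v$2 = 0" using assms by auto
  then have "v$1 = 0" "v$2 = 0" by (auto simp: mult_eq_0_iff)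
  then show False using assms by simp
qed

section \<open>Cross-ratios in a given basis\<close>

lemma span_singleton_eqE:
  assumes "span {u} = span {w}" "w \<noteq> 0"
  obtains p where "p \<noteq> 0" "u = p *\<^sub>R w"
proof -
  have "u \<in> span {w}" using assms(1) by (metis insertI1 span_base)
  then obtain p where p: "u = p *\<^sub>R w" by (auto simp: span_singleton)
  have "w \<in> span {u}" using assms(1) by (metis insertI1 span_base)
  then have "u \<noteq> 0" using assms(2) by (auto simp: span_singleton)
  then show ?thesis using p that by auto
qed

lemma span_singleton_scale: "p \<noteq> 0 ==> span {p *\<^sub>R w} = span {w}"
proof (rule span_eq[THEN iffD2], intro conjI)
  assume p: "p \<noteq> 0"
  have "w = (1 / p) *\<^sub>R (p *\<^sub>R w)" using p by simp
  then show "{w} \<subseteq> span {p *\<^sub>R w}" by (metis insertI1 span_base span_mul singletonD subsetI)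
  show "{p *\<^sub>R w} \<subseteq> span {w}" by (simp add: span_base span_mul)
qed

text \<open>The fourth line being that of \<open>Y\<close>, the cross-ratio is a ratio of differences.\<close>
lemma has_cross_ratio_iff:
  fixes X Y :: "'a::real_vector"
  assumes Y: "Y \<noteq> 0" and X: "X \<notin> span {Y}" and ne: "b \<noteq> c"
  shows "has_cross_ratio (span {X + a *\<^sub>R Y}) (span {X + b *\<^sub>R Y}) (span {X + c *\<^sub>R Y}) (span {Y}) r
     \<longleftrightarrow> r = (a - c) / (b - c)"
proof
  have indep: "i = i' \<and> j = j'" if "i *\<^sub>R X + j *\<^sub>R Y = i' *\<^sub>R X + j' *\<^sub>R Y" for i j i' j'
  proof -
    have e: "(i - i') *\<^sub>R X = (j' - j) *\<^sub>R Y" using that by (simp add: algebra_simps)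
    have "i = i'"
    proof (rule ccontr)
      assume n: "i \<noteq> i'"
      have "X = (1 / (i - i')) *\<^sub>R ((i - i') *\<^sub>R X)" using n by simp
      also have "\<dots> = ((j' - j) / (i - i')) *\<^sub>R Y" unfolding e by simp
      finally show False using X by (metis insertI1 span_base span_mul)
    qed
    then show ?thesis using e Y by simp
  qed
  assume "has_cross_ratio (span {X + a *\<^sub>R Y}) (span {X + b *\<^sub>R Y}) (span {X + c *\<^sub>R Y}) (span {Y}) r"
  then obtain X' Y' a' b' c' d' where
    A: "span {X + a *\<^sub>R Y} = span {X' + a' *\<^sub>R Y'}" and B: "span {X + b *\<^sub>R Y} = span {X' + b' *\<^sub>R Y'}"
    and C: "span {X + c *\<^sub>R Y} = span {X' + c' *\<^sub>R Y'}" and D: "span {Y} = span {X' + d' *\<^sub>R Y'}"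
    and n: "b' \<noteq> c'" "a' \<noteq> d'" and r: "r = ((a' - c') * (b' - d')) / ((b' - c') * (a' - d'))"
    unfolding has_cross_ratio_def by blast
  have nz: "X + k *\<^sub>R Y \<noteq> 0" for k using indep[of 1 k 0 0] by auto
  obtain p1 where p1: "p1 \<noteq> 0" "X' + a' *\<^sub>R Y' = p1 *\<^sub>R (X + a *\<^sub>R Y)" by (rule span_singleton_eqE[OF A[symmetric] nz])
  obtain p2 where p2: "p2 \<noteq> 0" "X' + b' *\<^sub>R Y' = p2 *\<^sub>R (X + b *\<^sub>R Y)" by (rule span_singleton_eqE[OF B[symmetric] nz])
  obtain p3 where p3: "p3 \<noteq> 0" "X' + c' *\<^sub>R Y' = p3 *\<^sub>R (X + c *\<^sub>R Y)" by (rule span_singleton_eqE[OF C[symmetric] nz])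
  obtain p4 where p4: "p4 \<noteq> 0" "X' + d' *\<^sub>R Y' = p4 *\<^sub>R Y" by (rule span_singleton_eqE[OF D[symmetric] Y])
  define y1 where "y1 = p1 / (a' - d')"
  define y2 where "y2 = (p1 * a - p4) / (a' - d')"
  have "(a' - d') *\<^sub>R Y' = (X' + a' *\<^sub>R Y') - (X' + d' *\<^sub>R Y')" by (simp add: algebra_simps)
  also have "\<dots> = p1 *\<^sub>R X + (p1 * a - p4) *\<^sub>R Y" unfolding p1 p4 by (simp add: algebra_simps)
  finally have "(1 / (a' - d')) *\<^sub>R ((a' - d') *\<^sub>R Y') = (1 / (a' - d')) *\<^sub>R (p1 *\<^sub>R X + (p1 * a - p4) *\<^sub>R Y)" by simp
  then have Y': "Y' = y1 *\<^sub>R X + y2 *\<^sub>R Y" using n(2) by (simp add: y1_def y2_def scaleR_add_right)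
  define x1 where "x1 = p1 - a' * y1"
  define x2 where "x2 = p1 * a - a' * y2"
  have "X' = p1 *\<^sub>R (X + a *\<^sub>R Y) - a' *\<^sub>R Y'" using p1(2) by (simp add: eq_diff_eq)
  then have X': "X' = x1 *\<^sub>R X + x2 *\<^sub>R Y" unfolding Y' by (simp add: x1_def x2_def algebra_simps)
  have k: "x1 + k * y1 = u \<and> x2 + k * y2 = w" if "X' + k *\<^sub>R Y' = u *\<^sub>R X + w *\<^sub>R Y" for k u w
    using indep[of "x1 + k * y1" "x2 + k * y2" u w] that unfolding X' Y' by (simp add: algebra_simps)
  have e: "x1 + a' * y1 = p1" "x2 + a' * y2 = p1 * a" "x1 + b' * y1 = p2" "x2 + b' * y2 = p2 * b"
    "x1 + c' * y1 = p3" "x2 + c' * y2 = p3 * c" "x1 + d' * y1 = 0" "x2 + d' * y2 = p4"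
    using k[of a' p1 "p1 * a"] k[of b' p2 "p2 * b"] k[of c' p3 "p3 * c"] k[of d' 0 p4] p1 p2 p3 p4
    by (simp_all add: algebra_simps)
  \<comment> \<open>\<Delta> is the determinant of the change of basis. The determinant of the
    vectors X' + i Y' and X' + j Y' is (j - i) \<Delta>; computed with the multiples p1, ..., p4 it
    gives the four differences, and all factors cancel in the cross-ratio.\<close>
  define \<Delta> where "\<Delta> = x1 * y2 - x2 * y1"
  have m: "(x1 + i * y1) * (x2 + j * y2) - (x1 + j * y1) * (x2 + i * y2) = (j - i) * \<Delta>" for i j
    by (simp add: \<Delta>_def algebra_simps)
  have ac: "p1 * p3 * (c - a) = (c' - a') * \<Delta>" and bd: "p2 * p4 = (d' - b') * \<Delta>"
    and bc: "p2 * p3 * (c - b) = (c' - b') * \<Delta>" and ad: "p1 * p4 = (d' - a') * \<Delta>"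
    using m[of a' c'] m[of b' d'] m[of b' c'] m[of a' d'] unfolding e by (simp_all add: algebra_simps)
  have \<Delta>: "\<Delta> \<noteq> 0" using ad p1 p4 by auto
  have "r * (b - c) = a - c"
  proof -
    let ?P = "p1 * p2 * p3 * p4"
    have "r * ((b' - c') * (a' - d')) = (a' - c') * (b' - d')" using r n by simp
    then have "r * (((c' - b') * \<Delta>) * ((d' - a') * \<Delta>)) = ((c' - a') * \<Delta>) * ((d' - b') * \<Delta>)" by algebra
    then have "?P * (r * (b - c)) = ?P * (a - c)" unfolding ac[symmetric] bd[symmetric] bc[symmetric] ad[symmetric] by algebra
    then show ?thesis using p1 p2 p3 p4 by simp
  qed
  then show "r = (a - c) / (b - c)" using ne by (simp add: field_simps)
next
  assume r: "r = (a - c) / (b - c)"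
  \<comment> \<open>\<open>has_cross_ratio\<close> wants a basis whose second vector lies on none of
    the four lines. X + \<tau> Y qualifies because \<tau> exceeds all three parameters; relative to
    Y and this vector they become 1 / (k - \<tau>), and the fourth line gets 0.\<close>
  define \<tau> where "\<tau> = \<bar>a\<bar> + \<bar>b\<bar> + \<bar>c\<bar> + 1"
  have t: "a - \<tau> \<noteq> 0" "b - \<tau> \<noteq> 0" "c - \<tau> \<noteq> 0" by (auto simp: \<tau>_def)
  define Y' where "Y' = X + \<tau> *\<^sub>R Y"
  have sp: "span {X + k *\<^sub>R Y} = span {Y + (1 / (k - \<tau>)) *\<^sub>R Y'}" if "k - \<tau> \<noteq> 0" for k
  proof -
    have "(k - \<tau>) *\<^sub>R (Y + (1 / (k - \<tau>)) *\<^sub>R Y') = X + k *\<^sub>R Y"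
      using that by (simp add: Y'_def scaleR_add_right) (simp add: algebra_simps)
    then show ?thesis using span_singleton_scale[OF that] by metis
  qed
  have Y'1: "Y' \<noteq> 0"
  proof
    assume "Y' = 0"
    then have "X = (- \<tau>) *\<^sub>R Y" by (simp add: Y'_def add_eq_0_iff)
    then show False using X by (metis insertI1 span_base span_mul)
  qed
  have Y'2: "Y \<notin> span {Y'}"
  proof
    assume "Y \<in> span {Y'}"
    then obtain k where k: "Y = k *\<^sub>R Y'" by (auto simp: span_singleton)
    then have "k \<noteq> 0" using Y by auto
    then have "Y' = (1 / k) *\<^sub>R Y" using k by simp
    then have "X = (1 / k - \<tau>) *\<^sub>R Y" by (simp add: Y'_def algebra_simps eq_diff_eq)
    then show False using X by (metis insertI1 span_base span_mul)
  qed
  show "has_cross_ratio (span {X + a *\<^sub>R Y}) (span {X + b *\<^sub>R Y}) (span {X + c *\<^sub>R Y}) (span {Y}) r"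
    unfolding has_cross_ratio_def
  proof (intro exI conjI)
    show "span {Y} = span {Y + 0 *\<^sub>R Y'}" by simp
    show "1 / (b - \<tau>) \<noteq> 1 / (c - \<tau>)" "1 / (a - \<tau>) \<noteq> 0" using t ne by auto
    show "r = ((1 / (a - \<tau>) - 1 / (c - \<tau>)) * (1 / (b - \<tau>) - 0)) / ((1 / (b - \<tau>) - 1 / (c - \<tau>)) * (1 / (a - \<tau>) - 0))"
    proof -
      have "1 / (a - \<tau>) - 1 / (c - \<tau>) = (c - a) / ((a - \<tau>) * (c - \<tau>))" "1 / (b - \<tau>) - 1 / (c - \<tau>) = (c - b) / ((b - \<tau>) * (c - \<tau>))"
        using t by (simp_all add: field_simps)
      then have "((1 / (a - \<tau>) - 1 / (c - \<tau>)) * (1 / (b - \<tau>) - 0)) / ((1 / (b - \<tau>) - 1 / (c - \<tau>)) * (1 / (a - \<tau>) - 0)) = (c - a) / (c - b)"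
      proof -
        assume e: "1 / (a - \<tau>) - 1 / (c - \<tau>) = (c - a) / ((a - \<tau>) * (c - \<tau>))" "1 / (b - \<tau>) - 1 / (c - \<tau>) = (c - b) / ((b - \<tau>) * (c - \<tau>))"
        define A B C where "A = a - \<tau>" and "B = b - \<tau>" and "C = c - \<tau>"
        have "A \<noteq> 0" "B \<noteq> 0" "C \<noteq> 0" "c - b \<noteq> 0" using t ne by (simp_all add: A_def B_def C_def)
        then have "((c - a) / (A * C) * (1 / B - 0)) / ((c - b) / (B * C) * (1 / A - 0)) = (c - a) / (c - b)"
          by (simp add: divide_simps)
        then show ?thesis unfolding e A_def B_def C_def .
      qed
      also have "\<dots> = (a - c) / (b - c)" by (metis minus_diff_eq minus_divide_divide)
      finally show ?thesis using r by simp
    qed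
  qed (use sp t Y'1 Y'2 in auto)
qed

text \<open>The invariant is defined through arbitrary parametrisations. Each of them is \<phi>
  applied to (x, \<beta>(x)) for a scalar function x of the parameter; \<open>m\<close> and
  \<open>k\<close> are its first two derivatives at 0.\<close>

lemma (in flecnodal_box) curve_jet:
  assumes \<beta>: "small_graph \<beta>" and b1: "vd 1 \<beta> 0 = 0"
    and c: "smooth_on {-1<..<1} c" "c 0 = s" "c ` {-1<..<1} \<subseteq> \<phi> ` graph \<beta>" "vd 1 c 0 \<noteq> 0"
  obtains m k where "m \<noteq> 0" "vd 1 c 0 = m *\<^sub>R pd \<phi> e1 0"
    "vd 2 c 0 = m\<^sup>2 *\<^sub>R (pd (pd \<phi> e1) e1 0 + vd 2 \<beta> 0 *\<^sub>R pd \<phi> e2 0) + k *\<^sub>R pd \<phi> e1 0"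
proof -
  let ?T = "{-1<..<1::real}" and ?E = "{-\<xi><..<\<xi>}"
  have T: "open ?T" "0 \<in> ?T" by auto
  have E: "open ?E" "0 \<in> ?E" using eps by auto
  have gA: "graph \<beta> \<subseteq> A" using graph_subset box_A by blast
  have s\<beta>: "smooth_on ?E \<beta>" using \<beta> by (simp add: small_graph_def)
  define d where "d t = \<psi> (c t)" for t
  have d: "d t \<in> graph \<beta>" "\<phi> (d t) = c t" if t: "t \<in> ?T" for t
  proof -
    obtain x where "x \<in> graph \<beta>" "c t = \<phi> x" using c(3) t by blast
    then show "d t \<in> graph \<beta>" "\<phi> (d t) = c t" using psi(2) gA by (auto simp: d_def)
  qed
  have dA: "d t \<in> A" if "t \<in> ?T" for t using d(1)[OF that] gA by blast
  have sd: "smooth_on ?T d"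
    unfolding d_def by (rule smooth_on_compose[OF T(1) phi(4) _ c(1) psi(1)]) (use c(3) gA in blast)
  have d0: "d 0 = 0" using psi(2)[OF A(2)] phi(2) c(2) by (simp add: d_def)
  define x where "x t = d t $ 1" for t
  have sx: "smooth_on ?T x" unfolding x_def by (rule smooth_on_nth[OF T(1) sd])
  have xE: "x t \<in> ?E" if "t \<in> ?T" for t
    using d(1)[OF that] by (auto simp: x_def in_graph_iff box_def abs_less_iff)
  have d2: "d t $ 2 = \<beta> (x t)" if "t \<in> ?T" for t using d(1)[OF that] by (simp add: x_def in_graph_iff)
  have x0: "x 0 = 0" by (simp add: x_def d0)
  have nth: "vd k d 0 $ i = vd k (\<lambda>t. d t $ i) 0" for k i
  proof -
    have "vd k d t $ i = vd k (\<lambda>t. d t $ i) t" if "t \<in> ?T" for t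
      using that
    proof (induction k arbitrary: t)
      case (Suc k)
      have "((\<lambda>t. vd k d t $ i) has_vector_derivative vd (Suc k) d t $ i) (at t)"
        by (rule bounded_linear.has_vector_derivative[OF bounded_linear_vec_nth has_vector_derivative_vd[OF T(1) sd Suc.prems]])
      then have "vd 1 (\<lambda>t. vd k d t $ i) t = vd (Suc k) d t $ i" by (rule vd_1I)
      moreover have "vd 1 (\<lambda>t. vd k d t $ i) t = vd 1 (vd k (\<lambda>t. d t $ i)) t"
        by (rule vd_cong[OF T(1) Suc.prems Suc.IH])
      ultimately show ?case by (simp add: vd_1_vd del: One_nat_def)
    qed simp
    then show ?thesis using T(2) by blast
  qed
  have dx: "(x has_real_derivative vd 1 x t) (at t)" if "t \<in> ?T" for t
    using has_vector_derivative_smooth[OF T(1) sx that] by (simp add: real_derivative_iff)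
  have d\<beta>: "(\<beta> has_real_derivative vd 1 \<beta> a) (at a)" if "a \<in> ?E" for a
    using has_vector_derivative_smooth[OF E(1) s\<beta> that] by (simp add: real_derivative_iff)
  have y1: "((\<lambda>t. \<beta> (x t)) has_vector_derivative vd 1 \<beta> (x t) * vd 1 x t) (at t)" if "t \<in> ?T" for t
    using DERIV_chain2[OF d\<beta>[OF xE[OF that]] dx[OF that]] by (simp add: real_derivative_iff)
  have "(vd 1 \<beta> has_real_derivative vd 2 \<beta> 0) (at (x 0))"
    using has_vector_derivative_vd[OF E(1) s\<beta> E(2), of 1] by (simp add: x0 real_derivative_iff numeral_2_eq_2)
  then have "((\<lambda>t. vd 1 \<beta> (x t)) has_real_derivative vd 2 \<beta> 0 * vd 1 x 0) (at 0)"
    by (rule DERIV_chain2[OF _ dx[OF T(2)]])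
  moreover have "(vd 1 x has_real_derivative vd 2 x 0) (at 0)"
    using has_vector_derivative_vd[OF T(1) sx T(2), of 1] by (simp add: real_derivative_iff numeral_2_eq_2)
  ultimately have "((\<lambda>t. vd 1 \<beta> (x t) * vd 1 x t) has_real_derivative
      vd 2 \<beta> 0 * vd 1 x 0 * vd 1 x 0 + vd 2 x 0 * vd 1 \<beta> (x 0)) (at 0)"
    by (rule DERIV_mult)
  then have y2: "vd 1 (\<lambda>t. vd 1 \<beta> (x t) * vd 1 x t) 0 = vd 2 \<beta> 0 * (vd 1 x 0)\<^sup>2"
    by (intro vd_1I) (simp add: x0 b1 power2_eq_square mult.assoc real_derivative_iff del: One_nat_def)
  have nth2: "vd k d 0 $ 2 = vd k (\<lambda>t. \<beta> (x t)) 0" for k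
    unfolding nth by (rule vd_cong[OF T d2])
  have v1: "vd 1 d 0 = vd 1 x 0 *\<^sub>R e1"
    using nth[of 1 1] nth2[of 1] vd_1I[OF y1[OF T(2)]]
    by (simp add: vec_eq_iff forall_2 x_def[abs_def, symmetric] x0 b1 del: One_nat_def)
  have v2: "vd 2 d 0 = vd 2 x 0 *\<^sub>R e1 + (vd 2 \<beta> 0 * (vd 1 x 0)\<^sup>2) *\<^sub>R e2"
  proof -
    have "vd 2 (\<lambda>t. \<beta> (x t)) 0 = vd 2 \<beta> 0 * (vd 1 x 0)\<^sup>2"
      using vd_SucI[OF T y1, of 1] y2 by (simp add: numeral_2_eq_2)
    then show ?thesis
      using nth[of 2 1] nth2[of 2] by (simp add: vec_eq_iff forall_2 x_def[abs_def, symmetric])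
  qed
  have l: "linear (\<lambda>v. pd \<phi> v 0)" by (rule pd_linear[OF phi(1) A(2)])
  have c1: "vd 1 c 0 = vd 1 x 0 *\<^sub>R pd \<phi> e1 0"
  proof -
    have "vd 1 c 0 = vd 1 (\<lambda>t. \<phi> (d t)) 0" by (rule vd_cong[OF T]) (simp add: d)
    also have "\<dots> = pd \<phi> (vd 1 d 0) 0" using vd_1_compose[OF T(1) phi(1) sd T(2) dA[OF T(2)]] by (simp add: d0 del: One_nat_def)
    finally show ?thesis unfolding v1 linear_cmul[OF l] .
  qed
  have c2: "vd 2 c 0 = (vd 1 x 0)\<^sup>2 *\<^sub>R (pd (pd \<phi> e1) e1 0 + vd 2 \<beta> 0 *\<^sub>R pd \<phi> e2 0) + vd 2 x 0 *\<^sub>R pd \<phi> e1 0"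
  proof -
    have "vd 2 c 0 = vd 2 (\<lambda>t. \<phi> (d t)) 0" by (rule vd_cong[OF T]) (simp add: d)
    also have "\<dots> = pd (pd \<phi> (vd 1 d 0)) (vd 1 d 0) 0 + pd \<phi> (vd 2 d 0) 0"
      using vd2_compose[OF A(1) T(1) phi(1) sd dA T(2)] by (simp add: d0 del: One_nat_def)
    also have "pd (pd \<phi> (vd 1 d 0)) (vd 1 d 0) 0 = (vd 1 x 0)\<^sup>2 *\<^sub>R pd (pd \<phi> e1) e1 0"
    proof -
      have "pd (pd \<phi> (k *\<^sub>R e1)) v 0 = k *\<^sub>R pd (pd \<phi> e1) v 0" for k v
      proof -
        have "pd (pd \<phi> (k *\<^sub>R e1)) v 0 = pd (\<lambda>y. k *\<^sub>R pd \<phi> e1 y) v 0"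
          by (intro pd_cong[OF A] smooth_on_pd phi(1)) (rule linear_cmul[OF pd_linear[OF phi(1)]])
        then show ?thesis using pd_bounded_linear[OF smooth_on_pd[OF phi(1)] A(2) bounded_linear_scaleR_right] by simp
      qed
      then show ?thesis
        unfolding v1 using linear_cmul[OF pd_linear[OF smooth_on_pd[OF phi(1)] A(2)]] by (simp add: power2_eq_square del: One_nat_def)
    qed
    also have "pd \<phi> (vd 2 d 0) 0 = vd 2 x 0 *\<^sub>R pd \<phi> e1 0 + (vd 2 \<beta> 0 * (vd 1 x 0)\<^sup>2) *\<^sub>R pd \<phi> e2 0"
      unfolding v2 linear_add[OF l] linear_cmul[OF l] ..
    finally show ?thesis by (simp add: algebra_simps del: One_nat_def)
  qed
  have "vd 1 x 0 \<noteq> 0" using c(4) c1 by auto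
  then show ?thesis using that c1 c2 by blast
qed

section \<open>Tangent lines of the lifted curves\<close>

context flecnodal_chart
begin

text \<open>\<open>lift_base\<close> is the velocity of the lift of the first coordinate axis and
  \<open>lift_fibre\<close> a vector along the fibre. A graph with vanishing slope and second
  derivative \<open>b\<close> at 0 has a lift with velocity
  \<open>lift_base + b *\<^sub>R lift_fibre\<close>.\<close>

definition lift_base where "lift_base = (pd \<phi> e1 0, line_matrix_deriv (pd \<phi> e1 0) (pd (pd \<phi> e1) e1 0))"
definition lift_fibre where "lift_fibre = (0 :: real^2, line_matrix_deriv (pd \<phi> e1 0) (pd \<phi> e2 0))"

lemma phi_frame: "pd \<phi> e1 0 $ 1 * pd \<phi> e2 0 $ 2 - pd \<phi> e1 0 $ 2 * pd \<phi> e2 0 $ 1 \<noteq> 0"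
proof
  let ?a = "pd \<phi> e1 0" and ?b = "pd \<phi> e2 0"
  assume z: "?a $ 1 * ?b $ 2 - ?a $ 2 * ?b $ 1 = 0"
  have l: "linear (\<lambda>v. pd \<phi> v 0)" by (rule pd_linear[OF phi(1) A(2)])
  note inj = bij_is_inj[OF pd_phi_bij[OF A(2)], unfolded linear_injective_0[OF l]]
  have c: "pd \<phi> v 0 = v$1 *\<^sub>R ?a + v$2 *\<^sub>R ?b" for v by (rule pd_coords[OF phi(1) A(2)])
  have "pd \<phi> (vector [?b $ 2, - ?a $ 2]) 0 = 0" "pd \<phi> (vector [?b $ 1, - ?a $ 1]) 0 = 0"
    unfolding c[of "vector [?b $ 2, - ?a $ 2]"] c[of "vector [?b $ 1, - ?a $ 1]"]
    using z by (simp_all add: vec_eq_iff forall_2 algebra_simps)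
  then have "(vector [?b $ 2, - ?a $ 2] :: real^2) = 0" "(vector [?b $ 1, - ?a $ 1] :: real^2) = 0" using inj by blast+
  then have "?a = 0" by (simp add: vec_eq_iff forall_2)
  then have "e1 = 0" using inj by blast
  then show False by (metis vector_2(1) zero_index zero_neq_one)
qed

lemma phi_e1_nz: "pd \<phi> e1 0 \<noteq> 0" using phi_frame by auto

lemma lift_fibre_nz: "lift_fibre \<noteq> 0"
  using line_matrix_deriv_nonzero[OF phi_frame] by (simp add: lift_fibre_def zero_prod_def)

lemma lift_base_not_fibre: "lift_base \<notin> span {lift_fibre}"
  using phi_e1_nz by (auto simp: lift_base_def lift_fibre_def span_singleton)

text \<open>The part of the second derivative along the curve does not turn its tangent line, and
  the rest of the velocity of the lift scales with \<open>m\<close>. So the line spanned is the same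
  for all parametrisations.\<close>

lemma lift_tangent_jet:
  assumes c: "smooth_on {-1<..<1} c" and m: "m \<noteq> 0" and c1: "vd 1 c 0 = m *\<^sub>R pd \<phi> e1 0"
    and c2: "vd 2 c 0 = m\<^sup>2 *\<^sub>R (pd (pd \<phi> e1) e1 0 + b *\<^sub>R pd \<phi> e2 0) + k *\<^sub>R pd \<phi> e1 0"
  shows "lift_tangent c = span {lift_base + b *\<^sub>R lift_fibre}"
    and "line_matrix (vd 1 c 0) = line_matrix (pd \<phi> e1 0)"
    and "fibre_tangent s (vd 1 c 0) = span {lift_fibre}"
proof -
  let ?T = "{-1<..<1::real}" and ?a = "pd \<phi> e1 0" and ?b = "pd \<phi> e2 0"
  have T: "open ?T" "0 \<in> ?T" by auto
  have nz: "vd 1 c 0 \<noteq> 0" using m phi_e1_nz c1 by simp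
  have d1: "(vd 1 c has_vector_derivative vd 2 c 0) (at 0)"
    using has_vector_derivative_vd[OF T(1) c T(2), of 1] by (simp add: numeral_2_eq_2)
  have "vd 1 (contact_lift c) 0 = (vd 1 c 0, line_matrix_deriv (vd 1 c 0) (vd 2 c 0))"
    unfolding contact_lift_def[abs_def]
    by (intro vd_1I has_vector_derivative_Pair has_vector_derivative_smooth[OF T(1) c T(2)]
        has_vector_derivative_line_matrix[OF d1 nz])
  also have "\<dots> = m *\<^sub>R (lift_base + b *\<^sub>R lift_fibre)"
    unfolding c1 c2 line_matrix_deriv_scale[OF m] line_matrix_deriv_linear line_matrix_deriv_self
    using m by (simp add: lift_base_def lift_fibre_def power2_eq_square scaleR_add_right line_matrix_deriv_self[of _ 1, simplified])
  finally show "lift_tangent c = span {lift_base + b *\<^sub>R lift_fibre}"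
    unfolding lift_tangent_def using span_singleton_scale[OF m] by simp
  show "line_matrix (vd 1 c 0) = line_matrix ?a" unfolding c1 by (rule line_matrix_scale[OF m])
  have f: "vd 1 (\<lambda>t. (s, line_matrix (vd 1 c 0 + t *\<^sub>R w))) 0 = (0, line_matrix_deriv (vd 1 c 0) w)" for w
  proof (intro vd_1I has_vector_derivative_Pair has_vector_derivative_const)
    have "((\<lambda>t. line_matrix (vd 1 c 0 + t *\<^sub>R w)) has_vector_derivative line_matrix_deriv (vd 1 c 0 + 0 *\<^sub>R w) w) (at 0)"
      using nz by (intro has_vector_derivative_line_matrix) (auto intro!: derivative_eq_intros)
    then show "((\<lambda>t. line_matrix (vd 1 c 0 + t *\<^sub>R w)) has_vector_derivative line_matrix_deriv (vd 1 c 0) w) (at 0)" by simp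
  qed
  have g: "(0, line_matrix_deriv (vd 1 c 0) w) \<in> span {lift_fibre}" for w
  proof -
    obtain v where v: "w = pd \<phi> v 0" using bij_is_surj[OF pd_phi_bij[OF A(2)]] by (rule surjE)
    have w: "w = v$1 *\<^sub>R ?a + v$2 *\<^sub>R ?b" by (rule trans[OF v pd_coords[OF phi(1) A(2)]])
    have "(0, line_matrix_deriv (vd 1 c 0) w) = (v$2 / m) *\<^sub>R lift_fibre"
      unfolding w c1 line_matrix_deriv_scale[OF m] by (simp add: line_matrix_deriv_linear line_matrix_deriv_self[of _ 1, simplified] lift_fibre_def)
    then show ?thesis by (metis insertI1 span_base span_mul)
  qed
  have h: "lift_fibre = (0, line_matrix_deriv (vd 1 c 0) (m *\<^sub>R ?b))"
    unfolding c1 line_matrix_deriv_scale[OF m] using m by (simp add: line_matrix_deriv_linear lift_fibre_def)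
  show "fibre_tangent s (vd 1 c 0) = span {lift_fibre}"
    unfolding fibre_tangent_def f
  proof (rule span_eq[THEN iffD2], intro conjI)
    show "{(0, line_matrix_deriv (vd 1 c 0) w) |w. True} \<subseteq> span {lift_fibre}" using g by auto
    show "{lift_fibre} \<subseteq> span {(0, line_matrix_deriv (vd 1 c 0) w) |w. True}"
      using h by (auto intro!: span_base)
  qed
qed

lemma vd_square: "vd 1 (\<lambda>a. k * a\<^sup>2 :: real) 0 = 0" "vd 2 (\<lambda>a. k * a\<^sup>2 :: real) 0 = 2 * k"
proof -
  have 1: "((\<lambda>a. k * a\<^sup>2 :: real) has_vector_derivative 2 * k * a) (at a)" for a
    by (auto simp flip: real_derivative_iff intro!: derivative_eq_intros)
  show "vd 1 (\<lambda>a. k * a\<^sup>2 :: real) 0 = 0" using vd_1I[OF 1[of 0]] by simp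
  have "vd 1 (\<lambda>a. 2 * k * a) 0 = 2 * k"
    by (rule vd_1I) (auto simp flip: real_derivative_iff intro!: derivative_eq_intros)
  then show "vd 2 (\<lambda>a. k * a\<^sup>2 :: real) 0 = 2 * k"
    using vd_SucI[OF open_UNIV UNIV_I 1, of 1] by (simp add: numeral_2_eq_2)
qed

text \<open>In the basis of \<open>lift_base\<close> and \<open>lift_fibre\<close> the three lifted
  curves have parameters -12 - 16 q, -12 and -4, and the fibre is the line at infinity. An
  equivalence is proved because the definite description in \<open>cr_invariant\<close> asks for
  uniqueness.\<close>

lemma has_cr_invariant_iff: "has_cr_invariant U n s \<rho> \<longleftrightarrow> \<rho> = 1 + 2 * q"
proof -
  have ratio: "(vd 2 bt 0 - 2 * (- 2)) / (2 * (- 6) - 2 * (- 2)) = 1 + 2 * q"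
    by (simp add: bt2 field_simps)
  \<comment> \<open>All admissible choices are treated at once: it suffices that the three curves
    run on the graphs of a box containing \<open>W\<close>.\<close>
  have main: "has_cross_ratio (lift_tangent cF) (lift_tangent cP) (lift_tangent cD) (fibre_tangent s (vd 1 cP 0)) \<rho>
        \<longleftrightarrow> \<rho> = 1 + 2 * q" (is ?cr)
    and lift: "contact_lift cF 0 = contact_lift cP 0 \<and> contact_lift cP 0 = contact_lift cD 0" (is ?lift)
    if g: "good \<xi>" and W: "W \<subseteq> \<phi> ` box \<xi>"
      and p: "parametrises cF (flecnodal_curve U n \<inter> W) s" "parametrises cP (parabolic_curve U n \<inter> W) s"
        "parametrises cD (conodal_curve W n) s" for \<xi> W cF cP cD
  proof -
    interpret flecnodal_box U f n s A \<phi> \<psi> F N h \<mu> r bt \<pi> \<xi> by unfold_locales (rule g)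
    have mono: "conodal_curve W n \<subseteq> conodal_curve V n"
    proof -
      have "{u\<in>W. \<exists>u'\<in>W. \<not> same_point (n u) (n u') \<and> tangent_plane n u = tangent_plane n u'} \<subseteq>
        {u\<in>V. \<exists>u'\<in>V. \<not> same_point (n u) (n u') \<and> tangent_plane n u = tangent_plane n u'}" using W by blast
      from closure_mono[OF this] W show ?thesis unfolding conodal_curve_def by blast
    qed
    have F: "smooth_on {-1<..<1} cF" "cF 0 = s" "cF ` {-1<..<1} \<subseteq> \<phi> ` graph bt" "vd 1 cF 0 \<noteq> 0"
      using p(1) W flecnodal_n by (auto simp: parametrises_def)
    have P: "smooth_on {-1<..<1} cP" "cP 0 = s" "cP ` {-1<..<1} \<subseteq> \<phi> ` graph (\<lambda>a. - 6 * a\<^sup>2)" "vd 1 cP 0 \<noteq> 0"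
      using p(2) W parabolic_n by (auto simp: parametrises_def)
    have D: "smooth_on {-1<..<1} cD" "cD 0 = s" "cD ` {-1<..<1} \<subseteq> \<phi> ` graph (\<lambda>a. - 2 * a\<^sup>2)" "vd 1 cD 0 \<noteq> 0"
      using p(3) mono conodal_V by (auto simp: parametrises_def)
    have sg: "small_graph (\<lambda>a. - 6 * a\<^sup>2)" "small_graph (\<lambda>a. - 2 * a\<^sup>2)" by (rule small_graph_square; simp)+
    obtain m k where mF: "m \<noteq> 0" "vd 1 cF 0 = m *\<^sub>R pd \<phi> e1 0"
      "vd 2 cF 0 = m\<^sup>2 *\<^sub>R (pd (pd \<phi> e1) e1 0 + vd 2 bt 0 *\<^sub>R pd \<phi> e2 0) + k *\<^sub>R pd \<phi> e1 0"
      by (rule curve_jet[OF small_graph_bt bt1 F])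
    obtain m' k' where mP: "m' \<noteq> 0" "vd 1 cP 0 = m' *\<^sub>R pd \<phi> e1 0"
      "vd 2 cP 0 = m'\<^sup>2 *\<^sub>R (pd (pd \<phi> e1) e1 0 + vd 2 (\<lambda>a. - 6 * a\<^sup>2) 0 *\<^sub>R pd \<phi> e2 0) + k' *\<^sub>R pd \<phi> e1 0"
      by (rule curve_jet[OF sg(1) vd_square(1) P])
    obtain m'' k'' where mD: "m'' \<noteq> 0" "vd 1 cD 0 = m'' *\<^sub>R pd \<phi> e1 0"
      "vd 2 cD 0 = m''\<^sup>2 *\<^sub>R (pd (pd \<phi> e1) e1 0 + vd 2 (\<lambda>a. - 2 * a\<^sup>2) 0 *\<^sub>R pd \<phi> e2 0) + k'' *\<^sub>R pd \<phi> e1 0"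
      by (rule curve_jet[OF sg(2) vd_square(1) D])
    note lF = lift_tangent_jet[OF F(1) mF] and lP = lift_tangent_jet[OF P(1) mP] and lD = lift_tangent_jet[OF D(1) mD]
    show ?cr
      unfolding lF(1) lP(1,3) lD(1) vd_square(2)
      by (subst has_cross_ratio_iff[OF lift_fibre_nz lift_base_not_fibre]) (simp_all add: ratio[simplified])
    show ?lift unfolding contact_lift_def lF(2) lP(2) lD(2) F(2) P(2) D(2) by simp
  qed
  show ?thesis
  proof
    assume cr: "has_cr_invariant U n s \<rho>"
    obtain \<xi> where g: "good \<xi>" using box_small[OF open_UNIV] by blast
    interpret flecnodal_box U f n s A \<phi> \<psi> F N h \<mu> r bt \<pi> \<xi> by unfold_locales (rule g)
    obtain W cF cP cD where *: "W \<subseteq> V" "parametrises cF (flecnodal_curve U n \<inter> W) s" "parametrises cP (parabolic_curve U n \<inter> W) s"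
      "parametrises cD (conodal_curve W n) s"
      "has_cross_ratio (lift_tangent cF) (lift_tangent cP) (lift_tangent cD) (fibre_tangent s (vd 1 cP 0)) \<rho>"
      using cr[unfolded has_cr_invariant_def, rule_format, OF conjI[OF V_open s_V]] by auto
    show "\<rho> = 1 + 2 * q" using main[OF g *(1-4)] *(5) by simp
  next
    assume \<rho>: "\<rho> = 1 + 2 * q"
    show "has_cr_invariant U n s \<rho>"
      unfolding has_cr_invariant_def
    proof (intro allI impI)
      fix W0 assume "open W0 \<and> s \<in> W0"
      then obtain \<xi> where g: "good \<xi>" "\<phi> ` box \<xi> \<subseteq> W0" using box_small by blast
      interpret flecnodal_box U f n s A \<phi> \<psi> F N h \<mu> r bt \<pi> \<xi> by unfold_locales (rule g)
      have sg: "small_graph (\<lambda>a. - 6 * a\<^sup>2)" "small_graph (\<lambda>a. - 2 * a\<^sup>2)" by (rule small_graph_square; simp)+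
      note pg = parametrises_graph[where \<sigma>=1, OF _ disjI1[OF refl]]
      note p = pg[OF small_graph_bt, folded flecnodal_n] pg[OF sg(1), folded parabolic_n] pg[OF sg(2), folded conodal_V]
      show "\<exists>W cF cP cD. open W \<and> s \<in> W \<and> W \<subseteq> W0 \<and> W \<subseteq> U \<and>
          parametrises cF (flecnodal_curve U n \<inter> W) s \<and> parametrises cP (parabolic_curve U n \<inter> W) s \<and>
          parametrises cD (conodal_curve W n) s \<and>
          contact_lift cF 0 = contact_lift cP 0 \<and> contact_lift cP 0 = contact_lift cD 0 \<and>
          has_cross_ratio (lift_tangent cF) (lift_tangent cP) (lift_tangent cD) (fibre_tangent s (vd 1 cP 0)) \<rho>"
        using V_open s_V g(2) V_U p main[OF g(1) order_refl p] lift[OF g(1) order_refl p] \<rho>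
        by (intro exI conjI) (assumption | simp)+
    qed
  qed
qed

lemma cr_invariant_eq: "cr_invariant U n s = 1 + 2 * q"
  unfolding cr_invariant_def has_cr_invariant_iff by simp

end

section \<open>Jets of curves in an affine chart\<close>

lemma tendsto_quotient_third:
  fixes c :: "real => real"
  assumes T: "open T" "0 \<in> T" and c: "smooth_on T c" and c0: "c 0 = 0" "vd 1 c 0 = 0" "vd 2 c 0 = 0"
  shows "((\<lambda>a. c a / a ^ 3) \<longlongrightarrow> vd 3 c 0 / 6) (at 0)"
proof (rule lhopital[where f'="vd 1 c" and g'="\<lambda>a. 3 * a\<^sup>2"])
  have ev: "\<forall>\<^sub>F a in at 0. a \<in> T" using T by (rule eventually_at_in_open')
  have nz: "\<forall>\<^sub>F a in at 0. (a::real) \<noteq> 0" by (simp add: eventually_at_filter)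
  show "(c \<longlongrightarrow> 0) (at 0)" using smooth_on_tendsto[OF c T(2)] c0 by simp
  show "((\<lambda>a::real. a ^ 3) \<longlongrightarrow> 0) (at 0)" by (auto intro!: tendsto_eq_intros)
  show "\<forall>\<^sub>F a in at 0. (a::real) ^ 3 \<noteq> 0" using nz by eventually_elim simp
  show "\<forall>\<^sub>F a in at 0. 3 * (a::real)\<^sup>2 \<noteq> 0" using nz by eventually_elim simp
  show "\<forall>\<^sub>F a in at 0. (c has_real_derivative vd 1 c a) (at a)"
    using ev by eventually_elim
      (use has_vector_derivative_smooth[OF T(1) c] in \<open>simp add: real_derivative_iff\<close>)
  show "\<forall>\<^sub>F a in at 0. ((\<lambda>a. a ^ 3) has_real_derivative 3 * a\<^sup>2) (at (a::real))"
    by (auto intro!: always_eventually derivative_eq_intros simp: power2_eq_square)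
  have v: "vd 1 (vd 1 c) 0 = vd 2 c 0" "vd 2 (vd 1 c) 0 = vd 3 c 0"
    by (simp_all add: vd_def numeral_2_eq_2 numeral_3_eq_3)
  have "((\<lambda>a. vd 1 c a / a\<^sup>2 / 3) \<longlongrightarrow> vd 2 (vd 1 c) 0 / 2 / 3) (at 0)"
    using c0 v by (intro tendsto_divide tendsto_const tendsto_quotient_second[OF T smooth_on_vd[OF T(1) c]]) simp_all
  then show "((\<lambda>a. vd 1 c a / (3 * a\<^sup>2)) \<longlongrightarrow> vd 3 c 0 / 6) (at 0)"
    by (simp add: v field_simps del: One_nat_def)
qed

lemma vd_bounded_linear:
  assumes T: "open T" and c: "smooth_on T c" and t: "t \<in> T" and l: "bounded_linear l"
  shows "vd k (\<lambda>t. l (c t)) t = l (vd k c t)"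
  using t
proof (induction k arbitrary: t)
  case (Suc k)
  have "((\<lambda>t. l (vd k c t)) has_vector_derivative l (vd (Suc k) c t)) (at t)"
    by (rule bounded_linear.has_vector_derivative[OF l has_vector_derivative_vd[OF T c Suc.prems]])
  then have "vd 1 (\<lambda>t. l (vd k c t)) t = l (vd (Suc k) c t)" by (rule vd_1I)
  moreover have "vd 1 (vd k (\<lambda>t. l (c t))) t = vd 1 (\<lambda>t. l (vd k c t)) t"
    by (rule vd_cong[OF T Suc.prems Suc.IH])
  ultimately show ?case by (simp add: vd_1_vd del: One_nat_def)
qed simp

lemma vd_rescale:
  assumes T: "open T" and c: "smooth_on T c" and t: "k * t \<in> T"
  shows "vd j (\<lambda>t. c (k * t)) t = k ^ j *\<^sub>R vd j c (k * t)"
  using t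
proof (induction j arbitrary: t)
  case (Suc j)
  have T': "open ((\<lambda>t. k * t) -` T)" by (intro open_vimage T continuous_intros)
  have "((\<lambda>t. k ^ j *\<^sub>R vd j c (k * t)) has_vector_derivative k ^ j *\<^sub>R (k *\<^sub>R vd (Suc j) c (k * t))) (at t)"
  proof (rule bounded_linear.has_vector_derivative[OF bounded_linear_scaleR_right])
    have "((\<lambda>t. vd j c (k * t)) has_vector_derivative pd (vd j c) k (k * t)) (at t)"
      by (rule has_vector_derivative_compose_smooth[where c="\<lambda>t. k * t", OF smooth_on_vd[OF T c] Suc.prems])
        (auto simp flip: real_derivative_iff intro!: derivative_eq_intros)
    moreover have "pd (vd j c) k (k * t) = k *\<^sub>R vd (Suc j) c (k * t)"
      using pd_eqI[OF has_vector_derivative_vd[OF T c Suc.prems, of j, unfolded has_vector_derivative_def]] .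
    ultimately show "((\<lambda>t. vd j c (k * t)) has_vector_derivative k *\<^sub>R vd (Suc j) c (k * t)) (at t)" by simp
  qed
  then have "vd 1 (\<lambda>t. k ^ j *\<^sub>R vd j c (k * t)) t = k ^ Suc j *\<^sub>R vd (Suc j) c (k * t)"
    by (intro vd_1I) (simp add: mult.commute)
  moreover have "vd 1 (vd j (\<lambda>t. c (k * t))) t = vd 1 (\<lambda>t. k ^ j *\<^sub>R vd j c (k * t)) t"
    using Suc.prems by (intro vd_cong[OF T' _ Suc.IH]) auto
  ultimately show ?case by (simp add: vd_1_vd del: One_nat_def)
qed simp

text \<open>Two curves near a cusp are compared by a height g, of second order, and a lateral
  coordinate p. At the height of a point \<open>y\<close> of the second curve the first one has a
  point on each side, at distances comparable to |y|; their lateral coordinates are of order |y|^3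
  with opposite signs, while that of \<open>y\<close> is of smaller order.\<close>

lemma opposite_cubics_enclose:
  fixes gF gD pF pD :: "real => real"
  assumes gF: "((\<lambda>x. gF x / x\<^sup>2) \<longlongrightarrow> A) (at 0)" "gF 0 = 0" "continuous_on {-r<..<r} gF" "r > 0"
    and gD: "((\<lambda>x. gD x / x\<^sup>2) \<longlongrightarrow> B) (at 0)" and AB: "A * B > 0"
    and pF: "((\<lambda>x. pF x / x ^ 3) \<longlongrightarrow> C) (at 0)" "C \<noteq> 0" and pD: "((\<lambda>x. pD x / x ^ 3) \<longlongrightarrow> 0) (at 0)"
    and \<eta>: "\<eta> > 0"
  shows "\<exists>\<xi>>0. \<forall>y. y \<noteq> 0 \<and> \<bar>y\<bar> < \<xi> --> (\<exists>u v. - \<eta> < u \<and> u < 0 \<and> 0 < v \<and> v < \<eta> \<and> gF u = gD y \<and> gF v = gD y \<and>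
     (pF u < pD y \<and> pD y < pF v \<or> pF v < pD y \<and> pD y < pF u))"
proof -
  have nz: "\<forall>\<^sub>F a in at 0. (a::real) \<noteq> 0" by (simp add: eventually_at_filter)
  have comm: "g / w / A = g / A / w" for g w by simp
  have A: "A \<noteq> 0" and BA: "B / A > 0" using AB by (auto simp: zero_less_mult_iff divide_pos_pos divide_neg_neg)
  define b where "b = B / A"
  have b: "b > 0" using BA by (simp add: b_def)
  have "((\<lambda>x. gF x / x\<^sup>2 / A) \<longlongrightarrow> A / A) (at 0)" by (intro tendsto_divide gF tendsto_const A)
  then have "\<forall>\<^sub>F x in at 0. 1/2 < gF x / x\<^sup>2 / A \<and> gF x / x\<^sup>2 / A < 2"
    using A by (intro eventually_conj order_tendstoD[where y="1"]) auto
  then have 1: "\<forall>\<^sub>F x in at 0. x\<^sup>2 / 2 < gF x / A \<and> gF x / A < 2 * x\<^sup>2"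
    using nz by eventually_elim (simp add: comm pos_less_divide_eq pos_divide_less_eq del: divide_divide_eq_left)
  have "((\<lambda>x. gD x / x\<^sup>2 / A) \<longlongrightarrow> b) (at 0)" unfolding b_def by (intro tendsto_divide gD tendsto_const A)
  then have "\<forall>\<^sub>F x in at 0. b / 2 < gD x / x\<^sup>2 / A \<and> gD x / x\<^sup>2 / A < 2 * b"
    using b by (intro eventually_conj order_tendstoD[where y="b"]) auto
  then have 2: "\<forall>\<^sub>F y in at 0. b / 2 * y\<^sup>2 < gD y / A \<and> gD y / A < 2 * b * y\<^sup>2"
    using nz by eventually_elim (simp add: comm pos_less_divide_eq pos_divide_less_eq del: divide_divide_eq_left)
  have "((\<lambda>x. pF x / x ^ 3 / C) \<longlongrightarrow> C / C) (at 0)" by (intro tendsto_divide pF tendsto_const)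
  then have "\<forall>\<^sub>F x in at 0. 1/2 < pF x / x ^ 3 / C"
    using pF(2) by (intro order_tendstoD(1)[where y="1"]) auto
  then have 3: "\<forall>\<^sub>F x in at 0. (0 < x --> x ^ 3 / 2 < pF x / C) \<and> (x < 0 --> pF x / C < x ^ 3 / 2)"
  proof eventually_elim
    case (elim x)
    have "pF x / C = (pF x / x ^ 3 / C) * x ^ 3" if "x \<noteq> 0" using that by simp
    moreover have "1/2 * x ^ 3 < (pF x / x ^ 3 / C) * x ^ 3" if "0 < x"
      by (rule mult_strict_right_mono[OF elim]) (use that in simp)
    moreover have "(pF x / x ^ 3 / C) * x ^ 3 < 1/2 * x ^ 3" if "x < 0"
      by (rule mult_strict_right_mono_neg[OF elim]) (use that in simp)
    ultimately show ?case by auto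
  qed
  \<comment> \<open>At the height of \<open>y\<close> a point x of the first curve satisfies |x| >
    sqrt (b / 4) |y|, so its lateral coordinate divided by \<open>C\<close> exceeds \<delta> |y|^3
    in modulus.\<close>
  define \<delta> where "\<delta> = sqrt (b / 4) ^ 3 / 2"
  have sb: "sqrt (b / 4) > 0" using b by simp
  then have \<delta>: "\<delta> > 0" by (simp add: \<delta>_def)
  have "((\<lambda>x. \<bar>pD x / x ^ 3 / C\<bar>) \<longlongrightarrow> \<bar>0 / C\<bar>) (at 0)" by (intro tendsto_rabs tendsto_divide pD tendsto_const pF)
  then have "\<forall>\<^sub>F x in at 0. \<bar>pD x / x ^ 3 / C\<bar> < \<delta>" using \<delta> by (intro order_tendstoD(2)) auto
  then have 4: "\<forall>\<^sub>F y in at 0. \<bar>pD y / C\<bar> < \<delta> * \<bar>y\<bar> ^ 3"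
    using nz
  proof eventually_elim
    case (elim y)
    have "\<bar>pD y / C\<bar> = \<bar>pD y / y ^ 3 / C\<bar> * \<bar>y\<bar> ^ 3" using elim by (simp add: abs_mult power_abs field_simps)
    also have "\<dots> < \<delta> * \<bar>y\<bar> ^ 3" by (rule mult_strict_right_mono) (use elim in simp_all)
    finally show ?case .
  qed
  from eventually_conj[OF 1 3] obtain d where d: "d > 0"
    and F: "\<And>x. x \<noteq> 0 ==> \<bar>x\<bar> < d ==> (x\<^sup>2 / 2 < gF x / A \<and> gF x / A < 2 * x\<^sup>2) \<and>
      (0 < x --> x ^ 3 / 2 < pF x / C) \<and> (x < 0 --> pF x / C < x ^ 3 / 2)"
    unfolding eventually_at dist_real_def by auto
  from eventually_conj[OF 2 4] obtain d' where d': "d' > 0"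
    and D: "\<And>y. y \<noteq> 0 ==> \<bar>y\<bar> < d' ==> (b / 2 * y\<^sup>2 < gD y / A \<and> gD y / A < 2 * b * y\<^sup>2) \<and> \<bar>pD y / C\<bar> < \<delta> * \<bar>y\<bar> ^ 3"
    unfolding eventually_at dist_real_def by auto
  define m where "m = min (min d \<eta>) r / 2"
  have m: "m > 0" "m < d" "m < \<eta>" "m < r" using d \<eta> gF(4) by (auto simp: m_def)
  \<comment> \<open>At distance \<open>c * \<bar>y\<bar>\<close> the height of the first curve,
    divided by \<open>A\<close>, exceeds that of \<open>y\<close>, so the intermediate value theorem
    finds a point of equal height before it.\<close>
  define c where "c = sqrt (4 * b)"
  have c: "c > 0" "c\<^sup>2 = 4 * b" using b by (simp_all add: c_def)
  define e where "e = min d' (m / c)"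
  have e: "e > 0" using d' m c by (simp add: e_def)
  have key: "\<exists>x. 0 < \<sigma> * x \<and> \<bar>x\<bar> < \<eta> \<and> gF x = gD y \<and> \<sigma> * (pF x / C) > \<bar>pD y / C\<bar>"
    if y: "y \<noteq> 0" "\<bar>y\<bar> < e" and \<sigma>: "\<sigma> = 1 \<or> \<sigma> = (-1::real)" for y \<sigma>
  proof -
    have yd: "\<bar>y\<bar> < d'" "c * \<bar>y\<bar> < m" using y c by (auto simp: e_def field_simps)
    note Dy = D[OF y(1) yd(1)]
    have s2: "(\<sigma> * z)\<^sup>2 = z\<^sup>2" "\<bar>\<sigma> * z\<bar> = \<bar>z\<bar>" for z using \<sigma> by auto
    have cy: "0 < c * \<bar>y\<bar>" using y c by simp
    have end1: "gD y / A < gF (\<sigma> * (c * \<bar>y\<bar>)) / A"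
    proof -
      have "(\<sigma> * (c * \<bar>y\<bar>))\<^sup>2 / 2 < gF (\<sigma> * (c * \<bar>y\<bar>)) / A"
        using F[of "\<sigma> * (c * \<bar>y\<bar>)"] s2[of "c * \<bar>y\<bar>"] cy c y(1) yd m \<sigma> by auto
      moreover have "(\<sigma> * (c * \<bar>y\<bar>))\<^sup>2 / 2 = 2 * b * y\<^sup>2" unfolding s2(1) by (simp add: power_mult_distrib c)
      ultimately show ?thesis using Dy by simp
    qed
    have y2: "b / 2 * y\<^sup>2 > 0" using b y by simp
    have "\<exists>z. 0 \<le> z \<and> z \<le> c * \<bar>y\<bar> \<and> gF (\<sigma> * z) / A = gD y / A"
    proof (rule IVT')
      show "gF (\<sigma> * 0) / A \<le> gD y / A" using Dy y2 gF(2) by simp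
      show "gD y / A \<le> gF (\<sigma> * (c * \<bar>y\<bar>)) / A" using end1 by simp
      show "continuous_on {0..c * \<bar>y\<bar>} (\<lambda>z. gF (\<sigma> * z) / A)"
        by (rule continuous_on_divide[OF continuous_on_compose2[OF gF(3)]])
           (use A yd m \<sigma> in \<open>auto intro!: continuous_intros\<close>)
    qed (use cy in simp)
    then obtain z where z: "0 \<le> z" "z \<le> c * \<bar>y\<bar>" "gF (\<sigma> * z) = gD y" using A by auto
    have z0: "z \<noteq> 0" using z(3) Dy y2 gF(2) by auto
    have zF: "\<sigma> * z \<noteq> 0" "\<bar>\<sigma> * z\<bar> < d" using z z0 yd m \<sigma> s2 by auto
    note Fz = F[OF zF]
    have "gD y / A < 2 * z\<^sup>2" "b / 2 * y\<^sup>2 < gD y / A" using Fz Dy z(3) s2(1)[of z] by simp_all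
    then have "b / 2 * y\<^sup>2 < 2 * z\<^sup>2" by linarith
    then have "(sqrt (b / 4) * \<bar>y\<bar>)\<^sup>2 < z\<^sup>2" using b by (simp add: power_mult_distrib)
    then have "sqrt (b / 4) * \<bar>y\<bar> < z" using z(1) by (rule power2_less_imp_less)
    then have "(sqrt (b / 4) * \<bar>y\<bar>) ^ 3 < z ^ 3" using sb by (intro power_strict_mono) auto
    then have "\<delta> * \<bar>y\<bar> ^ 3 < z ^ 3 / 2" by (simp add: \<delta>_def power_mult_distrib)
    moreover have "z ^ 3 / 2 < \<sigma> * (pF (\<sigma> * z) / C)" using Fz z z0 \<sigma> by auto
    ultimately have "\<sigma> * (pF (\<sigma> * z) / C) > \<bar>pD y / C\<bar>" using Dy by linarith
    moreover have "0 < \<sigma> * (\<sigma> * z)" using z z0 \<sigma> by auto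
    moreover have "\<bar>\<sigma> * z\<bar> < \<eta>" using z yd m s2 by simp
    ultimately show ?thesis using z(3) by blast
  qed
  show ?thesis
  proof (rule exI[of _ e], rule conjI[OF e], intro allI impI)
    fix y :: real assume y: "y \<noteq> 0 \<and> \<bar>y\<bar> < e"
    obtain v where v: "0 < 1 * v" "\<bar>v\<bar> < \<eta>" "gF v = gD y" "1 * (pF v / C) > \<bar>pD y / C\<bar>"
      using key[of y 1] y by blast
    obtain u where u: "0 < (-1) * u" "\<bar>u\<bar> < \<eta>" "gF u = gD y" "(-1) * (pF u / C) > \<bar>pD y / C\<bar>"
      using key[of y "-1"] y by blast
    have "pF u / C < pD y / C" "pD y / C < pF v / C" using u(4) v(4) by linarith+
    then have "pF u < pD y \<and> pD y < pF v \<or> pF v < pD y \<and> pD y < pF u"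
      using pF(2) by (cases "C > 0") (auto simp: divide_less_cancel)
    then show "\<exists>u v. - \<eta> < u \<and> u < 0 \<and> 0 < v \<and> v < \<eta> \<and> gF u = gD y \<and> gF v = gD y \<and>
       (pF u < pD y \<and> pD y < pF v \<or> pF v < pD y \<and> pD y < pF u)"
      using u v by (intro exI[of _ u] exI[of _ v]) auto
  qed
qed

section \<open>The front in affine charts\<close>

context swallowtail_chart
begin

text \<open>\<open>Hc\<close> and \<open>Kc\<close> are the images of \<open>h\<close> and
  \<open>pd F e2\<close> under the differential of \<open>affine_chart a\<close> at
  \<open>F x\<close>.\<close>

definition Hc where "Hc a x = (1 / (a \<bullet> F x)) *\<^sub>R (h x - (1 / (a \<bullet> F x) * (a \<bullet> h x)) *\<^sub>R F x)"
definition Kc where "Kc a x = (1 / (a \<bullet> F x)) *\<^sub>R (pd F e2 x - (1 / (a \<bullet> F x) * (a \<bullet> pd F e2 x)) *\<^sub>R F x)"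

text \<open>The chart is homogeneous of degree 0, so the term \<open>\<mu> x *\<^sub>R F x\<close>
  disappears and the derivative along \<open>e1\<close> is \<open>edge_fun\<close> times
  \<open>Hc\<close>. The last claim exchanges the order of differentiation and uses that
  \<open>edge_fun\<close> has derivative 2 along \<open>e2\<close>.\<close>

lemma affine_derivatives:
  assumes a: "a \<bullet> f s \<noteq> 0"
  obtains A' where "open A'" "0 \<in> A'" "A' \<subseteq> A"
    "smooth_on A' (\<lambda>x. affine_chart a (F x))" "smooth_on A' (Hc a)" "smooth_on A' (Kc a)"
    "\<And>x. x \<in> A' ==> pd (\<lambda>x. affine_chart a (F x)) e1 x = edge_fun x *\<^sub>R Hc a x"
    "\<And>x. x \<in> A' ==> pd (\<lambda>x. affine_chart a (F x)) e2 x = Kc a x"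
    "pd (Kc a) e1 0 = 2 *\<^sub>R Hc a 0"
proof -
  have saF: "smooth_on A (\<lambda>x. a \<bullet> F x)" by (rule smooth_on_inner[OF A(1) smooth_on_const[OF A(1)] smooth_F])
  define A' where "A' = A \<inter> (\<lambda>x. a \<bullet> F x) -` (- {0})"
  have A': "open A'" "0 \<in> A'" "A' \<subseteq> A" and nz: "\<And>x. x \<in> A' ==> a \<bullet> F x \<noteq> 0"
    using continuous_open_preimage[OF smooth_on_continuous[OF saF] A(1), of "- {0}"] A(2) a phi(2)
    by (auto simp: A'_def F_eq)
  define w where "w x = 1 / (a \<bullet> F x)" for x
  note sF = smooth_on_subset[OF smooth_F A'(3)] and sh = smooth_on_subset[OF h A'(3)]
  note saF' = smooth_on_subset[OF saF A'(3)]
  have sw: "smooth_on A' w" unfolding w_def by (rule smooth_on_divide[OF A'(1) smooth_on_const[OF A'(1)] saF' nz])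
  have sG: "smooth_on A' (\<lambda>x. w x *\<^sub>R F x)" by (rule smooth_on_scaleR[OF A'(1) sw sF])
  have G: "(\<lambda>x. affine_chart a (F x)) = (\<lambda>x. w x *\<^sub>R F x)"
    by (simp add: affine_chart_def w_def inverse_eq_divide)
  have H: "Hc a = (\<lambda>x. w x *\<^sub>R (h x - (w x * (a \<bullet> h x)) *\<^sub>R F x))" by (simp add: fun_eq_iff Hc_def w_def)
  have K: "Kc a = (\<lambda>x. w x *\<^sub>R (pd F e2 x - (w x * (a \<bullet> pd F e2 x)) *\<^sub>R F x))" by (simp add: fun_eq_iff Kc_def w_def)
  have sH: "smooth_on A' (Hc a)" unfolding H
    by (intro smooth_on_scaleR smooth_on_diff smooth_on_mult smooth_on_inner smooth_on_const A'(1) sw sF sh)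
  have sK: "smooth_on A' (Kc a)" unfolding K
    by (intro smooth_on_scaleR smooth_on_diff smooth_on_mult smooth_on_inner smooth_on_const smooth_on_pd A'(1) sw sF sh)
  have pdw: "pd w v x = - (w x)\<^sup>2 * (a \<bullet> pd F v x)" if x: "x \<in> A'" for v x
  proof -
    have "pd (\<lambda>x. w x * (a \<bullet> F x)) v x = w x * pd (\<lambda>x. a \<bullet> F x) v x + pd w v x * (a \<bullet> F x)"
      by (rule pd_bilinear[OF sw saF' x bounded_bilinear_mult])
    moreover have "pd (\<lambda>x. a \<bullet> F x) v x = a \<bullet> pd F v x" by (rule pd_bounded_linear[OF sF x bounded_linear_inner_right])
    moreover have "pd (\<lambda>x. w x * (a \<bullet> F x)) v x = pd (\<lambda>x. 1) v x"
      by (rule pd_cong[OF A'(1) x smooth_on_mult[OF A'(1) sw saF']]) (simp add: w_def nz)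
    ultimately show ?thesis using nz[OF x] by (simp add: w_def field_simps power2_eq_square)
  qed
  have d: "pd (\<lambda>x. w x *\<^sub>R F x) v x = w x *\<^sub>R (pd F v x - (w x * (a \<bullet> pd F v x)) *\<^sub>R F x)" if x: "x \<in> A'" for v x
    using pd_scaleR[OF sw sF x] by (simp add: pdw[OF x] algebra_simps power2_eq_square)
  have d1: "pd (\<lambda>x. w x *\<^sub>R F x) e1 x = edge_fun x *\<^sub>R Hc a x" if x: "x \<in> A'" for x
  proof -
    have Fx: "pd F e1 x = edge_fun x *\<^sub>R h x + \<mu> x *\<^sub>R F x" using Fa A'(3) x by blast
    have "w x * (a \<bullet> F x) = 1" using nz[OF x] by (simp add: w_def)
    then have e: "w x * (a \<bullet> (edge_fun x *\<^sub>R h x + \<mu> x *\<^sub>R F x)) = edge_fun x * (w x * (a \<bullet> h x)) + \<mu> x"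
      by (simp add: inner_add_right) algebra
    show ?thesis unfolding d[OF x] Fx e H by (simp add: algebra_simps)
  qed
  have d2: "pd (\<lambda>x. w x *\<^sub>R F x) e2 x = Kc a x" if "x \<in> A'" for x using d[OF that] by (simp add: K)
  have "pd (Kc a) e1 0 = pd (pd (\<lambda>x. w x *\<^sub>R F x) e2) e1 0" by (rule pd_cong[OF A'(1,2) sK]) (simp add: d2)
  also have "\<dots> = pd (pd (\<lambda>x. w x *\<^sub>R F x) e1) e2 0" by (rule pd_commute[OF A'(1) sG A'(2)])
  also have "\<dots> = pd (\<lambda>x. edge_fun x *\<^sub>R Hc a x) e2 0" by (rule pd_cong[OF A'(1,2) smooth_on_pd[OF sG] d1])
  also have "\<dots> = edge_fun 0 *\<^sub>R pd (Hc a) e2 0 + pd edge_fun e2 0 *\<^sub>R Hc a 0"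
    by (rule pd_scaleR[OF smooth_edge_fun[OF A'(1)] sH A'(2)])
  also have "\<dots> = 2 *\<^sub>R Hc a 0" by (simp add: pd_edge_fun edge_fun_def)
  finally have K1: "pd (Kc a) e1 0 = 2 *\<^sub>R Hc a 0" .
  show ?thesis by (rule that[unfolded G, OF A' sG sH sK d1 d2 K1])
qed

lemma HK_indep:
  assumes a: "a \<bullet> f s \<noteq> 0" and z: "i *\<^sub>R Hc a 0 + j *\<^sub>R Kc a 0 = 0"
  shows "i = 0 \<and> j = 0"
proof -
  have aF: "a \<bullet> F 0 \<noteq> 0" using a phi(2) by (simp add: F_eq)
  let ?w = "1 / (a \<bullet> F 0)"
  have "(- ?w * (i * (?w * (a \<bullet> h 0)) + j * (?w * (a \<bullet> pd F e2 0)))) *\<^sub>R F 0 + (?w * i) *\<^sub>R h 0 + (?w * j) *\<^sub>R pd F e2 0 + 0 *\<^sub>R N 0 = 0"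
    using z by (simp add: Hc_def Kc_def algebra_simps)
  from det4_indep[OF J0_nz[OF A(2), unfolded J0_def] this] show ?thesis using aF by simp
qed

text \<open>With \<open>HK_indep\<close> this makes \<open>Hc\<close> and \<open>Kc\<close> a basis
  of the affine tangent plane at the swallowtail; a functional that vanishes on \<open>Kc\<close>
  but not on the plane is therefore nonzero on \<open>Hc\<close>.\<close>

lemma affine_tangent_plane:
  assumes a: "a \<bullet> f s \<noteq> 0" and v: "v \<bullet> n s = 0" "v \<bullet> a = 0"
  obtains i j where "v = i *\<^sub>R Hc a 0 + j *\<^sub>R Kc a 0"
proof -
  have aF: "a \<bullet> F 0 \<noteq> 0" using a phi(2) by (simp add: F_eq)
  obtain i j k l where e: "v = i *\<^sub>R F 0 + j *\<^sub>R h 0 + k *\<^sub>R pd F e2 0 + l *\<^sub>R N 0"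
    by (rule det4_expand[OF J0_nz[OF A(2), unfolded J0_def]])
  have "l * (N 0 \<bullet> N 0) = 0"
  proof -
    have "N 0 \<bullet> (i *\<^sub>R F 0 + j *\<^sub>R h 0 + k *\<^sub>R pd F e2 0 + l *\<^sub>R N 0) = 0"
      unfolding e[symmetric] using v(1) phi(2) by (simp add: N_eq inner_commute)
    then show ?thesis by (simp add: inner_add_right NF[OF A(2)] N_h[OF A(2)])
  qed
  moreover have "N 0 \<noteq> 0" using leg phi_in_U[OF A(2)] by (simp add: legendrian_def N_eq)
  ultimately have l: "l = 0" by simp
  have "i * (a \<bullet> F 0) = - j * (a \<bullet> h 0) - k * (a \<bullet> pd F e2 0)"
    using v(2) by (simp add: e l inner_commute[of _ a] inner_add_right)
  then have i: "i = (- j * (a \<bullet> h 0) - k * (a \<bullet> pd F e2 0)) / (a \<bullet> F 0)" using aF by (simp add: field_simps)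
  have "v = (j * (a \<bullet> F 0)) *\<^sub>R Hc a 0 + (k * (a \<bullet> F 0)) *\<^sub>R Kc a 0"
    unfolding e l i using aF by (simp add: Hc_def Kc_def algebra_simps diff_divide_distrib)
  then show ?thesis by (rule that)
qed

text \<open>The velocity is E Hc + B Kc with E of second order and B = b'. In the third derivative
  \<open>Hc\<close> receives E'' and, because \<open>Kc\<close> itself moves in the direction of
  \<open>Hc\<close>, twice B' times 2 k.\<close>

lemma affine_curve_jet:
  fixes b :: "real => real"
  assumes a: "a \<bullet> f s \<noteq> 0" and T: "open T" "0 \<in> T"
    and b: "smooth_on T b" "b 0 = 0" "vd 1 b 0 = 0" and cA: "\<And>t. t \<in> T ==> vector [k * t, b t] \<in> A"
  defines "\<gamma> \<equiv> \<lambda>t. affine_chart a (f (\<phi> (vector [k * t, b t])))"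
  obtains S where "open S" "0 \<in> S" "S \<subseteq> T" "smooth_on S \<gamma>" "vd 1 \<gamma> 0 = 0" "vd 2 \<gamma> 0 = vd 2 b 0 *\<^sub>R Kc a 0"
    "vd 3 \<gamma> 0 = (24 * k ^ 3 + 6 * k * vd 2 b 0) *\<^sub>R Hc a 0 + vd 3 b 0 *\<^sub>R Kc a 0"
proof -
  obtain A' where A': "open A'" "0 \<in> A'" "A' \<subseteq> A"
    and sG: "smooth_on A' (\<lambda>x. affine_chart a (F x))" and sH: "smooth_on A' (Hc a)" and sK: "smooth_on A' (Kc a)"
    and G1: "\<And>x. x \<in> A' ==> pd (\<lambda>x. affine_chart a (F x)) e1 x = edge_fun x *\<^sub>R Hc a x"
    and G2: "\<And>x. x \<in> A' ==> pd (\<lambda>x. affine_chart a (F x)) e2 x = Kc a x"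
    and K1: "pd (Kc a) e1 0 = 2 *\<^sub>R Hc a 0"
  proof -
    assume that: "\<And>A'. open A' ==> 0 \<in> A' ==> A' \<subseteq> A ==> smooth_on A' (\<lambda>x. affine_chart a (F x)) ==>
      smooth_on A' (Hc a) ==> smooth_on A' (Kc a) ==>
      (\<And>x. x \<in> A' ==> pd (\<lambda>x. affine_chart a (F x)) e1 x = edge_fun x *\<^sub>R Hc a x) ==>
      (\<And>x. x \<in> A' ==> pd (\<lambda>x. affine_chart a (F x)) e2 x = Kc a x) ==> pd (Kc a) e1 0 = 2 *\<^sub>R Hc a 0 ==> thesis"
    show thesis by (rule affine_derivatives[OF a]) (rule that)
  qed
  define c where "c t = (vector [k * t, b t] :: real^2)" for t
  have sc: "smooth_on T c" unfolding c_def[abs_def]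
    by (intro smooth_on_vector2 T smooth_on_mult smooth_on_const smooth_on_ident b)
  have c0: "c 0 = 0" by (simp add: c_def b vec_eq_iff forall_2)
  define S where "S = T \<inter> c -` A'"
  have S: "open S" "0 \<in> S" "S \<subseteq> T"
    using continuous_open_preimage[OF smooth_on_continuous[OF sc] T(1) A'(1)] T A' c0 by (auto simp: S_def)
  have cS: "t \<in> S ==> c t \<in> A'" for t by (simp add: S_def)
  note sc' = smooth_on_subset[OF sc S(3)] and sb' = smooth_on_subset[OF b(1) S(3)]
  have g: "\<gamma> = (\<lambda>t. affine_chart a (F (c t)))" by (simp add: \<gamma>_def c_def F_eq)
  have s\<gamma>: "smooth_on S \<gamma>" unfolding g by (rule smooth_on_compose[OF S(1) A'(1) cS sc' sG])
  have dc: "(c has_vector_derivative vector [k, vd 1 b t]) (at t)" if "t \<in> S" for t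
  proof (rule has_vector_derivative_vec)
    fix i :: 2
    show "((\<lambda>t. c t $ i) has_vector_derivative vector [k, vd 1 b t] $ i) (at t)"
      using exhaust_2[of i] has_vector_derivative_smooth[OF S(1) sb' that]
      by (auto simp: c_def simp flip: real_derivative_iff intro!: derivative_eq_intros)
  qed
  define E where "E t = k * (12 * (k * t)\<^sup>2 + 2 * b t)" for t
  define B where "B = vd 1 b"
  have sE: "smooth_on S E" unfolding E_def by (intro smooth_intros S(1) sb')
  have sB: "smooth_on S B" unfolding B_def by (rule smooth_on_vd[OF S(1) sb'])
  have sHc: "smooth_on S (\<lambda>t. Hc a (c t))" and sKc: "smooth_on S (\<lambda>t. Kc a (c t))"
    by (rule smooth_on_compose[OF S(1) A'(1) cS sc' sH], assumption, rule smooth_on_compose[OF S(1) A'(1) cS sc' sK])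
  have d: "(\<gamma> has_vector_derivative E t *\<^sub>R Hc a (c t) + B t *\<^sub>R Kc a (c t)) (at t)" if t: "t \<in> S" for t
  proof -
    have "(\<gamma> has_vector_derivative pd (\<lambda>x. affine_chart a (F x)) (vector [k, vd 1 b t]) (c t)) (at t)"
      unfolding g by (rule has_vector_derivative_compose_smooth[where c=c, OF sG cS[OF t] dc[OF t]])
    then show ?thesis
      unfolding pd_coords[OF sG cS[OF t], of "vector [k, vd 1 b t]"] G1[OF cS[OF t]] G2[OF cS[OF t]]
      by (simp add: E_def B_def c_def edge_fun_def)
  qed
  have 1: "vd 1 \<gamma> 0 = 0" using vd_1I[OF d[OF S(2)]] by (simp add: E_def B_def b del: One_nat_def)
  have vb: "vd 1 (vd 1 b) 0 = vd 2 b 0" "vd 2 (vd 1 b) 0 = vd 3 b 0"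
    by (simp_all add: vd_def numeral_2_eq_2 numeral_3_eq_3)
  have vE: "vd 1 E 0 = 0" "vd 2 E 0 = k * (24 * k\<^sup>2 + 2 * vd 2 b 0)"
  proof -
    have db: "(b has_real_derivative vd 1 b t) (at t)" if "t \<in> S" for t
      using has_vector_derivative_smooth[OF S(1) sb' that] by (simp add: real_derivative_iff)
    have 1: "(E has_vector_derivative k * (24 * k\<^sup>2 * t + 2 * vd 1 b t)) (at t)" if "t \<in> S" for t
      unfolding E_def using db[OF that]
      by (auto simp: power2_eq_square simp flip: real_derivative_iff intro!: derivative_eq_intros)
    show "vd 1 E 0 = 0" using vd_1I[OF 1[OF S(2)]] by (simp add: b del: One_nat_def)
    have "(vd 1 b has_real_derivative vd 2 b 0) (at 0)"
      using has_vector_derivative_vd[OF S(1) sb' S(2), of 1] by (simp add: real_derivative_iff numeral_2_eq_2)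
    then have "vd 1 (\<lambda>t. k * (24 * k\<^sup>2 * t + 2 * vd 1 b t)) 0 = k * (24 * k\<^sup>2 + 2 * vd 2 b 0)"
      by (intro vd_1I) (auto simp flip: real_derivative_iff intro!: derivative_eq_intros)
    then show "vd 2 E 0 = k * (24 * k\<^sup>2 + 2 * vd 2 b 0)"
      using vd_SucI[OF S(1,2) 1, of 1] by (simp add: numeral_2_eq_2)
  qed
  have Kc1: "vd 1 (\<lambda>t. Kc a (c t)) 0 = (2 * k) *\<^sub>R Hc a 0"
  proof -
    have "vd 1 (\<lambda>t. Kc a (c t)) 0 = pd (Kc a) (vector [k, vd 1 b 0]) (c 0)"
      by (rule vd_1I[OF has_vector_derivative_compose_smooth[where c=c, OF sK cS[OF S(2)] dc[OF S(2)]]])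
    also have "\<dots> = (2 * k) *\<^sub>R Hc a 0"
      unfolding b(3) pd_coords[OF sK cS[OF S(2)], of "vector [k, 0]"] unfolding c0 K1 by simp
    finally show ?thesis .
  qed
  have E0: "E 0 = 0" "B 0 = 0" using b by (simp_all add: E_def B_def)
  have sum: "vd j (\<lambda>t. E t *\<^sub>R Hc a (c t) + B t *\<^sub>R Kc a (c t)) 0 =
      vd j (\<lambda>t. E t *\<^sub>R Hc a (c t)) 0 + vd j (\<lambda>t. B t *\<^sub>R Kc a (c t)) 0" if "j \<in> {1, 2}" for j
  proof -
    have a: "vd 1 (\<lambda>t. g t + g' t) t = vd 1 g t + vd 1 g' t"
      if "smooth_on S g" "smooth_on S g'" "t \<in> S" for g g' :: "real => real^4" and t
      by (intro vd_1I has_vector_derivative_add has_vector_derivative_smooth[OF S(1)] that)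
    have "vd 2 (\<lambda>t. g t + g' t) 0 = vd 2 g 0 + vd 2 g' 0" if "smooth_on S g" "smooth_on S g'" for g g' :: "real => real^4"
    proof -
      have "vd 1 (vd 1 (\<lambda>t. g t + g' t)) 0 = vd 1 (\<lambda>t. vd 1 g t + vd 1 g' t) 0"
        by (rule vd_cong[OF S(1,2) a[OF that]])
      then show ?thesis using a[OF smooth_on_vd[OF S(1) that(1)] smooth_on_vd[OF S(1) that(2)] S(2), of 1 1]
        by (simp add: vd_1_vd[unfolded One_nat_def] numeral_2_eq_2)
    qed
    then show ?thesis using that a[OF _ _ S(2)] smooth_on_scaleR[OF S(1) sE sHc] smooth_on_scaleR[OF S(1) sB sKc] by auto
  qed
  have 2: "vd 2 \<gamma> 0 = vd 2 b 0 *\<^sub>R Kc a 0"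
  proof -
    have "vd 2 \<gamma> 0 = vd 1 (\<lambda>t. E t *\<^sub>R Hc a (c t) + B t *\<^sub>R Kc a (c t)) 0"
      using vd_SucI[OF S(1,2) d, of 1] by (simp add: numeral_2_eq_2)
    then show ?thesis
      unfolding sum[of 1, OF insertI1] vd2_scaleR(1)[OF S(1) sE sHc S(2)] vd2_scaleR(1)[OF S(1) sB sKc S(2)] E0 vE c0
      by (simp add: B_def vb b(3) del: One_nat_def)
  qed
  have e: "24 * k ^ 3 + 6 * k * vd 2 b 0 = k * (24 * k\<^sup>2 + 2 * vd 2 b 0) + 2 * vd 2 b 0 * (2 * k)"
    by (simp add: algebra_simps power2_eq_square power3_eq_cube)
  have "vd 3 \<gamma> 0 = vd 2 (\<lambda>t. E t *\<^sub>R Hc a (c t) + B t *\<^sub>R Kc a (c t)) 0"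
    using vd_SucI[OF S(1,2) d, of 2] by (simp add: numeral_3_eq_3 numeral_2_eq_2)
  also have "\<dots> = (24 * k ^ 3 + 6 * k * vd 2 b 0) *\<^sub>R Hc a 0 + vd 3 b 0 *\<^sub>R Kc a 0"
    unfolding e sum[of 2, OF insertI2[OF insertI1]] vd2_scaleR(2)[OF S(1) sE sHc S(2)] vd2_scaleR(2)[OF S(1) sB sKc S(2)] E0 vE c0 Kc1
    by (simp add: B_def vb scaleR_add_left ac_simps del: One_nat_def)
  finally show ?thesis by (rule that[OF S s\<gamma> 1 2])
qed

end

section \<open>Jets of the graph curves in space\<close>

context flecnodal_box
begin

text \<open>A cusp needs a nonzero second derivative, which is along \<open>Kc\<close>, and a third
  derivative with a component along \<open>Hc\<close>, which is proportional to 4 + \<beta>''(0).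
  The value -4 is that of the self-intersection line, whose image is traversed twice and is no
  cusp.\<close>

lemma graph_curve_jet:
  assumes a: "a \<bullet> f s \<noteq> 0" and \<beta>: "small_graph \<beta>" "vd 1 \<beta> 0 = 0" and \<sigma>: "\<sigma> = 1 \<or> \<sigma> = (-1::real)"
  defines "\<gamma> \<equiv> affine_chart a \<circ> f \<circ> (\<lambda>t. \<phi> (vector [\<sigma> * \<xi> * t, \<beta> (\<sigma> * \<xi> * t)]))"
  shows "vd 1 \<gamma> 0 = 0" "vd 2 \<gamma> 0 = (\<xi>\<^sup>2 * vd 2 \<beta> 0) *\<^sub>R Kc a 0"
    "vd 2 \<beta> 0 \<noteq> 0 ==> vd 2 \<beta> 0 \<noteq> - 4 ==> semicubical_cusp \<gamma>"
proof -
  let ?T = "{-1<..<1::real}" and ?E = "{-\<xi><..<\<xi>}"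
  have T: "open ?T" "0 \<in> ?T" by auto
  have s\<beta>: "smooth_on ?E \<beta>" using \<beta> by (simp add: small_graph_def)
  have small: "\<bar>\<sigma> * \<xi> * t\<bar> < \<xi>" if "t \<in> ?T" for t
  proof -
    have "\<bar>\<sigma> * \<xi> * t\<bar> = \<xi> * \<bar>t\<bar>" using \<sigma> eps by (auto simp: abs_mult)
    also have "\<dots> < \<xi> * 1" using that eps by (intro mult_strict_left_mono) auto
    finally show ?thesis by simp
  qed
  have smallE: "\<sigma> * \<xi> * t \<in> ?E" if "t \<in> ?T" for t
    using small[OF that] unfolding abs_less_iff greaterThanLessThan_iff by linarith
  have sb: "smooth_on ?T (\<lambda>t. \<beta> (\<sigma> * \<xi> * t))"
    by (rule smooth_on_compose[OF T(1) _ _ _ s\<beta>])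
       (use smallE in \<open>auto intro!: smooth_on_mult smooth_on_const smooth_on_ident\<close>)
  have vb: "vd j (\<lambda>t. \<beta> (\<sigma> * \<xi> * t)) 0 = (\<sigma> * \<xi>) ^ j * vd j \<beta> 0" for j
    using vd_rescale[OF _ s\<beta>, of "\<sigma> * \<xi>" 0 j] eps by simp
  obtain S where S: "vd 1 (\<lambda>t. affine_chart a (f (\<phi> (vector [\<sigma> * \<xi> * t, \<beta> (\<sigma> * \<xi> * t)])))) 0 = 0"
    "vd 2 (\<lambda>t. affine_chart a (f (\<phi> (vector [\<sigma> * \<xi> * t, \<beta> (\<sigma> * \<xi> * t)])))) 0 = vd 2 (\<lambda>t. \<beta> (\<sigma> * \<xi> * t)) 0 *\<^sub>R Kc a 0"
    "vd 3 (\<lambda>t. affine_chart a (f (\<phi> (vector [\<sigma> * \<xi> * t, \<beta> (\<sigma> * \<xi> * t)])))) 0 =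
      (24 * (\<sigma> * \<xi>) ^ 3 + 6 * (\<sigma> * \<xi>) * vd 2 (\<lambda>t. \<beta> (\<sigma> * \<xi> * t)) 0) *\<^sub>R Hc a 0 + vd 3 (\<lambda>t. \<beta> (\<sigma> * \<xi> * t)) 0 *\<^sub>R Kc a 0"
  proof (rule affine_curve_jet[OF a T sb])
    show "\<beta> (\<sigma> * \<xi> * 0) = 0" using \<beta>(1) by (simp add: small_graph_def)
    show "vd 1 (\<lambda>t. \<beta> (\<sigma> * \<xi> * t)) 0 = 0" by (simp add: vb \<beta>(2) del: One_nat_def)
    show "vector [\<sigma> * \<xi> * t, \<beta> (\<sigma> * \<xi> * t)] \<in> A" if "t \<in> ?T" for t
      using graph_mem[OF \<beta>(1) small[OF that]] graph_subset box_A by blast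
  qed (rule that)
  have g: "\<gamma> = (\<lambda>t. affine_chart a (f (\<phi> (vector [\<sigma> * \<xi> * t, \<beta> (\<sigma> * \<xi> * t)]))))"
    by (simp add: \<gamma>_def o_def)
  have s2: "(\<sigma> * \<xi>)\<^sup>2 = \<xi>\<^sup>2" using \<sigma> by auto
  show 1: "vd 1 \<gamma> 0 = 0" and 2: "vd 2 \<gamma> 0 = (\<xi>\<^sup>2 * vd 2 \<beta> 0) *\<^sub>R Kc a 0"
    unfolding g S(1,2) by (simp_all add: vb s2 del: One_nat_def)
  show "semicubical_cusp \<gamma>" if nz: "vd 2 \<beta> 0 \<noteq> 0" "vd 2 \<beta> 0 \<noteq> - 4"
    unfolding semicubical_cusp_def
  proof (intro conjI 1)
    have K: "Kc a 0 \<noteq> 0" using HK_indep[OF a, of 0 1] by auto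
    then show "vd 2 \<gamma> 0 \<noteq> 0" using nz eps by (simp add: 2)
    define \<kappa> where "\<kappa> = 24 * (\<sigma> * \<xi>) ^ 3 + 6 * (\<sigma> * \<xi>) * (\<xi>\<^sup>2 * vd 2 \<beta> 0)"
    have "\<kappa> = 6 * (\<sigma> * \<xi>) * \<xi>\<^sup>2 * (4 + vd 2 \<beta> 0)"
    proof -
      have "(\<sigma> * \<xi>) ^ 3 = (\<sigma> * \<xi>) * \<xi>\<^sup>2" unfolding s2[symmetric] by (simp add: power3_eq_cube power2_eq_square)
      then show ?thesis unfolding \<kappa>_def by (simp add: algebra_simps)
    qed
    then have \<kappa>: "\<kappa> \<noteq> 0" using nz \<sigma> eps by auto
    show "vd 3 \<gamma> 0 \<notin> span {vd 2 \<gamma> 0}"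
    proof
      assume "vd 3 \<gamma> 0 \<in> span {vd 2 \<gamma> 0}"
      then obtain j where "vd 3 \<gamma> 0 = j *\<^sub>R vd 2 \<gamma> 0" by (auto simp: span_singleton)
      then have "\<kappa> *\<^sub>R Hc a 0 + (vd 3 (\<lambda>t. \<beta> (\<sigma> * \<xi> * t)) 0 - j * (\<xi>\<^sup>2 * vd 2 \<beta> 0)) *\<^sub>R Kc a 0 = 0"
        unfolding 2 unfolding g S(3) \<kappa>_def vb s2 by (simp add: scaleR_diff_left add_diff_eq)
      then show False using HK_indep[OF a] \<kappa> by blast
    qed
  qed
qed

text \<open>These limits feed \<open>opposite_cubics_enclose\<close>: a height functional sees the
  coefficient of \<open>Kc\<close>, a lateral functional vanishing on \<open>Kc\<close> sees that of
  \<open>Hc\<close>, which is zero for the self-intersection line.\<close>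

lemma graph_functional_jet:
  assumes a: "a \<bullet> f s \<noteq> 0" and \<beta>: "small_graph \<beta>" "vd 1 \<beta> 0 = 0"
  defines "\<Gamma> \<equiv> \<lambda>x. affine_chart a (f (\<phi> (vector [x, \<beta> x])))"
  shows "((\<lambda>x. (l \<bullet> \<Gamma> x - l \<bullet> \<Gamma> 0) / x\<^sup>2) \<longlongrightarrow> vd 2 \<beta> 0 * (l \<bullet> Kc a 0) / 2) (at 0)"
    and "l \<bullet> Kc a 0 = 0 ==>
      ((\<lambda>x. (l \<bullet> \<Gamma> x - l \<bullet> \<Gamma> 0) / x ^ 3) \<longlongrightarrow> (4 + vd 2 \<beta> 0) * (l \<bullet> Hc a 0)) (at 0)"
    and "\<exists>r>0. continuous_on {-r<..<r} (\<lambda>x. l \<bullet> \<Gamma> x - l \<bullet> \<Gamma> 0)"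
proof -
  let ?E = "{-\<xi><..<\<xi>}"
  have E: "open ?E" "0 \<in> ?E" using eps by auto
  have s\<beta>: "smooth_on ?E \<beta>" using \<beta> by (simp add: small_graph_def)
  obtain S where S: "open S" "0 \<in> S" and s\<Gamma>: "smooth_on S \<Gamma>" and v: "vd 1 \<Gamma> 0 = 0" "vd 2 \<Gamma> 0 = vd 2 \<beta> 0 *\<^sub>R Kc a 0"
    "vd 3 \<Gamma> 0 = (24 + 6 * vd 2 \<beta> 0) *\<^sub>R Hc a 0 + vd 3 \<beta> 0 *\<^sub>R Kc a 0"
  proof (rule affine_curve_jet[OF a E s\<beta> _ \<beta>(2), of 1, simplified mult_1 power_one mult_1_right, folded \<Gamma>_def])
    show "\<beta> 0 = 0" using \<beta>(1) by (simp add: small_graph_def)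
    show "vector [t, \<beta> t] \<in> A" if "t \<in> ?E" for t
    proof -
      have "\<bar>t\<bar> < \<xi>" using that by auto
      then show ?thesis using graph_mem[OF \<beta>(1)] graph_subset box_A by blast
    qed
  qed (rule that)
  define g where "g x = l \<bullet> \<Gamma> x - l \<bullet> \<Gamma> 0" for x
  have sl: "smooth_on S (\<lambda>x. l \<bullet> \<Gamma> x)" by (intro smooth_on_inner smooth_on_const S s\<Gamma>)
  have sg: "smooth_on S g" unfolding g_def by (intro smooth_on_diff smooth_on_const S sl)
  have vg: "vd (Suc j) g 0 = l \<bullet> vd (Suc j) \<Gamma> 0" for j
  proof -
    have "vd (Suc j) g 0 = vd j (vd 1 (\<lambda>x. l \<bullet> \<Gamma> x)) 0"
    proof (rule vd_SucI[OF S])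
      show "(g has_vector_derivative vd 1 (\<lambda>x. l \<bullet> \<Gamma> x) t) (at t)" if "t \<in> S" for t
        unfolding g_def has_vector_derivative_diff_const by (rule has_vector_derivative_smooth[OF S(1) sl that])
    qed
    also have "\<dots> = l \<bullet> vd (Suc j) \<Gamma> 0"
      unfolding vd_Suc'[symmetric] by (rule vd_bounded_linear[OF S(1) s\<Gamma> S(2) bounded_linear_inner_right])
    finally show ?thesis .
  qed
  have g0: "g 0 = 0" "vd 1 g 0 = 0" "vd 2 g 0 = vd 2 \<beta> 0 * (l \<bullet> Kc a 0)"
    "vd 3 g 0 = (24 + 6 * vd 2 \<beta> 0) * (l \<bullet> Hc a 0) + vd 3 \<beta> 0 * (l \<bullet> Kc a 0)"
    using vg[of 0] vg[of 1] vg[of 2] v by (simp_all add: g_def numeral_2_eq_2 numeral_3_eq_3 inner_add_right)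
  show "((\<lambda>x. (l \<bullet> \<Gamma> x - l \<bullet> \<Gamma> 0) / x\<^sup>2) \<longlongrightarrow> vd 2 \<beta> 0 * (l \<bullet> Kc a 0) / 2) (at 0)"
    using tendsto_quotient_second[OF S sg g0(1,2)] unfolding g0(3) by (simp add: g_def)
  show "((\<lambda>x. (l \<bullet> \<Gamma> x - l \<bullet> \<Gamma> 0) / x ^ 3) \<longlongrightarrow> (4 + vd 2 \<beta> 0) * (l \<bullet> Hc a 0)) (at 0)" if "l \<bullet> Kc a 0 = 0"
  proof -
    have e: "((24 + 6 * vd 2 \<beta> 0) * (l \<bullet> Hc a 0) + vd 3 \<beta> 0 * (l \<bullet> Kc a 0)) / 6 = (4 + vd 2 \<beta> 0) * (l \<bullet> Hc a 0)"
      using that by (simp add: algebra_simps add_divide_distrib)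
    show ?thesis using tendsto_quotient_third[OF S sg g0(1,2)] that unfolding g0(3,4) e by (simp add: g_def)
  qed
  obtain d where "d > 0" "ball 0 d \<subseteq> S" using S openE by blast
  then have "{-d<..<d} \<subseteq> S" by (auto simp: ball_def dist_real_def subset_iff abs_less_iff)
  then show "\<exists>r>0. continuous_on {-r<..<r} (\<lambda>x. l \<bullet> \<Gamma> x - l \<bullet> \<Gamma> 0)"
    using continuous_on_subset[OF smooth_on_continuous[OF sg]] \<open>d > 0\<close> unfolding g_def by blast
qed

lemma graph_param_image:
  assumes \<beta>: "small_graph \<beta>" and \<sigma>: "\<sigma> = 1 \<or> \<sigma> = (-1::real)" and T: "T \<subseteq> {-1<..<1}"
  shows "(\<lambda>t. \<phi> (vector [\<sigma> * \<xi> * t, \<beta> (\<sigma> * \<xi> * t)])) ` T = \<phi> ` {x \<in> graph \<beta>. \<sigma> * x$1 / \<xi> \<in> T}"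
proof safe
  have ss: "\<sigma> * (\<sigma> * z) = z" for z using \<sigma> by auto
  fix t assume t: "t \<in> T"
  have "\<bar>\<sigma> * \<xi> * t\<bar> = \<xi> * \<bar>t\<bar>" using \<sigma> eps by (auto simp: abs_mult)
  also have "\<dots> < \<xi> * 1" using subsetD[OF T t] eps by (intro mult_strict_left_mono) auto
  finally have "vector [\<sigma> * \<xi> * t, \<beta> (\<sigma> * \<xi> * t)] \<in> graph \<beta>" by (intro graph_mem[OF \<beta>]) simp
  moreover have "\<sigma> * (vector [\<sigma> * \<xi> * t, \<beta> (\<sigma> * \<xi> * t)] :: real^2) $ 1 / \<xi> = t"
    using ss[of "\<xi> * t"] eps by (simp add: mult.assoc)
  ultimately show "\<phi> (vector [\<sigma> * \<xi> * t, \<beta> (\<sigma> * \<xi> * t)]) \<in> \<phi> ` {x \<in> graph \<beta>. \<sigma> * x$1 / \<xi> \<in> T}"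
    using t by auto
next
  have ss: "\<sigma> * (\<sigma> * z) = z" for z using \<sigma> by auto
  fix x assume x: "x \<in> graph \<beta>" "\<sigma> * x$1 / \<xi> \<in> T"
  have e: "\<sigma> * \<xi> * (\<sigma> * x$1 / \<xi>) = x$1" using ss[of "x$1"] eps by simp
  have e2: "x = vector [\<sigma> * \<xi> * (\<sigma> * x$1 / \<xi>), \<beta> (\<sigma> * \<xi> * (\<sigma> * x$1 / \<xi>))]"
    unfolding e using x by (simp add: in_graph_iff vec_eq_iff forall_2)
  show "\<phi> x \<in> (\<lambda>t. \<phi> (vector [\<sigma> * \<xi> * t, \<beta> (\<sigma> * \<xi> * t)])) ` T"
    by (rule image_eqI[where x="\<sigma> * x$1 / \<xi>"]) (rule arg_cong[where f=\<phi>, OF e2], rule x(2))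
qed

lemma graph_param_branches:
  assumes \<beta>: "small_graph \<beta>" and \<sigma>: "\<sigma> = 1 \<or> \<sigma> = (-1::real)"
  shows "(\<lambda>t. \<phi> (vector [\<sigma> * \<xi> * t, \<beta> (\<sigma> * \<xi> * t)])) ` {-1<..<0} = \<phi> ` {x \<in> graph \<beta>. \<sigma> * x$1 < 0}"
    and "(\<lambda>t. \<phi> (vector [\<sigma> * \<xi> * t, \<beta> (\<sigma> * \<xi> * t)])) ` {0<..<1} = \<phi> ` {x \<in> graph \<beta>. \<sigma> * x$1 > 0}"
proof -
  have "\<bar>\<sigma> * x$1\<bar> < \<xi>" if "x \<in> graph \<beta>" for x using that \<sigma> by (auto simp: in_graph_iff box_def)
  then have "-1 < \<sigma> * x$1 / \<xi>" "\<sigma> * x$1 / \<xi> < 1" if "x \<in> graph \<beta>" for x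
    using that eps by (simp_all add: pos_less_divide_eq pos_divide_less_eq abs_less_iff) (metis minus_less_iff)
  then show "(\<lambda>t. \<phi> (vector [\<sigma> * \<xi> * t, \<beta> (\<sigma> * \<xi> * t)])) ` {-1<..<0} = \<phi> ` {x \<in> graph \<beta>. \<sigma> * x$1 < 0}"
    "(\<lambda>t. \<phi> (vector [\<sigma> * \<xi> * t, \<beta> (\<sigma> * \<xi> * t)])) ` {0<..<1} = \<phi> ` {x \<in> graph \<beta>. \<sigma> * x$1 > 0}"
    using eps by (subst graph_param_image[OF \<beta> \<sigma>]; force simp: pos_less_divide_eq pos_divide_less_eq)+
qed

section \<open>The configurations\<close>

lemma separates_phi:
  assumes "open P" "open Q" "P \<subseteq> A" "Q \<subseteq> A" "P \<inter> Q = {}" "X \<subseteq> A" "C \<subseteq> A" "X - C \<subseteq> P \<union> Q"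
    "B \<subseteq> P" "D \<subseteq> Q" "B \<subseteq> X - C" "D \<subseteq> X - C"
  shows "separates_in (\<phi> ` X) (\<phi> ` C) (\<phi> ` B) (\<phi> ` D)"
proof (rule separates_inI[OF open_phi_image[OF assms(1,3)] open_phi_image[OF assms(2,4)]])
  have d: "\<phi> ` X - \<phi> ` C = \<phi> ` (X - C)"
    by (rule inj_on_image_set_diff[OF phi_inj, symmetric]) (use assms in auto)
  show "\<phi> ` P \<inter> \<phi> ` Q = {}"
    using inj_on_image_Int[OF phi_inj, of P Q] assms by simp
  show "\<phi> ` X - \<phi> ` C \<subseteq> \<phi> ` P \<union> \<phi> ` Q" "\<phi> ` B \<subseteq> \<phi> ` X - \<phi> ` C" "\<phi> ` D \<subseteq> \<phi> ` X - \<phi> ` C"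
    unfolding d image_Un[symmetric] by (rule image_mono[OF assms(8)] image_mono[OF assms(11)] image_mono[OF assms(12)])+
  show "\<phi> ` B \<subseteq> \<phi> ` P" "\<phi> ` D \<subseteq> \<phi> ` Q" by (rule image_mono[OF assms(9)] image_mono[OF assms(10)])+
qed

lemma open_above_below:
  assumes \<beta>: "small_graph \<beta>"
  shows "open {x\<in>box \<xi>. x$2 < \<beta> (x$1)}" "open {x\<in>box \<xi>. \<beta> (x$1) < x$2}"
proof -
  have c: "continuous_on (box \<xi>) (\<lambda>x. x$2 - \<beta> (x$1))"
    by (intro continuous_intros continuous_on_compose2[OF smooth_on_continuous[of "{-\<xi><..<\<xi>}" \<beta>]])
       (use \<beta> in \<open>auto simp: small_graph_def box_def\<close>)
  have "{x\<in>box \<xi>. x$2 < \<beta> (x$1)} = box \<xi> \<inter> (\<lambda>x. x$2 - \<beta> (x$1)) -` {..<0}"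
    "{x\<in>box \<xi>. \<beta> (x$1) < x$2} = box \<xi> \<inter> (\<lambda>x. x$2 - \<beta> (x$1)) -` {0<..}" by auto
  then show "open {x\<in>box \<xi>. x$2 < \<beta> (x$1)}" "open {x\<in>box \<xi>. \<beta> (x$1) < x$2}"
    using continuous_open_preimage[OF c box_open, of "{..<0}"] continuous_open_preimage[OF c box_open, of "{0<..}"] by simp_all
qed

lemma graph_nz: "small_graph \<beta> ==> x \<in> graph \<beta> ==> x \<noteq> 0 \<longleftrightarrow> x$1 \<noteq> 0"
  by (auto simp: in_graph_iff small_graph_def vec_eq_iff forall_2)

lemma flecnodal_minus: "flecnodal_curve U f \<inter> V - {s} = \<phi> ` (graph bt - {0})"
  and edge_minus: "cuspidal_edge U f \<inter> V - {s} = \<phi> ` (graph (\<lambda>a. - 6 * a\<^sup>2) - {0})"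
  unfolding flecnodal_f edge_V using graph_subset box_A by (intro phi_minus_s; blast)+

lemma good_graph:
  assumes "x \<in> graph bt" "x \<noteq> 0"
  shows "(bt (x$1) + 6 * (x$1)\<^sup>2) * q < 0" "q > - 1/2 ==> bt (x$1) < - 2 * (x$1)\<^sup>2" "q < - 1/2 ==> bt (x$1) > - 2 * (x$1)\<^sup>2"
  using good graph_bt_edge_fun(2)[OF assms] assms(1) by (auto simp: good_def in_graph_iff box_def)

lemma good_bt:
  assumes "x \<in> box \<xi>" "x$1 \<noteq> 0"
  shows "(bt (x$1) + 6 * (x$1)\<^sup>2) * q < 0" "q > - 1/2 ==> bt (x$1) < - 2 * (x$1)\<^sup>2" "q < - 1/2 ==> bt (x$1) > - 2 * (x$1)\<^sup>2"
  using good assms by (auto simp: good_def box_def)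

lemma elliptic_picture: "q > 0 ==> flecnodal_curve U f \<inter> V - {s} \<subseteq> small_domain U f V"
  unfolding flecnodal_minus small_domain_V
proof (intro image_mono subsetI)
  fix x assume q: "q > 0" and x: "x \<in> graph bt - {0}"
  then have "(bt (x$1) + 6 * (x$1)\<^sup>2) * q < 0" using good_graph(1) by blast
  then show "x \<in> lower" using q x by (simp add: in_graph_iff lower_def mult_less_0_iff)
qed

text \<open>The self-intersection graph divides the box: the edge lies below it, and for q < - 1/2
  the flecnodal curve lies above.\<close>

lemma separated_picture:
  assumes q: "q < - 1/2"
  shows "separates_in V (self_intersection V f) (flecnodal_curve U f \<inter> V - {s}) (cuspidal_edge U f \<inter> V - {s})"
  unfolding self_V flecnodal_minus edge_minus
proof (rule separates_phi)
  note ab = open_above_below[OF small_graph_square[of "-2"]]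
  show "open {x\<in>box \<xi>. - 2 * (x$1)\<^sup>2 < x$2}" "open {x\<in>box \<xi>. x$2 < - 2 * (x$1)\<^sup>2}" using ab by simp_all
  show F: "graph bt - {0} \<subseteq> {x\<in>box \<xi>. - 2 * (x$1)\<^sup>2 < x$2}" using good_graph(3)[OF _ _ q] by (auto simp: in_graph_iff)
  show E: "graph (\<lambda>a. - 6 * a\<^sup>2) - {0} \<subseteq> {x\<in>box \<xi>. x$2 < - 2 * (x$1)\<^sup>2}"
    using graph_nz[OF small_graph_square[of "-6"]] by (auto simp: in_graph_iff)
  show "graph bt - {0} \<subseteq> box \<xi> - graph (\<lambda>a. - 2 * a\<^sup>2)" "graph (\<lambda>a. - 6 * a\<^sup>2) - {0} \<subseteq> box \<xi> - graph (\<lambda>a. - 2 * a\<^sup>2)"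
    using F E by (auto simp: in_graph_iff)
qed (use box_A graph_subset in \<open>auto simp: in_graph_iff\<close>)

text \<open>Here -6 a^2 < \<open>bt a\<close> < -2 a^2 for a nonzero. On the half \<tau> x1 > 0 the
  open region below the flecnodal graph contains that branch of the edge; the region above the graph
  together with the other half contains the self-intersection line.\<close>

lemma branchwise_picture:
  assumes q: "- 1/2 < q" "q < 0"
  shows "branchwise_separated U f s V (\<lambda>t. \<phi> (vector [1 * \<xi> * t, - 6 * (1 * \<xi> * t)\<^sup>2]))"
proof -
  let ?X = "{x\<in>box \<xi>. x \<noteq> 0 \<and> - 6 * (x$1)\<^sup>2 \<le> x$2}"
  have X: "V - small_domain U f V - {s} = \<phi> ` ?X"
  proof -
    have "V - \<phi> ` lower = \<phi> ` (box \<xi> - lower)"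
      by (rule inj_on_image_set_diff[OF phi_inj, symmetric]) (use box_A upper_lower_box in auto)
    moreover have "\<phi> ` (box \<xi> - lower) - {s} = \<phi> ` (box \<xi> - lower - {0})" by (rule phi_minus_s) (use box_A in auto)
    moreover have "box \<xi> - lower - {0} = ?X" by (auto simp: lower_def)
    ultimately show ?thesis unfolding small_domain_V by metis
  qed
  have sep: "separates_in (\<phi> ` ?X) (\<phi> ` {x\<in>graph bt. \<tau> * x$1 > 0}) (\<phi> ` {x\<in>graph (\<lambda>a. - 6 * a\<^sup>2). \<tau> * x$1 > 0})
      (\<phi> ` (graph (\<lambda>a. - 2 * a\<^sup>2) - {0}))" if \<tau>: "\<tau> \<noteq> 0" for \<tau>
  proof (rule separates_phi)
    have o: "open {x :: real^2. \<tau> * x$1 > 0}" "open {x :: real^2. \<tau> * x$1 < 0}"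
      by (intro open_Collect_less continuous_intros)+
    have e: "{x\<in>box \<xi>. \<tau> * x$1 > 0 \<and> x$2 < bt (x$1)} = {x\<in>box \<xi>. x$2 < bt (x$1)} \<inter> {x. \<tau> * x$1 > 0}"
      "{x\<in>box \<xi>. \<tau> * x$1 < 0 \<or> bt (x$1) < x$2} = (box \<xi> \<inter> {x. \<tau> * x$1 < 0}) \<union> {x\<in>box \<xi>. bt (x$1) < x$2}" by auto
    show "open {x\<in>box \<xi>. \<tau> * x$1 > 0 \<and> x$2 < bt (x$1)}" "open {x\<in>box \<xi>. \<tau> * x$1 < 0 \<or> bt (x$1) < x$2}"
      unfolding e by (intro open_Int open_Un open_above_below[OF small_graph_bt] o box_open)+
    have lt: "- 6 * (x$1)\<^sup>2 < bt (x$1)" "bt (x$1) < - 2 * (x$1)\<^sup>2" if "x \<in> box \<xi>" "x$1 \<noteq> 0" for x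
      using good_bt(1,2)[OF that] q by (auto simp: mult_less_0_iff)
    show "{x\<in>graph (\<lambda>a. - 6 * a\<^sup>2). \<tau> * x$1 > 0} \<subseteq> {x\<in>box \<xi>. \<tau> * x$1 > 0 \<and> x$2 < bt (x$1)}"
    proof
      fix x assume x: "x \<in> {x\<in>graph (\<lambda>a. - 6 * a\<^sup>2). \<tau> * x$1 > 0}"
      then have "x \<in> box \<xi>" "x$1 \<noteq> 0" by (auto simp: in_graph_iff)
      then show "x \<in> {x\<in>box \<xi>. \<tau> * x$1 > 0 \<and> x$2 < bt (x$1)}" using lt(1)[of x] x by (simp add: in_graph_iff)
    qed
    have D: "x \<in> box \<xi>" "x$1 \<noteq> 0" "bt (x$1) < x$2" "- 6 * (x$1)\<^sup>2 < x$2" if "x \<in> graph (\<lambda>a. - 2 * a\<^sup>2) - {0}" for x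
    proof -
      show x: "x \<in> box \<xi>" "x$1 \<noteq> 0" using that graph_nz[OF small_graph_square[of "-2"]] by (auto simp: in_graph_iff)
      show "bt (x$1) < x$2" "- 6 * (x$1)\<^sup>2 < x$2" using lt[OF x] that by (auto simp: in_graph_iff)
    qed
    show "graph (\<lambda>a. - 2 * a\<^sup>2) - {0} \<subseteq> {x\<in>box \<xi>. \<tau> * x$1 < 0 \<or> bt (x$1) < x$2}" using D by blast
    show "graph (\<lambda>a. - 2 * a\<^sup>2) - {0} \<subseteq> ?X - {x\<in>graph bt. \<tau> * x$1 > 0}" using D by (force simp: in_graph_iff)
    show "{x\<in>graph (\<lambda>a. - 6 * a\<^sup>2). \<tau> * x$1 > 0} \<subseteq> ?X - {x\<in>graph bt. \<tau> * x$1 > 0}"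
    proof
      fix x assume x: "x \<in> {x\<in>graph (\<lambda>a. - 6 * a\<^sup>2). \<tau> * x$1 > 0}"
      then have "x \<in> box \<xi>" "x$1 \<noteq> 0" by (auto simp: in_graph_iff)
      then show "x \<in> ?X - {x\<in>graph bt. \<tau> * x$1 > 0}" using lt(1)[of x] x by (auto simp: in_graph_iff)
    qed
    show "?X - {x\<in>graph bt. \<tau> * x$1 > 0} \<subseteq> {x\<in>box \<xi>. \<tau> * x$1 > 0 \<and> x$2 < bt (x$1)} \<union> {x\<in>box \<xi>. \<tau> * x$1 < 0 \<or> bt (x$1) < x$2}"
    proof
      fix x assume x: "x \<in> ?X - {x\<in>graph bt. \<tau> * x$1 > 0}"
      show "x \<in> {x\<in>box \<xi>. \<tau> * x$1 > 0 \<and> x$2 < bt (x$1)} \<union> {x\<in>box \<xi>. \<tau> * x$1 < 0 \<or> bt (x$1) < x$2}"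
      proof (cases "x$1 = 0")
        case True
        \<comment> \<open>In the part considered a point with x1 = 0 has x2 > 0, since the small
          domain and the swallowtail are removed; so it lies above the flecnodal graph.\<close>
        then have "x$2 \<noteq> 0" using x by (auto simp: vec_eq_iff forall_2)
        then show ?thesis using x True by (auto simp: bt0)
      next
        case False
        then have "\<tau> * x$1 \<noteq> 0" using \<tau> by simp
        then have "\<tau> * x$1 < 0 \<or> \<tau> * x$1 > 0" by linarith
        then show ?thesis using x by (auto simp: in_graph_iff)
      qed
    qed
  qed (use box_A graph_subset in auto)
  have q': "q \<noteq> - 1/2" using q by simp
  note br = branches[OF q'] and e6 = graph_param_branches[OF small_graph_square[of "-6"], of 1]
  have s: "{x\<in>graph \<beta>. x$1 * side < 0} = (if side > 0 then {x\<in>graph \<beta>. (-1) * x$1 > 0} else {x\<in>graph \<beta>. 1 * x$1 > 0})"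
    "{x\<in>graph \<beta>. x$1 * side > 0} = (if side > 0 then {x\<in>graph \<beta>. 1 * x$1 > 0} else {x\<in>graph \<beta>. (-1) * x$1 > 0})"
    "{x\<in>graph \<beta>. 1 * x$1 < 0} = {x\<in>graph \<beta>. (-1) * x$1 > 0}" for \<beta>
    using side_nz by (auto simp: mult_less_0_iff zero_less_mult_iff)
  have e1: "(\<lambda>t. \<phi> (vector [1 * \<xi> * t, - 6 * (1 * \<xi> * t)\<^sup>2])) ` {-1<..<0} = \<phi> ` {x \<in> graph (\<lambda>a. - 6 * a\<^sup>2). (-1) * x$1 > 0}"
    and e2: "(\<lambda>t. \<phi> (vector [1 * \<xi> * t, - 6 * (1 * \<xi> * t)\<^sup>2])) ` {0<..<1} = \<phi> ` {x \<in> graph (\<lambda>a. - 6 * a\<^sup>2). 1 * x$1 > 0}"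
    using e6 s(3) by simp_all
  show ?thesis
    unfolding branchwise_separated_def Let_def X self_minus br s(1,2) e1 e2
    using sep[of 1] sep[of "-1"] by (cases "side > 0") simp_all
qed

text \<open>For - 3/4 < q < - 1/2 the value bt''(0) lies strictly between -4 and 0. So the flecnodal
  curve and the self-intersection line leave the swallowtail on the same side of a transversal
  plane, and the flecnodal curve has a nonzero cubic lateral term while that of the
  self-intersection line vanishes.\<close>

lemma enclosed_picture:
  assumes q: "- 3/4 < q" "q < - 1/2" and a: "a \<bullet> f s \<noteq> 0" and k: "k \<noteq> 0"
  shows "runs_between f s a (n s) (k *\<^sub>R Kc a 0) (self_intersection V f) (left_branch U f \<inter> V) (right_branch U f \<inter> V)"
  unfolding runs_between_def
proof (intro allI impI, goal_cases)
  case (1 l m \<eta>)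
  note lm = 1(1) and \<eta> = 1(2)
  from lm have lK: "l \<bullet> Kc a 0 \<noteq> 0" and mK: "m \<bullet> Kc a 0 = 0" using k by simp_all
  obtain v where v: "v \<bullet> n s = 0" "v \<bullet> a = 0" "m \<bullet> v \<noteq> 0" using lm by blast
  obtain i j where "v = i *\<^sub>R Hc a 0 + j *\<^sub>R Kc a 0" by (rule affine_tangent_plane[OF a v(1,2)])
  then have mH: "m \<bullet> Hc a 0 \<noteq> 0" using v(3) mK by (auto simp: inner_add_right)
  define \<Gamma> where "\<Gamma> \<beta> x = affine_chart a (f (\<phi> (vector [x, \<beta> x])))" for \<beta> :: "real => real" and x
  let ?d = "\<lambda>a::real. - 2 * a\<^sup>2"
  have sd: "small_graph ?d" by (rule small_graph_square) simp
  have jF: "((\<lambda>x. (l \<bullet> \<Gamma> bt x - l \<bullet> \<Gamma> bt 0) / x\<^sup>2) \<longlongrightarrow> vd 2 bt 0 * (l \<bullet> Kc a 0) / 2) (at 0)"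
    "l \<bullet> Kc a 0 = 0 ==> ((\<lambda>x. (l \<bullet> \<Gamma> bt x - l \<bullet> \<Gamma> bt 0) / x ^ 3) \<longlongrightarrow> (4 + vd 2 bt 0) * (l \<bullet> Hc a 0)) (at 0)"
    "\<exists>r>0. continuous_on {-r<..<r} (\<lambda>x. l \<bullet> \<Gamma> bt x - l \<bullet> \<Gamma> bt 0)" for l
    unfolding \<Gamma>_def by (rule graph_functional_jet[OF a small_graph_bt bt1]; assumption)+
  have jD: "((\<lambda>x. (l \<bullet> \<Gamma> ?d x - l \<bullet> \<Gamma> ?d 0) / x\<^sup>2) \<longlongrightarrow> 2 * - 2 * (l \<bullet> Kc a 0) / 2) (at 0)"
    "l \<bullet> Kc a 0 = 0 ==> ((\<lambda>x. (l \<bullet> \<Gamma> ?d x - l \<bullet> \<Gamma> ?d 0) / x ^ 3) \<longlongrightarrow> 0) (at 0)" for l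
    unfolding \<Gamma>_def using graph_functional_jet(1,2)[OF a sd vd_square(1), of l] unfolding vd_square(2) by simp_all
  have "isCont (\<lambda>x. \<phi> (vector [x, bt x])) 0"
    by (rule smooth_on_isCont[OF smooth_graph_param[OF small_graph_bt]]) (use eps in simp)
  moreover have "\<phi> (vector [0, bt 0]) = s"
  proof -
    have "(vector [0, bt 0] :: real^2) = 0" by (simp add: vec_eq_iff forall_2 bt0)
    then show ?thesis by (simp add: phi)
  qed
  ultimately obtain \<eta>' where \<eta>': "\<eta>' > 0" "\<And>x. \<bar>x\<bar> < \<eta>' ==> \<phi> (vector [x, bt x]) \<in> ball s \<eta>"
    using \<eta> unfolding continuous_at_eps_delta by (metis dist_commute dist_real_def diff_zero mem_ball)
  define \<delta> where "\<delta> = min \<eta>' \<xi>"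
  have \<delta>: "\<delta> > 0" using \<eta>' eps by (simp add: \<delta>_def)
  obtain r' where r': "r' > 0" "continuous_on {-r'<..<r'} (\<lambda>x. l \<bullet> \<Gamma> bt x - l \<bullet> \<Gamma> bt 0)" using jF(3) by blast
  have b2: "- 4 < vd 2 bt 0" "vd 2 bt 0 < 0" using q by (simp_all add: bt2)
  have AB: "vd 2 bt 0 * (l \<bullet> Kc a 0) / 2 * (2 * - 2 * (l \<bullet> Kc a 0) / 2) > 0"
  proof -
    have "vd 2 bt 0 * (l \<bullet> Kc a 0) / 2 * (2 * - 2 * (l \<bullet> Kc a 0) / 2) = (- vd 2 bt 0) * (l \<bullet> Kc a 0)\<^sup>2"
      by (simp add: power2_eq_square)
    then show ?thesis using b2 lK by (simp add: mult_neg_pos)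
  qed
  have C: "(4 + vd 2 bt 0) * (m \<bullet> Hc a 0) \<noteq> 0" using b2 mH by simp
  have pD: "((\<lambda>x. (m \<bullet> \<Gamma> ?d x - m \<bullet> \<Gamma> ?d 0) / x ^ 3) \<longlongrightarrow> 0) (at 0)" by (rule jD(2)[OF mK])
  obtain e where e: "e > 0" and
    enc: "\<And>y. y \<noteq> 0 ==> \<bar>y\<bar> < e ==> \<exists>u v. - \<delta> < u \<and> u < 0 \<and> 0 < v \<and> v < \<delta> \<and>
      l \<bullet> \<Gamma> bt u - l \<bullet> \<Gamma> bt 0 = l \<bullet> \<Gamma> ?d y - l \<bullet> \<Gamma> ?d 0 \<and> l \<bullet> \<Gamma> bt v - l \<bullet> \<Gamma> bt 0 = l \<bullet> \<Gamma> ?d y - l \<bullet> \<Gamma> ?d 0 \<and>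
      (m \<bullet> \<Gamma> bt u - m \<bullet> \<Gamma> bt 0 < m \<bullet> \<Gamma> ?d y - m \<bullet> \<Gamma> ?d 0 \<and> m \<bullet> \<Gamma> ?d y - m \<bullet> \<Gamma> ?d 0 < m \<bullet> \<Gamma> bt v - m \<bullet> \<Gamma> bt 0 \<or>
       m \<bullet> \<Gamma> bt v - m \<bullet> \<Gamma> bt 0 < m \<bullet> \<Gamma> ?d y - m \<bullet> \<Gamma> ?d 0 \<and> m \<bullet> \<Gamma> ?d y - m \<bullet> \<Gamma> ?d 0 < m \<bullet> \<Gamma> bt u - m \<bullet> \<Gamma> bt 0)"
    using opposite_cubics_enclose[OF jF(1) _ r'(2,1) jD(1) AB jF(2)[OF mK] C pD \<delta>] by auto
  have \<Gamma>0: "\<Gamma> ?d 0 = \<Gamma> bt 0" by (simp add: \<Gamma>_def bt0)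
  have "isCont (\<lambda>u. \<psi> u $ 1) s"
    using smooth_on_isCont[OF smooth_on_nth[OF phi(4) psi(1)]] A(2) phi(2) by blast
  moreover have "\<psi> s $ 1 = 0" using psi(2)[OF A(2)] phi(2) by simp
  ultimately obtain e' where e': "e' > 0" "\<And>u. u \<in> ball s e' ==> \<bar>\<psi> u $ 1\<bar> < e"
    using e unfolding continuous_at_eps_delta by (metis dist_commute dist_real_def diff_zero mem_ball)
  show ?case
  proof (intro exI[of _ e'] conjI e' ballI, goal_cases)
    case (1 d)
    note d = 1
    then obtain x where x: "d = \<phi> x" "x \<in> graph ?d" "x \<noteq> 0" using self_minus by blast
    have xA: "x \<in> A" using x(2) graph_subset box_A by blast
    have y: "x$1 \<noteq> 0" "\<bar>x$1\<bar> < e"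
      using graph_nz[OF sd x(2)] x(3) e'(2)[of d] d psi(2)[OF xA] by (auto simp: x(1))
    have fd: "affine_chart a (f d) = \<Gamma> ?d (x$1)"
      using x(2) vec_coords[of x] by (simp add: \<Gamma>_def x(1) in_graph_iff)
    obtain u v where uv: "- \<delta> < u" "u < 0" "0 < v" "v < \<delta>"
      and lv: "l \<bullet> \<Gamma> bt u = l \<bullet> \<Gamma> ?d (x$1)" "l \<bullet> \<Gamma> bt v = l \<bullet> \<Gamma> ?d (x$1)"
      and mv: "m \<bullet> \<Gamma> bt u < m \<bullet> \<Gamma> ?d (x$1) \<and> m \<bullet> \<Gamma> ?d (x$1) < m \<bullet> \<Gamma> bt v \<or>
       m \<bullet> \<Gamma> bt v < m \<bullet> \<Gamma> ?d (x$1) \<and> m \<bullet> \<Gamma> ?d (x$1) < m \<bullet> \<Gamma> bt u"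
      using enc[OF y] unfolding \<Gamma>0 by auto
    have g: "vector [u, bt u] \<in> graph bt" "vector [v, bt v] \<in> graph bt"
      using uv by (auto intro!: graph_mem[OF small_graph_bt] simp: \<delta>_def)
    have uv': "\<bar>u\<bar> < \<eta>'" "\<bar>v\<bar> < \<eta>'" using uv by (auto simp: \<delta>_def)
    note b = \<eta>'(2)[OF uv'(1)] \<eta>'(2)[OF uv'(2)]
    have q': "q \<noteq> - 1/2" using q by simp
    note fold = fd \<Gamma>_def[symmetric] Let_def
    \<comment> \<open>Which of the two points found lies on the left branch depends on the sign of
      \<open>side\<close>.\<close>
    show ?case
    proof (cases "side > 0")
      case True
      have "\<phi> (vector [u, bt u]) \<in> left_branch U f \<inter> V" "\<phi> (vector [v, bt v]) \<in> right_branch U f \<inter> V"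
        unfolding branches[OF q'] using g uv True by (auto simp: mult_neg_pos intro!: imageI)
      then show ?thesis using lv mv b
        by (intro bexI[of _ "\<phi> (vector [u, bt u])"] bexI[of _ "\<phi> (vector [v, bt v])"]) (auto simp: fold)
    next
      case False
      then have "side < 0" using side_nz by simp
      then have "\<phi> (vector [v, bt v]) \<in> left_branch U f \<inter> V" "\<phi> (vector [u, bt u]) \<in> right_branch U f \<inter> V"
        unfolding branches[OF q'] using g uv by (auto simp: mult_pos_neg mult_neg_neg intro!: imageI)
      then show ?thesis using lv mv b
        by (intro bexI[of _ "\<phi> (vector [v, bt v])"] bexI[of _ "\<phi> (vector [u, bt u])"]) (auto simp: fold)
    qed
  qed
qed

end

section \<open>Existence of the chart\<close>

lemma pd_nth: "smooth_on U f ==> x \<in> U ==> pd f v x $ i = pd (\<lambda>y. f y $ i) v x"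
  using pd_bounded_linear[OF _ _ bounded_linear_vec_nth] by metis

lemma pd_compose:
  assumes "smooth_on U g" "smooth_on V f" "x \<in> U" "g x \<in> V"
  shows "pd (\<lambda>x. f (g x)) v x = pd f (pd g v x) (g x)"
  using pd_eqI[OF has_derivative_compose[OF smooth_on_has_derivative[OF assms(1,3)] smooth_on_has_derivative[OF assms(2,4)]]] .

lemma smooth_swallowtail_model: "open U ==> smooth_on U swallowtail_model"
  unfolding swallowtail_model_def by (intro smooth_intros)

lemma pd_swallowtail_model:
  "pd swallowtail_model e1 x = edge_fun x *\<^sub>R vector [x$1, 1, 0]"
  "pd swallowtail_model e2 x = vector [(x$1)\<^sup>2, 2 * x$1, 1]"
proof -
  note n = pd_nth[OF smooth_swallowtail_model[OF open_UNIV] UNIV_I]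
  have "((\<lambda>y. swallowtail_model y $ 1) has_derivative (\<lambda>v. (12 * (x$1)^3 + 2 * x$1 * x$2) * v$1 + (x$1)\<^sup>2 * v$2)) (at x)"
    "((\<lambda>y. swallowtail_model y $ 2) has_derivative (\<lambda>v. (12 * (x$1)\<^sup>2 + 2 * x$2) * v$1 + 2 * x$1 * v$2)) (at x)"
    "((\<lambda>y. swallowtail_model y $ 3) has_derivative (\<lambda>v. v$2)) (at x)"
    unfolding swallowtail_model_def
    by (auto intro!: derivative_eq_intros bounded_linear.has_derivative[OF bounded_linear_vec_nth]
        simp: fun_eq_iff algebra_simps power2_eq_square power3_eq_cube)
  note d = this[THEN pd_eqI]
  show "pd swallowtail_model e1 x = edge_fun x *\<^sub>R vector [x$1, 1, 0]"
    by (simp add: vec_eq_iff forall_3 n d edge_fun_def power2_eq_square power3_eq_cube algebra_simps)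
  show "pd swallowtail_model e2 x = vector [(x$1)\<^sup>2, 2 * x$1, 1]"
    by (simp add: vec_eq_iff forall_3 n d)
qed

text \<open>Euler's relation in degree 0: the map is constant along rays.\<close>

lemma pd_homogeneous:
  assumes W: "open W" "smooth_on W \<Psi>" and hom: "\<And>x r. x \<in> W ==> r \<noteq> 0 ==> r *\<^sub>R x \<in> W \<and> \<Psi> (r *\<^sub>R x) = \<Psi> x" and z: "z \<in> W"
  shows "pd \<Psi> z z = 0"
proof -
  have "((\<lambda>t. \<Psi> (z + t *\<^sub>R z)) has_vector_derivative pd \<Psi> z (z + 0 *\<^sub>R z)) (at 0)"
    by (rule has_vector_derivative_line[OF W(2)]) (simp add: z)
  moreover have "((\<lambda>t. \<Psi> (z + t *\<^sub>R z)) has_vector_derivative 0) (at 0)"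
  proof (rule has_vector_derivative_transform_within_open[where S="{-1<..}"])
    show "((\<lambda>t. \<Psi> z) has_vector_derivative 0) (at (0::real))" by (rule has_vector_derivative_const)
    show "\<Psi> z = \<Psi> (z + t *\<^sub>R z)" if "t \<in> {-1<..}" for t
      using hom[OF z, of "1 + t"] that by (simp add: scaleR_add_left)
  qed auto
  ultimately show ?thesis using vector_derivative_unique_at by fastforce
qed

text \<open>A homogeneous chart of projective space forgets the scale; adding the functional
  \<open>e \<bullet> v\<close> turns its differential into an isomorphism of 4-space.\<close>

lemma surj_completion_bij:
  fixes l :: "real^4 => real^3"
  assumes l: "linear l" "surj l" "l e = 0" and e: "e \<noteq> 0"
  shows "bij (\<lambda>v. vector [l v $ 1, l v $ 2, l v $ 3, e \<bullet> v] :: real^4)" (is "bij ?L")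
proof -
  have lin: "linear ?L"
    by (rule linearI) (simp_all add: vec_eq_iff forall_4 linear_add[OF l(1)] linear_cmul[OF l(1)] inner_add_right)
  have "surj ?L"
  proof (rule surjI)
    fix y :: "real^4"
    define v where "v = inv l (vector [y$1, y$2, y$3])"
    have v: "l v = vector [y$1, y$2, y$3]" unfolding v_def by (rule surj_f_inv_f[OF l(2)])
    show "?L (v + ((y$4 - e \<bullet> v) / (e \<bullet> e)) *\<^sub>R e) = y"
      using e by (simp add: vec_eq_iff forall_4 linear_add[OF l(1)] linear_cmul[OF l(1)] l(3) v inner_add_right)
  qed
  then show ?thesis using linear_surjective_imp_injective[OF lin] by (simp add: bij_def)
qed

lemma surj_kernel:
  fixes l :: "real^4 => real^3"
  assumes l: "linear l" "surj l" "l e = 0" and e: "e \<noteq> 0" and v: "l v = 0"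
  shows "v \<in> span {e}"
proof -
  define k where "k = (e \<bullet> v) / (e \<bullet> e)"
  have k: "l (k *\<^sub>R e) = 0" "e \<bullet> (k *\<^sub>R e) = e \<bullet> v" using l e by (simp_all add: linear_cmul k_def)
  have "(vector [l v $ 1, l v $ 2, l v $ 3, e \<bullet> v] :: real^4) =
      vector [l (k *\<^sub>R e) $ 1, l (k *\<^sub>R e) $ 2, l (k *\<^sub>R e) $ 3, e \<bullet> (k *\<^sub>R e)]"
    unfolding k v ..
  then have "v = k *\<^sub>R e" by (rule injD[OF bij_is_inj[OF surj_completion_bij[OF l e]]])
  then have "\<exists>k. v = k *\<^sub>R e" by (rule exI)
  then show ?thesis by (auto simp: span_singleton)
qed

text \<open>A direction annihilated by the differential of the model is mapped by that of
  \<open>f\<close> into the kernel of the differential of the chart, which is the line of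
  \<open>f u\<close>; so the induced map is no immersion.\<close>

lemma germ_not_regular:
  assumes g: "germ_equivalent U f u g" and U: "open U" "smooth_on U f" "\<And>u. u \<in> U ==> f u \<noteq> 0"
    and dg: "smooth_on UNIV g" "pd g e1 0 = 0"
  shows "\<not> regular_at f u"
proof
  assume reg: "regular_at f u"
  obtain A \<phi> W \<Psi> where A: "open A" "0 \<in> A" and \<phi>: "smooth_on A \<phi>" "\<phi> ` A \<subseteq> U" "\<phi> 0 = u" "bij (frechet_derivative \<phi> (at 0))"
    and W: "open W" "smooth_on W \<Psi>" and hom: "\<forall>x\<in>W. \<forall>r. r \<noteq> 0 --> r *\<^sub>R x \<in> W \<and> \<Psi> (r *\<^sub>R x) = \<Psi> x"
    and fu: "f u \<in> W" and surj: "surj (frechet_derivative \<Psi> (at (f u)))"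
    and eq: "\<forall>x\<in>A. f (\<phi> x) \<in> W \<and> \<Psi> (f (\<phi> x)) = g x"
    using g unfolding germ_equivalent_def by blast
  have uU: "u \<in> U" using \<phi> A by blast
  have sF: "smooth_on A (\<lambda>x. f (\<phi> x))" by (rule smooth_on_compose[OF A(1) U(1) _ \<phi>(1) U(2)]) (use \<phi> in blast)
  have l: "linear (\<lambda>v. pd \<Psi> v (f u))" by (rule pd_linear[OF W(2) fu])
  have "pd \<Psi> (pd (\<lambda>x. f (\<phi> x)) e1 0) (f (\<phi> 0)) = pd (\<lambda>x. \<Psi> (f (\<phi> x))) e1 0"
    using pd_compose[OF sF W(2) A(2)] eq A by simp
  also have "\<dots> = pd g e1 0"
    by (rule pd_cong[OF A smooth_on_compose[OF A(1) W(1) _ sF W(2)]]) (use eq in auto)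
  finally have "pd \<Psi> (pd f (pd \<phi> e1 0) u) (f u) = 0"
    using pd_compose[OF \<phi>(1) U(2) A(2)] uU by (simp add: \<phi>(3) dg)
  then have "pd f (pd \<phi> e1 0) u \<in> span {f u}"
    by (intro surj_kernel[OF l]) (use surj pd_homogeneous[OF W _ fu] hom U(3)[OF uU] in \<open>auto simp: pd_def[abs_def]\<close>)
  then have "pd \<phi> e1 0 = 0" using reg by (simp add: regular_at_def pd_def)
  moreover have "pd \<phi> 0 0 = 0" using linear_0[OF pd_linear[OF \<phi>(1) A(2)]] .
  ultimately have "frechet_derivative \<phi> (at 0) e1 = frechet_derivative \<phi> (at 0) 0" by (simp add: pd_def)
  then have "e1 = (0 :: real^2)" by (rule injD[OF bij_is_inj[OF \<phi>(4)]])
  then show False by (metis vector_2(1) zero_index zero_neq_one)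
qed

lemma cuspidal_not_regular:
  assumes U: "open U" "smooth_on U f" "\<And>u. u \<in> U ==> f u \<noteq> 0"
  shows "cuspidal_point U f u ==> \<not> regular_at f u" "swallowtail_point U f u ==> \<not> regular_at f u"
proof -
  let ?c = "\<lambda>x :: real^2. vector [(x$1)^2, (x$1)^3, x$2] :: real^3"
  have s: "smooth_on UNIV ?c" by (intro smooth_intros open_UNIV)
  have "((\<lambda>y. ?c y $ 1) has_derivative (\<lambda>v. 0)) (at 0)" "((\<lambda>y. ?c y $ 2) has_derivative (\<lambda>v. 0)) (at 0)"
    "((\<lambda>y. ?c y $ 3) has_derivative (\<lambda>v. v$2)) (at 0)"
    by (auto intro!: derivative_eq_intros bounded_linear.has_derivative[OF bounded_linear_vec_nth] simp: fun_eq_iff)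
  then have "pd ?c e1 0 = 0" by (simp add: vec_eq_iff forall_3 pd_nth[OF s UNIV_I] pd_eqI)
  then show "cuspidal_point U f u ==> \<not> regular_at f u"
    unfolding cuspidal_point_def using germ_not_regular[OF _ U s] by blast
  have "pd swallowtail_model e1 0 = 0" by (simp add: pd_swallowtail_model edge_fun_def)
  then show "swallowtail_point U f u ==> \<not> regular_at f u"
    unfolding swallowtail_point_def swallowtail_model_def[abs_def, symmetric]
    using germ_not_regular[OF _ U smooth_swallowtail_model[OF open_UNIV]] by blast
qed

text \<open>At 0 the factor \<open>edge_fun\<close> vanishes while its derivative along
  \<open>e2\<close> is 2; differentiating the product there isolates \<open>c 0\<close>.\<close>

lemma edge_division:
  assumes A: "open A" "0 \<in> A" and c: "smooth_on A c" and z: "\<And>x. x \<in> A ==> edge_fun x * c x = 0"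
  shows "c 0 = (0::real)"
proof -
  have s: "smooth_on A edge_fun" unfolding edge_fun_def by (intro smooth_intros A)
  have "(edge_fun has_derivative (\<lambda>v. 2 * v$2)) (at 0)"
    unfolding edge_fun_def
    by (auto intro!: derivative_eq_intros bounded_linear.has_derivative[OF bounded_linear_vec_nth])
  then have "pd edge_fun e2 0 = 2" by (simp add: pd_eqI)
  moreover have "pd (\<lambda>x. edge_fun x * c x) e2 0 = edge_fun 0 * pd c e2 0 + pd edge_fun e2 0 * c 0"
    by (rule pd_bilinear[OF s c A(2) bounded_bilinear_mult])
  moreover have "pd (\<lambda>x. edge_fun x * c x) e2 0 = pd (\<lambda>x. 0) e2 0"
    by (rule pd_cong[OF A smooth_on_mult[OF A(1) s c] z])
  ultimately show ?thesis by (simp add: edge_fun_def)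
qed

lemma eventually_pos_product:
  fixes c :: "'a::t2_space => real"
  assumes "isCont c z" "c z * k > 0"
  shows "\<forall>\<^sub>F x in nhds z. c x * k > 0"
proof -
  have "((\<lambda>x. c x * k) \<longlongrightarrow> c z * k) (nhds z)"
    using assms(1) by (intro tendsto_mult tendsto_const) (simp add: isCont_def tendsto_at_iff_tendsto_nhds)
  then show ?thesis using assms(2) by (rule order_tendstoD(1))
qed

text \<open>The field \<open>h\<close> is pulled back from the model, where the division by
  \<open>edge_fun\<close> is explicit, and \<mu> accounts for the scale. Immersivity of the dual
  surface makes \<open>al\<close> and \<open>ga\<close> nonzero at 0, and a small \<open>A\<close>
  propagates the signs.\<close>

theorem swallowtail_chart_exists:
  assumes leg: "legendrian U f n" and edge: "cuspidal_edge U f = {u\<in>U. \<not> regular_at f u}"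
    and reg: "regular_at n s" and swt: "swallowtail_point U f s"
    and A0: "open A0" "0 \<in> A0" and \<phi>: "smooth_on A0 \<phi>" "\<phi> ` A0 \<subseteq> U" "\<phi> 0 = s" "bij (frechet_derivative \<phi> (at 0))"
    and W: "open W" "smooth_on W \<Psi>" and hom: "\<And>x r. x \<in> W ==> r \<noteq> 0 ==> r *\<^sub>R x \<in> W \<and> \<Psi> (r *\<^sub>R x) = \<Psi> x"
    and fs: "f s \<in> W" and surj: "surj (frechet_derivative \<Psi> (at (f s)))"
    and eq: "\<And>x. x \<in> A0 ==> f (\<phi> x) \<in> W \<and> \<Psi> (f (\<phi> x)) = swallowtail_model x"
  obtains A \<psi> h \<mu> where "A \<subseteq> A0" "swallowtail_chart U f n s A \<phi> \<psi> (\<lambda>x. f (\<phi> x)) (\<lambda>x. n (\<phi> x)) h \<mu>"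
proof -
  have U: "open U" "smooth_on U f" "smooth_on U n" and fnz: "\<And>u. u \<in> U ==> f u \<noteq> 0" and nnz: "\<And>u. u \<in> U ==> n u \<noteq> 0"
    and fn: "\<And>u. u \<in> U ==> f u \<bullet> n u = 0" "\<And>u v. u \<in> U ==> pd f v u \<bullet> n u = 0"
    using leg by (auto simp: legendrian_def pd_def)
  have sU: "s \<in> U" using \<phi> A0 by blast
  define e where "e = f s"
  have e: "e \<noteq> 0" using fnz[OF sU] by (simp add: e_def)
  have b\<phi>: "bij (\<lambda>v. pd \<phi> v 0)" using \<phi>(4) by (simp add: pd_def)
  obtain A1 V1 \<psi> where A1: "open A1" "A1 \<subseteq> A0" "0 \<in> A1" and V1: "open V1" "\<phi> ` A1 = V1" "\<psi> ` V1 = A1"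
    and \<psi>: "smooth_on V1 \<psi>" "\<And>x. x \<in> A1 ==> \<psi> (\<phi> x) = x" "\<And>y. y \<in> V1 ==> \<phi> (\<psi> y) = y"
    and d\<phi>: "\<And>x. x \<in> A1 ==> bij (\<lambda>v. pd \<phi> v x)"
    by (rule smooth_inverse_function[OF A0(1) \<phi>(1) A0(2) b\<phi>], rule that)
  define F where "F x = f (\<phi> x)" for x
  define N where "N x = n (\<phi> x)" for x
  have \<phi>U: "x \<in> A1 ==> \<phi> x \<in> U" for x using \<phi>(2) A1(2) by blast
  note s\<phi> = smooth_on_subset[OF \<phi>(1) A1(2)]
  have sF: "smooth_on A1 F" and sN: "smooth_on A1 N" unfolding F_def[abs_def] N_def[abs_def]
    by (rule smooth_on_compose[OF A1(1) U(1) \<phi>U s\<phi> U(2)], assumption, rule smooth_on_compose[OF A1(1) U(1) \<phi>U s\<phi> U(3)])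
  have F0: "F 0 = e" by (simp add: F_def \<phi> e_def)
  have FW: "F x \<in> W" "\<Psi> (F x) = swallowtail_model x" if "x \<in> A1" for x using eq A1(2) that by (auto simp: F_def)
  have pdF: "pd F v x = pd f (pd \<phi> v x) (\<phi> x)" "pd N v x = pd n (pd \<phi> v x) (\<phi> x)" if "x \<in> A1" for v x
    unfolding F_def[abs_def] N_def[abs_def] using pd_compose[OF s\<phi> _ that \<phi>U[OF that]] U by blast+
  have dp: "dual_pair A1 F N"
    unfolding dual_pair_def using A1 sF sN \<phi>U fnz nnz fn by (simp add: F_def N_def pdF[unfolded F_def N_def])
      (simp add: pdF[unfolded F_def[abs_def] N_def[abs_def]] F_def[abs_def])
  have NF: "N x \<bullet> F x = 0" "N x \<bullet> pd F v x = 0" "pd N v x \<bullet> F x = 0" if "x \<in> A1" for v x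
    using dp dual_pair_pd_N[OF dp that] that by (auto simp: dual_pair_def inner_commute)
  \<comment> \<open>Completing \<Psi> by the scale \<open>e \<bullet> z\<close> gives a local
    diffeomorphism of 4-space, through which vectors of the model can be pulled back.\<close>
  define \<Theta> where "\<Theta> z = (vector [\<Psi> z $ 1, \<Psi> z $ 2, \<Psi> z $ 3, e \<bullet> z] :: real^4)" for z
  have s\<Theta>: "smooth_on W \<Theta>" unfolding \<Theta>_def[abs_def] by (intro smooth_intros W)
  have d\<Theta>: "pd \<Theta> v z = vector [pd \<Psi> v z $ 1, pd \<Psi> v z $ 2, pd \<Psi> v z $ 3, e \<bullet> v]" if z: "z \<in> W" for v z
  proof -
    have "pd (\<lambda>z. e \<bullet> z) v z = e \<bullet> v" by (rule pd_eqI) (auto intro!: derivative_eq_intros)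
    then show ?thesis
      by (simp add: vec_eq_iff forall_4 pd_nth[OF s\<Theta> z] pd_nth[OF W(2) z] \<Theta>_def)
  qed
  have b\<Theta>: "bij (\<lambda>v. pd \<Theta> v e)"
    unfolding d\<Theta>[OF fs[folded e_def]]
    by (rule surj_completion_bij[OF pd_linear[OF W(2) fs[folded e_def]] _ pd_homogeneous[OF W hom fs[folded e_def]] e])
      (use surj in \<open>auto simp: pd_def[abs_def] e_def\<close>)
  obtain W1 Y g where W1: "open W1" "W1 \<subseteq> W" "e \<in> W1"
    and Y: "open Y" "\<Theta> ` W1 = Y" "g ` Y = W1" and g: "smooth_on Y g" "\<And>z. z \<in> W1 ==> g (\<Theta> z) = z" "\<And>y. y \<in> Y ==> \<Theta> (g y) = y"
    and bij: "\<And>z. z \<in> W1 ==> bij (\<lambda>v. pd \<Theta> v z)"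
    by (rule smooth_inverse_function[OF W(1) s\<Theta> fs[folded e_def] b\<Theta>], rule that)
  have d\<Theta>g: "pd \<Theta> (pd g w (\<Theta> z)) z = w" if z: "z \<in> W1" for w z
  proof -
    have zY: "\<Theta> z \<in> Y" using Y z by blast
    have "pd \<Theta> (pd g w (\<Theta> z)) (g (\<Theta> z)) = pd (\<lambda>y. \<Theta> (g y)) w (\<Theta> z)"
      using pd_compose[OF g(1) smooth_on_subset[OF s\<Theta> W1(2)] zY] g(2)[OF z] z by simp
    also have "\<dots> = pd (\<lambda>y. y) w (\<Theta> z)"
    proof (rule pd_cong[OF Y(1) zY])
      show "smooth_on Y (\<lambda>y. \<Theta> (g y))" by (rule smooth_on_compose[OF Y(1) W1(1) _ g(1) smooth_on_subset[OF s\<Theta> W1(2)]]) (use Y in blast)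
    qed (rule g(3))
    also have "\<dots> = w" by (rule pd_eqI) (rule has_derivative_ident)
    finally show ?thesis using g(2)[OF z] by simp
  qed
  define A2 where "A2 = A1 \<inter> F -` W1 \<inter> (\<lambda>x. e \<bullet> F x) -` (- {0})"
  have seF: "smooth_on A1 (\<lambda>x. e \<bullet> F x)" by (intro smooth_on_inner smooth_on_const A1 sF)
  have A2: "open A2" "0 \<in> A2" "A2 \<subseteq> A1"
  proof -
    have "open ((A1 \<inter> F -` W1) \<inter> (A1 \<inter> (\<lambda>x. e \<bullet> F x) -` (- {0})))"
      by (intro open_Int continuous_open_preimage[OF smooth_on_continuous] sF seF A1 W1) auto
    moreover have "(A1 \<inter> F -` W1) \<inter> (A1 \<inter> (\<lambda>x. e \<bullet> F x) -` (- {0})) = A2" by (auto simp: A2_def)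
    ultimately show "open A2" by simp
  qed (use A1 W1 F0 e in \<open>auto simp: A2_def\<close>)
  have FW1: "F x \<in> W1" "e \<bullet> F x \<noteq> 0" if "x \<in> A2" for x using that by (auto simp: A2_def)
  note sF2 = smooth_on_subset[OF sF A2(3)] and sN2 = smooth_on_subset[OF sN A2(3)]
  \<comment> \<open>The derivative of the model along \<open>e1\<close> is \<open>edge_fun x\<close>
    times (x1, 1, 0); \<open>h x\<close> is the preimage of this vector with scale component
    0.\<close>
  define h where "h x = x$1 *\<^sub>R pd g (vector [1, 0, 0, 0]) (\<Theta> (F x)) + pd g (vector [0, 1, 0, 0]) (\<Theta> (F x))" for x
  define \<mu> where "\<mu> x = (e \<bullet> pd F e1 x) / (e \<bullet> F x)" for x
  have s\<Theta>F: "smooth_on A2 (\<lambda>x. \<Theta> (F x))"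
    by (rule smooth_on_compose[OF A2(1) W1(1) FW1(1) sF2 smooth_on_subset[OF s\<Theta> W1(2)]])
  have \<Theta>Y: "x \<in> A2 ==> \<Theta> (F x) \<in> Y" for x using FW1 Y by blast
  have sh: "smooth_on A2 h" unfolding h_def[abs_def]
    by (intro smooth_on_add smooth_on_scaleR smooth_on_nth smooth_on_ident smooth_on_compose[OF A2(1) Y(1) \<Theta>Y s\<Theta>F] smooth_on_pd g A2)
  have s\<mu>: "smooth_on A2 \<mu>" unfolding \<mu>_def[abs_def]
    by (intro smooth_on_divide smooth_on_inner smooth_on_const smooth_on_pd A2 sF2 FW1)
  have L: "linear (\<lambda>v. pd \<Theta> v (F x))" if "x \<in> A2" for x using FW1[OF that] W1 by (intro pd_linear[OF s\<Theta>]) blast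
  have \<Theta>h: "pd \<Theta> (h x) (F x) = vector [x$1, 1, 0, 0]" if x: "x \<in> A2" for x
    unfolding h_def linear_add[OF L[OF x]] linear_cmul[OF L[OF x]] d\<Theta>g[OF FW1(1)[OF x]]
    by (simp add: vec_eq_iff forall_4)
  have \<Psi>F: "pd \<Psi> (pd F v x) (F x) = pd swallowtail_model v x" if x: "x \<in> A1" for v x
  proof -
    have "pd \<Psi> (pd F v x) (F x) = pd (\<lambda>x. \<Psi> (F x)) v x"
      using pd_compose[OF sF W(2) x FW(1)[OF x]] by simp
    also have "\<dots> = pd swallowtail_model v x"
      by (rule pd_cong[OF A1(1) x smooth_on_compose[OF A1(1) W(1) FW(1) sF W(2)] FW(2)])
    finally show ?thesis .
  qed
  have \<Theta>F: "pd \<Theta> (F x) (F x) = vector [0, 0, 0, e \<bullet> F x]" if x: "x \<in> A2" for x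
    using FW(1) A2(3) x by (simp add: d\<Theta> pd_homogeneous[OF W hom] subset_iff)
  have Fa: "pd F e1 x = edge_fun x *\<^sub>R h x + \<mu> x *\<^sub>R F x" if x: "x \<in> A2" for x
  proof (rule injD[OF bij_is_inj[OF bij[OF FW1(1)[OF x]]]])
    have x1: "x \<in> A1" using A2(3) x by blast
    have "pd \<Theta> (edge_fun x *\<^sub>R h x + \<mu> x *\<^sub>R F x) (F x) = vector [edge_fun x * x$1, edge_fun x, 0, e \<bullet> pd F e1 x]"
      unfolding linear_add[OF L[OF x]] linear_cmul[OF L[OF x]] \<Theta>h[OF x] \<Theta>F[OF x]
      using FW1[OF x] by (simp add: vec_eq_iff forall_4 \<mu>_def)
    moreover have "pd \<Theta> (pd F e1 x) (F x) = vector [edge_fun x * x$1, edge_fun x, 0, e \<bullet> pd F e1 x]"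
      unfolding d\<Theta>[OF FW(1)[OF x1]] \<Psi>F[OF x1] pd_swallowtail_model by simp
    ultimately show "pd \<Theta> (pd F e1 x) (F x) = pd \<Theta> (edge_fun x *\<^sub>R h x + \<mu> x *\<^sub>R F x) (F x)" by simp
  qed
  have Nh: "N 0 \<bullet> h 0 = 0"
  proof (rule edge_division[OF A2(1,2)])
    show "smooth_on A2 (\<lambda>x. N x \<bullet> h x)" by (intro smooth_on_inner A2 sN2 sh)
    show "edge_fun x * (N x \<bullet> h x) = 0" if "x \<in> A2" for x
    proof -
      have x: "x \<in> A1" using A2(3) that by blast
      show ?thesis using NF(2)[OF x, of e1] NF(1)[OF x] unfolding Fa[OF that] by (simp add: inner_add_right)
    qed
  qed
  have x0: "0 \<in> A1" "0 \<in> A2" using A1 A2 by auto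
  have J0: "det4 (F 0) (h 0) (pd F e2 0) (N 0) \<noteq> 0"
  proof
    assume "det4 (F 0) (h 0) (pd F e2 0) (N 0) = 0"
    then obtain i j k l where z: "i *\<^sub>R F 0 + j *\<^sub>R h 0 + k *\<^sub>R pd F e2 0 + l *\<^sub>R N 0 = 0" and nz: "\<not> (i = 0 \<and> j = 0 \<and> k = 0 \<and> l = 0)"
      by (rule det4_exists_dependence)
    have "N 0 \<bullet> (i *\<^sub>R F 0 + j *\<^sub>R h 0 + k *\<^sub>R pd F e2 0 + l *\<^sub>R N 0) = 0" unfolding z by simp
    then have l: "l = 0" using nnz[OF sU] by (simp add: inner_add_right NF[OF x0(1)] Nh) (simp add: N_def \<phi>)
    have \<Theta>b: "pd \<Theta> (pd F e2 0) (F 0) = vector [0, 0, 1, e \<bullet> pd F e2 0]"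
      unfolding d\<Theta>[OF FW(1)[OF x0(1)]] \<Psi>F[OF x0(1)] pd_swallowtail_model by simp
    have "pd \<Theta> (i *\<^sub>R F 0 + j *\<^sub>R h 0 + k *\<^sub>R pd F e2 0) (F 0) = pd \<Theta> 0 (F 0)" using z l by simp
    then have "i *\<^sub>R vector [0, 0, 0, e \<bullet> F 0] + j *\<^sub>R vector [0, 1, 0, 0] + k *\<^sub>R vector [0, 0, 1, e \<bullet> pd F e2 0] = (0 :: real^4)"
      unfolding linear_add[OF L[OF x0(2)]] linear_cmul[OF L[OF x0(2)]] linear_0[OF L[OF x0(2)]] \<Theta>h[OF x0(2)] \<Theta>F[OF x0(2)] \<Theta>b zero_index .
    then have "j = 0 \<and> k = 0 \<and> i * (e \<bullet> F 0) + k * (e \<bullet> pd F e2 0) = 0" by (auto simp: vec_eq_iff forall_4)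
    then show False using nz l e unfolding F0 by auto
  qed
  have II0: "pd N e1 0 \<bullet> pd F e2 0 = 0"
    using Fa[OF x0(2)] NF(3)[OF x0(1)] II_sym[OF dp x0(1), of e1 e2]
    by (simp add: II_def edge_fun_def)
  \<comment> \<open>Such a derivative of \<open>N\<close>, after subtraction of a multiple of
    \<open>N 0\<close>, is orthogonal to the whole frame \<open>F\<close>, \<open>h\<close>,
    \<open>pd F e2\<close>, \<open>N\<close> and hence zero; the immersivity of \<open>n\<close>
    then leaves v = 0.\<close>
  have inN: "v = 0" if v: "pd N v 0 \<bullet> h 0 = 0" "pd N v 0 \<bullet> pd F e2 0 = 0" for v
  proof -
    define k where "k = (pd N v 0 \<bullet> N 0) / (N 0 \<bullet> N 0)"
    have N0: "N 0 \<noteq> 0" using nnz[OF sU] by (simp add: N_def \<phi>)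
    have "pd N v 0 - k *\<^sub>R N 0 = 0"
      using J0[unfolded det4_nonzero_iff, rule_format, of "pd N v 0 - k *\<^sub>R N 0"] v NF[OF x0(1)] Nh N0
      by (simp add: inner_diff_left k_def)
    then have "pd n (pd \<phi> v 0) s \<in> span {n s}"
      using span_mul[OF span_base, of "n s" "{n s}" k] pdF(2)[OF x0(1)] by (simp add: N_def \<phi>)
    then have "pd \<phi> v 0 = 0" using reg by (simp add: regular_at_def pd_def)
    then have "pd \<phi> v 0 = pd \<phi> 0 0" using linear_0[OF pd_linear[OF s\<phi> x0(1)]] by simp
    then show "v = 0" by (rule injD[OF bij_is_inj[OF d\<phi>[OF x0(1)]]])
  qed
  have e12: "e1 \<noteq> 0" by (metis vector_2(1) zero_index zero_neq_one)
  have al: "pd N e1 0 \<bullet> h 0 \<noteq> 0" using inN[of e1] II0 e12 by blast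
  have ga: "pd N e2 0 \<bullet> pd F e2 0 \<noteq> 0"
  proof
    assume z: "pd N e2 0 \<bullet> pd F e2 0 = 0"
    \<comment> \<open>Chosen so that the derivative of \<open>N\<close> along the vector with
      entries \<open>?c\<close> and 1 is orthogonal to \<open>h\<close>; were \<open>ga\<close>
      zero, it would be orthogonal to \<open>pd F e2\<close> too.\<close>
    let ?c = "- (pd N e2 0 \<bullet> h 0) / (pd N e1 0 \<bullet> h 0)"
    have c: "pd N (vector [?c, 1]) 0 = ?c *\<^sub>R pd N e1 0 + pd N e2 0"
      using pd_coords[OF sN x0(1), of "vector [?c, 1]"] by simp
    have "(vector [?c, 1] :: real^2) = 0"
      by (rule inN; unfold c) (use al z II0 in \<open>simp_all add: inner_add_left inner_diff_left\<close>)
    then show False by (metis vector_2(2) zero_index zero_neq_one)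
  qed
  \<comment> \<open>Besides the signs, the representative of \<open>F x\<close> on the hyperplane
    \<open>e \<bullet> z = e \<bullet> e\<close> is kept in \<open>W1\<close>, where \<Theta> is
    injective. On this hyperplane \<Theta> is determined by \<Psi>, so points with equal image in
    the model coincide.\<close>
  have ev: "\<forall>\<^sub>F x in nhds 0. x \<in> A2 \<and> ((e \<bullet> e) / (e \<bullet> F x)) *\<^sub>R F x \<in> W1 \<and>
     (pd N e1 x \<bullet> h x) * (pd N e1 0 \<bullet> h 0) > 0 \<and> (pd N e2 x \<bullet> pd F e2 x) * (pd N e2 0 \<bullet> pd F e2 0) > 0 \<and>
     det4 (F x) (h x) (pd F e2 x) (N x) * det4 (F 0) (h 0) (pd F e2 0) (N 0) > 0 \<and>
     ((pd N e1 x \<bullet> h x) * (pd N e2 x \<bullet> pd F e2 x) - edge_fun x * (pd N e2 x \<bullet> h x)\<^sup>2) *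
        ((pd N e1 0 \<bullet> h 0) * (pd N e2 0 \<bullet> pd F e2 0)) > 0"
  proof (intro eventually_conj)
    have ic: "isCont c 0" if "smooth_on A2 c" for c :: "real^2 => real" using smooth_on_isCont[OF that x0(2)] .
    note sm = smooth_on_inner[OF A2(1)] smooth_on_pd sF2 sN2 sh
    show "\<forall>\<^sub>F x in nhds 0. x \<in> A2" using A2 by (simp add: eventually_nhds) blast
    define G where "G x = ((e \<bullet> e) / (e \<bullet> F x)) *\<^sub>R F x" for x
    have "smooth_on A2 G" unfolding G_def[abs_def]
      by (intro smooth_on_scaleR smooth_on_divide smooth_on_inner smooth_on_const A2 sF2 FW1)
    from smooth_on_isCont[OF this x0(2)] have "(G \<longlongrightarrow> G 0) (nhds 0)"
      by (simp add: isCont_def tendsto_at_iff_tendsto_nhds)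
    moreover have "G 0 = e" using e by (simp add: G_def F0)
    ultimately have "((\<lambda>x. ((e \<bullet> e) / (e \<bullet> F x)) *\<^sub>R F x) \<longlongrightarrow> e) (nhds 0)" by (simp add: G_def[abs_def])
    then show "\<forall>\<^sub>F x in nhds 0. ((e \<bullet> e) / (e \<bullet> F x)) *\<^sub>R F x \<in> W1" using topological_tendstoD W1 by blast
    show "\<forall>\<^sub>F x in nhds 0. (pd N e1 x \<bullet> h x) * (pd N e1 0 \<bullet> h 0) > 0"
      using al by (intro eventually_pos_product ic sm) (auto simp: zero_less_mult_iff)
    show "\<forall>\<^sub>F x in nhds 0. (pd N e2 x \<bullet> pd F e2 x) * (pd N e2 0 \<bullet> pd F e2 0) > 0"
      using ga by (intro eventually_pos_product ic sm) (auto simp: zero_less_mult_iff)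
    show "\<forall>\<^sub>F x in nhds 0. det4 (F x) (h x) (pd F e2 x) (N x) * det4 (F 0) (h 0) (pd F e2 0) (N 0) > 0"
      using J0 by (intro eventually_pos_product ic smooth_on_det4[OF A2(1)] sm) (auto simp: zero_less_mult_iff)
    show "\<forall>\<^sub>F x in nhds 0. ((pd N e1 x \<bullet> h x) * (pd N e2 x \<bullet> pd F e2 x) - edge_fun x * (pd N e2 x \<bullet> h x)\<^sup>2) *
        ((pd N e1 0 \<bullet> h 0) * (pd N e2 0 \<bullet> pd F e2 0)) > 0"
    proof (intro eventually_pos_product ic smooth_on_diff smooth_on_mult smooth_on_power sm A2)
      show "smooth_on A2 edge_fun" unfolding edge_fun_def by (intro smooth_intros A2)
      have "(pd N e1 0 \<bullet> h 0) * (pd N e2 0 \<bullet> pd F e2 0) \<noteq> 0" using al ga by simp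
      moreover have sq: "x * x > 0" if "x \<noteq> 0" for x :: real using that by (auto simp: zero_less_mult_iff linorder_neq_iff)
      ultimately show "((pd N e1 0 \<bullet> h 0) * (pd N e2 0 \<bullet> pd F e2 0) - edge_fun 0 * (pd N e2 0 \<bullet> h 0)\<^sup>2) *
        ((pd N e1 0 \<bullet> h 0) * (pd N e2 0 \<bullet> pd F e2 0)) > 0"
        using sq[of "(pd N e1 0 \<bullet> h 0) * (pd N e2 0 \<bullet> pd F e2 0)"] by (simp add: edge_fun_def)
    qed
  qed
  then obtain A where A: "open A" "0 \<in> A" and P: "\<And>x. x \<in> A ==> x \<in> A2" "\<And>x. x \<in> A ==> ((e \<bullet> e) / (e \<bullet> F x)) *\<^sub>R F x \<in> W1"
     "\<And>x. x \<in> A ==> (pd N e1 x \<bullet> h x) * (pd N e1 0 \<bullet> h 0) > 0" "\<And>x. x \<in> A ==> (pd N e2 x \<bullet> pd F e2 x) * (pd N e2 0 \<bullet> pd F e2 0) > 0"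
     "\<And>x. x \<in> A ==> det4 (F x) (h x) (pd F e2 x) (N x) * det4 (F 0) (h 0) (pd F e2 0) (N 0) > 0"
     "\<And>x. x \<in> A ==> ((pd N e1 x \<bullet> h x) * (pd N e2 x \<bullet> pd F e2 x) - edge_fun x * (pd N e2 x \<bullet> h x)\<^sup>2) *
        ((pd N e1 0 \<bullet> h 0) * (pd N e2 0 \<bullet> pd F e2 0)) > 0"
    unfolding eventually_nhds by blast
  have AA: "A \<subseteq> A2" "A \<subseteq> A1" "A \<subseteq> A0" using P(1) A2(3) A1(2) by blast+
  have opn: "open (\<phi> ` A)"
  proof -
    have "\<phi> ` A = V1 \<inter> \<psi> -` A"
    proof
      show "\<phi> ` A \<subseteq> V1 \<inter> \<psi> -` A" using V1(2) AA(2) \<psi>(2) by auto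
      show "V1 \<inter> \<psi> -` A \<subseteq> \<phi> ` A"
      proof
      fix y assume "y \<in> V1 \<inter> \<psi> -` A"
      then have "y \<in> V1" "\<psi> y \<in> A" by auto
      then show "y \<in> \<phi> ` A" using \<psi>(3) by (metis imageI)
      qed
    qed
    then show ?thesis using continuous_open_preimage[OF smooth_on_continuous[OF \<psi>(1)] V1(1) A(1)] by simp
  qed
  have "swallowtail_chart U f n s A \<phi> \<psi> F N h \<mu>"
  proof
    show "same_point (F x) (F y) \<longleftrightarrow> swallowtail_model x = swallowtail_model y" if xy: "x \<in> A" "y \<in> A" for x y
    proof
      have x1: "x \<in> A1" "y \<in> A1" using AA xy by auto
      note FWx = FW[OF x1(1)] and FWy = FW[OF x1(2)]
      show "swallowtail_model x = swallowtail_model y" if "same_point (F x) (F y)"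
        using that hom[OF FWx(1)] FWx(2) FWy(2) by (auto simp: same_point_def)
      assume m: "swallowtail_model x = swallowtail_model y"
      let ?p = "(e \<bullet> e) / (e \<bullet> F x)" and ?r = "(e \<bullet> e) / (e \<bullet> F y)"
      have nz: "e \<bullet> F x \<noteq> 0" "e \<bullet> F y \<noteq> 0" using FW1 P(1) xy by auto
      then have p: "?p \<noteq> 0" "?r \<noteq> 0" using e by simp_all
      have "\<Theta> (?p *\<^sub>R F x) = \<Theta> (?r *\<^sub>R F y)"
        using hom[OF FWx(1) p(1)] hom[OF FWy(1) p(2)] FWx(2) FWy(2) m nz by (simp add: \<Theta>_def)
      then have eq': "?p *\<^sub>R F x = ?r *\<^sub>R F y" using g(2) P(2) xy by metis
      have "F y = (1 / ?r) *\<^sub>R (?r *\<^sub>R F y)" using p by simp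
      also have "\<dots> = (1 / ?r * ?p) *\<^sub>R F x" unfolding eq'[symmetric] by (rule scaleR_scaleR)
      finally show "same_point (F x) (F y)" unfolding same_point_def using p by (intro exI[of _ "1 / ?r * ?p"]) simp
    qed
    show "smooth_on (\<phi> ` A) \<psi>" by (rule smooth_on_subset[OF \<psi>(1)]) (use V1 AA in blast)
    show "\<phi> ` A \<subseteq> U" using \<phi>(2) AA(3) by blast
    show "smooth_on A \<phi>" by (rule smooth_on_subset[OF \<phi>(1) AA(3)])
    show "smooth_on A h" "smooth_on A \<mu>" by (rule smooth_on_subset[OF sh AA(1)] smooth_on_subset[OF s\<mu> AA(1)])+
    show "F = (\<lambda>x. f (\<phi> x))" "N = (\<lambda>x. n (\<phi> x))" by (simp_all add: fun_eq_iff F_def N_def)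
  qed (use leg edge swt A P \<phi> AA opn \<psi>(2) Fa in auto)
  then show ?thesis using that AA(3) by (simp add: F_def[abs_def] N_def[abs_def])
qed

context swallowtail_chart
begin

lemma flecnodal_chart_exists:
  obtains r bt \<pi> where "flecnodal_chart U f n s A \<phi> \<psi> F N h \<mu> r bt \<pi>"
proof (rule flecnodal_functions)
  fix r bt \<pi>
  assume "r > 0" "\<And>a b. \<bar>a\<bar> < r ==> \<bar>b\<bar> < r ==> vector [a, b] \<in> A"
    "smooth_on {-r<..<r} bt" "smooth_on {-r<..<r} \<pi>" "bt 0 = 0" "\<pi> 0 = 0"
    "\<And>a. \<bar>a\<bar> < r ==> vector [a, bt a] \<in> A \<and> G1 (vector [a, bt a]) (\<pi> a) = 0 \<and> G2 (vector [a, bt a]) (\<pi> a) = 0"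
    "\<And>a b p. \<bar>a\<bar> < r ==> \<bar>b\<bar> < r ==> G1 (vector [a, b]) p = 0 ==> G2 (vector [a, b]) p = 0 ==>
       b = bt a \<and> p = \<pi> a"
    "\<And>a. \<bar>a\<bar> < r ==> inj (\<lambda>u. pd Phi u (vector [a, bt a, \<pi> a]))"
    "vd 1 bt 0 = 0" "vd 2 bt 0 = - 12 - 16 * q" "vd 1 \<pi> 0 = - 4"
  then have "flecnodal_chart U f n s A \<phi> \<psi> F N h \<mu> r bt \<pi>"
    unfolding flecnodal_chart_def flecnodal_chart_axioms_def using swallowtail_chart_axioms by blast
  then show thesis by (rule that)
qed

text \<open>For a concrete front \<open>h\<close> is known only through an existence theorem, so
  \<open>al\<close> cannot be evaluated from its definition. Its value at 0 is still determined by
  the quotient of \<open>II F N x e1 e1\<close> by \<open>edge_fun\<close>.\<close>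

lemma al_unique:
  assumes "\<And>x. x \<in> A ==> II F N x e1 e1 = edge_fun x * c"
  shows "al 0 = c"
proof -
  have "al 0 - c = 0"
  proof (rule edge_division[OF A])
    show "smooth_on A (\<lambda>x. al x - c)" by (intro smooth_on_diff smooth_on_const A smooth_abg)
    show "edge_fun x * (al x - c) = 0" if "x \<in> A" for x
      using assms[OF that] II_edge(1)[OF that] by (simp add: right_diff_distrib)
  qed
  then show ?thesis by simp
qed

end

lemma general_position_edge:
  assumes gp: "front_in_general_position U f n"
  shows "cuspidal_edge U f = {u\<in>U. \<not> regular_at f u}"
proof -
  have "open U" "smooth_on U f" "\<And>u. u \<in> U ==> f u \<noteq> 0"
    using gp by (auto simp: front_in_general_position_def legendrian_def)
  from cuspidal_not_regular[OF this] show ?thesis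
    using gp unfolding front_in_general_position_def cuspidal_edge_def by blast
qed

theorem general_position_chart:
  assumes gp: "front_in_general_position U f n" and s: "s \<in> U" and sw: "swallowtail_point U f s"
  obtains A \<phi> \<psi> F N h \<mu> r bt \<pi> where "flecnodal_chart U f n s A \<phi> \<psi> F N h \<mu> r bt \<pi>"
proof -
  have leg: "legendrian U f n" and reg: "regular_at n s" using gp s sw by (auto simp: front_in_general_position_def)
  obtain A0 \<phi> W \<Psi> where g: "open A0" "0 \<in> A0" "smooth_on A0 \<phi>" "\<phi> ` A0 \<subseteq> U" "\<phi> 0 = s" "bij (frechet_derivative \<phi> (at 0))"
    "open W" "smooth_on W \<Psi>" "\<forall>x\<in>W. \<forall>r. r \<noteq> 0 --> r *\<^sub>R x \<in> W \<and> \<Psi> (r *\<^sub>R x) = \<Psi> x"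
    "f s \<in> W" "surj (frechet_derivative \<Psi> (at (f s)))" "\<forall>x\<in>A0. f (\<phi> x) \<in> W \<and> \<Psi> (f (\<phi> x)) = swallowtail_model x"
    using sw unfolding swallowtail_point_def swallowtail_model_def[abs_def, symmetric] germ_equivalent_def by blast
  obtain A \<psi> h \<mu> where "swallowtail_chart U f n s A \<phi> \<psi> (\<lambda>x. f (\<phi> x)) (\<lambda>x. n (\<phi> x)) h \<mu>"
  proof (rule swallowtail_chart_exists[OF leg general_position_edge[OF gp] reg sw g(1-8) _ g(10,11)])
    show "r *\<^sub>R x \<in> W \<and> \<Psi> (r *\<^sub>R x) = \<Psi> x" if "x \<in> W" "r \<noteq> 0" for x r using g(9) that by blast
    show "f (\<phi> x) \<in> W \<and> \<Psi> (f (\<phi> x)) = swallowtail_model x" if "x \<in> A0" for x using g(12) that by blast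
  qed (rule that)
  then interpret swallowtail_chart U f n s A \<phi> \<psi> "\<lambda>x. f (\<phi> x)" "\<lambda>x. n (\<phi> x)" h \<mu> .
  show ?thesis by (rule flecnodal_chart_exists) (rule that)
qed

section \<open>Swallowtails with a given cr-invariant\<close>

lemma inverse_derivative_bij:
  fixes f g :: "real^'n => real^'n"
  assumes "open V" "smooth_on U f" "smooth_on V g" "\<And>y. y \<in> V ==> g y \<in> U" "\<And>y. y \<in> V ==> f (g y) = y" "y \<in> V" "open U"
  shows "bij (\<lambda>v. pd g v y)"
proof -
  have l: "linear (\<lambda>v. pd g v y)" by (rule pd_linear[OF assms(3,6)])
  have "pd f (pd g v y) (g y) = v" for v
  proof -
    have "pd f (pd g v y) (g y) = pd (\<lambda>y. f (g y)) v y"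
      using pd_compose[OF assms(3,2,6) assms(4)[OF assms(6)]] by simp
    also have "\<dots> = pd (\<lambda>y. y) v y"
      by (rule pd_cong[OF assms(1,6) smooth_on_compose[OF assms(1,7,4,3,2)] assms(5)])
    also have "\<dots> = v" by (rule pd_eqI) (rule has_derivative_ident)
    finally show ?thesis .
  qed
  then have "inj (\<lambda>v. pd g v y)" by (metis injI)
  then show ?thesis using linear_injective_imp_surjective[OF l] by (simp add: bij_def)
qed

text \<open>The normal form bent by the quadratic term k x2^2 / 2, which results in
  \<open>al 0 = - 1\<close> and \<open>ga 0 = - k\<close>, hence in \<open>q = k\<close>.\<close>

definition std_front :: "real => real^2 => real^4" where
  "std_front k x = vector [1, 3 * (x$1)^4 + (x$1)^2 * x$2 + k * (x$2)^2 / 2, 4 * (x$1)^3 + 2 * x$1 * x$2, x$2]"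

text \<open>The tangent plane of \<open>std_front k\<close>, normalised to second coordinate
  1.\<close>

definition std_dual :: "real => real^2 => real^4" where
  "std_dual k x = vector [(x$1)^4 + k * (x$2)^2 / 2, 1, - (x$1), (x$1)^2 - k * x$2]"

lemma smooth_std: "smooth_on UNIV (std_front k)" "smooth_on UNIV (std_dual k)"
  unfolding std_front_def std_dual_def
  by (intro smooth_intros smooth_on_divide open_UNIV; simp)+

lemma pd_std:
  "pd (std_front k) v x = vector [0, (12 * (x$1)^3 + 2 * x$1 * x$2) * v$1 + ((x$1)^2 + k * x$2) * v$2,
     edge_fun x * v$1 + 2 * x$1 * v$2, v$2]"
  "pd (std_dual k) v x = vector [4 * (x$1)^3 * v$1 + k * x$2 * v$2, 0, - (v$1), 2 * x$1 * v$1 - k * v$2]"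
proof -
  note n = pd_nth[OF smooth_std(1) UNIV_I] pd_nth[OF smooth_std(2) UNIV_I]
  note [intro!] = bounded_linear.has_derivative[OF bounded_linear_vec_nth]
  have "((\<lambda>y. std_front k y $ 1) has_derivative (\<lambda>v. 0)) (at x)"
    "((\<lambda>y. std_front k y $ 2) has_derivative (\<lambda>v. (12 * (x$1)^3 + 2 * x$1 * x$2) * v$1 + ((x$1)^2 + k * x$2) * v$2)) (at x)"
    "((\<lambda>y. std_front k y $ 3) has_derivative (\<lambda>v. edge_fun x * v$1 + 2 * x$1 * v$2)) (at x)"
    "((\<lambda>y. std_front k y $ 4) has_derivative (\<lambda>v. v$2)) (at x)"
    unfolding std_front_def
    by (auto intro!: derivative_eq_intros simp: edge_fun_def fun_eq_iff algebra_simps power2_eq_square power3_eq_cube)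
  note d = this[THEN pd_eqI]
  show "pd (std_front k) v x = vector [0, (12 * (x$1)^3 + 2 * x$1 * x$2) * v$1 + ((x$1)^2 + k * x$2) * v$2,
     edge_fun x * v$1 + 2 * x$1 * v$2, v$2]"
    by (simp add: vec_eq_iff forall_4 n d)
  have "((\<lambda>y. std_dual k y $ 1) has_derivative (\<lambda>v. 4 * (x$1)^3 * v$1 + k * x$2 * v$2)) (at x)"
    "((\<lambda>y. std_dual k y $ 2) has_derivative (\<lambda>v. 0)) (at x)"
    "((\<lambda>y. std_dual k y $ 3) has_derivative (\<lambda>v. - (v$1))) (at x)"
    "((\<lambda>y. std_dual k y $ 4) has_derivative (\<lambda>v. 2 * x$1 * v$1 - k * v$2)) (at x)"
    unfolding std_dual_def
    by (auto intro!: derivative_eq_intros simp: fun_eq_iff algebra_simps power2_eq_square power3_eq_cube)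
  note d = this[THEN pd_eqI]
  show "pd (std_dual k) v x = vector [4 * (x$1)^3 * v$1 + k * x$2 * v$2, 0, - (v$1), 2 * x$1 * v$1 - k * v$2]"
    by (simp add: vec_eq_iff forall_4 n d)
qed

lemma std_nz: "std_front k x \<noteq> 0" "std_dual k x \<noteq> 0"
  by (simp_all add: std_front_def std_dual_def vec_eq_iff forall_4)

lemma std_dual_regular: "k \<noteq> 0 ==> regular_at (std_dual k) x"
  unfolding regular_at_def pd_def[symmetric]
proof (intro allI impI)
  fix v assume k: "k \<noteq> 0" and "pd (std_dual k) v x \<in> span {std_dual k x}"
  then obtain r where r: "pd (std_dual k) v x = r *\<^sub>R std_dual k x" by (auto simp: span_singleton)
  then have "r = 0" by (simp add: pd_std std_dual_def vec_eq_iff forall_4)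
  then show "v = 0" using r k by (auto simp: pd_std vec_eq_iff forall_4 forall_2)
qed

lemma std_legendrian: "k \<noteq> 0 ==> legendrian UNIV (std_front k) (std_dual k)"
  unfolding legendrian_def pd_def[symmetric]
proof (intro conjI ballI allI impI open_UNIV smooth_std std_nz)
  assume k: "k \<noteq> 0"
  fix u v :: "real^2"
  show "std_front k u \<bullet> std_dual k u = 0"
    by (simp add: std_front_def std_dual_def inner_vec_def sum_4) algebra
  show "pd (std_front k) v u \<bullet> std_dual k u = 0"
    by (simp add: pd_std std_dual_def inner_vec_def sum_4 edge_fun_def) algebra
  show "v = 0" if "pd (std_front k) v u \<in> span {std_front k u} \<and> pd (std_dual k) v u \<in> span {std_dual k u}"
    using that std_dual_regular[OF k, of u] by (simp add: regular_at_def pd_def)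
  fix u' assume "same_point (std_front k u) (std_front k u') \<and> same_point (std_dual k u) (std_dual k u')"
  then obtain r where r: "std_dual k u' = r *\<^sub>R std_dual k u" by (auto simp: same_point_def)
  then have "r = 1" by (simp add: std_dual_def vec_eq_iff forall_4)
  then show "u = u'" using r k by (auto simp: std_dual_def vec_eq_iff forall_4 forall_2)
qed

lemma std_front_regular: "edge_fun x \<noteq> 0 ==> regular_at (std_front k) x"
  unfolding regular_at_def pd_def[symmetric]
proof (intro allI impI)
  fix v assume e: "edge_fun x \<noteq> 0" and "pd (std_front k) v x \<in> span {std_front k x}"
  then obtain r where r: "pd (std_front k) v x = r *\<^sub>R std_front k x" by (auto simp: span_singleton)
  then have "r = 0" by (simp add: pd_std std_front_def vec_eq_iff forall_4)
  then show "v = 0" using r e by (auto simp: pd_std vec_eq_iff forall_4 forall_2)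
qed

text \<open>The standard affine chart followed by the shear that removes the quadratic term, so that
  in it the front is the normal form itself.\<close>

definition std_chart :: "real => real^4 => real^3" where
  "std_chart k x = vector [x$2 / x$1 - k * (x$4 / x$1)^2 / 2, x$3 / x$1, x$4 / x$1]"

lemma open_std: "open {x :: real^4. x$1 \<noteq> 0}"
  by (intro open_Collect_neq continuous_intros)

lemma smooth_std_chart: "smooth_on {x. x$1 \<noteq> 0} (std_chart k)"
  unfolding std_chart_def by (intro smooth_intros smooth_on_divide open_std) auto

lemma std_chart_hom: "r \<noteq> 0 ==> std_chart k (r *\<^sub>R x) = std_chart k x"
  by (simp add: std_chart_def)

lemma std_chart_front: "std_chart k (std_front k x) = swallowtail_model x"
  by (simp add: std_chart_def std_front_def swallowtail_model_def)

lemma pd_std_chart: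
  assumes "p$1 = 1" "v$1 = 0"
  shows "pd (std_chart k) v p = vector [v$2 - k * p$4 * v$4, v$3, v$4]"
proof -
  have p: "p \<in> {x. x$1 \<noteq> 0}" using assms by simp
  note n = pd_nth[OF smooth_std_chart p]
  note [intro!] = bounded_linear.has_derivative[OF bounded_linear_vec_nth]
  have "((\<lambda>y. std_chart k y $ 1) has_derivative (\<lambda>v. (v$2 - p$2 * v$1) - k * p$4 * (v$4 - p$4 * v$1))) (at p)"
    "((\<lambda>y. std_chart k y $ 2) has_derivative (\<lambda>v. v$3 - p$3 * v$1)) (at p)"
    "((\<lambda>y. std_chart k y $ 3) has_derivative (\<lambda>v. v$4 - p$4 * v$1)) (at p)"
    unfolding std_chart_def using assms(1)
    by (auto intro!: derivative_eq_intros simp: fun_eq_iff field_simps power2_eq_square)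
  note d = this[THEN pd_eqI]
  show ?thesis by (simp add: vec_eq_iff forall_3 n d assms(2))
qed

lemma std_chart_surj:
  assumes "p$1 = 1" shows "surj (\<lambda>v. pd (std_chart k) v p)"
proof (rule surjI)
  fix y :: "real^3"
  show "pd (std_chart k) (vector [0, y$1 + k * p$4 * y$3, y$2, y$3]) p = y"
    by (subst pd_std_chart[OF assms]) (simp_all add: vec_eq_iff forall_3)
qed

lemma std_swallowtail: "swallowtail_point UNIV (std_front k) 0"
  unfolding swallowtail_point_def swallowtail_model_def[abs_def, symmetric] germ_equivalent_def
proof (intro exI conjI)
  show "smooth_on UNIV (\<lambda>x :: real^2. x)" by (rule smooth_on_ident[OF open_UNIV])
  show "open {x :: real^4. x$1 \<noteq> 0}" by (rule open_std)
  show "smooth_on {x. x$1 \<noteq> 0} (std_chart k)" by (rule smooth_std_chart)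
  show "surj (frechet_derivative (std_chart k) (at (std_front k 0)))"
    using std_chart_surj[of "std_front k 0" k] by (simp add: pd_def[abs_def] std_front_def)
  show "bij (frechet_derivative (\<lambda>x :: real^2. x) (at 0))" by (simp add: frechet_derivative_ident flip: id_def)
qed (auto simp: std_chart_hom std_chart_front, simp_all add: std_front_def)

text \<open>The swallowtail surface \<open>(X, Y, Z)\<close> satisfies \<open>12 X + Z^2 = w^2\<close> and
  \<open>27 Y^2 / 2 - 36 X Z + Z^3 = w^3\<close> with \<open>w = edge_fun / 2\<close>.\<close>
definition cusp_coords :: "real => real^3 => real^3" where
  "cusp_coords b y = vector [12 * y$1 + (y$3)^2, 27 / 2 * (y$2)^2 - 36 * y$1 * y$3 + (y$3)^3, y$3 - b]"

lemma smooth_cusp_coords: "smooth_on UNIV (cusp_coords b)"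
  unfolding cusp_coords_def by (intro smooth_intros open_UNIV)

lemma cusp_coords_surj:
  assumes "y$2 \<noteq> 0" shows "surj (\<lambda>v. pd (cusp_coords b) v y)"
proof (rule surjI)
  note n = pd_nth[OF smooth_cusp_coords UNIV_I]
  note [intro!] = bounded_linear.has_derivative[OF bounded_linear_vec_nth]
  have "((\<lambda>y. cusp_coords b y $ 1) has_derivative (\<lambda>v. 12 * v$1 + 2 * y$3 * v$3)) (at y)"
    "((\<lambda>y. cusp_coords b y $ 2) has_derivative (\<lambda>v. 27 * y$2 * v$2 - 36 * y$3 * v$1 + (3 * (y$3)^2 - 36 * y$1) * v$3)) (at y)"
    "((\<lambda>y. cusp_coords b y $ 3) has_derivative (\<lambda>v. v$3)) (at y)"
    unfolding cusp_coords_def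
    by (auto intro!: derivative_eq_intros simp: fun_eq_iff algebra_simps power2_eq_square)
  note d = this[THEN pd_eqI]
  fix z :: "real^3"
  define v1 where "v1 = (z$1 - 2 * y$3 * z$3) / 12"
  show "pd (cusp_coords b) (vector [v1, (z$2 + 36 * y$3 * v1 - (3 * (y$3)^2 - 36 * y$1) * z$3) / (27 * y$2), z$3]) y = z"
    using assms by (simp add: vec_eq_iff forall_3 n d) (simp add: v1_def field_simps)
qed

text \<open>At a point of the edge other than the swallowtail, w = \<open>edge_fun\<close> / 2 and
  the shifted x2 are local coordinates; in them and in \<open>cusp_coords\<close> the surface is
  (w^2, w^3) times a line.\<close>

lemma std_cuspidal:
  assumes e: "edge_fun u = 0" and u: "u$1 \<noteq> 0"
  shows "cuspidal_point UNIV (std_front k) u"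
proof -
  define \<Lambda> where "\<Lambda> x = (vector [6 * (x$1)^2 + x$2, x$2 - u$2] :: real^2)" for x :: "real^2"
  have s\<Lambda>: "smooth_on UNIV \<Lambda>" unfolding \<Lambda>_def[abs_def] by (intro smooth_intros open_UNIV)
  note n = pd_nth[OF s\<Lambda> UNIV_I]
  note [intro!] = bounded_linear.has_derivative[OF bounded_linear_vec_nth]
  have "((\<lambda>y. \<Lambda> y $ 1) has_derivative (\<lambda>v. 12 * u$1 * v$1 + v$2)) (at u)"
    "((\<lambda>y. \<Lambda> y $ 2) has_derivative (\<lambda>v. v$2)) (at u)"
    unfolding \<Lambda>_def by (auto intro!: derivative_eq_intros simp: fun_eq_iff algebra_simps power2_eq_square)
  note d = this[THEN pd_eqI]
  have \<Lambda>u: "\<Lambda> u = 0" using e by (simp add: \<Lambda>_def vec_eq_iff forall_2 edge_fun_def)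
  have l: "linear (\<lambda>v. pd \<Lambda> v u)" by (rule pd_linear[OF s\<Lambda> UNIV_I])
  have "inj (\<lambda>v. pd \<Lambda> v u)"
    unfolding linear_injective_0[OF l] using u by (auto simp: vec_eq_iff forall_2 n d)
  then have bij: "bij (\<lambda>v. pd \<Lambda> v u)" using linear_injective_imp_surjective[OF l] by (simp add: bij_def)
  obtain U' V g where U': "open U'" "U' \<subseteq> UNIV" "u \<in> U'" and V: "open V" "\<Lambda> ` U' = V" "g ` V = U'"
    and g: "smooth_on V g" "\<And>x. x \<in> U' ==> g (\<Lambda> x) = x" "\<And>y. y \<in> V ==> \<Lambda> (g y) = y"
    and bU: "\<And>x. x \<in> U' ==> bij (\<lambda>v. pd \<Lambda> v x)"
    by (rule smooth_inverse_function[OF open_UNIV s\<Lambda> UNIV_I bij], rule that)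
  have V0: "0 \<in> V" and g0: "g 0 = u" using V(2) U'(3) \<Lambda>u g(2) by force+
  define \<Psi> where "\<Psi> x = cusp_coords (u$2) (std_chart k x)" for x
  have s\<Psi>: "smooth_on {x. x$1 \<noteq> 0} \<Psi>" unfolding \<Psi>_def[abs_def]
    by (rule smooth_on_compose[OF open_std open_UNIV _ smooth_std_chart smooth_cusp_coords]) simp
  have fu: "std_front k u $ 1 = 1" by (simp add: std_front_def)
  have "surj (\<lambda>v. pd \<Psi> v (std_front k u))"
  proof -
    have b: "u$2 = - 6 * (u$1)\<^sup>2" using e by (simp add: edge_fun_def)
    have "swallowtail_model u $ 2 = - 8 * (u$1)^3"
      by (simp add: swallowtail_model_def b power2_eq_square power3_eq_cube)
    then have y: "std_chart k (std_front k u) $ 2 \<noteq> 0" using u by (simp add: std_chart_front)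
    have "pd \<Psi> v (std_front k u) = pd (cusp_coords (u$2)) (pd (std_chart k) v (std_front k u)) (std_chart k (std_front k u))" for v
      unfolding \<Psi>_def[abs_def] by (rule pd_compose[OF smooth_std_chart smooth_cusp_coords]) (simp_all add: fu)
    then have "(\<lambda>v. pd \<Psi> v (std_front k u)) =
        (\<lambda>w. pd (cusp_coords (u$2)) w (std_chart k (std_front k u))) \<circ> (\<lambda>v. pd (std_chart k) v (std_front k u))"
      by (simp add: fun_eq_iff)
    then show ?thesis using comp_surj[OF std_chart_surj[OF fu] cusp_coords_surj[OF y]] by metis
  qed
  then have surj: "surj (frechet_derivative \<Psi> (at (std_front k u)))" by (simp add: pd_def[abs_def])
  have "bij (\<lambda>v. pd g v 0)"
    by (rule inverse_derivative_bij[OF V(1) s\<Lambda> g(1) _ g(3) V0 open_UNIV]) simp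
  then have bg: "bij (frechet_derivative g (at 0))" by (simp add: pd_def[abs_def])
  have eq: "\<Psi> (std_front k (g x)) = vector [(x$1)^2, (x$1)^3, x$2]" if "x \<in> V" for x
  proof -
    have x: "x$1 = 6 * (g x$1)^2 + g x$2" "x$2 = g x$2 - u$2" using arg_cong[OF g(3)[OF that], of "\<lambda>y. y$1"]
        arg_cong[OF g(3)[OF that], of "\<lambda>y. y$2"] by (simp_all add: \<Lambda>_def)
    have 1: "12 * (3 * a^4 + a^2 * b) + b^2 = (6 * a^2 + b)^2"
      and 2: "27 / 2 * (4 * a^3 + 2 * a * b)^2 - 36 * (3 * a^4 + a^2 * b) * b + b^3 = (6 * a^2 + b)^3" for a b :: real
      by algebra+
    show ?thesis
      unfolding \<Psi>_def std_chart_front using 1[of "g x$1" "g x$2"] 2[of "g x$1" "g x$2"]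
      by (simp add: cusp_coords_def swallowtail_model_def vec_eq_iff forall_3 x)
  qed
  show ?thesis
    unfolding cuspidal_point_def germ_equivalent_def
    by (intro exI[of _ V] exI[of _ g] exI[of _ "{x. x$1 \<noteq> 0}"] exI[of _ \<Psi>] conjI V(1) V0 g(1) g0 bg open_std s\<Psi> surj)
      (use eq in \<open>auto simp: \<Psi>_def std_chart_hom\<close>, simp_all add: std_front_def)
qed

text \<open>\<open>II\<close> is diagonal with entries \<open>- edge_fun x\<close> and
  \<open>- k\<close>, so the discriminant vanishes on the edge alone, where the front is not
  regular.\<close>

lemma std_parabolic: assumes k: "k \<noteq> 0" shows "parabolic_curve UNIV (std_front k) = {}"
proof -
  have dp: "dual_pair UNIV (std_front k) (std_dual k)"
    using std_legendrian[OF k] by (auto simp: dual_pair_def legendrian_def pd_def)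
  have i: "II (std_front k) (std_dual k) x e1 e1 = - edge_fun x" "II (std_front k) (std_dual k) x e1 e2 = 0"
    "II (std_front k) (std_dual k) x e2 e2 = - k" for x
    by (simp_all add: II_def pd_std inner_vec_def sum_4)
  have "card (asymptotic_lines UNIV (std_front k) x) \<noteq> 1" if r: "regular_at (std_front k) x" for x
  proof -
    have j: "jac (std_front k) (std_dual k) x \<noteq> 0" using regular_at_iff_jac[OF dp UNIV_I] r by blast
    have "pd (std_front k) e1 x \<noteq> 0"
    proof
      assume "pd (std_front k) e1 x = 0"
      then have "frechet_derivative (std_front k) (at x) e1 \<in> span {std_front k x}" by (simp add: pd_def span_zero)
      then have "e1 = (0 :: real^2)" using r unfolding regular_at_def by blast
      then show False by (metis vector_2(1) zero_index zero_neq_one)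
    qed
    then have "edge_fun x \<noteq> 0"
    proof -
      have "(12 * (x$1)^3 + 2 * x$1 * x$2) = x$1 * edge_fun x" by (simp add: edge_fun_def power2_eq_square power3_eq_cube algebra_simps)
      then show ?thesis using \<open>pd (std_front k) e1 x \<noteq> 0\<close> by (auto simp: pd_std vec_eq_iff forall_4)
    qed
    then have "discr (std_front k) (std_dual k) x \<noteq> 0" using k by (simp add: discr_def i)
    then show ?thesis
      using asymptotic_lines_card(1,3)[OF dp UNIV_I j] k by (cases "discr (std_front k) (std_dual k) x > 0") (auto simp: i)
  qed
  then show ?thesis by (auto simp: parabolic_curve_def)
qed

lemma std_general_position:
  assumes k: "k \<noteq> 0" shows "front_in_general_position UNIV (std_front k) (std_dual k)"
  unfolding front_in_general_position_def
proof (intro conjI ballI impI std_legendrian[OF k] std_dual_regular[OF k])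
  fix u :: "real^2"
  show "regular_at (std_front k) u \<or> cuspidal_point UNIV (std_front k) u \<or> swallowtail_point UNIV (std_front k) u"
  proof (cases "edge_fun u = 0")
    case True
    show ?thesis
    proof (cases "u$1 = 0")
      case u: True
      then have "u = 0" using True by (simp add: edge_fun_def vec_eq_iff forall_2)
      then show ?thesis using std_swallowtail by blast
    next
      case False
      then show ?thesis using std_cuspidal[OF True] by blast
    qed
  next
    case False
    then show ?thesis using std_front_regular by blast
  qed
  show "regular_at (std_dual k) u \<or> cuspidal_point UNIV (std_dual k) u \<or> swallowtail_point UNIV (std_dual k) u"
    using std_dual_regular[OF k] by blast
  show "u \<notin> closure (parabolic_curve UNIV (std_front k))" by (simp add: std_parabolic[OF k])
  assume "swallowtail_point UNIV (std_dual k) u"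
  then have False
    using cuspidal_not_regular(2)[OF open_UNIV smooth_std(2) std_nz(2)] std_dual_regular[OF k] by blast
  then show "u \<notin> closure (parabolic_curve UNIV (std_dual k))" "regular_at (std_front k) u" by blast+
qed

text \<open>The chart theorem is applied with the identity as \<phi>, so that the coefficients can
  be computed in the given coordinates.\<close>

lemma std_cr_invariant:
  assumes k: "k \<noteq> 0" shows "cr_invariant UNIV (std_dual k) 0 = 1 + 2 * k"
proof -
  note gp = std_general_position[OF k]
  obtain A \<psi> h \<mu> where "A \<subseteq> UNIV" and c:
    "swallowtail_chart UNIV (std_front k) (std_dual k) 0 A (\<lambda>x. x) \<psi> (\<lambda>x. std_front k x) (\<lambda>x. std_dual k x) h \<mu>"
  proof (rule swallowtail_chart_exists[OF std_legendrian[OF k] general_position_edge[OF gp] std_dual_regular[OF k] std_swallowtail[of k]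
        open_UNIV UNIV_I smooth_on_ident[OF open_UNIV] _ refl _ open_std smooth_std_chart[of k]])
    show "surj (frechet_derivative (std_chart k) (at (std_front k 0)))"
      using std_chart_surj[of "std_front k 0" k] by (simp add: pd_def[abs_def] std_front_def)
    show "bij (frechet_derivative (\<lambda>x :: real^2. x) (at 0))" by (simp add: frechet_derivative_ident flip: id_def)
    show "std_front k x \<in> {x. x$1 \<noteq> 0} \<and> std_chart k (std_front k x) = swallowtail_model x" for x
      by (simp add: std_chart_front) (simp add: std_front_def)
    show "std_front k 0 \<in> {x. x$1 \<noteq> 0}" by (simp add: std_front_def)
  qed (auto simp: std_chart_hom)
  interpret swallowtail_chart UNIV "std_front k" "std_dual k" 0 A "\<lambda>x. x" \<psi> "\<lambda>x. std_front k x" "\<lambda>x. std_dual k x" h \<mu> by (rule c)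
  obtain r bt \<pi> where fc: "flecnodal_chart UNIV (std_front k) (std_dual k) 0 A (\<lambda>x. x) \<psi> (\<lambda>x. std_front k x) (\<lambda>x. std_dual k x) h \<mu> r bt \<pi>"
    by (rule flecnodal_chart_exists)
  have "al 0 = - 1"
    by (rule al_unique) (simp add: II_def pd_std inner_vec_def sum_4)
  moreover have "ga 0 = - k" by (simp add: ga_def pd_std inner_vec_def sum_4)
  ultimately have "q = k" by (simp add: q_def)
  then show ?thesis using flecnodal_chart.cr_invariant_eq[OF fc] by simp
qed

theorem swallowtail_with_invariant:
  assumes "\<rho> \<noteq> 1"
  shows "\<exists>(U :: (real^2) set) f n s. front_in_general_position U f n \<and> s \<in> U \<and> swallowtail_point U f s \<and> cr_invariant U n s = \<rho>"
proof -
  let ?k = "(\<rho> - 1) / 2"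
  have k: "?k \<noteq> 0" using assms by simp
  have "1 + 2 * ?k = \<rho>" by (simp add: field_simps)
  then show ?thesis
    using std_general_position[OF k] std_swallowtail[of ?k] std_cr_invariant[OF k] by (metis UNIV_I)
qed

lemma swallowtails_in_intervals:
  "\<forall>I \<in> {{1<..}, {0<..<1}, {-1/2<..<0}, {..<-1/2}}.
     \<exists>(U :: (real^2) set) (f :: real^2 => real^4) (n :: real^2 => real^4) (s :: real^2).
       front_in_general_position U f n \<and> s \<in> U \<and> swallowtail_point U f s \<and> cr_invariant U n s \<in> I"
proof
  fix I :: "real set" assume "I \<in> {{1<..}, {0<..<1}, {-1/2<..<0}, {..<-1/2}}"
  then have "2 \<in> I \<or> 1/2 \<in> I \<or> - 1/4 \<in> I \<or> - 1 \<in> I" by auto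
  then obtain \<rho> where "\<rho> \<in> I" "\<rho> \<noteq> 1" by fastforce
  then show "\<exists>(U :: (real^2) set) f n s. front_in_general_position U f n \<and> s \<in> U \<and> swallowtail_point U f s \<and> cr_invariant U n s \<in> I"
    using swallowtail_with_invariant by metis
qed

text \<open>The open sets \<open>W\<close> make each configuration a statement about germs, and the
  covectors \<open>a\<close> range over all affine charts containing the swallowtail, so that the
  directions of the cusps are compared in each of them.\<close>

theorem theorem13:
  shows "(\<forall>(U :: (real^2) set) (f :: real^2 \<Rightarrow> real^4) (n :: real^2 \<Rightarrow> real^4) (s :: real^2) (\<rho> :: real).
     front_in_general_position U f n \<and> s \<in> U \<and> swallowtail_point U f s \<and>
     \<rho> = cr_invariant U n s \<longrightarrow>
     (elliptic_swallowtail U f s \<or> hyperbolic_swallowtail U f s) \<and>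
     (elliptic_swallowtail U f s \<longleftrightarrow> \<rho> \<in> {1<..}) \<and>
     (hyperbolic_swallowtail U f s \<longleftrightarrow> \<rho> \<in> {..<1}) \<and>
     (\<rho> \<notin> {0, -1/2} \<longrightarrow>
       (\<forall>W. open W \<and> s \<in> W \<longrightarrow>
         (\<exists>V cE cF cD. V \<subseteq> W \<and> local_picture U f s V cE cF cD \<and>
            cF ` {-1<..<0} = left_branch U f \<inter> V \<and>
            cF ` {0<..<1} = right_branch U f \<inter> V \<and>
            (\<forall>a. a \<bullet> f s \<noteq> 0 \<longrightarrow>
               semicubical_cusp (affine_chart a \<circ> f \<circ> cF) \<and>
               semicubical_cusp (affine_chart a \<circ> f \<circ> cE) \<and>
               cotangent_cusps (affine_chart a \<circ> f \<circ> cF) (affine_chart a \<circ> f \<circ> cE)) \<and>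
            (\<rho> \<in> {1<..} \<longrightarrow>
               flecnodal_curve U f \<inter> V - {s} \<subseteq> small_domain U f V) \<and>
            (\<rho> \<in> {0<..<1} \<longrightarrow>
               branchwise_separated U f s V cE) \<and>
            (\<rho> \<in> {-1/2<..<0} \<longrightarrow>
               separates_in V (self_intersection V f)
                 (flecnodal_curve U f \<inter> V - {s}) (cuspidal_edge U f \<inter> V - {s}) \<and>
               (\<forall>a. a \<bullet> f s \<noteq> 0 \<longrightarrow>
                  runs_between f s a (n s) (vd 2 (affine_chart a \<circ> f \<circ> cF) 0)
                    (self_intersection V f) (left_branch U f \<inter> V) (right_branch U f \<inter> V) \<and>
                  codirected_cusps (affine_chart a \<circ> f \<circ> cF) (affine_chart a \<circ> f \<circ> cE))) \<and>
            (\<rho> \<in> {..<-1/2} \<longrightarrow>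
               (\<forall>a. a \<bullet> f s \<noteq> 0 \<longrightarrow>
                  opposite_cusps (affine_chart a \<circ> f \<circ> cF) (affine_chart a \<circ> f \<circ> cE)))))))
   \<and>
   (\<forall>I \<in> {{1<..}, {0<..<1}, {-1/2<..<0}, {..<-1/2}}.
     \<exists>(U :: (real^2) set) (f :: real^2 \<Rightarrow> real^4) (n :: real^2 \<Rightarrow> real^4) (s :: real^2).
       front_in_general_position U f n \<and> s \<in> U \<and> swallowtail_point U f s \<and> cr_invariant U n s \<in> I)"
proof (rule conjI[OF _ swallowtails_in_intervals], intro allI impI, elim conjE, goal_cases)
  case (1 U f n s \<rho>)
  obtain A \<phi> \<psi> F N h \<mu> r bt \<pi> where fc: "flecnodal_chart U f n s A \<phi> \<psi> F N h \<mu> r bt \<pi>"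
    by (rule general_position_chart[OF 1(1-3)])
  interpret flecnodal_chart U f n s A \<phi> \<psi> F N h \<mu> r bt \<pi> by (rule fc)
  have \<rho>q: "\<rho> = 1 + 2 * q" using 1(4) by (simp add: cr_invariant_eq)
  \<comment> \<open>Under \<rho> = 1 + 2 q the thresholds 1, 0 and -1/2 for \<rho> become 0, -1/2
    and -3/4 for q.\<close>
  have conv: "\<rho> \<in> {1<..} \<longleftrightarrow> q > 0" "\<rho> \<in> {..<1} \<longleftrightarrow> q < 0" "\<rho> \<notin> {0, -1/2} \<longleftrightarrow> q \<noteq> - 1/2 \<and> q \<noteq> - 3/4"
    "\<rho> \<in> {0<..<1} \<longleftrightarrow> - 1/2 < q \<and> q < 0" "\<rho> \<in> {-1/2<..<0} \<longleftrightarrow> - 3/4 < q \<and> q < - 1/2" "\<rho> \<in> {..<-1/2} \<longleftrightarrow> q < - 3/4"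
    by (auto simp: \<rho>q)
  show ?case
    unfolding conv
  proof (intro conjI impI allI, goal_cases)
    case (4 W)
    then have q: "q \<noteq> - 1/2" "q \<noteq> - 3/4" by blast+
    obtain \<xi> where g: "good \<xi>" and VW: "\<phi> ` box \<xi> \<subseteq> W" using box_small 4(2) by blast
    interpret flecnodal_box U f n s A \<phi> \<psi> F N h \<mu> r bt \<pi> \<xi> by unfold_locales (rule g)
    \<comment> \<open>Orients the flecnodal curve so that negative parameters run on its left
      branch.\<close>
    define \<sigma> :: real where "\<sigma> = (if side > 0 then 1 else -1)"
    have \<sigma>: "\<sigma> = 1 \<or> \<sigma> = -1" by (simp add: \<sigma>_def)
    have side: "x * side < 0 \<longleftrightarrow> \<sigma> * x < 0" "x * side > 0 \<longleftrightarrow> \<sigma> * x > 0" for x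
      using side_nz by (auto simp: \<sigma>_def mult_less_0_iff zero_less_mult_iff)
    define cE where "cE t = \<phi> (vector [1 * \<xi> * t, - 6 * (1 * \<xi> * t)\<^sup>2])" for t
    define cF where "cF t = \<phi> (vector [\<sigma> * \<xi> * t, bt (\<sigma> * \<xi> * t)])" for t
    define cD where "cD t = \<phi> (vector [1 * \<xi> * t, - 2 * (1 * \<xi> * t)\<^sup>2])" for t
    note fold = cE_def[abs_def, symmetric] cF_def[abs_def, symmetric] cD_def[abs_def, symmetric]
    have s6: "small_graph (\<lambda>a. - 6 * a\<^sup>2)" by (rule small_graph_square) simp
    note jF = graph_curve_jet[OF _ small_graph_bt bt1 \<sigma>, unfolded fold]
      and jE = graph_curve_jet[OF _ s6 vd_square(1) disjI1[OF refl], unfolded fold vd_square(2)]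
    have "local_picture U f s V cE cF cD" using local_picture_V[OF \<sigma>] unfolding fold .
    moreover have "cF ` {-1<..<0} = left_branch U f \<inter> V" "cF ` {0<..<1} = right_branch U f \<inter> V"
      using graph_param_branches[OF small_graph_bt \<sigma>] unfolding fold branches[OF q(1)] side .
    moreover have cusps: "semicubical_cusp (affine_chart a \<circ> f \<circ> cF)" "semicubical_cusp (affine_chart a \<circ> f \<circ> cE)"
      and ratio: "vd 2 (affine_chart a \<circ> f \<circ> cF) 0 = (1 + 4 * q / 3) *\<^sub>R vd 2 (affine_chart a \<circ> f \<circ> cE) 0"
      and run: "- 3/4 < q ==> q < - 1/2 ==> runs_between f s a (n s) (vd 2 (affine_chart a \<circ> f \<circ> cF) 0)
              (self_intersection V f) (left_branch U f \<inter> V) (right_branch U f \<inter> V)"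
      if a: "a \<bullet> f s \<noteq> 0" for a
    proof -
      show "semicubical_cusp (affine_chart a \<circ> f \<circ> cF)" using jF(3)[OF a] q by (simp add: bt2)
      show "semicubical_cusp (affine_chart a \<circ> f \<circ> cE)" using jE(3)[OF a] by simp
      show "vd 2 (affine_chart a \<circ> f \<circ> cF) 0 = (1 + 4 * q / 3) *\<^sub>R vd 2 (affine_chart a \<circ> f \<circ> cE) 0"
      proof -
        \<comment> \<open>The factor is the quotient of -12 - 16 q by -12, the second derivatives of
          \<open>bt\<close> and of the edge. It is positive exactly for q > - 3/4, which decides
          whether the two cusps point in the same or in opposite directions.\<close>
        have e: "\<xi>\<^sup>2 * (- 12 - 16 * q) = (1 + 4 * q / 3) * (\<xi>\<^sup>2 * (2 * - 6))" by (simp add: algebra_simps)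
        show ?thesis unfolding jF(2)[OF a] jE(2)[OF a] bt2 scaleR_scaleR e ..
      qed
      show "runs_between f s a (n s) (vd 2 (affine_chart a \<circ> f \<circ> cF) 0)
              (self_intersection V f) (left_branch U f \<inter> V) (right_branch U f \<inter> V)" if "- 3/4 < q" "q < - 1/2"
        unfolding jF(2)[OF a] by (rule enclosed_picture[OF that a]) (use q eps in \<open>simp add: bt2\<close>)
    qed
    moreover have "cotangent_cusps (affine_chart a \<circ> f \<circ> cF) (affine_chart a \<circ> f \<circ> cE)"
      "- 3/4 < q ==> codirected_cusps (affine_chart a \<circ> f \<circ> cF) (affine_chart a \<circ> f \<circ> cE)"
      "q < - 3/4 ==> opposite_cusps (affine_chart a \<circ> f \<circ> cF) (affine_chart a \<circ> f \<circ> cE)"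
      if a: "a \<bullet> f s \<noteq> 0" for a
      unfolding cotangent_cusps_def codirected_cusps_def opposite_cusps_def
      using q by (intro exI[of _ "1 + 4 * q / 3"] conjI ratio[OF a]; simp add: field_simps)+
    moreover note elliptic_picture separated_picture
    moreover have "- 1/2 < q ==> q < 0 ==> branchwise_separated U f s V cE" using branchwise_picture unfolding fold .
    ultimately show ?case using VW by (intro exI[of _ V] exI[of _ cE] exI[of _ cF] exI[of _ cD]) simp
  qed (use swallowtail_type q_nz in auto)
qed

end
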